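(* Let $d\ge 1$ be an integer and $T>0$, and let $A,B:\mathbb{R}^d\to\mathbb{R}^{d\times d}$, $G,\gamma:\mathbb{R}^d\to\mathbb{R}^d$, $A=(a_{ij})$, $B=(b_{ij})$, $G=(G_i)$, $\gamma=(\gamma_i)$, satisfy: (H1) there is $\alpha>0$ with $\xi^TA(u)\xi\ge\alpha|\xi|^2$ for all $u,\xi\in\mathbb{R}^d$, and every $a_{ij}$ is Lipschitz continuous with constant $L$; (H2) $B,G,\gamma$ are $C^1$, bounded and Lipschitz continuous. Let $u_0\in X_0^1$. Then there is a unique $u\in C(0,T,X_0^1)$ solving the weak problem: $u:[0,T]\to X_0^1$, $u(0)=u_0$, and $$\mathcal{A}_{u}(u_t,v)=\mathcal{B}_{u}(u,v)\qquad\text{for all } v\in X_0^1,$$ and $u$ depends continuously on the initial data (for the $X^1$-norm of the initial data and the $L^\infty(0,T,X^1)$-norm of the solutions). Furthermore, there is a constant $C$ depending on $\|u_0\|_1,A,B,G,\gamma$ such that $$\|u\|_{L^\infty(0,T,X^1)}+\|u_t\|_{L^\infty(0,T,X^1)}\le C.$$ In addition, let $k>1$ be an integer, $m=\max\{1,k-1\}$, and assume that $a_{ij}\in C^k$, $b_{ij},G_i,\gamma_i\in C^m$ for $i,j=1,\dots,d$, and $u_0\in X_0^k$. Let $u:[0,T]\to X_0^1$ satisfy the weak problem above. Then $u(t)\in X_0^k$ for all $t\in[0,T]$, and there is a constant $C$ depending on $\|u_0\|_k,A,B,G,\gamma$ such that $$\|u\|_{L^\infty(0,T,X^k)}+\|u_t\|_{L^\infty(0,T,X^k)}\le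 C.$$
   Context: $\Omega=(-1,1)$. $H^k=H^k(\Omega)$ is the usual real Sobolev space (with $H^0=L^2$), and for $k\ge 1$, $H_0^k$ is the set of $\varphi\in H^k$ with $\varphi(-1)=\varphi(1)=0$ (only the function values vanish at the endpoints). $X^k$ and $X_0^k$ are the products of $d$ copies of $H^k$ and $H_0^k$. For $\varphi,\psi\in X^0$, $\langle\varphi,\psi\rangle=\sum_{j=1}^d\int_\Omega\varphi_j\psi_j\,dx$, with norm $\|\cdot\|_0$, and $\|\varphi\|_k^2=\sum_{j=0}^k\|\frac{d^j}{dx^j}\varphi\|_0^2$ on $X^k$. $\|u\|_{L^\infty(0,T,X^k)}=\operatorname{ess\,sup}_{t\in(0,T)}\|u(t)\|_k$; $C(0,T,X)$ denotes continuous functions of $t$ with values in $X$. For $\varphi,\psi\in X_0^1$ and $w\in X_0^1$: $$\mathcal{A}_w(\varphi,\psi)=\langle\varphi,\psi\rangle+\int_\Omega (A(w)\varphi_x)\cdot\psi_x\,dx,$$ $$\mathcal{B}_w(\varphi,\psi)=\int_\Omega (B(w)\varphi_x)\cdot\psi_x\,dx+\Big\langle\frac{\partial}{\partial x}G(\varphi),\psi\Big\rangle+\langle\gamma(\varphi),\psi\rangle,$$ where $\cdot$ is the Euclidean inner product in $\mathbb{R}^d$. The weak problem is the weak form of the initial-boundary-value problem $\left(I-\partial_x(A(u)\partial_x)\right)\partial_tu=-\partial_x(B(u)\partial_xu)+\partial_xG(u)+\gamma(u)$ on $(-1,1)\times(0,T]$, $u(\pm1,t)=0$, $u(x,0)=u_0(x)$.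 *)

theory Defs
  imports "HOL-Analysis.Analysis" "HOL-Probability.Essential_Supremum"
begin

(* C_k n f: f is n times continuously differentiable on the whole space. *)
primrec C_k :: "nat \<Rightarrow> ('a::real_normed_vector \<Rightarrow> 'b::real_normed_vector) \<Rightarrow> bool" where
  "C_k 0 f \<longleftrightarrow> continuous_on UNIV f"
| "C_k (Suc n) f \<longleftrightarrow>
     (\<forall>x. f differentiable (at x)) \<and> (\<forall>v. C_k n (\<lambda>x. frechet_derivative f (at x) v))"

abbreviation Om :: "real measure" where
  "Om \<equiv> lebesgue_on {-1<..<1}"

(* Elements of L^2, H^k, X^k are represented by functions on the reals, of which only the
   values on (-1,1) up to Lebesgue null sets matter. Equality in these spaces is therefore
   AE-equality with respect to Om. *)
definition L2 :: "(real \<Rightarrow> real) set" where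
  "L2 = {f. f \<in> borel_measurable Om \<and> integrable Om (\<lambda>x. (f x)\<^sup>2)}"

definition test_fun :: "(real \<Rightarrow> real) \<Rightarrow> bool" where
  "test_fun \<phi> \<longleftrightarrow> (\<forall>n. C_k n \<phi>) \<and>
     (\<exists>K. compact K \<and> K \<subseteq> {-1<..<1} \<and> (\<forall>x. x \<notin> K \<longrightarrow> \<phi> x = 0))"

definition has_weak_deriv :: "nat \<Rightarrow> (real \<Rightarrow> real) \<Rightarrow> (real \<Rightarrow> real) \<Rightarrow> bool" where
  "has_weak_deriv j f g \<longleftrightarrow> (\<forall>\<phi>. test_fun \<phi> \<longrightarrow>
     (LINT x|Om. f x * (deriv ^^ j) \<phi> x) = (-1) ^ j * (LINT x|Om. g x * \<phi> x))"

definition H :: "nat \<Rightarrow> (real \<Rightarrow> real) set" where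
  "H k = {f \<in> L2. \<forall>j\<le>k. \<exists>g\<in>L2. has_weak_deriv j f g}"

(* The boundary values of f are those of its continuous representative (used for k >= 1). *)
definition H0 :: "nat \<Rightarrow> (real \<Rightarrow> real) set" where
  "H0 k = {f \<in> H k. \<exists>g. continuous_on {-1..1} g \<and> (AE x in Om. g x = f x) \<and>
                        g (-1) = 0 \<and> g 1 = 0}"

(* A representative of the j-th weak derivative, which is unique up to null sets;
   meaningful only if an L^2 weak derivative exists. *)
definition weak_deriv :: "nat \<Rightarrow> (real \<Rightarrow> real) \<Rightarrow> real \<Rightarrow> real" where
  "weak_deriv j f = (SOME g. g \<in> L2 \<and> has_weak_deriv j f g)"

definition X :: "nat \<Rightarrow> (real \<Rightarrow> real^'d) set" where
  "X k = {\<phi>. \<forall>i. (\<lambda>x. \<phi> x $ i) \<in> H k}"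

definition X0 :: "nat \<Rightarrow> (real \<Rightarrow> real^'d) set" where
  "X0 k = {\<phi>. \<forall>i. (\<lambda>x. \<phi> x $ i) \<in> H0 k}"

definition vderiv :: "nat \<Rightarrow> (real \<Rightarrow> real^'d) \<Rightarrow> real \<Rightarrow> real^'d" where
  "vderiv j \<phi> x = (\<chi> i. weak_deriv j (\<lambda>y. \<phi> y $ i) x)"

definition ip0 :: "(real \<Rightarrow> real^'d) \<Rightarrow> (real \<Rightarrow> real^'d) \<Rightarrow> real" where
  "ip0 \<phi> \<psi> = (\<Sum>i\<in>UNIV. LINT x|Om. \<phi> x $ i * \<psi> x $ i)"

definition norm0 :: "(real \<Rightarrow> real^'d) \<Rightarrow> real" where
  "norm0 \<phi> = sqrt (ip0 \<phi> \<phi>)"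

definition Xnorm :: "nat \<Rightarrow> (real \<Rightarrow> real^'d) \<Rightarrow> real" where
  "Xnorm k \<phi> = sqrt (\<Sum>j\<le>k. (norm0 (vderiv j \<phi>))\<^sup>2)"

(* The norm of L^infinity(0,T,X^k). The value \<infinity> off X^k makes a finite norm
   entail u t \<in> X k for almost every t. *)
definition LinfX :: "real \<Rightarrow> nat \<Rightarrow> (real \<Rightarrow> real \<Rightarrow> real^'d) \<Rightarrow> ereal" where
  "LinfX T k u = esssup (lebesgue_on {0<..<T})
     (\<lambda>t. if u t \<in> X k then ereal (Xnorm k (u t)) else \<infinity>)"

definition aform :: "(real^'d \<Rightarrow> real^'d^'d) \<Rightarrow> (real \<Rightarrow> real^'d) \<Rightarrow>
    (real \<Rightarrow> real^'d) \<Rightarrow> (real \<Rightarrow> real^'d) \<Rightarrow> real" where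
  "aform A w \<phi> \<psi> = ip0 \<phi> \<psi> + (LINT x|Om. (A (w x) *v vderiv 1 \<phi> x) \<bullet> vderiv 1 \<psi> x)"

definition bform :: "(real^'d \<Rightarrow> real^'d^'d) \<Rightarrow> (real^'d \<Rightarrow> real^'d) \<Rightarrow> (real^'d \<Rightarrow> real^'d) \<Rightarrow>
    (real \<Rightarrow> real^'d) \<Rightarrow> (real \<Rightarrow> real^'d) \<Rightarrow> (real \<Rightarrow> real^'d) \<Rightarrow> real" where
  "bform B G \<gamma> w \<phi> \<psi> = (LINT x|Om. (B (w x) *v vderiv 1 \<phi> x) \<bullet> vderiv 1 \<psi> x)
     + ip0 (vderiv 1 (\<lambda>x. G (\<phi> x))) \<psi> + ip0 (\<lambda>x. \<gamma> (\<phi> x)) \<psi>"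

(* u \<in> C(0,T,X_0^1) *)
definition C_X01 :: "real \<Rightarrow> (real \<Rightarrow> real \<Rightarrow> real^'d) \<Rightarrow> bool" where
  "C_X01 T u \<longleftrightarrow> (\<forall>t\<in>{0..T}. u t \<in> X0 1 \<and>
     ((\<lambda>s. Xnorm 1 (\<lambda>x. u s x - u t x)) \<longlongrightarrow> 0) (at t within {0..T}))"

(* u_t is the derivative in the norm of X^1 of the map t \<mapsto> u t, with values in X_0^1,
   at every t in (0,T] (one-sided at T). *)
definition time_deriv :: "real \<Rightarrow> (real \<Rightarrow> real \<Rightarrow> real^'d) \<Rightarrow> (real \<Rightarrow> real \<Rightarrow> real^'d) \<Rightarrow> bool" where
  "time_deriv T u ut \<longleftrightarrow> (\<forall>t\<in>{0<..T}. ut t \<in> X0 1 \<and>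
     ((\<lambda>s. Xnorm 1 (\<lambda>x. (1 / (s - t)) *\<^sub>R (u s x - u t x) - ut t x)) \<longlongrightarrow> 0) (at t within {0..T}))"

definition weak_solution :: "real \<Rightarrow> (real^'d \<Rightarrow> real^'d^'d) \<Rightarrow> (real^'d \<Rightarrow> real^'d^'d) \<Rightarrow>
    (real^'d \<Rightarrow> real^'d) \<Rightarrow> (real^'d \<Rightarrow> real^'d) \<Rightarrow> (real \<Rightarrow> real^'d) \<Rightarrow>
    (real \<Rightarrow> real \<Rightarrow> real^'d) \<Rightarrow> (real \<Rightarrow> real \<Rightarrow> real^'d) \<Rightarrow> bool" where
  "weak_solution T A B G \<gamma> u0 u ut \<longleftrightarrow>
     C_X01 T u \<and> (AE x in Om. u 0 x = u0 x) \<and> time_deriv T u ut \<and>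
     (\<forall>t\<in>{0<..T}. \<forall>v\<in>X0 1. aform A (u t) (ut t) v = bform B G \<gamma> (u t) (u t) v)"

end

theory Submission
  imports Defs
begin

text \<open>
  A function u in X_0^1 is the primitive of its derivative y = u_x, an L^2 function with mean
  zero, so the weak problem becomes a problem for y and its time derivative. Integrating the weak
  equation once, with w = u_t, it says that p = A(u) w_x - B(u) u_x + G(u) is absolutely continuous
  with p_x = w - gamma(u). Hence p is bounded, continuous in x, and depends on y in a locally
  Lipschitz way, and at each point x the function y solves the linear equation
  y_t = A(u)^{-1} (B(u) y + p - G(u)). Therefore y(t, x) = P(t, x) y_0(x) + r(t, x), where (P, r)
  takes values in the Banach space of bounded continuous functions of x. There the problem is an
  ordinary differential equation with a locally Lipschitz right-hand side, and the energy estimate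
  makes its solutions global. Uniqueness, continuous dependence and the bound come from Gronwall's
  inequality in L^2.

  For the regularity, if y_0 has j derivatives in L^2, then j successive differentiations of the
  pointwise equation in x give linear equations whose coefficients and forcing terms are controlled
  by the previous step.
\<close>

section \<open>Ordinary differential equations\<close>

text \<open>The map from y to its time derivative \<eta> is already locally Lipschitz in L^2
  (\<open>WF_stab\<close>), which is what uniqueness and stability use. Existence is set up with
  pointwise values because the regularity proof differentiates in x an equation that has to hold at
  every x. Writing y = P y_0 + r puts the roughness of the datum into the fixed factor y_0; what
  evolves is continuous in x, because A(u)^{-1} B(u), p and G(u) are. The integration constant p(-1)
  is determined by the mean zero condition on \<eta>, a two-point boundary problem solved by
  shooting. Dimension one enters through the bound of sup |u| by twice the L^2 norm of u_x:
  coefficient differences are then small uniformly in x, and their products with L^2 functions stay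
  in L^2. It also replaces boundedness of A, which is only Lipschitz. Norms of solutions need not be
  differentiable in time and u_t is given only for t > 0, so Gronwall's inequality is proved for
  one-sided increments. Constants uniform in the datum arise by treating all solutions with data in
  a ball as one indexed family.\<close>

lemma dini_gronwall:
  fixes N :: "real \<Rightarrow> real"
  assumes cont: "continuous_on {0..T} N" and K: "K \<ge> 0" and c: "c \<ge> 0" and N0: "N 0 \<ge> 0"
    and incr: "\<And>t \<epsilon>. \<lbrakk>0 < t; t \<le> T; \<epsilon> > 0\<rbrakk> \<Longrightarrow>
      \<forall>\<^sub>F s in at t within {0..T}. N t \<le> N s + (K * N t + c + \<epsilon>) * \<bar>s - t\<bar>"
    and t: "t \<in> {0..T}"
  shows "N t \<le> (N 0 + c * t) * exp (K * t)"
proof -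
  \<comment> \<open>The \<epsilon> next to N 0 starts the majorant strictly above N, the one next to
    c makes its slope exceed the admissible one. At the first time u with N u \<ge> \<psi> u,
    comparison of the left difference quotients yields N s > \<psi> s for some s < u, a
    contradiction.\<close>
  have main: "N t \<le> (N 0 + \<epsilon> + (c + \<epsilon>) * t) * exp (K * t)" if \<epsilon>: "\<epsilon> > 0" for \<epsilon>
  proof (rule ccontr)
    define \<psi> where "\<psi> = (\<lambda>t. (N 0 + \<epsilon> + (c + \<epsilon>) * t) * exp (K * t))"
    assume "\<not> ?thesis"
    then have tN: "N t > \<psi> t" by (simp add: \<psi>_def)
    define S where "S = {s \<in> {0..T}. N s - \<psi> s \<in> {0..}}"
    have c\<psi>: "continuous_on A \<psi>" for A unfolding \<psi>_def by (intro continuous_intros)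
    have cd: "continuous_on {0..T} (\<lambda>s. N s - \<psi> s)" by (intro continuous_intros cont c\<psi>)
    have clS: "closed S"
      using continuous_closed_preimage[OF cd closed_atLeastAtMost closed_atLeast[of 0]]
      by (simp add: S_def vimage_def Int_def)
    have neS: "S \<noteq> {}" using t tN by (auto simp: S_def intro!: exI[of _ t])
    have bdS: "bdd_below S" by (rule bdd_belowI[of _ 0]) (auto simp: S_def)
    define u where "u = Inf S"
    have uS: "u \<in> S" unfolding u_def by (rule closed_contains_Inf[OF neS bdS clS])
    have less: "N s < \<psi> s" if "0 \<le> s" "s < u" for s
    proof (rule ccontr)
      assume "\<not> N s < \<psi> s"
      then have "s \<in> S" using that uS by (auto simp: S_def)
      then have "u \<le> s" unfolding u_def by (rule cInf_lower[OF _ bdS])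
      then show False using that by simp
    qed
    have u0: "u > 0"
    proof (rule ccontr)
      assume "\<not> u > 0"
      then have "u = 0" using uS by (auto simp: S_def)
      then show False using uS \<epsilon> by (auto simp: S_def \<psi>_def)
    qed
    have uT: "u \<le> T" and Nu: "N u \<ge> \<psi> u" using uS by (auto simp: S_def)
    have fm: "at_left u \<le> at u within {0..T}"
      using at_le[of "{0..u}" "{0..T}" u] uT u0 by (simp add: at_within_Icc_at_left)
    have inl: "\<forall>\<^sub>F s in at_left u. s \<in> {0<..<u}" by (rule eventually_at_leftI[OF _ u0]) simp
    have tN': "(N \<longlongrightarrow> N u) (at_left u)"
      using cont u0 uT fm unfolding continuous_on_def by (auto intro: tendsto_mono)
    have t\<psi>': "(\<psi> \<longlongrightarrow> \<psi> u) (at_left u)"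
      using c\<psi>[of "{0..T}"] u0 uT fm unfolding continuous_on_def by (auto intro: tendsto_mono)
    have "N u \<le> \<psi> u"
      by (rule tendsto_le[OF _ t\<psi>' tN']) (use inl in \<open>auto elim!: eventually_mono intro: less less_imp_le\<close>)
    then have Nueq: "N u = \<psi> u" using Nu by simp
    have D: "(\<psi> has_real_derivative (K * \<psi> u + (c + \<epsilon>) * exp (K * u))) (at u within {..<u})"
      unfolding \<psi>_def by (auto intro!: derivative_eq_intros simp: algebra_simps)
    have e1: "exp (K * u) \<ge> 1" using K u0 by simp
    have "(c + \<epsilon>) * 1 \<le> (c + \<epsilon>) * exp (K * u)"
      by (rule mult_left_mono[OF e1]) (use c \<epsilon> in simp)
    then have lt: "K * \<psi> u + c + \<epsilon>/2 < K * \<psi> u + (c + \<epsilon>) * exp (K * u)" using \<epsilon> by simp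
    have ev1: "\<forall>\<^sub>F s in at_left u. K * \<psi> u + c + \<epsilon>/2 < (\<psi> s - \<psi> u) / (s - u)"
      using order_tendstoD(1)[OF D[unfolded has_field_derivative_iff] lt] by simp
    have ev2: "\<forall>\<^sub>F s in at_left u. N u \<le> N s + (K * N u + c + \<epsilon>/2) * \<bar>s - u\<bar>"
      using incr[OF u0 uT, of "\<epsilon>/2"] \<epsilon> fm by (auto intro: filter_leD)
    have "\<forall>\<^sub>F s in at_left u. False"
      using ev1 ev2 inl
    proof eventually_elim
      case (elim s)
      then have su: "s < u" "0 < s" by auto
      have "(K * \<psi> u + c + \<epsilon>/2) * (u - s) < \<psi> u - \<psi> s"
        using elim(1) su by (simp add: divide_simps split: if_splits) (simp add: algebra_simps)
      then show False using elim(2) less[of s] su Nueq by (simp add: abs_if)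
    qed
    then show False by simp
  qed
  have "((\<lambda>\<epsilon>. (N 0 + \<epsilon> + (c + \<epsilon>) * t) * exp (K * t)) \<longlongrightarrow> (N 0 + 0 + (c + 0) * t) * exp (K * t)) (at_right 0)"
    by (intro tendsto_intros)
  then have "N t \<le> (N 0 + 0 + (c + 0) * t) * exp (K * t)"
    by (rule tendsto_lowerbound) (use eventually_at_right_less[of "0::real"] in \<open>auto elim!: eventually_mono intro: main\<close>)
  then show ?thesis by simp
qed

lemma has_vector_derivative_increment:
  fixes y :: "real \<Rightarrow> 'a::real_normed_vector"
  assumes "(y has_vector_derivative y') (at t within S)" "\<epsilon> > 0"
  shows "\<forall>\<^sub>F s in at t within S. norm (y s - y t) \<le> (norm y' + \<epsilon>) * \<bar>s - t\<bar>"
proof -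
  have "\<forall>\<^sub>F s in at t within S. norm (y s - y t - (s - t) *\<^sub>R y') \<le> \<epsilon> * norm (s - t)"
    using assms unfolding has_vector_derivative_def has_derivative_within_alt2 by blast
  then show ?thesis
  proof eventually_elim
    case (elim s)
    have "norm (y s - y t) \<le> norm (y s - y t - (s - t) *\<^sub>R y') + norm ((s - t) *\<^sub>R y')"
      using norm_triangle_sub[of "y s - y t" "(s - t) *\<^sub>R y'"] by simp
    then show ?case using elim unfolding distrib_right by (simp add: mult.commute)
  qed
qed

text \<open>The norm of y may fail to be differentiable, so its growth is read off from increments
  of y.\<close>

lemma ode_bound:
  fixes y :: "real \<Rightarrow> 'a::real_normed_vector"
  assumes d: "\<And>t. t \<in> {0..T} \<Longrightarrow> (y has_vector_derivative y' t) (at t within {0..T})"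
    and b: "\<And>t. t \<in> {0..T} \<Longrightarrow> norm (y' t) \<le> K * norm (y t) + c"
    and K: "K \<ge> 0" and c: "c \<ge> 0" and t: "t \<in> {0..T}"
  shows "norm (y t) \<le> (norm (y 0) + c * t) * exp (K * t)"
proof (rule dini_gronwall[where N="\<lambda>t. norm (y t)" and T=T])
  show "continuous_on {0..T} (\<lambda>t. norm (y t))"
    using d by (intro continuous_on_norm) (meson continuous_on_eq_continuous_within has_vector_derivative_continuous)
  fix t \<epsilon> :: real assume t: "0 < t" "t \<le> T" "\<epsilon> > 0"
  show "\<forall>\<^sub>F s in at t within {0..T}. norm (y t) \<le> norm (y s) + (K * norm (y t) + c + \<epsilon>) * \<bar>s - t\<bar>"
    using has_vector_derivative_increment[OF d t(3), of t, unfolded atLeastAtMost_iff, OF conjI[OF less_imp_le[OF t(1)] t(2)]]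
  proof eventually_elim
    case (elim s)
    have "norm (y t) \<le> norm (y s) + norm (y s - y t)"
      by (metis add.commute norm_minus_commute norm_triangle_sub)
    moreover have "(norm (y' t) + \<epsilon>) * \<bar>s - t\<bar> \<le> (K * norm (y t) + c + \<epsilon>) * \<bar>s - t\<bar>"
      by (rule mult_right_mono) (use b[of t] t in auto)
    ultimately show ?case using elim by linarith
  qed
qed (use K c t in auto)

text \<open>The Picard iterates are named because the measurability in x of a solution of an equation with
  parameter x is inherited from them.\<close>

primrec pic :: "(real \<Rightarrow> 'a \<Rightarrow> 'a) \<Rightarrow> real \<Rightarrow> 'a \<Rightarrow> nat \<Rightarrow> real \<Rightarrow> 'a::real_normed_vector" where
  "pic f a y0 0 = (\<lambda>t. y0)"
| "pic f a y0 (Suc n) = (\<lambda>t. y0 + integral {a..t} (\<lambda>s. f s (pic f a y0 n s)))"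

lemma continuous_on_lipschitz_comp:
  fixes f :: "real \<Rightarrow> 'a::real_normed_vector \<Rightarrow> 'b::real_normed_vector"
  assumes cont: "\<And>y. continuous_on S (\<lambda>t. f t y)"
    and lip: "\<And>t y z. t \<in> S \<Longrightarrow> norm (f t y - f t z) \<le> L * norm (y - z)"
    and Y: "continuous_on S Y"
  shows "continuous_on S (\<lambda>t. f t (Y t))"
  unfolding continuous_on_def
proof
  fix t assume t: "t \<in> S"
  have 1: "((\<lambda>s. f s (Y t)) \<longlongrightarrow> f t (Y t)) (at t within S)"
    using cont t by (auto simp: continuous_on_def)
  have "((\<lambda>s. Y s - Y t) \<longlongrightarrow> Y t - Y t) (at t within S)"
    using Y t by (intro tendsto_intros) (auto simp: continuous_on_def)
  then have 2: "((\<lambda>s. L * norm (Y s - Y t)) \<longlongrightarrow> 0) (at t within S)"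
    by (intro tendsto_mult_right_zero tendsto_norm_zero) simp
  have "((\<lambda>s. f s (Y s) - f s (Y t)) \<longlongrightarrow> 0) (at t within S)"
    by (rule Lim_null_comparison[OF _ 2]) (auto simp: eventually_at_filter intro!: always_eventually lip)
  from tendsto_add[OF this 1] show "((\<lambda>t. f t (Y t)) \<longlongrightarrow> f t (Y t)) (at t within S)" by simp
qed

text \<open>The Lipschitz bound holds on the whole space, so the increments of the iterates are
  dominated by an exponential series and a single application covers all of [a,b].\<close>

lemma picard:
  fixes f :: "real \<Rightarrow> 'a::banach \<Rightarrow> 'a"
  assumes ab: "a \<le> b" and L: "L \<ge> 0"
    and cont: "\<And>y. continuous_on {a..b} (\<lambda>t. f t y)"
    and lip: "\<And>t y z. t \<in> {a..b} \<Longrightarrow> norm (f t y - f t z) \<le> L * norm (y - z)"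
  obtains y where "\<And>t. t \<in> {a..b} \<Longrightarrow> (\<lambda>n. pic f a y0 n t) \<longlonglongrightarrow> y t" "y a = y0"
    "\<And>t. t \<in> {a..b} \<Longrightarrow> (y has_vector_derivative f t (y t)) (at t within {a..b})"
proof -
  define Y where "Y = pic f a y0"
  have cfc: "continuous_on {a..b} (\<lambda>s. f s (g s))" if "continuous_on {a..b} g" for g
    by (rule continuous_on_lipschitz_comp[OF cont lip that])
  have cY: "continuous_on {a..b} (Y n)" for n
  proof (induction n)
    case (Suc n)
    have "(\<lambda>s. f s (Y n s)) integrable_on {a..b}" by (intro integrable_continuous_real cfc Suc)
    then show ?case unfolding Y_def pic.simps
      by (intro continuous_intros indefinite_integral_continuous_1) (simp add: Y_def)
  qed (simp add: Y_def)
  have ci: "continuous_on {a..t} g" if "continuous_on {a..b} g" "t \<in> {a..b}" for t and g :: "real \<Rightarrow> 'z::topological_space"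
    using that by (auto intro: continuous_on_subset)
  have int: "(\<lambda>s. f s (g s)) integrable_on {a..t}" if "continuous_on {a..b} g" "t \<in> {a..b}" for t g
    by (intro integrable_continuous_real ci[OF cfc[OF that(1)] that(2)])
  obtain M where M: "\<And>s. s \<in> {a..b} \<Longrightarrow> norm (f s y0) \<le> M"
    using compact_imp_bounded[OF compact_continuous_image[OF cont[of y0] compact_Icc]]
    by (auto simp: bounded_iff simp del: atLeastAtMost_iff)
  have M0: "M \<ge> 0" by (rule order_trans[OF norm_ge_zero M[of a]]) (use ab in simp)
  \<comment> \<open>The factorial gain: integrating L times the n-th bound raises the power of t - a
    by one. \<open>M\<close> bounds f along the constant iterate y0.\<close>
  have diff: "norm (Y (Suc n) t - Y n t) \<le> M * (b - a) * ((L * (t - a)) ^ n / fact n)" if "t \<in> {a..b}" for n t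
    using that
  proof (induction n arbitrary: t)
    case 0
    have "norm (integral {a..t} (\<lambda>s. f s y0)) \<le> M * (t - a)"
      by (rule integral_bound) (use 0 ci[OF cont] M in auto)
    also have "\<dots> \<le> M * (b - a)" using 0 M0 by (intro mult_left_mono) auto
    finally show ?case by (simp add: Y_def)
  next
    case (Suc n)
    have hi: "((\<lambda>s. L * (M * (b - a) * ((L * (s - a)) ^ n / fact n))) has_integral
        (M * (b - a) * ((L * (t - a)) ^ Suc n / fact (Suc n)) - M * (b - a) * ((L * (a - a)) ^ Suc n / fact (Suc n)))) {a..t}"
    proof (rule fundamental_theorem_of_calculus)
      fix s
      have "((\<lambda>s. M * (b - a) * ((L * (s - a)) ^ Suc n / fact (Suc n))) has_real_derivative
         M * (b - a) * ((real (Suc n) * (L * (s - a)) ^ n * L) / fact (Suc n))) (at s within {a..t})"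
      proof (intro DERIV_cmult DERIV_cdivide)
        have "((\<lambda>s. L * (s - a)) has_real_derivative L) (at s within {a..t})"
          by (auto intro!: derivative_eq_intros)
        from DERIV_power[OF this, of "Suc n"]
        show "((\<lambda>s. (L * (s - a)) ^ Suc n) has_real_derivative real (Suc n) * (L * (s - a)) ^ n * L) (at s within {a..t})"
          by (simp only: diff_Suc_Suc diff_zero mult.assoc mult.commute[of L])
      qed
      moreover have "M * (b - a) * ((real (Suc n) * (L * (s - a)) ^ n * L) / fact (Suc n)) = L * (M * (b - a) * ((L * (s - a)) ^ n / fact n))"
      proof -
        have "M * (b - a) * ((real (Suc n) * P * L) / (real (Suc n) * F)) = L * (M * (b - a) * (P / F))" for P F :: real
          by (simp del: of_nat_Suc)
        then show ?thesis unfolding fact_Suc by simp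
      qed
      ultimately show "((\<lambda>s. M * (b - a) * ((L * (s - a)) ^ Suc n / fact (Suc n))) has_vector_derivative
          L * (M * (b - a) * ((L * (s - a)) ^ n / fact n))) (at s within {a..t})"
        unfolding has_real_derivative_iff_has_vector_derivative by metis
    qed (use Suc in auto)
    have "Y (Suc (Suc n)) t - Y (Suc n) t = integral {a..t} (\<lambda>s. f s (Y (Suc n) s)) - integral {a..t} (\<lambda>s. f s (Y n s))"
      unfolding Y_def pic.simps(2)[of f a y0 "Suc n"] pic.simps(2)[of f a y0 n] by simp
    also have "\<dots> = integral {a..t} (\<lambda>s. f s (Y (Suc n) s) - f s (Y n s))"
      by (rule integral_diff[symmetric]; rule int[OF cY Suc.prems])
    finally have "norm (Y (Suc (Suc n)) t - Y (Suc n) t) = norm (integral {a..t} (\<lambda>s. f s (Y (Suc n) s) - f s (Y n s)))" by simp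
    also have "\<dots> \<le> integral {a..t} (\<lambda>s. L * (M * (b - a) * ((L * (s - a)) ^ n / fact n)))"
    proof (rule integral_norm_bound_integral)
      show "(\<lambda>s. f s (Y (Suc n) s) - f s (Y n s)) integrable_on {a..t}"
        by (intro integrable_diff int[OF cY Suc.prems])
      show "(\<lambda>s. L * (M * (b - a) * ((L * (s - a)) ^ n / fact n))) integrable_on {a..t}" using hi by blast
      fix s assume "s \<in> {a..t}"
      then have s: "s \<in> {a..b}" using Suc.prems by auto
      show "norm (f s (Y (Suc n) s) - f s (Y n s)) \<le> L * (M * (b - a) * ((L * (s - a)) ^ n / fact n))"
        using lip[OF s, of "Y (Suc n) s" "Y n s"] mult_left_mono[OF Suc.IH[OF s] L] by linarith
    qed
    also have "\<dots> = M * (b - a) * ((L * (t - a)) ^ Suc n / fact (Suc n))"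
      using integral_unique[OF hi] by simp
    finally show ?case .
  qed
  define e where "e = (\<lambda>n. M * (b - a) * ((L * (b - a)) ^ n / fact n))"
  have sume: "summable e" unfolding e_def
    by (intro summable_mult) (use summable_exp[of "L * (b - a)"] in \<open>simp add: divide_inverse mult.commute\<close>)
  have de: "norm (Y (Suc n) t - Y n t) \<le> e n" if t: "t \<in> {a..b}" for n t
  proof -
    have "(L * (t - a)) ^ n \<le> (L * (b - a)) ^ n"
      by (rule power_mono) (use t L in \<open>auto intro: mult_left_mono\<close>)
    then have "M * (b - a) * ((L * (t - a)) ^ n / fact n) \<le> e n"
      unfolding e_def using M0 ab by (intro mult_left_mono divide_right_mono) auto
    then show ?thesis using diff[OF t, of n] by linarith
  qed
  \<comment> \<open>The limit is written as a telescoping series so that the Weierstrass test gives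
    uniform convergence on [a,b].\<close>
  define y where "y = (\<lambda>t. y0 + (\<Sum>n. Y (Suc n) t - Y n t))"
  have tel: "Y n t = y0 + (\<Sum>k<n. Y (Suc k) t - Y k t)" for n t
    by (subst sum_lessThan_telescope) (simp add: Y_def)
  have ul: "uniform_limit {a..b} (\<lambda>n t. \<Sum>k<n. Y (Suc k) t - Y k t) (\<lambda>t. \<Sum>n. Y (Suc n) t - Y n t) sequentially"
    by (rule Weierstrass_m_test[OF de sume])
  have ulY: "uniform_limit {a..b} Y y sequentially"
  proof -
    have "uniform_limit {a..b} (\<lambda>n t. y0 + (\<Sum>k<n. Y (Suc k) t - Y k t)) y sequentially"
      unfolding y_def by (intro uniform_limit_intros ul)
    then show ?thesis by (simp add: tel[symmetric])
  qed
  have cy: "continuous_on {a..b} y"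
    by (rule uniform_limit_theorem[OF _ ulY]) (auto simp: cY)
  have lim: "(\<lambda>n. Y n t) \<longlonglongrightarrow> y t" if "t \<in> {a..b}" for t
    by (rule tendsto_uniform_limitI[OF ulY that])
  have eq: "y t = y0 + integral {a..t} (\<lambda>s. f s (y s))" if t: "t \<in> {a..b}" for t
  proof -
    have ul2: "uniform_limit {a..t} (\<lambda>n s. f s (Y n s)) (\<lambda>s. f s (y s)) sequentially"
      unfolding uniform_limit_iff
    proof (intro allI impI)
      fix r :: real assume "r > 0"
      \<comment> \<open>The divisor L + 1 is positive also for L = 0 and makes L * r / (L + 1)
        strictly smaller than r.\<close>
      then have "\<forall>\<^sub>F n in sequentially. \<forall>s\<in>{a..b}. dist (Y n s) (y s) < r / (L + 1)"
        using ulY L unfolding uniform_limit_iff by simp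
      then show "\<forall>\<^sub>F n in sequentially. \<forall>s\<in>{a..t}. dist (f s (Y n s)) (f s (y s)) < r"
      proof eventually_elim
        case (elim n)
        show ?case
        proof
        fix s assume "s \<in> {a..t}"
        then have s: "s \<in> {a..b}" using t by auto
        have "norm (f s (Y n s) - f s (y s)) \<le> L * norm (Y n s - y s)" by (rule lip[OF s])
        also have "\<dots> \<le> L * (r / (L + 1))" using elim(1) s L by (intro mult_left_mono) (auto simp: dist_norm less_imp_le)
        also have "\<dots> < r" using \<open>r > 0\<close> L by (simp add: field_simps)
        finally show "dist (f s (Y n s)) (f s (y s)) < r" by (simp add: dist_norm)
        qed
      qed
    qed
    obtain I K where I: "\<And>n. ((\<lambda>s. f s (Y n s)) has_integral I n) {a..t}" and K: "((\<lambda>s. f s (y s)) has_integral K) {a..t}" "(I \<longlongrightarrow> K) sequentially"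
      by (rule uniform_limit_integral[OF ul2 ci[OF cfc[OF cY] t]]) auto
    have "(\<lambda>n. Y (Suc n) t) \<longlonglongrightarrow> y0 + integral {a..t} (\<lambda>s. f s (y s))"
    proof -
      have "I = (\<lambda>n. integral {a..t} (\<lambda>s. f s (Y n s)))" using integral_unique[OF I] by (simp add: fun_eq_iff)
      moreover have "integral {a..t} (\<lambda>s. f s (y s)) = K" by (rule integral_unique[OF K(1)])
      ultimately show ?thesis using K(2) by (auto simp: Y_def intro!: tendsto_intros)
    qed
    then show ?thesis using LIMSEQ_Suc[OF lim[OF t]] LIMSEQ_unique by blast
  qed
  show thesis
  proof (rule that[of y])
    show "(\<lambda>n. pic f a y0 n t) \<longlonglongrightarrow> y t" if "t \<in> {a..b}" for t
      using lim[OF that] by (simp add: Y_def)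
    show "y a = y0" using eq[of a] ab by simp
    show "(y has_vector_derivative f t (y t)) (at t within {a..b})" if t: "t \<in> {a..b}" for t
    proof (rule has_vector_derivative_transform[OF t])
      show "((\<lambda>t. y0 + integral {a..t} (\<lambda>s. f s (y s))) has_vector_derivative f t (y t)) (at t within {a..b})"
        using integral_has_vector_derivative[OF cfc[OF cy] t] by (auto intro!: derivative_eq_intros)
    qed (rule eq)
  qed
qed

section \<open>Square integrable functions and their primitives\<close>

text \<open>Genuine functions on the closed interval, not classes modulo null sets: later the
  equation for y is used at every single x, and \<open>n2\<close> is accordingly only a
  seminorm.\<close>

definition L2v :: "(real \<Rightarrow> 'a::euclidean_space) \<Rightarrow> bool" where
  "L2v f \<longleftrightarrow> f \<in> borel_measurable (lebesgue_on {-1..1}) \<and> (\<lambda>x. (norm (f x))\<^sup>2) integrable_on {-1..1}"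

definition n2 :: "(real \<Rightarrow> 'a::euclidean_space) \<Rightarrow> real" where
  "n2 f = sqrt (integral {-1..1} (\<lambda>x. (norm (f x))\<^sup>2))"

definition prim :: "(real \<Rightarrow> 'a::euclidean_space) \<Rightarrow> real \<Rightarrow> 'a" where
  "prim f x = integral {-1..x} f"

lemma L2v_meas: "L2v f \<Longrightarrow> f \<in> borel_measurable (lebesgue_on {-1..1})"
  by (simp add: L2v_def)

lemma L2v_dominated:
  fixes f :: "real \<Rightarrow> 'a::euclidean_space" and g :: "real \<Rightarrow> 'b::euclidean_space"
  assumes "L2v g" "f \<in> borel_measurable (lebesgue_on {-1..1})" "\<And>x. x \<in> {-1..1} \<Longrightarrow> norm (f x) \<le> K * norm (g x)"
  shows "L2v f"
proof -
  have "(\<lambda>x. (norm (f x))\<^sup>2) absolutely_integrable_on {-1..1}"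
  proof (rule measurable_bounded_by_integrable_imp_absolutely_integrable)
    show "(\<lambda>x. K\<^sup>2 * (norm (g x))\<^sup>2) integrable_on {-1..1}"
      using assms(1) by (intro integrable_on_mult_right) (simp add: L2v_def)
    fix x :: real assume x: "x \<in> {-1..1}"
    have "(norm (f x))\<^sup>2 \<le> (K * norm (g x))\<^sup>2" by (intro power_mono assms(3) x) simp
    then show "norm ((norm (f x))\<^sup>2) \<le> K\<^sup>2 * (norm (g x))\<^sup>2" by (simp add: power_mult_distrib)
  qed (use assms(2) in auto)
  then show ?thesis using assms(2) by (simp add: L2v_def absolutely_integrable_on_def)
qed

lemma L2v_bounded:
  assumes "f \<in> borel_measurable (lebesgue_on {-1..1})" "\<And>x. x \<in> {-1..1} \<Longrightarrow> norm (f x) \<le> K"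
  shows "L2v f"
proof (rule L2v_dominated[where g="\<lambda>x. 1::real" and K=K])
  show "L2v (\<lambda>x. 1::real)" by (simp add: L2v_def integrable_on_const)
qed (use assms in auto)

lemma L2v_continuous: "continuous_on {-1..1} f \<Longrightarrow> L2v f"
proof -
  assume c: "continuous_on {-1..1} f"
  obtain K where "\<And>s. s \<in> {-1..1} \<Longrightarrow> norm (f s) \<le> K"
    using compact_imp_bounded[OF compact_continuous_image[OF c compact_Icc]]
    by (auto simp: bounded_iff simp del: atLeastAtMost_iff)
  then show ?thesis
    by (intro L2v_bounded continuous_imp_measurable_on_sets_lebesgue[OF c]) auto
qed

lemma L2v_norm: "L2v f \<Longrightarrow> L2v (\<lambda>x. norm (f x))"
  unfolding L2v_def by auto

lemma L2v_int_sq: "L2v f \<Longrightarrow> (\<lambda>x. (norm (f x))\<^sup>2) integrable_on {-1..1}"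
  by (simp add: L2v_def)

lemma two_mult_le: "a * b \<le> a\<^sup>2 + (b::real)\<^sup>2"
proof -
  have "0 \<le> (a - b)\<^sup>2" "0 \<le> a\<^sup>2 + b\<^sup>2" by auto
  then show ?thesis unfolding power2_diff by linarith
qed

lemma bilinear_measurable:
  fixes prod :: "'a::euclidean_space \<Rightarrow> 'b::euclidean_space \<Rightarrow> 'c::euclidean_space"
  assumes "bounded_bilinear prod" "f \<in> borel_measurable M" "g \<in> borel_measurable M"
  shows "(\<lambda>x. prod (f x) (g x)) \<in> borel_measurable M"
  by (rule borel_measurable_continuous_Pair[OF assms(2,3)],
      rule bounded_bilinear.continuous_on[OF assms(1) continuous_on_fst[OF continuous_on_id] continuous_on_snd[OF continuous_on_id]])

lemma L2v_bilinear_integrable: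
  fixes prod :: "'a::euclidean_space \<Rightarrow> 'b::euclidean_space \<Rightarrow> 'c::euclidean_space"
  assumes bb: "bounded_bilinear prod" and f: "L2v f" and g: "L2v g"
  shows "(\<lambda>x. prod (f x) (g x)) absolutely_integrable_on {-1..1}"
proof -
  obtain K where K: "K > 0" "\<And>a b. norm (prod a b) \<le> norm a * norm b * K"
    using bounded_bilinear.pos_bounded[OF bb] by blast
  show ?thesis
  proof (rule measurable_bounded_by_integrable_imp_absolutely_integrable)
    show "(\<lambda>x. K * ((norm (f x))\<^sup>2 + (norm (g x))\<^sup>2)) integrable_on {-1..1}"
      using f g by (intro integrable_on_mult_right integrable_add) (auto simp: L2v_def)
    fix x :: real
    have "norm (prod (f x) (g x)) \<le> K * (norm (f x) * norm (g x))" using K(2)[of "f x" "g x"] by (simp add: ac_simps)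
    also have "\<dots> \<le> K * ((norm (f x))\<^sup>2 + (norm (g x))\<^sup>2)" using K two_mult_le by (intro mult_left_mono) auto
    finally show "norm (prod (f x) (g x)) \<le> K * ((norm (f x))\<^sup>2 + (norm (g x))\<^sup>2)" .
  qed (use f g in \<open>auto intro: bilinear_measurable[OF bb] L2v_meas\<close>)
qed

lemma L2v_bilinear_bounded:
  fixes prod :: "'a::euclidean_space \<Rightarrow> 'b::euclidean_space \<Rightarrow> 'c::euclidean_space"
  assumes bb: "bounded_bilinear prod" and f: "f \<in> borel_measurable (lebesgue_on {-1..1})"
    "\<And>x. x \<in> {-1..1} \<Longrightarrow> norm (f x) \<le> C" and g: "L2v g"
  shows "L2v (\<lambda>x. prod (f x) (g x))"
proof -
  obtain K where K: "K > 0" "\<And>a b. norm (prod a b) \<le> norm a * norm b * K"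
    using bounded_bilinear.pos_bounded[OF bb] by blast
  show ?thesis
  proof (rule L2v_dominated[OF g, where K="C * K"])
    fix x :: real assume x: "x \<in> {-1..1}"
    have "norm (f x) * norm (g x) * K \<le> C * norm (g x) * K"
      using f(2)[OF x] K(1) by (intro mult_right_mono) auto
    then show "norm (prod (f x) (g x)) \<le> C * K * norm (g x)"
      using K(2)[of "f x" "g x"] by (simp add: ac_simps)
  qed (use f g in \<open>auto intro: bilinear_measurable[OF bb] L2v_meas\<close>)
qed

lemma L2v_abs_int: "L2v f \<Longrightarrow> f absolutely_integrable_on {-1..1}"
  using L2v_bilinear_integrable[OF bounded_bilinear_scaleR L2v_continuous[of "\<lambda>x. 1::real"], of f] by simp

lemma L2v_int: "L2v f \<Longrightarrow> f integrable_on {-1..1}"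
  using L2v_abs_int by (auto simp: absolutely_integrable_on_def)

lemma int_sub: "(f :: real \<Rightarrow> 'a::banach) integrable_on {-1..1} \<Longrightarrow> -1 \<le> a \<Longrightarrow> b \<le> 1 \<Longrightarrow> f integrable_on {a..b::real}"
  by (erule integrable_subinterval_real) auto

lemma L2v_int_sub: "L2v f \<Longrightarrow> -1 \<le> a \<Longrightarrow> b \<le> 1 \<Longrightarrow> f integrable_on {a..b::real}"
  by (rule int_sub[OF L2v_int])

lemma L2v_scaleR: "L2v f \<Longrightarrow> L2v (\<lambda>x. c *\<^sub>R f x)"
  by (rule L2v_dominated[of f _ "\<bar>c\<bar>"]) (auto dest: L2v_meas)

lemma L2v_uminus: "L2v f \<Longrightarrow> L2v (\<lambda>x. - f x)"
  using L2v_scaleR[of f "-1"] by simp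

lemma L2v_add:
  fixes f :: "real \<Rightarrow> 'a::euclidean_space"
  assumes "L2v f" "L2v g" shows "L2v (\<lambda>x. f x + g x)"
proof -
  have i: "(\<lambda>x. f x \<bullet> g x) integrable_on {-1..1}"
    using L2v_bilinear_integrable[OF bounded_bilinear_inner assms] by (simp add: absolutely_integrable_on_def)
  have "(\<lambda>x. (norm (f x))\<^sup>2 + 2 * (f x \<bullet> g x) + (norm (g x))\<^sup>2) integrable_on {-1..1}"
    using assms by (intro integrable_add integrable_on_mult_right i) (auto simp: L2v_def)
  moreover have "(norm (f x))\<^sup>2 + 2 * (f x \<bullet> g x) + (norm (g x))\<^sup>2 = (norm (f x + g x))\<^sup>2" for x
    unfolding power2_norm_eq_inner inner_add_left inner_add_right inner_commute[of "g x" "f x"] by simp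
  moreover have "(\<lambda>x. f x + g x) \<in> borel_measurable (lebesgue_on {-1..1})"
    using assms by (intro borel_measurable_add L2v_meas)
  ultimately show ?thesis by (simp add: L2v_def)
qed

lemma L2v_diff: "L2v f \<Longrightarrow> L2v g \<Longrightarrow> L2v (\<lambda>x. f x - g x)"
  using L2v_add[of f "\<lambda>x. - g x"] L2v_uminus[of g] by simp

lemma integral_nonneg_pos:
  fixes f :: "real \<Rightarrow> real"
  assumes "\<And>x. x \<in> S \<Longrightarrow> 0 \<le> f x"
  shows "0 \<le> integral S f"
proof (cases "f integrable_on S")
  case True
  then show ?thesis by (rule Henstock_Kurzweil_Integration.integral_nonneg) (rule assms)
qed (simp add: not_integrable_integral)

lemma n2_sq: "(n2 f)\<^sup>2 = integral {-1..1} (\<lambda>x. (norm (f x))\<^sup>2)"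
  unfolding n2_def by (rule real_sqrt_pow2) (rule integral_nonneg_pos, simp)

lemma n2_nonneg: "n2 f \<ge> 0"
  unfolding n2_def by (rule real_sqrt_ge_zero) (rule integral_nonneg_pos, simp)

lemma n2_norm [simp]: "n2 (\<lambda>x. norm (f x)) = n2 f"
  by (simp add: n2_def)

lemma n2_minus: "n2 (\<lambda>x. - f x) = n2 f"
  by (simp add: n2_def)

lemma n2_scaleR: "n2 (\<lambda>x. c *\<^sub>R f x) = \<bar>c\<bar> * n2 f"
  by (simp add: n2_def power_mult_distrib real_sqrt_mult)

lemma n2_commute: "n2 (\<lambda>x. f x - g x) = n2 (\<lambda>x. g x - f x)"
  by (simp add: n2_def norm_minus_commute)

lemma n2_cong: "(\<And>x. x \<in> {-1..1} \<Longrightarrow> f x = g x) \<Longrightarrow> n2 f = n2 g"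
  unfolding n2_def by (auto intro!: Henstock_Kurzweil_Integration.integral_cong)

lemma n2_mono:
  fixes f :: "real \<Rightarrow> 'a::euclidean_space" and g :: "real \<Rightarrow> 'b::euclidean_space"
  assumes f: "L2v f" and g: "L2v g" and K: "K \<ge> 0" and le: "\<And>x. x \<in> {-1..1} \<Longrightarrow> norm (f x) \<le> K * norm (g x)"
  shows "n2 f \<le> K * n2 g"
proof -
  have "(n2 f)\<^sup>2 \<le> integral {-1..1} (\<lambda>x. K\<^sup>2 * (norm (g x))\<^sup>2)"
    unfolding n2_sq
  proof (rule Henstock_Kurzweil_Integration.integral_le)
    fix x :: real assume x: "x \<in> {-1..1}"
    show "(norm (f x))\<^sup>2 \<le> K\<^sup>2 * (norm (g x))\<^sup>2"
      using power_mono[OF le[OF x], of 2] by (simp add: power_mult_distrib)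
  qed (use f g in \<open>auto intro!: integrable_on_mult_right L2v_int_sq\<close>)
  also have "\<dots> = (K * n2 g)\<^sup>2" by (simp add: power_mult_distrib n2_sq)
  finally show ?thesis by (rule power2_le_imp_le) (simp add: K n2_nonneg)
qed

text \<open>The factor 2 is sqrt 2, the norm of the constant one on an interval of length two,
  rounded up. The factors 2 in \<open>prim_bound\<close> and 4 in \<open>prim_n2\<close> have the
  same origin.\<close>

lemma n2_bound:
  assumes f: "L2v f" and K: "K \<ge> 0" and le: "\<And>x. x \<in> {-1..1} \<Longrightarrow> norm (f x) \<le> K"
  shows "n2 f \<le> 2 * K"
proof -
  have "n2 f \<le> K * n2 (\<lambda>x. 1::real)"
    by (rule n2_mono[OF f L2v_continuous K]) (use le in auto)
  also have "\<dots> \<le> K * sqrt 4" unfolding n2_def by (intro mult_left_mono K real_sqrt_le_mono) simp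
  finally show ?thesis by simp
qed

text \<open>The integral of the square of t |f| - |g| is a nonnegative quadratic in t; the
  degenerate case of vanishing leading coefficient is treated apart.\<close>

lemma cauchy_schwarz:
  fixes f :: "real \<Rightarrow> 'a::euclidean_space" and g :: "real \<Rightarrow> 'b::euclidean_space"
  assumes f: "L2v f" and g: "L2v g"
  shows "integral {-1..1} (\<lambda>x. norm (f x) * norm (g x)) \<le> n2 f * n2 g"
proof -
  define A where "A = (n2 f)\<^sup>2"
  define B where "B = (n2 g)\<^sup>2"
  define C where "C = integral {-1..1} (\<lambda>x. norm (f x) * norm (g x))"
  have i: "(\<lambda>x. norm (f x) * norm (g x)) integrable_on {-1..1}"
    using L2v_bilinear_integrable[OF bounded_bilinear_mult L2v_norm[OF f] L2v_norm[OF g]] by (simp add: absolutely_integrable_on_def)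
  have q: "0 \<le> t\<^sup>2 * A - 2 * t * C + B" for t
  proof -
    have "0 \<le> integral {-1..1} (\<lambda>x. (t * norm (f x) - norm (g x))\<^sup>2)"
      by (rule integral_nonneg_pos) simp
    also have "(\<lambda>x. (t * norm (f x) - norm (g x))\<^sup>2) = (\<lambda>x. t\<^sup>2 * (norm (f x))\<^sup>2 - 2 * t * (norm (f x) * norm (g x)) + (norm (g x))\<^sup>2)"
      by (simp add: power2_diff power_mult_distrib algebra_simps)
    also have "integral {-1..1} \<dots> = t\<^sup>2 * A - 2 * t * C + B"
      using f g i unfolding A_def B_def C_def n2_sq
      by (simp add: L2v_def integrable_on_mult_right Henstock_Kurzweil_Integration.integral_add Henstock_Kurzweil_Integration.integral_diff integrable_diff)
    finally show ?thesis .
  qed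
  have "C\<^sup>2 \<le> A * B"
  proof (cases "A = 0")
    case True
    have "C = 0"
    proof (rule ccontr)
      assume "C \<noteq> 0"
      \<comment> \<open>With A = 0 the quadratic is linear in t, and at this t its value is
        -1.\<close>
      then show False using q[of "(B + 1) / (2 * C)"] True by simp
    qed
    then show ?thesis using True by simp
  next
    case False
    then have A: "A > 0" by (simp add: A_def)
    have "(C/A)\<^sup>2 * A - 2 * (C/A) * C + B = B - C\<^sup>2 / A" using A by (simp add: power2_eq_square field_simps)
    then have "C\<^sup>2 / A \<le> B" using q[of "C/A"] by simp
    then show ?thesis using A by (simp add: field_simps)
  qed
  then have "C\<^sup>2 \<le> (n2 f * n2 g)\<^sup>2" by (simp add: A_def B_def power_mult_distrib)
  then show ?thesis unfolding C_def[symmetric] by (rule power2_le_imp_le) (simp add: n2_nonneg)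
qed

lemma integral_bilinear_le:
  fixes prod :: "'a::euclidean_space \<Rightarrow> 'b::euclidean_space \<Rightarrow> 'c::euclidean_space"
  assumes bb: "bounded_bilinear prod" and K: "\<And>a b. norm (prod a b) \<le> norm a * norm b"
    and f: "L2v f" and g: "L2v g"
  shows "norm (integral {-1..1} (\<lambda>x. prod (f x) (g x))) \<le> n2 f * n2 g"
proof -
  have i: "(\<lambda>x. norm (f x) * norm (g x)) integrable_on {-1..1}"
    using L2v_bilinear_integrable[OF bounded_bilinear_mult L2v_norm[OF f] L2v_norm[OF g]] by (simp add: absolutely_integrable_on_def)
  have "norm (integral {-1..1} (\<lambda>x. prod (f x) (g x))) \<le> integral {-1..1} (\<lambda>x. norm (f x) * norm (g x))"
    by (rule integral_norm_bound_integral)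
      (use K i L2v_bilinear_integrable[OF bb f g] in \<open>auto simp: absolutely_integrable_on_def\<close>)
  then show ?thesis using cauchy_schwarz[OF f g] by simp
qed

lemma integral_inner_le: "L2v f \<Longrightarrow> L2v g \<Longrightarrow> integral {-1..1} (\<lambda>x. f x \<bullet> g x) \<le> n2 f * n2 g"
proof -
  assume "L2v f" "L2v g"
  then have "norm (integral {-1..1} (\<lambda>x. f x \<bullet> g x)) \<le> n2 f * n2 g"
    by (intro integral_bilinear_le[OF bounded_bilinear_inner]) (auto simp: Cauchy_Schwarz_ineq2)
  then show ?thesis by (simp only: real_norm_def abs_le_iff)
qed

lemma n2_add:
  fixes f g :: "real \<Rightarrow> 'a::euclidean_space"
  assumes f: "L2v f" and g: "L2v g"
  shows "n2 (\<lambda>x. f x + g x) \<le> n2 f + n2 g"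
proof -
  have i: "(\<lambda>x. f x \<bullet> g x) integrable_on {-1..1}"
    using L2v_bilinear_integrable[OF bounded_bilinear_inner f g] by (simp add: absolutely_integrable_on_def)
  have "(n2 (\<lambda>x. f x + g x))\<^sup>2 = integral {-1..1} (\<lambda>x. (norm (f x))\<^sup>2 + 2 * (f x \<bullet> g x) + (norm (g x))\<^sup>2)"
  proof -
    have "(norm (f x))\<^sup>2 + 2 * (f x \<bullet> g x) + (norm (g x))\<^sup>2 = (norm (f x + g x))\<^sup>2" for x
      unfolding power2_norm_eq_inner inner_add_left inner_add_right inner_commute[of "g x" "f x"] by simp
    then show ?thesis unfolding n2_sq by simp
  qed
  also have "\<dots> = (n2 f)\<^sup>2 + 2 * integral {-1..1} (\<lambda>x. f x \<bullet> g x) + (n2 g)\<^sup>2"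
    using f g i unfolding n2_sq
    by (simp add: L2v_def integrable_on_mult_right Henstock_Kurzweil_Integration.integral_add integrable_add)
  also have "\<dots> \<le> (n2 f + n2 g)\<^sup>2" using integral_inner_le[OF f g] by (simp add: power2_sum)
  finally show ?thesis by (rule power2_le_imp_le) (simp add: n2_nonneg)
qed

lemma n2_diff: "L2v f \<Longrightarrow> L2v g \<Longrightarrow> n2 (\<lambda>x. f x - g x) \<le> n2 f + n2 g"
  using n2_add[of f "\<lambda>x. - g x"] L2v_uminus[of g] by (simp add: n2_minus)

lemma n2_triangle: "L2v f \<Longrightarrow> L2v g \<Longrightarrow> n2 f \<le> n2 g + n2 (\<lambda>x. f x - g x)"
  using n2_add[OF _ L2v_diff[of f g], of g] by simp

lemma n2_triangle_abs: "L2v f \<Longrightarrow> L2v g \<Longrightarrow> \<bar>n2 f - n2 g\<bar> \<le> n2 (\<lambda>x. f x - g x)"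
  using n2_triangle[of f g] n2_triangle[of g f] n2_commute[of f g] by simp

lemma integral_norm_le_n2:
  assumes f: "L2v f" and ab: "-1 \<le> a" "b \<le> 1"
  shows "integral {a..b} (\<lambda>x. norm (f x)) \<le> 2 * n2 f"
proof -
  have "integral {a..b} (\<lambda>x. norm (f x)) \<le> integral {-1..1} (\<lambda>x. norm (f x))"
    by (rule integral_subset_le) (use ab L2v_int[OF L2v_norm[OF f]] L2v_int_sub[OF L2v_norm[OF f]] in auto)
  also have "\<dots> \<le> n2 f * n2 (\<lambda>x. 1::real)"
    using cauchy_schwarz[OF f L2v_continuous[of "\<lambda>x. 1::real"]] by simp
  also have "\<dots> \<le> n2 f * 2"
  proof (rule mult_left_mono[OF _ n2_nonneg])
    have "L2v (\<lambda>x. 1::real)" by (rule L2v_continuous) simp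
    from n2_bound[OF this, of 1] show "n2 (\<lambda>x. 1::real) \<le> 2" by simp
  qed
  finally show ?thesis by simp
qed

text \<open>The one-dimensional Sobolev embedding, from Cauchy-Schwarz against the constant
  one.\<close>

lemma prim_bound:
  assumes f: "L2v f" and x: "x \<in> {-1..1}"
  shows "norm (prim f x) \<le> 2 * n2 f"
proof -
  have "norm (prim f x) \<le> integral {-1..x} (\<lambda>x. norm (f x))" unfolding prim_def
    by (rule integral_norm_bound_integral) (use x L2v_int_sub[OF f] L2v_int_sub[OF L2v_norm[OF f]] in auto)
  also have "\<dots> \<le> 2 * n2 f" by (rule integral_norm_le_n2[OF f]) (use x in auto)
  finally show ?thesis .
qed

lemma prim_continuous: "L2v f \<Longrightarrow> continuous_on {-1..1} (prim f)"
  unfolding prim_def[abs_def] by (intro indefinite_integral_continuous_1 L2v_int)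

lemma prim_L2v: "L2v f \<Longrightarrow> L2v (prim f)"
  by (rule L2v_continuous[OF prim_continuous])

lemma prim_n2: "L2v f \<Longrightarrow> n2 (prim f) \<le> 4 * n2 f"
proof -
  assume f: "L2v f"
  have "n2 (prim f) \<le> 2 * (2 * n2 f)"
    by (rule n2_bound[OF prim_L2v[OF f]]) (use n2_nonneg[of f] prim_bound[OF f] in auto)
  then show ?thesis by simp
qed

lemma prim_diff:
  assumes "L2v f" "L2v g" "x \<in> {-1..1}"
  shows "prim (\<lambda>x. f x - g x) x = prim f x - prim g x"
  unfolding prim_def by (rule Henstock_Kurzweil_Integration.integral_diff) (use assms L2v_int_sub in auto)

lemma prim_add:
  assumes "L2v f" "L2v g" "x \<in> {-1..1}"
  shows "prim (\<lambda>x. f x + g x) x = prim f x + prim g x"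
  unfolding prim_def by (rule Henstock_Kurzweil_Integration.integral_add) (use assms L2v_int_sub in auto)

lemma prim_scaleR: "prim (\<lambda>x. c *\<^sub>R f x) x = c *\<^sub>R prim f x"
  unfolding prim_def by simp

lemma prim_m1 [simp]: "prim f (-1) = 0"
  unfolding prim_def by simp

lemma prim_increment:
  assumes f: "f integrable_on {-1..1}" and ab: "-1 \<le> a" "a \<le> b" "b \<le> 1"
  shows "prim f b - prim f a = integral {a..b} f"
proof -
  have "f integrable_on {-1..b}" by (rule int_sub[OF f]) (use ab in auto)
  from Henstock_Kurzweil_Integration.integral_combine[OF ab(1) ab(2) this] show ?thesis
    unfolding prim_def by (metis add_diff_cancel_left')
qed

text \<open>Since y is merely integrable, u has no derivative at prescribed points. The defect of
  the claimed formula is instead shown to have increments at most \<epsilon> times those of the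
  integral of |y|: locally by freezing the derivative of F, globally by bisection. The continuity of
  F' is required uniformly in the direction v for this freezing.\<close>

lemma chain_rule_prim:
  fixes u y :: "real \<Rightarrow> 'a::euclidean_space" and F :: "'a \<Rightarrow> 'b::euclidean_space"
  assumes y: "y absolutely_integrable_on {-1..1}"
    and u: "\<And>x. x \<in> {-1..1} \<Longrightarrow> u x = u (-1) + prim y x"
    and dF: "\<And>w. (F has_derivative F' w) (at w)"
    and cF: "\<And>w \<epsilon>. \<epsilon> > 0 \<Longrightarrow> \<exists>\<delta>>0. \<forall>w'. norm (w' - w) < \<delta> \<longrightarrow> (\<forall>v. norm (F' w' v - F' w v) \<le> \<epsilon> * norm v)"
    and int: "(\<lambda>x. F' (u x) (y x)) integrable_on {-1..1}"
    and x: "x \<in> {-1..1}"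
  shows "F (u x) = F (u (-1)) + integral {-1..x} (\<lambda>x. F' (u x) (y x))"
proof -
  have yi: "y integrable_on {-1..1}" and ny: "(\<lambda>x. norm (y x)) integrable_on {-1..1}"
    using y by (auto simp: absolutely_integrable_on_def)
  have cu: "continuous_on {-1..1} u"
  proof (rule continuous_on_eq)
    show "continuous_on {-1..1} (\<lambda>x. u (-1) + prim y x)"
      unfolding prim_def by (intro continuous_intros indefinite_integral_continuous_1 yi)
  qed (rule u[symmetric])
  \<comment> \<open>\<open>D\<close> is the defect and \<open>V\<close> the variation against which
    its increments are measured; since V 1 is finite, arbitrary \<epsilon> forces D x = 0.\<close>
  define D where "D = (\<lambda>x. F (u x) - F (u (-1)) - integral {-1..x} (\<lambda>x. F' (u x) (y x)))"
  define V where "V = (\<lambda>x. integral {-1..x} (\<lambda>x. norm (y x)))"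
  have bd: "norm (D x) \<le> \<epsilon> * V 1" if e: "\<epsilon> > 0" for \<epsilon>
  proof -
    define e where "e = \<epsilon> / 2"
    have "e > 0" using that by (simp add: e_def)
    have loc: "\<exists>d>0. \<forall>a\<in>{-1..1}. \<forall>b\<in>{-1..1}. a \<le> b \<longrightarrow> \<bar>a - c\<bar> < d \<longrightarrow> \<bar>b - c\<bar> < d \<longrightarrow> norm (D b - D a) \<le> \<epsilon> * (V b - V a)"
      if c: "c \<in> {-1..1}" for c
    proof -
      obtain \<delta> where \<delta>: "\<delta> > 0" "\<And>w' v. norm (w' - u c) < \<delta> \<Longrightarrow> norm (F' w' v - F' (u c) v) \<le> e * norm v"
        using cF[OF \<open>e > 0\<close>] by blast
      obtain d where d: "d > 0" "\<And>x. x \<in> {-1..1} \<Longrightarrow> \<bar>x - c\<bar> < d \<Longrightarrow> norm (u x - u c) < \<delta>"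
        using cu c \<delta>(1) unfolding continuous_on_iff dist_norm by (metis real_norm_def)
      show ?thesis
      proof (intro exI[of _ d] conjI ballI impI d(1))
        fix a b :: real assume ab: "a \<in> {-1..1}" "b \<in> {-1..1}" "a \<le> b" "\<bar>a - c\<bar> < d" "\<bar>b - c\<bar> < d"
        have lin: "bounded_linear (F' (u c))" by (rule has_derivative_bounded_linear[OF dF])
        have yab: "y integrable_on {a..b}" "(\<lambda>x. norm (y x)) integrable_on {a..b}" "(\<lambda>x. F' (u x) (y x)) integrable_on {a..b}"
          using ab int_sub[OF yi] int_sub[OF ny] int_sub[OF int] by auto
        have cy: "(\<lambda>x. F' (u c) (y x)) integrable_on {a..b}"
          using integrable_linear[OF yab(1) lin] by (simp add: o_def)
        have Vab: "V b - V a = integral {a..b} (\<lambda>x. norm (y x))"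
          using prim_increment[OF ny] ab unfolding V_def prim_def by auto
        have uab: "u b - u a = integral {a..b} y"
          using prim_increment[OF yi, of a b] u[OF ab(1)] u[OF ab(2)] ab by auto
        have Fi: "F' (u c) (u b - u a) = integral {a..b} (\<lambda>x. F' (u c) (y x))"
          unfolding uab using integral_linear[OF yab(1) lin] by (simp add: o_def)
        have nu: "norm (u b - u a) \<le> V b - V a"
          unfolding uab Vab by (rule integral_norm_bound_integral) (use yab in auto)
        \<comment> \<open>The mean value inequality for F minus its linearisation at u c, on a ball
          where the derivative of that difference has norm at most e.\<close>
        have 1: "norm (F (u b) - F (u a) - F' (u c) (u b - u a)) \<le> e * norm (u b - u a)"
        proof -
          have "norm ((F (u b) - F' (u c) (u b)) - (F (u a) - F' (u c) (u a))) \<le> e * norm (u b - u a)"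
          proof (rule differentiable_bound[where S="ball (u c) \<delta>" and f="\<lambda>w. F w - F' (u c) w" and f'="\<lambda>w v. F' w v - F' (u c) v"])
            fix w assume w: "w \<in> ball (u c) \<delta>"
            show "((\<lambda>w. F w - F' (u c) w) has_derivative (\<lambda>v. F' w v - F' (u c) v)) (at w within ball (u c) \<delta>)"
              by (intro has_derivative_diff has_derivative_at_withinI[OF dF] bounded_linear_imp_has_derivative lin)
            show "onorm (\<lambda>v. F' w v - F' (u c) v) \<le> e"
              by (rule onorm_le) (use \<delta>(2) w in \<open>auto simp: dist_norm norm_minus_commute\<close>)
          qed (use d(2)[of a] d(2)[of b] ab in \<open>auto simp: dist_norm norm_minus_commute\<close>)
          then show ?thesis by (simp add: linear_diff[OF bounded_linear.linear[OF lin]] algebra_simps)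
        qed
        have 2: "norm (integral {a..b} (\<lambda>x. F' (u x) (y x) - F' (u c) (y x))) \<le> integral {a..b} (\<lambda>x. e * norm (y x))"
        proof (rule integral_norm_bound_integral)
          fix x assume "x \<in> {a..b}"
          then show "norm (F' (u x) (y x) - F' (u c) (y x)) \<le> e * norm (y x)"
            using ab by (intro \<delta>(2) d(2)) auto
        qed (use yab cy in \<open>auto intro!: integrable_diff integrable_on_mult_right\<close>)
        have "D b - D a = F (u b) - F (u a) - integral {a..b} (\<lambda>x. F' (u x) (y x))"
          using prim_increment[OF int, of a b] ab unfolding D_def prim_def by (auto simp: algebra_simps)
        also have "\<dots> = (F (u b) - F (u a) - F' (u c) (u b - u a)) - integral {a..b} (\<lambda>x. F' (u x) (y x) - F' (u c) (y x))"
          unfolding Fi by (simp add: Henstock_Kurzweil_Integration.integral_diff yab cy)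
        finally have eqD: "D b - D a = (F (u b) - F (u a) - F' (u c) (u b - u a)) - integral {a..b} (\<lambda>x. F' (u x) (y x) - F' (u c) (y x))" .
        have "norm (D b - D a) \<le> norm (F (u b) - F (u a) - F' (u c) (u b - u a)) + norm (integral {a..b} (\<lambda>x. F' (u x) (y x) - F' (u c) (y x)))"
          unfolding eqD by (rule norm_triangle_ineq4)
        also have "\<dots> \<le> e * norm (u b - u a) + integral {a..b} (\<lambda>x. e * norm (y x))"
          by (rule add_mono[OF 1 2])
        also have "\<dots> \<le> e * (V b - V a) + e * (V b - V a)"
          using nu \<open>e > 0\<close> by (simp add: Vab)
        finally show "norm (D b - D a) \<le> \<epsilon> * (V b - V a)" by (simp add: e_def field_simps)
      qed
    qed
    \<comment> \<open>The estimate is additive over adjacent intervals and holds near every point,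
      so Bolzano's bisection principle gives it on all of [-1,1].\<close>
    have "\<forall>a b. -1 \<le> a \<and> a \<le> b \<and> b \<le> 1 \<longrightarrow> norm (D b - D a) \<le> \<epsilon> * (V b - V a)"
    proof (rule ccontr)
      assume "\<not> ?thesis"
      then obtain a0 b0 where ab0: "-1 \<le> a0" "a0 \<le> b0" "b0 \<le> 1" "\<not> norm (D b0 - D a0) \<le> \<epsilon> * (V b0 - V a0)" by auto
      have "-1 \<le> a0 \<and> b0 \<le> 1 \<longrightarrow> norm (D b0 - D a0) \<le> \<epsilon> * (V b0 - V a0)"
      proof (rule Bolzano[OF ab0(2)])
        fix a b c :: real
        assume 1: "-1 \<le> a \<and> b \<le> 1 \<longrightarrow> norm (D b - D a) \<le> \<epsilon> * (V b - V a)"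
          and 2: "-1 \<le> b \<and> c \<le> 1 \<longrightarrow> norm (D c - D b) \<le> \<epsilon> * (V c - V b)" and 3: "a \<le> b" "b \<le> c"
        show "-1 \<le> a \<and> c \<le> 1 \<longrightarrow> norm (D c - D a) \<le> \<epsilon> * (V c - V a)"
        proof
          assume "-1 \<le> a \<and> c \<le> 1"
          moreover have "norm (D c - D a) \<le> norm (D c - D b) + norm (D b - D a)"
            using norm_triangle_ineq[of "D c - D b" "D b - D a"] by simp
          ultimately show "norm (D c - D a) \<le> \<epsilon> * (V c - V a)" using 1 2 3 by (simp add: algebra_simps)
        qed
      next
        fix c assume "a0 \<le> c" "c \<le> b0"
        then have "c \<in> {-1..1}" using ab0 by auto
        from loc[OF this] obtain d where d: "d > 0" "\<And>a b. a \<in> {-1..1} \<Longrightarrow> b \<in> {-1..1} \<Longrightarrow> a \<le> b \<Longrightarrow> \<bar>a - c\<bar> < d \<Longrightarrow> \<bar>b - c\<bar> < d \<Longrightarrow> norm (D b - D a) \<le> \<epsilon> * (V b - V a)"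
          by blast
        show "\<exists>d>0. \<forall>a b. a \<le> c \<and> c \<le> b \<and> b - a < d \<longrightarrow> -1 \<le> a \<and> b \<le> 1 \<longrightarrow> norm (D b - D a) \<le> \<epsilon> * (V b - V a)"
          by (rule exI[of _ d]) (auto intro!: d)
      qed
      then show False using ab0 by auto
    qed
    from this[rule_format, of "-1" x] have "norm (D x) \<le> \<epsilon> * V x"
      using x by (simp add: D_def V_def)
    also have "\<dots> \<le> \<epsilon> * V 1" unfolding V_def
      by (intro mult_left_mono integral_subset_le) (use x ny int_sub[OF ny] e in auto)
    finally show ?thesis .
  qed
  have "V 1 \<ge> 0" unfolding V_def by (rule Henstock_Kurzweil_Integration.integral_nonneg) (use ny in auto)
  have "norm (D x) \<le> e" if "e > 0" for e
  proof -
    have "norm (D x) \<le> e / (V 1 + 1) * V 1" by (rule bd) (use that \<open>V 1 \<ge> 0\<close> in auto)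
    also have "\<dots> \<le> e" using that \<open>V 1 \<ge> 0\<close> by (simp add: field_simps)
    finally show ?thesis .
  qed
  then have "norm (D x) \<le> 0" by (rule field_le_epsilon) simp
  then show ?thesis by (simp add: D_def algebra_simps)
qed

section \<open>Functions of class C^k and test functions\<close>

text \<open>The chain rule for the bilinear map on the pair (f, g); its derivative depends linearly
  on the base point, which gives the uniform continuity that the chain rule demands.\<close>

lemma product_rule_prim:
  fixes f y :: "real \<Rightarrow> 'a::euclidean_space" and g z :: "real \<Rightarrow> 'b::euclidean_space"
    and prod :: "'a \<Rightarrow> 'b \<Rightarrow> 'c::euclidean_space"
  assumes bb: "bounded_bilinear prod" and y: "L2v y" and z: "L2v z"
    and f: "\<And>x. x \<in> {-1..1} \<Longrightarrow> f x = f (-1) + prim y x"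
    and g: "\<And>x. x \<in> {-1..1} \<Longrightarrow> g x = g (-1) + prim z x"
    and x: "x \<in> {-1..1}"
  shows "prod (f x) (g x) = prod (f (-1)) (g (-1)) + integral {-1..x} (\<lambda>x. prod (f x) (z x) + prod (y x) (g x))"
proof -
  interpret bounded_bilinear prod by fact
  obtain K where K: "K > 0" "\<And>a b. norm (prod a b) \<le> norm a * norm b * K" using pos_bounded by blast
  have cf: "continuous_on {-1..1} f" by (rule continuous_on_eq[OF _ f[symmetric]]) (intro continuous_intros prim_continuous[OF y])
  have cg: "continuous_on {-1..1} g" by (rule continuous_on_eq[OF _ g[symmetric]]) (intro continuous_intros prim_continuous[OF z])
  have i: "(\<lambda>x. prod (f x) (z x) + prod (y x) (g x)) integrable_on {-1..1}"
    using L2v_bilinear_integrable[OF bb L2v_continuous[OF cf] z] L2v_bilinear_integrable[OF bb y L2v_continuous[OF cg]]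
    by (auto simp: absolutely_integrable_on_def intro!: integrable_add)
  have yz: "(\<lambda>x. (y x, z x)) absolutely_integrable_on {-1..1}"
  proof (rule measurable_bounded_by_integrable_imp_absolutely_integrable)
    show "(\<lambda>x. norm (y x) + norm (z x)) integrable_on {-1..1}"
      by (intro integrable_add L2v_int L2v_norm y z)
    show "(\<lambda>x. (y x, z x)) \<in> borel_measurable (lebesgue_on {- 1..1})"
      using y z by (intro borel_measurable_Pair L2v_meas)
  qed (auto simp: norm_Pair_le)
  have pr: "prim (\<lambda>x. (y x, z x)) x = (prim y x, prim z x)" if "x \<in> {-1..1}" for x
  proof -
    have i2: "(\<lambda>x. (y x, z x)) integrable_on {-1..x}" using yz that int_sub by (auto simp: absolutely_integrable_on_def)
    show ?thesis unfolding prim_def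
      using integral_linear[OF i2 bounded_linear_fst] integral_linear[OF i2 bounded_linear_snd]
      by (auto simp: o_def prod_eq_iff)
  qed
  have "prod (fst (f x, g x)) (snd (f x, g x)) = prod (fst (f (-1), g (-1))) (snd (f (-1), g (-1))) +
      integral {-1..x} (\<lambda>x. prod (fst (f x, g x)) (snd (y x, z x)) + prod (fst (y x, z x)) (snd (f x, g x)))"
  proof (rule chain_rule_prim[where u="\<lambda>x. (f x, g x)" and y="\<lambda>x. (y x, z x)" and F="\<lambda>p. prod (fst p) (snd p)"
      and F'="\<lambda>p v. prod (fst p) (snd v) + prod (fst v) (snd p)", OF yz])
    show "(f x, g x) = (f (-1), g (-1)) + prim (\<lambda>x. (y x, z x)) x" if "x \<in> {-1..1}" for x
      using f[OF that] g[OF that] pr[OF that] by simp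
    show "((\<lambda>p. prod (fst p) (snd p)) has_derivative (\<lambda>v. prod (fst w) (snd v) + prod (fst v) (snd w))) (at w)" for w
      by (rule FDERIV) (auto intro: has_derivative_fst has_derivative_snd)
  next
    fix w :: "'a \<times> 'b" and \<epsilon> :: real assume e: "\<epsilon> > 0"
    show "\<exists>\<delta>>0. \<forall>w'. norm (w' - w) < \<delta> \<longrightarrow> (\<forall>v. norm (prod (fst w') (snd v) + prod (fst v) (snd w') - (prod (fst w) (snd v) + prod (fst v) (snd w))) \<le> \<epsilon> * norm v)"
    proof (intro exI[of _ "\<epsilon> / (2 * K)"] conjI allI impI)
      fix w' v :: "'a \<times> 'b" assume w: "norm (w' - w) < \<epsilon> / (2 * K)"
      have "norm (prod (fst w') (snd v) + prod (fst v) (snd w') - (prod (fst w) (snd v) + prod (fst v) (snd w)))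
        = norm (prod (fst (w' - w)) (snd v) + prod (fst v) (snd (w' - w)))"
        by (simp add: diff_left diff_right add_diff_add)
      also have "\<dots> \<le> norm (fst (w' - w)) * norm (snd v) * K + norm (fst v) * norm (snd (w' - w)) * K"
        by (rule norm_triangle_le, rule add_mono[OF K(2) K(2)])
      also have "\<dots> \<le> norm (w' - w) * norm v * K + norm v * norm (w' - w) * K"
      proof -
        have n: "norm (fst a) \<le> norm a" "norm (snd a) \<le> norm a" for a :: "'a \<times> 'b"
          using norm_fst_le[of "fst a" "snd a"] norm_snd_le[of "snd a" "fst a"] by simp_all
        show ?thesis using K(1) by (intro add_mono mult_right_mono[where c=K] mult_mono n) auto
      qed
      also have "\<dots> = (2 * K * norm (w' - w)) * norm v" by simp
      also have "\<dots> \<le> \<epsilon> * norm v" using w K(1) by (intro mult_right_mono) (auto simp: field_simps)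
      finally show "norm (prod (fst w') (snd v) + prod (fst v) (snd w') - (prod (fst w) (snd v) + prod (fst v) (snd w))) \<le> \<epsilon> * norm v" .
    qed (use K e in auto)
  qed (use i x in auto)
  then show ?thesis by simp
qed


lemma C_kI:
  assumes "\<And>x. (f has_derivative F x) (at x)" "\<And>v. C_k n (\<lambda>x. F x v)"
  shows "C_k (Suc n) f"
proof -
  have "frechet_derivative f (at x) = F x" for x using frechet_derivative_at[OF assms(1)] by simp
  then show ?thesis using assms by (auto simp: differentiable_def)
qed

lemma C_kE: "C_k (Suc n) f \<Longrightarrow> (f has_derivative frechet_derivative f (at x)) (at x)"
  by (simp add: frechet_derivative_works)

lemma C_k_const: "C_k n (\<lambda>x. c)"
  by (induction n arbitrary: c) (auto intro!: C_kI[where F="\<lambda>x v. 0"] simp del: C_k.simps(2))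

lemma C_k_continuous: "C_k n f \<Longrightarrow> continuous_on UNIV f"
proof (cases n)
  case (Suc m)
  moreover assume "C_k n f"
  ultimately show ?thesis
    by (auto intro!: differentiable_imp_continuous_on simp: differentiable_on_def intro: differentiable_at_withinI)
qed simp

lemma C_k_Suc_imp: "C_k (Suc n) f \<Longrightarrow> C_k n f"
proof (induction n arbitrary: f)
  case 0
  then show ?case using C_k_continuous[of "Suc 0" f] by (simp del: C_k.simps(2))
next
  case (Suc n)
  from Suc.prems have "C_k (Suc n) (\<lambda>x. frechet_derivative f (at x) v)" for v by (subst (asm) C_k.simps(2)) blast
  from C_kI[OF C_kE[OF Suc.prems] Suc.IH[OF this]] show ?case .
qed

lemma C_k_le: "C_k n f \<Longrightarrow> m \<le> n \<Longrightarrow> C_k m f"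
  by (induction n) (auto simp: le_Suc_eq simp del: C_k.simps(2) dest: C_k_Suc_imp)

lemma C_k_frechet: "C_k (Suc n) f \<Longrightarrow> C_k n (\<lambda>x. frechet_derivative f (at x) v)"
  by simp

lemma C_k_add:
  fixes f g :: "'a::real_normed_vector \<Rightarrow> 'b::real_normed_vector"
  shows "C_k n f \<Longrightarrow> C_k n g \<Longrightarrow> C_k n (\<lambda>x. f x + g x)"
proof (induction n arbitrary: f g)
  case 0
  then show ?case by (simp add: continuous_on_add)
next
  case (Suc n)
  show ?case
    by (rule C_kI[OF has_derivative_add[OF C_kE[OF Suc.prems(1)] C_kE[OF Suc.prems(2)]]])
       (intro Suc.IH C_k_frechet Suc.prems)
qed

lemma C_k_mult:
  fixes f g :: "'a::real_normed_vector \<Rightarrow> real"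
  shows "C_k n f \<Longrightarrow> C_k n g \<Longrightarrow> C_k n (\<lambda>x. f x * g x)"
proof (induction n arbitrary: f g)
  case 0
  then show ?case by (simp add: continuous_on_mult)
next
  case (Suc n)
  show ?case
    by (rule C_kI[OF has_derivative_mult[OF C_kE[OF Suc.prems(1)] C_kE[OF Suc.prems(2)]]])
       (intro C_k_add Suc.IH; ((rule C_k_frechet, rule Suc.prems) | (rule C_k_Suc_imp, rule Suc.prems)))
qed

lemma C_k_scale: "C_k n f \<Longrightarrow> C_k n (\<lambda>x. c * (f x :: real))"
  by (intro C_k_mult C_k_const)

lemma C_k_sum:
  fixes f :: "'i \<Rightarrow> 'a::real_normed_vector \<Rightarrow> real"
  assumes "\<And>i. i \<in> I \<Longrightarrow> C_k n (f i)"
  shows "C_k n (\<lambda>x. \<Sum>i\<in>I. f i x)"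
  using assms by (induction I rule: infinite_finite_induct) (auto intro: C_k_add C_k_const)

lemma C_k_real_SucI:
  fixes f :: "real \<Rightarrow> real"
  assumes "\<And>x. (f has_real_derivative f' x) (at x)" "C_k n f'"
  shows "C_k (Suc n) f"
  by (rule C_kI[where F="\<lambda>x v. f' x * v"])
     (use assms C_k_mult[OF _ C_k_const] in \<open>auto simp: has_field_derivative_def\<close>)

lemma C_k_real_SucE:
  fixes f :: "real \<Rightarrow> real"
  assumes "C_k (Suc n) f"
  shows "(f has_real_derivative deriv f x) (at x)" "C_k n (deriv f)"
proof -
  show d: "(f has_real_derivative deriv f x) (at x)" for x
    using assms by (auto simp: DERIV_deriv_iff_real_differentiable)
  have "frechet_derivative f (at x) 1 = deriv f x" for x
    using frechet_derivative_at[OF d[unfolded has_field_derivative_def], of x, symmetric] by simp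
  then show "C_k n (deriv f)" using C_k_frechet[OF assms, of 1] by simp
qed

lemma C_k_affine:
  fixes f :: "real \<Rightarrow> real"
  shows "C_k n f \<Longrightarrow> C_k n (\<lambda>x. f (c * x + d))"
proof (induction n arbitrary: f)
  case 0
  then have f: "continuous_on UNIV f" by simp
  have "continuous_on UNIV (\<lambda>x. f (c * x + d))"
    by (rule continuous_on_compose2[OF f]) (auto intro!: continuous_intros)
  then show ?case by simp
next
  case (Suc n)
  show ?case
  proof (rule C_k_real_SucI)
    show "((\<lambda>x. f (c * x + d)) has_real_derivative deriv f (c * x + d) * c) (at x)" for x
      by (rule DERIV_chain2[OF C_k_real_SucE(1)[OF Suc.prems]]) (auto intro!: derivative_eq_intros)
    show "C_k n (\<lambda>x. deriv f (c * x + d) * c)"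
      by (rule C_k_mult[OF Suc.IH[OF C_k_real_SucE(2)[OF Suc.prems]] C_k_const])
  qed
qed

text \<open>\<open>C_k\<close> speaks of each directional derivative separately. In finite dimension
  the basis directions control all others, which turns this into continuity uniform over v;
  \<epsilon> is split among the N basis vectors.\<close>

lemma C1_equicontinuous_derivative:
  fixes F :: "'a::euclidean_space \<Rightarrow> 'b::real_normed_vector"
  assumes C: "C_k (Suc 0) F" and e: "\<epsilon> > 0"
  shows "\<exists>\<delta>>0. \<forall>w'. norm (w' - w) < \<delta> \<longrightarrow>
    (\<forall>v. norm (frechet_derivative F (at w') v - frechet_derivative F (at w) v) \<le> \<epsilon> * norm v)"
proof -
  let ?D = "\<lambda>w. frechet_derivative F (at w)"
  have lin: "bounded_linear (?D w)" for w by (rule has_derivative_bounded_linear[OF C_kE[OF C]])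
  define N where "N = real DIM('a)"
  have N: "N > 0" by (simp add: N_def)
  have c: "continuous_on UNIV (\<lambda>w. ?D w b)" for b using C_k_frechet[OF C, of b] by simp
  have "\<forall>b. \<exists>\<delta>>0. \<forall>w'. dist w' w < \<delta> \<longrightarrow> dist (?D w' b) (?D w b) < \<epsilon> / N"
  proof
    fix b show "\<exists>\<delta>>0. \<forall>w'. dist w' w < \<delta> \<longrightarrow> dist (?D w' b) (?D w b) < \<epsilon> / N"
      using c[of b] e N unfolding continuous_on_iff by (metis UNIV_I divide_pos_pos)
  qed
  then obtain \<delta> where \<delta>: "\<And>b. \<delta> b > 0" "\<And>b w'. dist w' w < \<delta> b \<Longrightarrow> dist (?D w' b) (?D w b) < \<epsilon> / N"
    by metis
  define d where "d = Min (\<delta> ` Basis)"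
  have d: "d > 0" "\<And>b. b \<in> Basis \<Longrightarrow> d \<le> \<delta> b" using \<delta>(1) by (auto simp: d_def)
  show ?thesis
  proof (intro exI[of _ d] conjI allI impI d(1))
    fix w' v assume w': "norm (w' - w) < d"
    have ex: "?D x v = (\<Sum>b\<in>Basis. (v \<bullet> b) *\<^sub>R ?D x b)" for x
    proof -
      interpret bounded_linear "?D x" by (rule lin)
      have "?D x v = ?D x (\<Sum>b\<in>Basis. (v \<bullet> b) *\<^sub>R b)" by (simp add: euclidean_representation)
      also have "\<dots> = (\<Sum>b\<in>Basis. (v \<bullet> b) *\<^sub>R ?D x b)" by (simp add: sum scaleR)
      finally show ?thesis .
    qed
    have "norm (?D w' v - ?D w v) = norm (\<Sum>b\<in>Basis. (v \<bullet> b) *\<^sub>R (?D w' b - ?D w b))"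
      unfolding ex by (simp add: sum_subtractf scaleR_diff_right)
    also have "\<dots> \<le> (\<Sum>b\<in>(Basis::'a set). norm v * (\<epsilon> / N))"
    proof (rule sum_norm_le)
      fix b :: 'a assume b: "b \<in> Basis"
      have "norm (?D w' b - ?D w b) \<le> \<epsilon> / N"
        using \<delta>(2)[of w' b] d(2)[OF b] w' by (auto simp: dist_norm)
      then show "norm ((v \<bullet> b) *\<^sub>R (?D w' b - ?D w b)) \<le> norm v * (\<epsilon> / N)"
        unfolding norm_scaleR using Basis_le_norm[OF b, of v] by (intro mult_mono) auto
    qed
    also have "\<dots> = \<epsilon> * norm v" using N by (simp add: N_def)
    finally show "norm (?D w' v - ?D w v) \<le> \<epsilon> * norm v" .
  qed
qed

text \<open>The functions P(1/x) exp(-1/x), extended by zero. Keeping the polynomial as a parameter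
  makes the class closed under differentiation, so smoothness is an induction with P
  arbitrary.\<close>

definition expbump :: "real poly \<Rightarrow> real \<Rightarrow> real" where
  "expbump P x = (if x \<le> 0 then 0 else poly P (1/x) * exp (- (1/x)))"

lemma poly_exp_tendsto_0: "((\<lambda>s. poly P s * exp (- s)) \<longlongrightarrow> (0::real)) at_top"
proof -
  have "((\<lambda>s. \<Sum>i\<le>degree P. coeff P i * (s ^ i / exp s)) \<longlongrightarrow> (\<Sum>i\<le>degree P. coeff P i * 0)) at_top"
    by (intro tendsto_sum tendsto_mult tendsto_const tendsto_power_div_exp_0)
  moreover have "(\<Sum>i\<le>degree P. coeff P i * (s ^ i / exp s)) = poly P s * exp (- s)" for s :: real
    by (simp add: poly_altdef sum_distrib_right exp_minus divide_inverse mult.assoc)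
  ultimately show ?thesis by simp
qed

lemma expbump_tendsto_0: "(expbump P \<longlongrightarrow> 0) (at_right 0)"
proof -
  have "((\<lambda>x. poly P (inverse x) * exp (- (inverse x))) \<longlongrightarrow> (0::real)) (at_right 0)"
    by (rule filterlim_compose[OF poly_exp_tendsto_0 filterlim_inverse_at_top_right])
  moreover have "\<forall>\<^sub>F x in at_right 0. poly P (inverse x) * exp (- (inverse x)) = expbump P x"
    using eventually_at_right_less[of "0::real"] by (rule eventually_mono) (simp add: expbump_def inverse_eq_divide)
  ultimately show ?thesis by (rule Lim_transform_eventually)
qed

text \<open>With s = 1/x one has ds/dx = -s^2, so P(s) exp(-s) differentiates to s^2 (P - P')(s)
  exp(-s).\<close>

lemma expbump_deriv: "(expbump P has_real_derivative expbump ([:0,0,1:] * (P - pderiv P)) x) (at x)"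
proof -
  consider "x < 0" | "x = 0" | "x > 0" by linarith
  then show ?thesis
  proof cases
    case 1
    have "((\<lambda>x. 0) has_real_derivative 0) (at x)" by simp
    then have "(expbump P has_real_derivative 0) (at x)"
      by (rule has_field_derivative_transform_within_open[where S="{..<0}"]) (use 1 in \<open>auto simp: expbump_def\<close>)
    then show ?thesis using 1 by (simp add: expbump_def)
  next
    case 2
    have "((\<lambda>h. (expbump P h - expbump P 0) / (h - 0)) \<longlongrightarrow> 0) (at 0)"
    proof (rule filterlim_split_at)
      show "((\<lambda>h. (expbump P h - expbump P 0) / (h - 0)) \<longlongrightarrow> 0) (at_left 0)"
        by (rule tendsto_eventually) (auto simp: eventually_at_filter expbump_def)
      \<comment> \<open>The difference quotient at 0 is itself of this class: dividing by h
        multiplies the polynomial by its argument 1/h.\<close>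
      show "((\<lambda>h. (expbump P h - expbump P 0) / (h - 0)) \<longlongrightarrow> 0) (at_right 0)"
        by (rule Lim_transform_eventually[OF expbump_tendsto_0[of "pCons 0 P"]])
           (auto simp: eventually_at_filter expbump_def)
    qed
    then show ?thesis unfolding 2 has_field_derivative_iff by (simp add: expbump_def)
  next
    case 3
    have "((\<lambda>x. poly P (1/x) * exp (- (1/x))) has_real_derivative
        (poly (pderiv P) (1/x) * (-1 / x\<^sup>2)) * exp (- (1/x)) + poly P (1/x) * (exp (- (1/x)) * (1 / x\<^sup>2))) (at x)"
      using 3 by (auto intro!: derivative_eq_intros DERIV_chain2[OF poly_DERIV] simp: power2_eq_square field_simps)
    then have "(expbump P has_real_derivative
        (poly (pderiv P) (1/x) * (-1 / x\<^sup>2)) * exp (- (1/x)) + poly P (1/x) * (exp (- (1/x)) * (1 / x\<^sup>2))) (at x)"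
      by (rule has_field_derivative_transform_within_open[where S="{0<..}"]) (use 3 in \<open>auto simp: expbump_def\<close>)
    then show ?thesis using 3 by (simp add: expbump_def power2_eq_square field_simps)
  qed
qed

lemma C_k_expbump: "C_k n (expbump P)"
proof (induction n arbitrary: P)
  case 0
  have "isCont (expbump P) x" for x by (rule DERIV_isCont[OF expbump_deriv])
  then show ?case by (simp add: continuous_at_imp_continuous_on)
next
  case (Suc n)
  show ?case by (rule C_k_real_SucI[OF expbump_deriv Suc])
qed

text \<open>On (a,b) this is exp(-1/(n (x-a))) exp(-1/(n (b-x))), and 0 elsewhere. These test
  functions are bounded by one and tend pointwise to the indicator of (a,b), so dominated
  convergence replaces mollification. The affine arguments are in the form of
  \<open>C_k_affine\<close>.\<close>

definition cutoff :: "real \<Rightarrow> real \<Rightarrow> nat \<Rightarrow> real \<Rightarrow> real" where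
  "cutoff a b n x = expbump 1 (real n * x + - (real n * a)) * expbump 1 (- real n * x + real n * b)"

lemma test_fun_cutoff:
  assumes "-1 < a" "b < 1"
  shows "test_fun (cutoff a b n)"
  unfolding test_fun_def
proof (intro conjI allI)
  show "C_k m (cutoff a b n)" for m
    unfolding cutoff_def by (rule C_k_mult[OF C_k_affine[OF C_k_expbump] C_k_affine[OF C_k_expbump]])
  show "\<exists>K. compact K \<and> K \<subseteq> {-1<..<1} \<and> (\<forall>x. x \<notin> K \<longrightarrow> cutoff a b n x = 0)"
  proof (intro exI[of _ "{a..b}"] conjI allI impI)
    fix x assume "x \<notin> {a..b}"
    then consider "x < a" | "x > b" by fastforce
    then show "cutoff a b n x = 0"
    proof cases
      case 1
      then have "real n * x \<le> real n * a" by (intro mult_left_mono) auto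
      then show ?thesis by (simp add: cutoff_def expbump_def)
    next
      case 2
      then have "real n * b \<le> real n * x" by (intro mult_left_mono) auto
      then show ?thesis by (simp add: cutoff_def expbump_def)
    qed
  qed (use assms in auto)
qed

lemma cutoff_bound: "\<bar>cutoff a b n x\<bar> \<le> 1"
proof -
  have "\<bar>expbump 1 y\<bar> \<le> 1" for y by (simp add: expbump_def)
  then show ?thesis unfolding cutoff_def abs_mult by (intro mult_le_one) auto
qed

lemma cutoff_limit: "(\<lambda>n. cutoff a b n x) \<longlonglongrightarrow> indicator {a<..<b} x"
proof (cases "x \<in> {a<..<b}")
  case False
  then consider "x \<le> a" | "x \<ge> b" by fastforce
  then have "cutoff a b n x = 0" for n
  proof cases
    case 1
    then have "real n * x \<le> real n * a" by (intro mult_left_mono) auto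
    then show ?thesis by (simp add: cutoff_def expbump_def)
  next
    case 2
    then have "real n * b \<le> real n * x" by (intro mult_left_mono) auto
    then show ?thesis by (simp add: cutoff_def expbump_def)
  qed
  then show ?thesis using False by simp
next
  case True
  have l: "(\<lambda>n. exp (- (1 / (real n * c)))) \<longlonglongrightarrow> 1" if "c > 0" for c :: real
  proof -
    have "(\<lambda>n. (1/c) * inverse (real n)) \<longlonglongrightarrow> (1/c) * 0" by (intro tendsto_mult tendsto_const lim_inverse_n)
    then have "(\<lambda>n. exp (- ((1/c) * inverse (real n)))) \<longlonglongrightarrow> exp (- ((1/c) * 0))" by (intro tendsto_exp tendsto_minus)
    then show ?thesis by (simp add: field_simps)
  qed
  have "(\<lambda>n. exp (- (1 / (real n * (x - a)))) * exp (- (1 / (real n * (b - x))))) \<longlonglongrightarrow> 1 * 1"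
    using True by (intro tendsto_mult l) auto
  moreover have "\<forall>\<^sub>F n in sequentially. exp (- (1 / (real n * (x - a)))) * exp (- (1 / (real n * (b - x)))) = cutoff a b n x"
    using eventually_gt_at_top[of 0]
  proof eventually_elim
    case (elim n)
    then have "real n * (x - a) > 0" "real n * (b - x) > 0" using True by auto
    then show ?case by (simp add: cutoff_def expbump_def algebra_simps)
  qed
  ultimately show ?thesis using True by (simp add: Lim_transform_eventually)
qed

lemma test_funD:
  assumes "test_fun \<phi>"
  shows test_fun_C: "C_k n \<phi>"
    and test_fun_deriv: "(\<phi> has_real_derivative deriv \<phi> x) (at x)"
    and test_fun_continuous: "continuous_on S \<phi>"
proof -
  show C: "C_k n \<phi>" for n using assms by (simp add: test_fun_def)
  show "(\<phi> has_real_derivative deriv \<phi> x) (at x)" by (rule C_k_real_SucE(1)[OF C[of "Suc 0"]])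
  show "continuous_on S \<phi>" using C_k_continuous[OF C[of 0]] continuous_on_subset by blast
qed

lemma test_fun_support:
  assumes "test_fun \<phi>"
  obtains r where "0 \<le> r" "r < 1" "\<And>x. \<bar>x\<bar> > r \<Longrightarrow> \<phi> x = 0"
proof -
  obtain K where K: "compact K" "K \<subseteq> {-1<..<1}" "\<And>x. x \<notin> K \<Longrightarrow> \<phi> x = 0"
    using assms by (auto simp: test_fun_def)
  show thesis
  proof (cases "K = {}")
    case True
    then show ?thesis using K(3) by (intro that[of 0]) auto
  next
    case False
    obtain k where k: "k \<in> K" "\<And>x. x \<in> K \<Longrightarrow> \<bar>x\<bar> \<le> \<bar>k\<bar>"
      using continuous_attains_sup[OF K(1) False continuous_on_rabs[OF continuous_on_id]] by auto
    show ?thesis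
    proof (rule that[of "\<bar>k\<bar>"])
      have "k \<in> {-1<..<1}" using k(1) K(2) by blast
      then show "\<bar>k\<bar> < 1" by auto
      show "\<phi> x = 0" if "\<bar>x\<bar> > \<bar>k\<bar>" for x using k(2)[of x] K(3)[of x] that by force
    qed simp
  qed
qed

lemma test_funI:
  assumes "\<And>n. C_k n \<phi>" "0 \<le> r" "r < 1" "\<And>x. \<bar>x\<bar> > r \<Longrightarrow> \<phi> x = 0"
  shows "test_fun \<phi>"
  unfolding test_fun_def using assms by (auto intro!: exI[of _ "{-r..r}"])

lemma test_fun_boundary: "test_fun \<phi> \<Longrightarrow> \<phi> (-1) = 0 \<and> \<phi> 1 = 0"
proof -
  assume "test_fun \<phi>"
  then obtain r where "0 \<le> r" "r < 1" "\<And>x. \<bar>x\<bar> > r \<Longrightarrow> \<phi> x = 0" using test_fun_support by metis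
  then show ?thesis by auto
qed

lemma test_fun_derivative:
  assumes "test_fun \<phi>"
  shows "test_fun (deriv \<phi>)"
proof -
  obtain r where r: "0 \<le> r" "r < 1" "\<And>x. \<bar>x\<bar> > r \<Longrightarrow> \<phi> x = 0" using test_fun_support[OF assms] by metis
  show ?thesis
  proof (rule test_funI[OF _ r(1,2)])
    show "C_k n (deriv \<phi>)" for n by (rule C_k_real_SucE(2)[OF test_fun_C[OF assms]])
    fix x :: real assume x: "\<bar>x\<bar> > r"
    have op: "open {x::real. r < \<bar>x\<bar>}" by (intro open_Collect_less continuous_intros)
    have "((\<lambda>x. 0) has_real_derivative 0) (at x)" by simp
    then have "(\<phi> has_real_derivative 0) (at x)"
      by (rule has_field_derivative_transform_within_open[OF _ op]) (use x r in auto)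
    then show "deriv \<phi> x = 0" by (rule DERIV_imp_deriv)
  qed
qed

lemma test_fun_higher_derivative: "test_fun \<phi> \<Longrightarrow> test_fun ((deriv ^^ j) \<phi>)"
  by (induction j) (auto intro: test_fun_derivative)

lemma test_fun_combine:
  assumes "test_fun \<phi>" "test_fun \<psi>"
  shows "test_fun (\<lambda>x. \<phi> x + c * \<psi> x)"
proof -
  obtain r where r: "0 \<le> r" "r < 1" "\<And>x. \<bar>x\<bar> > r \<Longrightarrow> \<phi> x = 0" using test_fun_support[OF assms(1)] by metis
  obtain s where s: "0 \<le> s" "s < 1" "\<And>x. \<bar>x\<bar> > s \<Longrightarrow> \<psi> x = 0" using test_fun_support[OF assms(2)] by metis
  show ?thesis
  proof (rule test_funI[of _ "max r s"])
    show "C_k n (\<lambda>x. \<phi> x + c * \<psi> x)" for n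
      by (rule C_k_add[OF test_fun_C[OF assms(1)] C_k_scale[OF test_fun_C[OF assms(2)]]])
  qed (use r s in auto)
qed

text \<open>To the left of the support the primitive is zero trivially, to the right of it exactly
  because the total integral is zero.\<close>

lemma test_fun_primitive:
  assumes t: "test_fun \<theta>" and z: "integral {-1..1} \<theta> = 0"
  shows "test_fun (\<lambda>x. integral {-1..x} \<theta>)" "deriv (\<lambda>x. integral {-1..x} \<theta>) = \<theta>"
proof -
  obtain r where r: "0 \<le> r" "r < 1" "\<And>x. \<bar>x\<bar> > r \<Longrightarrow> \<theta> x = 0" using test_fun_support[OF t] by metis
  have int: "\<theta> integrable_on {a..b}" for a b by (intro integrable_continuous_real test_fun_continuous[OF t])
  have 0: "integral {a..b} \<theta> = 0" if "\<And>x. x \<in> {a<..<b} \<Longrightarrow> \<theta> x = 0" for a b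
    unfolding integral_open_interval_real using that by (subst Henstock_Kurzweil_Integration.integral_cong[where g="\<lambda>_. 0"]) auto
  have supp: "integral {-1..x} \<theta> = 0" if "\<bar>x\<bar> > r" for x
  proof (cases "x < 0")
    case True
    then show ?thesis using that r by (intro 0) auto
  next
    case False
    then have rx: "r < x" using that by simp
    have "integral {-1..1} \<theta> = integral {-1..r} \<theta> + integral {r..1} \<theta>"
      using Henstock_Kurzweil_Integration.integral_combine[of "-1" r 1 \<theta>] int r by simp
    moreover have "integral {-1..x} \<theta> = integral {-1..r} \<theta> + integral {r..x} \<theta>"
      using Henstock_Kurzweil_Integration.integral_combine[of "-1" r x \<theta>] int r rx by simp
    moreover have "integral {r..1} \<theta> = 0" "integral {r..x} \<theta> = 0" using r by (auto intro!: 0)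
    ultimately show ?thesis using z by simp
  qed
  have d: "((\<lambda>x. integral {-1..x} \<theta>) has_real_derivative \<theta> x) (at x)" for x
  proof (cases "\<bar>x\<bar> > r")
    case True
    have op: "open {x::real. r < \<bar>x\<bar>}" by (intro open_Collect_less continuous_intros)
    have "((\<lambda>x. 0) has_real_derivative 0) (at x)" by simp
    then have "((\<lambda>x. integral {-1..x} \<theta>) has_real_derivative 0) (at x)"
      by (rule has_field_derivative_transform_within_open[OF _ op]) (use True supp in auto)
    then show ?thesis using r(3)[OF True] by simp
  next
    case False
    then have x: "x \<in> {-1<..<1}" using r by auto
    have "((\<lambda>x. integral {-1..x} \<theta>) has_real_derivative \<theta> x) (at x within {-1..1})"
      by (rule integral_has_real_derivative[OF test_fun_continuous[OF t]]) (use x in auto)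
    then have "((\<lambda>x. integral {-1..x} \<theta>) has_real_derivative \<theta> x) (at x within {-1<..<1})"
      by (rule DERIV_subset) auto
    then show ?thesis using x by (simp add: at_within_open[OF x])
  qed
  have "C_k n (\<lambda>x. integral {-1..x} \<theta>)" for n
    by (rule C_k_Suc_imp[OF C_k_real_SucI[OF d test_fun_C[OF t]]])
  then show "test_fun (\<lambda>x. integral {-1..x} \<theta>)" by (rule test_funI[OF _ r(1,2) supp])
  show "deriv (\<lambda>x. integral {-1..x} \<theta>) = \<theta>" using DERIV_imp_deriv[OF d] by auto
qed

section \<open>The fundamental lemma of the calculus of variations and the du Bois-Reymond
  lemma\<close>

lemma Om_integrable:
  fixes f :: "real \<Rightarrow> 'a::euclidean_space"
  assumes "f absolutely_integrable_on {-1..1}"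
  shows "integrable Om f" "(LINT x|Om. f x) = integral {-1..1} f"
proof -
  have "f absolutely_integrable_on {-1<..<1}" by (rule set_integrable_subset[OF assms]) auto
  then show "integrable Om f" by (rule absolutely_integrable_imp_integrable) simp
  from lebesgue_integral_eq_integral[OF this] show "(LINT x|Om. f x) = integral {-1..1} f"
    by (simp add: integral_open_interval_real)
qed

text \<open>Testing with \<open>cutoff\<close> and letting n grow shows that g has integral zero
  over every interval whose endpoints lie in (-1,1). Lebesgue's differentiation theorem then gives g
  = 0 almost everywhere.\<close>

lemma weak_zero:
  assumes g: "integrable Om g" and z: "\<And>\<phi>. test_fun \<phi> \<Longrightarrow> (LINT x|Om. g x * \<phi> x) = 0"
  shows "AE x in Om. g x = 0"
proof -
  define h where "h = (\<lambda>x. if x \<in> {-1<..<1} then g x else 0)"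
  have hi: "integrable lebesgue h" unfolding h_def using g by (subst Lebesgue_Measure.integrable_restrict_UNIV) auto
  have hab: "h absolutely_integrable_on S" if "S \<in> sets lebesgue" for S
    using integrable_mult_indicator[OF that hi] by (simp add: set_integrable_def)
  have ho: "h integrable_on S" if "S \<in> sets lebesgue" for S
    using hab[OF that] set_lebesgue_integral_eq_integral(1) by blast
  have zero: "integral {a..b} h = 0" if ab: "-1 < a" "b < 1" for a b
  proof -
    have gm: "g \<in> borel_measurable Om" using g by auto
    have "(\<lambda>n. LINT x|Om. g x * cutoff a b n x) \<longlonglongrightarrow> (LINT x|Om. g x * indicator {a<..<b} x)"
    proof (rule integral_dominated_convergence[where w="\<lambda>x. \<bar>g x\<bar>"])
      show "(\<lambda>x. g x * indicator {a<..<b} x) \<in> borel_measurable Om"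
      proof (rule borel_measurable_times[OF gm])
        show "indicator {a<..<b} \<in> borel_measurable Om"
          by (rule measurable_restrict_space1, rule borel_measurable_indicator) simp
      qed
      show "(\<lambda>x. g x * cutoff a b n x) \<in> borel_measurable Om" for n
        by (intro borel_measurable_times gm continuous_imp_measurable_on_sets_lebesgue
            test_fun_continuous[OF test_fun_cutoff[OF ab]]) auto
      show "AE x in Om. (\<lambda>n. g x * cutoff a b n x) \<longlonglongrightarrow> g x * indicator {a<..<b} x"
        by (intro AE_I2 tendsto_mult tendsto_const cutoff_limit)
      show "AE x in Om. norm (g x * cutoff a b n x) \<le> \<bar>g x\<bar>" for n
        using mult_left_mono[OF cutoff_bound abs_ge_zero] by (intro AE_I2) (auto simp: abs_mult)
    qed (use g in auto)
    then have "(LINT x|Om. g x * indicator {a<..<b} x) = 0"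
      using z[OF test_fun_cutoff[OF ab]] by (simp add: LIMSEQ_const_iff)
    also have "(LINT x|Om. g x * indicator {a<..<b} x) = (LINT x|lebesgue. indicator {-1<..<1} x *\<^sub>R (g x * indicator {a<..<b} x))"
      by (rule integral_restrict_space) simp
    also have "\<dots> = (LINT x:{a<..<b}|lebesgue. h x)"
      unfolding set_lebesgue_integral_def using ab
      by (intro Bochner_Integration.integral_cong) (auto simp: h_def indicator_def)
    also have "\<dots> = integral {a<..<b} h"
      by (rule set_lebesgue_integral_eq_integral(2)[OF hab]) auto
    finally show ?thesis by (simp add: integral_open_interval_real)
  qed
  obtain N where N: "negligible N" "\<And>x e. x \<notin> N \<Longrightarrow> 0 < e \<Longrightarrow>
      \<exists>d>0. \<forall>k. 0 < k \<and> k < d \<longrightarrow> norm (integral (cbox x (x + k *\<^sub>R One)) h /\<^sub>R k ^ DIM(real) - h x) < e"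
    by (rule integrable_ccontinuous_explicit[of h]) (auto intro: ho)
  have "g x = 0" if x: "x \<notin> N" "x \<in> {-1<..<1}" for x
  proof (rule ccontr)
    assume "g x \<noteq> 0"
    then have "\<bar>h x\<bar> > 0" using x by (simp add: h_def)
    from N(2)[OF x(1) this] obtain d where d: "d > 0"
      "\<And>k. 0 < k \<Longrightarrow> k < d \<Longrightarrow> norm (integral (cbox x (x + k *\<^sub>R One)) h /\<^sub>R k ^ DIM(real) - h x) < \<bar>h x\<bar>" by blast
    \<comment> \<open>The second term keeps x + k below 1, so that [x, x + k] is one of the
      intervals with vanishing integral.\<close>
    define k where "k = min (d/2) ((1 - x)/2)"
    have k: "0 < k" "k < d" "x + k < 1" using d x by (auto simp: k_def min_def field_simps)
    have "integral {x..x+k} h = 0" by (rule zero) (use x k in auto)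
    then show False using d(2)[OF k(1,2)] by simp
  qed
  then have "AE x in lebesgue. x \<in> {-1<..<1} \<longrightarrow> g x = 0"
    using N(1) by (intro AE_I'[of N]) (auto simp: negligible_iff_null_sets)
  then show ?thesis by (subst AE_restrict_space_iff) auto
qed

lemma integral_by_parts_prim:
  fixes f y :: "real \<Rightarrow> 'a::euclidean_space" and g z :: "real \<Rightarrow> 'b::euclidean_space"
    and prod :: "'a \<Rightarrow> 'b \<Rightarrow> 'c::euclidean_space"
  assumes bb: "bounded_bilinear prod" and y: "L2v y" and z: "L2v z"
    and f: "\<And>x. x \<in> {-1..1} \<Longrightarrow> f x = f (-1) + prim y x"
    and g: "\<And>x. x \<in> {-1..1} \<Longrightarrow> g x = g (-1) + prim z x" and b: "g (-1) = 0" "g 1 = 0"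
  shows "integral {-1..1} (\<lambda>x. prod (f x) (z x)) = - integral {-1..1} (\<lambda>x. prod (y x) (g x))"
proof -
  have lf: "L2v f" by (rule L2v_continuous, rule continuous_on_eq[OF _ f[symmetric]]) (intro continuous_intros prim_continuous[OF y])
  have lg: "L2v g" by (rule L2v_continuous, rule continuous_on_eq[OF _ g[symmetric]]) (intro continuous_intros prim_continuous[OF z])
  have "prod (f 1) (g 1) = prod (f (-1)) (g (-1)) + integral {-1..1} (\<lambda>x. prod (f x) (z x) + prod (y x) (g x))"
    by (rule product_rule_prim[OF bb y z f g]) auto
  then have "integral {-1..1} (\<lambda>x. prod (f x) (z x) + prod (y x) (g x)) = 0"
    using b by (simp add: bounded_bilinear.zero_right[OF bb])
  moreover have "integral {-1..1} (\<lambda>x. prod (f x) (z x) + prod (y x) (g x)) =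
     integral {-1..1} (\<lambda>x. prod (f x) (z x)) + integral {-1..1} (\<lambda>x. prod (y x) (g x))"
    using L2v_bilinear_integrable[OF bb lf z] L2v_bilinear_integrable[OF bb y lg]
    by (intro Henstock_Kurzweil_Integration.integral_add) (auto simp: absolutely_integrable_on_def)
  ultimately show ?thesis by (simp add: eq_neg_iff_add_eq_0)
qed

lemma test_fun_L2v: "test_fun \<phi> \<Longrightarrow> L2v \<phi>"
  by (intro L2v_continuous test_fun_continuous)

lemma test_fun_prim:
  assumes "test_fun \<phi>" "x \<in> {-1..1}"
  shows "\<phi> x = \<phi> (-1) + prim (deriv \<phi>) x"
proof -
  have "(deriv \<phi> has_integral \<phi> x - \<phi> (-1)) {-1..x}"
    using test_fun_deriv[OF assms(1)] assms(2)
    by (intro fundamental_theorem_of_calculus)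
       (auto simp: has_real_derivative_iff_has_vector_derivative[symmetric] intro: DERIV_subset)
  then show ?thesis by (simp add: prim_def integral_unique)
qed

text \<open>By parts, h = f - \<open>prim g\<close> annihilates all derivatives of test functions,
  that is, all test functions of mean zero. Subtracting from an arbitrary test function its mean
  times a fixed one of integral 1 shows that h minus a constant annihilates everything.\<close>

lemma du_Bois_Reymond:
  fixes f g :: "real \<Rightarrow> real"
  assumes f: "L2v f" and g: "L2v g"
    and w: "\<And>\<phi>. test_fun \<phi> \<Longrightarrow> integral {-1..1} (\<lambda>x. f x * deriv \<phi> x) = - integral {-1..1} (\<lambda>x. g x * \<phi> x)"
  shows "\<exists>c. AE x in Om. f x = c + prim g x"
proof -
  define h where "h = (\<lambda>x. f x - prim g x)"
  have h: "L2v h" unfolding h_def by (intro L2v_diff f prim_L2v g)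
  have i: "(\<lambda>x. p x * \<phi> x) absolutely_integrable_on {-1..1}" if "L2v p" "test_fun \<phi>" for p \<phi> :: "real \<Rightarrow> real"
    by (rule L2v_bilinear_integrable[OF bounded_bilinear_mult that(1) test_fun_L2v[OF that(2)]])
  have i': "(\<lambda>x. p x * \<phi> x) integrable_on {-1..1}" if "L2v p" "test_fun \<phi>" for p \<phi> :: "real \<Rightarrow> real"
    using i[OF that] by (simp add: absolutely_integrable_on_def)
  have h0: "integral {-1..1} (\<lambda>x. h x * deriv \<phi> x) = 0" if t: "test_fun \<phi>" for \<phi>
  proof -
    have "integral {-1..1} (\<lambda>x. prim g x * deriv \<phi> x) = - integral {-1..1} (\<lambda>x. g x * \<phi> x)"
    proof (rule integral_by_parts_prim[OF bounded_bilinear_mult g test_fun_L2v[OF test_fun_derivative[OF t]]])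
      show "\<phi> x = \<phi> (-1) + prim (deriv \<phi>) x" if "x \<in> {-1..1}" for x by (rule test_fun_prim[OF t that])
    qed (use test_fun_boundary[OF t] in auto)
    moreover have "integral {-1..1} (\<lambda>x. h x * deriv \<phi> x) = integral {-1..1} (\<lambda>x. f x * deriv \<phi> x) - integral {-1..1} (\<lambda>x. prim g x * deriv \<phi> x)"
      unfolding h_def left_diff_distrib
      by (intro Henstock_Kurzweil_Integration.integral_diff i' f prim_L2v g test_fun_derivative t)
    ultimately show ?thesis using w[OF t] by simp
  qed
  \<comment> \<open>A test function with nonzero integral exists, as otherwise
    \<open>weak_zero\<close> would make the constant one vanish almost everywhere.\<close>
  obtain \<eta>0 where e0: "test_fun \<eta>0" "integral {-1..1} \<eta>0 \<noteq> 0"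
  proof (rule ccontr)
    assume "\<not> thesis"
    then have z: "\<And>\<phi>. test_fun \<phi> \<Longrightarrow> integral {-1..1} \<phi> = 0" using that by blast
    have "AE x in Om. (1::real) = 0"
    proof (rule weak_zero)
      have c: "L2v (\<lambda>x. 1::real)" by (rule L2v_continuous) simp
      show "integrable Om (\<lambda>x. 1::real)" by (rule Om_integrable(1)[OF L2v_abs_int[OF c]])
      show "(LINT x|Om. 1 * \<phi> x) = 0" if "test_fun \<phi>" for \<phi>
        using Om_integrable(2)[OF i[OF c that]] z[OF that] by simp
    qed
    then have "ae_filter Om = bot" by (simp add: eventually_False)
    then have "emeasure Om (space Om) = 0" by (simp add: ae_filter_eq_bot_iff)
    then show False by (simp add: emeasure_restrict_space space_restrict_space)
  qed
  \<comment> \<open>Normalisation to integral one; as a test function it is \<eta>0 plus a multiple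
    of \<eta>0, which is the form of \<open>test_fun_combine\<close>.\<close>
  define \<eta> where "\<eta> = (\<lambda>x. 0 * \<eta>0 x + (1 / integral {-1..1} \<eta>0) * \<eta>0 x)"
  have e: "test_fun \<eta>"
    unfolding \<eta>_def using test_fun_combine[OF e0(1) e0(1), of "1 / integral {-1..1} \<eta>0 - 1"]
    by (simp add: algebra_simps)
  have e1: "integral {-1..1} \<eta> = 1" using e0(2) by (simp add: \<eta>_def)
  define c where "c = integral {-1..1} (\<lambda>x. h x * \<eta> x)"
  have hc: "L2v (\<lambda>x. h x - c)" by (intro L2v_diff h L2v_continuous) simp
  have "AE x in Om. h x - c = 0"
  proof (rule weak_zero)
    show "integrable Om (\<lambda>x. h x - c)" by (rule Om_integrable(1)[OF L2v_abs_int[OF hc]])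
    fix \<theta>2 assume t: "test_fun \<theta>2"
    define m where "m = integral {-1..1} \<theta>2"
    have it: "\<theta>2 integrable_on {-1..1}" "\<eta> integrable_on {-1..1}" using t e by (auto intro: L2v_int test_fun_L2v)
    \<comment> \<open>Removing the mean makes \<theta> the derivative of a test function, so that
      \<open>h0\<close> applies.\<close>
    define \<theta> where "\<theta> = (\<lambda>x. \<theta>2 x + (- m) * \<eta> x)"
    have th: "test_fun \<theta>" unfolding \<theta>_def by (rule test_fun_combine[OF t e])
    have "integral {-1..1} \<theta> = m + integral {-1..1} (\<lambda>x. - m * \<eta> x)"
      unfolding \<theta>_def m_def using it by (intro Henstock_Kurzweil_Integration.integral_add integrable_on_mult_right) auto
    then have "integral {-1..1} \<theta> = 0" using e1 by simp
    note P = test_fun_primitive[OF th this]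
    from h0[OF P(1)] have "integral {-1..1} (\<lambda>x. h x * \<theta> x) = 0" by (simp add: P(2))
    also have "(\<lambda>x. h x * \<theta> x) = (\<lambda>x. h x * \<theta>2 x - m * (h x * \<eta> x))" by (simp add: \<theta>_def algebra_simps)
    also have "integral {-1..1} \<dots> = integral {-1..1} (\<lambda>x. h x * \<theta>2 x) - m * c"
      unfolding c_def using i'[OF h t] i'[OF h e]
      by (subst Henstock_Kurzweil_Integration.integral_diff) (auto intro!: integrable_on_mult_right)
    finally have hm: "integral {-1..1} (\<lambda>x. h x * \<theta>2 x) = m * c" by simp
    have "integral {-1..1} (\<lambda>x. (h x - c) * \<theta>2 x) = integral {-1..1} (\<lambda>x. h x * \<theta>2 x) - integral {-1..1} (\<lambda>x. c * \<theta>2 x)"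
      unfolding left_diff_distrib using i'[OF h t] it by (intro Henstock_Kurzweil_Integration.integral_diff integrable_on_mult_right) auto
    then show "(LINT x|Om. (h x - c) * \<theta>2 x) = 0"
      using Om_integrable(2)[OF i[OF hc t]] hm by (simp add: m_def)
  qed
  then show ?thesis by (intro exI[of _ c]) (auto simp: h_def algebra_simps elim!: AE_mp)
qed

section \<open>Sobolev spaces on the interval\<close>

text \<open>The passage from the Bochner integral on the open interval to functions on the closed
  one; the values outside (-1,1) are set to zero.\<close>

lemma L2_rep:
  assumes "f \<in> L2"
  obtains g where "L2v g" "\<And>x. x \<in> {-1<..<1} \<Longrightarrow> g x = f x"
proof -
  define g where "g = (\<lambda>x. if x \<in> {-1<..<1} then f x else 0)"
  have "(\<lambda>x. (f x)\<^sup>2) integrable_on {-1<..<1}"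
    using assms by (intro integrable_on_lebesgue_on) (auto simp: L2_def)
  then have "(\<lambda>x. (norm (g x))\<^sup>2) integrable_on {-1<..<1}"
    by (rule integrable_eq) (simp add: g_def)
  then have "(\<lambda>x. (norm (g x))\<^sup>2) integrable_on {-1..1}"
    by (simp only: integrable_on_open_interval_real)
  moreover have "g \<in> borel_measurable (lebesgue_on {-1..1})"
    unfolding g_def by (rule measurable_restrict_space1, rule borel_measurable_if_I) (use assms in \<open>auto simp: L2_def\<close>)
  ultimately show ?thesis by (intro that[of g]) (auto simp: L2v_def g_def)
qed

lemma Om_AE_I: "(\<And>x. x \<in> {-1<..<1} \<Longrightarrow> P x) \<Longrightarrow> AE x in Om. P x"
  by (rule AE_I2) (auto simp: space_restrict_space)

lemma L2v_Om_measurable: "L2v f \<Longrightarrow> f \<in> borel_measurable Om"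
  by (rule measurable_restrict_mono[OF L2v_meas]) auto

lemma L2v_L2: "L2v f \<Longrightarrow> f \<in> L2"
proof -
  assume f: "L2v f"
  have "integrable Om (\<lambda>x. f x * f x)"
    by (rule Om_integrable(1)[OF L2v_bilinear_integrable[OF bounded_bilinear_mult f f]])
  then show ?thesis using L2v_Om_measurable[OF f] by (simp add: L2_def power2_eq_square)
qed

lemma LINT_AE_eq:
  fixes f g :: "real \<Rightarrow> 'a::euclidean_space"
  assumes "f \<in> borel_measurable Om" "g absolutely_integrable_on {-1..1}" "AE x in Om. f x = g x"
  shows "(LINT x|Om. f x) = integral {-1..1} g"
proof -
  have "(LINT x|Om. f x) = (LINT x|Om. g x)"
    using Om_integrable(1)[OF assms(2)] by (intro integral_cong_AE assms) auto
  then show ?thesis using Om_integrable(2)[OF assms(2)] by simp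
qed

lemma L2_AE:
  assumes f: "f \<in> borel_measurable Om" and g: "L2v g" and eq: "AE x in Om. f x = g x"
  shows "f \<in> L2"
proof -
  have "g \<in> L2" by (rule L2v_L2[OF g])
  then have g2: "integrable Om (\<lambda>x. (g x)\<^sup>2)" by (simp add: L2_def)
  have "integrable Om (\<lambda>x. (f x)\<^sup>2) = integrable Om (\<lambda>x. (g x)\<^sup>2)"
  proof (rule integrable_cong_AE)
    show "(\<lambda>x. (f x)\<^sup>2) \<in> borel_measurable Om" using f by simp
    show "(\<lambda>x. (g x)\<^sup>2) \<in> borel_measurable Om" using g2 by auto
    show "AE x in Om. (f x)\<^sup>2 = (g x)\<^sup>2" using eq by (auto elim!: AE_mp)
  qed
  then show ?thesis using f g2 by (simp add: L2_def)
qed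

lemma test_fun_Om_measurable: "test_fun \<phi> \<Longrightarrow> \<phi> \<in> borel_measurable Om"
  by (rule L2v_Om_measurable[OF test_fun_L2v])

lemma LINT_test_AE:
  fixes f g \<phi> :: "real \<Rightarrow> real"
  assumes "f \<in> borel_measurable Om" "L2v g" "AE x in Om. f x = g x" "test_fun \<phi>"
  shows "(LINT x|Om. f x * \<phi> x) = integral {-1..1} (\<lambda>x. g x * \<phi> x)"
proof (rule LINT_AE_eq)
  show "(\<lambda>x. f x * \<phi> x) \<in> borel_measurable Om"
    by (intro borel_measurable_times assms(1) test_fun_Om_measurable assms(4))
  show "(\<lambda>x. g x * \<phi> x) absolutely_integrable_on {-1..1}"
    by (rule L2v_bilinear_integrable[OF bounded_bilinear_mult assms(2) test_fun_L2v[OF assms(4)]])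
  show "AE x in Om. f x * \<phi> x = g x * \<phi> x" using assms(3) by (auto elim!: AE_mp)
qed

lemma has_weak_deriv_unique:
  assumes g: "g1 \<in> L2" "g2 \<in> L2" and w: "has_weak_deriv j f g1" "has_weak_deriv j f g2"
  shows "AE x in Om. g1 x = g2 x"
proof -
  obtain h1 where h1: "L2v h1" "\<And>x. x \<in> {-1<..<1} \<Longrightarrow> h1 x = g1 x" using L2_rep[OF g(1)] by metis
  obtain h2 where h2: "L2v h2" "\<And>x. x \<in> {-1<..<1} \<Longrightarrow> h2 x = g2 x" using L2_rep[OF g(2)] by metis
  have d: "L2v (\<lambda>x. h1 x - h2 x)" by (rule L2v_diff[OF h1(1) h2(1)])
  have "AE x in Om. h1 x - h2 x = 0"
  proof (rule weak_zero)
    show "integrable Om (\<lambda>x. h1 x - h2 x)" by (rule Om_integrable(1)[OF L2v_abs_int[OF d]])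
    fix \<phi> assume t: "test_fun \<phi>"
    have i: "(\<lambda>x. h x * \<phi> x) absolutely_integrable_on {-1..1}" if "L2v h" for h :: "real \<Rightarrow> real"
      by (rule L2v_bilinear_integrable[OF bounded_bilinear_mult that test_fun_L2v[OF t]])
    have e: "(LINT x|Om. g1 x * \<phi> x) = integral {-1..1} (\<lambda>x. h1 x * \<phi> x)"
       "(LINT x|Om. g2 x * \<phi> x) = integral {-1..1} (\<lambda>x. h2 x * \<phi> x)"
      using g h1 h2 t by (auto intro!: LINT_test_AE Om_AE_I simp: L2_def)
    have "(-1::real) ^ j * (LINT x|Om. g1 x * \<phi> x) = (-1) ^ j * (LINT x|Om. g2 x * \<phi> x)"
      using w(1)[unfolded has_weak_deriv_def, rule_format, OF t] w(2)[unfolded has_weak_deriv_def, rule_format, OF t]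
      by (rule subst)
    then have eq: "integral {-1..1} (\<lambda>x. h1 x * \<phi> x) = integral {-1..1} (\<lambda>x. h2 x * \<phi> x)" using e by simp
    have "(LINT x|Om. (h1 x - h2 x) * \<phi> x) = integral {-1..1} (\<lambda>x. h1 x * \<phi> x - h2 x * \<phi> x)"
      unfolding Om_integrable(2)[OF i[OF d]] by (simp add: left_diff_distrib)
    also have "\<dots> = 0" using i[OF h1(1)] i[OF h2(1)] eq
      by (subst Henstock_Kurzweil_Integration.integral_diff) (auto simp: absolutely_integrable_on_def)
    finally show "(LINT x|Om. (h1 x - h2 x) * \<phi> x) = 0" .
  qed
  moreover have "AE x in Om. h1 x = g1 x \<and> h2 x = g2 x" by (rule Om_AE_I) (use h1 h2 in auto)
  ultimately show ?thesis by (auto elim: AE_mp)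
qed

lemma has_weak_deriv_0: "has_weak_deriv 0 f f"
  by (simp add: has_weak_deriv_def)

text \<open>One integration by parts; the constant c disappears against the derivative of a test
  function. This equivalence carries all inductions on the order of a Sobolev space.\<close>

lemma has_weak_deriv_shift:
  fixes f y :: "real \<Rightarrow> real"
  assumes f: "f \<in> borel_measurable Om" and y: "L2v y" and eq: "AE x in Om. f x = c + prim y x"
  shows "has_weak_deriv (Suc j) f g \<longleftrightarrow> has_weak_deriv j y g"
proof -
  have cp: "L2v (\<lambda>x. c + prim y x)" by (intro L2v_add L2v_continuous prim_continuous y) simp
  have key: "(LINT x|Om. f x * (deriv ^^ Suc j) \<phi> x) = - (LINT x|Om. y x * (deriv ^^ j) \<phi> x)" if t: "test_fun \<phi>" for \<phi>
  proof -
    define \<psi> where "\<psi> = (deriv ^^ j) \<phi>"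
    have ps: "test_fun \<psi>" unfolding \<psi>_def by (rule test_fun_higher_derivative[OF t])
    have "(LINT x|Om. f x * deriv \<psi> x) = integral {-1..1} (\<lambda>x. (c + prim y x) * deriv \<psi> x)"
      by (rule LINT_test_AE[OF f cp eq test_fun_derivative[OF ps]])
    also have "\<dots> = - integral {-1..1} (\<lambda>x. y x * \<psi> x)"
    proof (rule integral_by_parts_prim[OF bounded_bilinear_mult y test_fun_L2v[OF test_fun_derivative[OF ps]]])
      show "\<psi> x = \<psi> (-1) + prim (deriv \<psi>) x" if "x \<in> {-1..1}" for x by (rule test_fun_prim[OF ps that])
    qed (use test_fun_boundary[OF ps] in auto)
    also have "integral {-1..1} (\<lambda>x. y x * \<psi> x) = (LINT x|Om. y x * \<psi> x)"
      by (rule LINT_test_AE[OF L2v_Om_measurable[OF y] y _ ps, symmetric]) simp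
    finally show ?thesis by (simp add: \<psi>_def)
  qed
  show ?thesis unfolding has_weak_deriv_def using key by auto
qed

lemma H_0: "H 0 = L2"
  by (auto simp: H_def intro: has_weak_deriv_0)

lemma H_measurable: "f \<in> H k \<Longrightarrow> f \<in> borel_measurable Om"
  by (auto simp: H_def L2_def)

text \<open>By du Bois-Reymond a function with weak derivative y is almost everywhere a constant
  plus the primitive of y. So H^(k+1) consists of constants plus primitives of elements of H^k;
  \<open>H_SucI\<close> is the converse.\<close>

lemma H_SucE:
  assumes f: "f \<in> H (Suc k)"
  obtains c y where "L2v y" "AE x in Om. f x = c + prim y x" "y \<in> H k"
proof -
  have fL: "f \<in> L2" and w: "\<And>j. j \<le> Suc k \<Longrightarrow> \<exists>g\<in>L2. has_weak_deriv j f g" using f by (auto simp: H_def)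
  obtain g where g: "g \<in> L2" "has_weak_deriv 1 f g" using w[of 1] by auto
  obtain y where y: "L2v y" "\<And>x. x \<in> {-1<..<1} \<Longrightarrow> y x = g x" using L2_rep[OF g(1)] by metis
  obtain F where F: "L2v F" "\<And>x. x \<in> {-1<..<1} \<Longrightarrow> F x = f x" using L2_rep[OF fL] by metis
  have "\<exists>c. AE x in Om. F x = c + prim y x"
  proof (rule du_Bois_Reymond[OF F(1) y(1)])
    fix \<phi> assume t: "test_fun \<phi>"
    have "(LINT x|Om. f x * deriv \<phi> x) = - (LINT x|Om. g x * \<phi> x)"
      using g(2) t by (simp add: has_weak_deriv_def)
    moreover have "(LINT x|Om. f x * deriv \<phi> x) = integral {-1..1} (\<lambda>x. F x * deriv \<phi> x)"
      using F fL by (intro LINT_test_AE test_fun_derivative t Om_AE_I) (auto simp: L2_def)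
    moreover have "(LINT x|Om. g x * \<phi> x) = integral {-1..1} (\<lambda>x. y x * \<phi> x)"
      using y g by (intro LINT_test_AE t Om_AE_I) (auto simp: L2_def)
    ultimately show "integral {-1..1} (\<lambda>x. F x * deriv \<phi> x) = - integral {-1..1} (\<lambda>x. y x * \<phi> x)" by simp
  qed
  then obtain c where "AE x in Om. F x = c + prim y x" by blast
  moreover have "AE x in Om. F x = f x" by (rule Om_AE_I) (rule F(2))
  ultimately have c: "AE x in Om. f x = c + prim y x" by (auto elim: AE_mp)
  have fm: "f \<in> borel_measurable Om" using fL by (simp add: L2_def)
  have "y \<in> H k"
    unfolding H_def using L2v_L2[OF y(1)] w[of "Suc _"] has_weak_deriv_shift[OF fm y(1) c] by auto
  then show ?thesis using that y(1) c by blast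
qed

lemma H_SucI:
  fixes f y :: "real \<Rightarrow> real"
  assumes f: "f \<in> borel_measurable Om" and y: "L2v y" and c: "AE x in Om. f x = c + prim y x" and H: "y \<in> H k"
  shows "f \<in> H (Suc k)"
proof -
  have fL: "f \<in> L2"
    by (rule L2_AE[OF f _ c]) (intro L2v_add L2v_continuous prim_continuous y, simp)
  have "\<exists>g\<in>L2. has_weak_deriv j f g" if "j \<le> Suc k" for j
  proof (cases j)
    case 0
    then show ?thesis using fL has_weak_deriv_0 by auto
  next
    case (Suc i)
    then show ?thesis using H that has_weak_deriv_shift[OF f y c] by (auto simp: H_def)
  qed
  then show ?thesis using fL by (auto simp: H_def)
qed

lemma weak_deriv_AE:
  assumes "g \<in> L2" "has_weak_deriv j f g"
  shows "weak_deriv j f \<in> L2" "AE x in Om. weak_deriv j f x = g x"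
proof -
  have "weak_deriv j f \<in> L2 \<and> has_weak_deriv j f (weak_deriv j f)"
    unfolding weak_deriv_def by (rule someI[of _ g]) (use assms in auto)
  then show "weak_deriv j f \<in> L2" "AE x in Om. weak_deriv j f x = g x"
    using has_weak_deriv_unique assms by auto
qed

lemma continuous_AE_eq:
  fixes p q :: "real \<Rightarrow> real"
  assumes p: "continuous_on {-1..1} p" and q: "continuous_on {-1..1} q" and e: "AE x in Om. p x = q x" and x: "x \<in> {-1..1}"
  shows "p x = q x"
proof -
  have c: "continuous_on {-1..1} (\<lambda>x. \<bar>p x - q x\<bar>)" by (intro continuous_intros p q)
  have ai: "(\<lambda>x. \<bar>p x - q x\<bar>) absolutely_integrable_on {-1..1}" by (rule L2v_abs_int[OF L2v_continuous[OF c]])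
  have "(LINT x|Om. \<bar>p x - q x\<bar>) = 0"
    by (rule integral_eq_zero_AE) (use e in \<open>auto elim!: AE_mp\<close>)
  then have "integral {-1..1} (\<lambda>x. \<bar>p x - q x\<bar>) = 0" using Om_integrable(2)[OF ai] by simp
  then have "\<forall>x\<in>{-1..1}. \<bar>p x - q x\<bar> = 0" using integral_eq_0_iff[OF c] by simp
  then show ?thesis using x by auto
qed

lemma axis_expansion: "x = (\<Sum>i\<in>UNIV. (x $ i) *\<^sub>R axis i (1::real))"
  by (simp add: vec_eq_iff axis_def if_distrib[of "\<lambda>z. _ * z"] sum.delta' cong: if_cong)

lemma vec_measurable:
  fixes f :: "'a \<Rightarrow> real^'d"
  assumes "\<And>i. (\<lambda>x. f x $ i) \<in> borel_measurable M"
  shows "f \<in> borel_measurable M"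
proof -
  have "(\<lambda>x. \<Sum>i\<in>UNIV. (f x $ i) *\<^sub>R axis i (1::real)) \<in> borel_measurable M"
    by (intro borel_measurable_sum borel_measurable_scaleR assms borel_measurable_const)
  then show ?thesis by (simp add: axis_expansion[symmetric])
qed

lemma vec_nth_measurable: "f \<in> borel_measurable M \<Longrightarrow> (\<lambda>x. f x $ i :: real) \<in> borel_measurable M"
  by (rule borel_measurable_continuous_on[of "\<lambda>v. v $ i"]) (auto intro: continuous_intros)

lemma L2v_nth: "L2v y \<Longrightarrow> L2v (\<lambda>x. y x $ i :: real)"
  by (rule L2v_dominated[where g=y and K=1]) (auto intro: vec_nth_measurable L2v_meas component_le_norm_cart)

lemma L2v_sum:
  fixes f :: "'i \<Rightarrow> real \<Rightarrow> 'a::euclidean_space"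
  assumes "\<And>i. i \<in> I \<Longrightarrow> L2v (f i)"
  shows "L2v (\<lambda>x. \<Sum>i\<in>I. f i x)"
  using assms
proof (induction I rule: infinite_finite_induct)
  case (insert a F)
  then show ?case by (auto intro!: L2v_add)
qed (auto intro: L2v_continuous)

lemma L2v_vecI:
  fixes y :: "real \<Rightarrow> real^'d"
  assumes "\<And>i. L2v (\<lambda>x. y x $ i)"
  shows "L2v y"
proof -
  have "L2v (\<lambda>x. (y x $ i) *\<^sub>R axis i (1::real) :: real^'d)" for i
    by (rule L2v_dominated[OF assms[of i], where K=1])
       (auto intro!: borel_measurable_scaleR L2v_meas[OF assms] simp: norm_axis_1)
  then have "L2v (\<lambda>x. \<Sum>i\<in>UNIV. (y x $ i) *\<^sub>R axis i (1::real))" by (rule L2v_sum)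
  then show ?thesis by (simp add: axis_expansion[symmetric])
qed

lemma prim_nth:
  fixes y :: "real \<Rightarrow> real^'d"
  assumes "L2v y" "x \<in> {-1..1}"
  shows "prim y x $ i = prim (\<lambda>x. y x $ i) x"
proof -
  have "y integrable_on {-1..x}" using assms by (intro L2v_int_sub) auto
  from integral_linear[OF this bounded_linear_vec_nth[of i]] show ?thesis by (simp add: prim_def o_def)
qed

text \<open>The elements of X_0^1 are, up to null sets, the primitives from -1 of the square integrable y
  with mean zero; prim y is then the continuous representative and y the weak derivative.\<close>

definition rep :: "(real \<Rightarrow> real^'d) \<Rightarrow> (real \<Rightarrow> real^'d) \<Rightarrow> bool" where
  "rep \<phi> y \<longleftrightarrow> L2v y \<and> prim y 1 = 0 \<and> (AE x in Om. \<phi> x = prim y x)"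

lemma X01_measurable: "\<phi> \<in> X0 k \<Longrightarrow> \<phi> \<in> borel_measurable Om"
  by (rule vec_measurable) (auto simp: X0_def H0_def intro: H_measurable)

lemma X01_rep:
  assumes "\<phi> \<in> X0 1"
  obtains y where "rep \<phi> y"
proof -
  have "\<exists>y. L2v y \<and> prim y 1 = 0 \<and> (AE x in Om. \<phi> x $ i = prim y x)" for i
  proof -
    have h: "(\<lambda>x. \<phi> x $ i) \<in> H0 1" using assms by (auto simp: X0_def)
    obtain g where g: "continuous_on {-1..1} g" "AE x in Om. g x = \<phi> x $ i" "g (-1) = 0" "g 1 = 0"
      using h by (auto simp: H0_def)
    have "(\<lambda>x. \<phi> x $ i) \<in> H (Suc 0)" using h by (simp add: H0_def)
    then obtain c y where y: "L2v y" "AE x in Om. \<phi> x $ i = c + prim y x" "y \<in> H 0"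
      using H_SucE by metis
    \<comment> \<open>The continuous representative from \<open>H0\<close> agrees almost everywhere,
      hence at every point of [-1,1], with c + prim y. Its value at -1 gives c = 0, its value at 1
      gives prim y 1 = 0.\<close>
    have "AE x in Om. g x = c + prim y x" using g(2) y(2) by (auto elim: AE_mp)
    then have e: "g x = c + prim y x" if "x \<in> {-1..1}" for x
      using that by (intro continuous_AE_eq[OF g(1)]) (auto intro!: continuous_intros prim_continuous y)
    have "c = 0" using e[of "-1"] g by simp
    then show ?thesis using e[of 1] g y by auto
  qed
  then obtain y where y: "\<And>i. L2v (y i)" "\<And>i. prim (y i) 1 = 0" "\<And>i. AE x in Om. \<phi> x $ i = prim (y i) x" by metis
  define z where "z x = (\<chi> i. y i x)" for x
  have zi: "(\<lambda>x. z x $ i) = y i" for i by (simp add: z_def)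
  have z: "L2v z" by (rule L2v_vecI) (simp add: zi y)
  have "prim z 1 = 0" using prim_nth[OF z, of 1] y(2) by (simp add: vec_eq_iff zi)
  moreover have "AE x in Om. \<forall>i. \<phi> x $ i = prim (y i) x" using y(3) by (simp add: AE_all_countable)
  then have "AE x in Om. \<phi> x = prim z x"
  proof (rule AE_mp, intro AE_I2 impI)
    fix x assume "x \<in> space Om" and a: "\<forall>i. \<phi> x $ i = prim (y i) x"
    then have "x \<in> {-1..1}" by (auto simp: space_restrict_space)
    then show "\<phi> x = prim z x" using a prim_nth[OF z] by (simp add: vec_eq_iff zi)
  qed
  ultimately show ?thesis using that z by (simp add: rep_def)
qed

lemma rep_L2v: "rep \<phi> y \<Longrightarrow> L2v y" and rep_prim1: "rep \<phi> y \<Longrightarrow> prim y 1 = 0"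
  and rep_AE: "rep \<phi> y \<Longrightarrow> AE x in Om. \<phi> x = prim y x"
  by (auto simp: rep_def)

lemma rep_prim: "L2v y \<Longrightarrow> prim y 1 = 0 \<Longrightarrow> rep (prim y) y"
  by (simp add: rep_def)

lemma rep_nth_AE:
  assumes "rep \<phi> y"
  shows "AE x in Om. \<phi> x $ i = 0 + prim (\<lambda>x. y x $ i) x"
  using rep_AE[OF assms]
proof (rule AE_mp, intro AE_I2 impI)
  fix x assume "x \<in> space Om" and a: "\<phi> x = prim y x"
  then have "x \<in> {-1..1}" by (auto simp: space_restrict_space)
  then show "\<phi> x $ i = 0 + prim (\<lambda>x. y x $ i) x" using a prim_nth[OF rep_L2v[OF assms]] by simp
qed

lemma X01I:
  assumes m: "\<phi> \<in> borel_measurable Om" and r: "rep \<phi> y"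
  shows "\<phi> \<in> X0 1"
proof -
  have "(\<lambda>x. \<phi> x $ i) \<in> H0 1" for i
  proof -
    have yi: "L2v (\<lambda>x. y x $ i)" by (rule L2v_nth[OF rep_L2v[OF r]])
    have "(\<lambda>x. \<phi> x $ i) \<in> H (Suc 0)"
      by (rule H_SucI[OF vec_nth_measurable[OF m] yi rep_nth_AE[OF r]]) (simp add: H_0 L2v_L2 yi)
    moreover have "AE x in Om. prim (\<lambda>x. y x $ i) x = \<phi> x $ i" using rep_nth_AE[OF r, of i] by (auto elim: AE_mp)
    moreover have "prim (\<lambda>x. y x $ i) 1 = 0" using prim_nth[OF rep_L2v[OF r], of 1 i] rep_prim1[OF r] by simp
    ultimately show ?thesis using prim_continuous[OF yi] by (auto simp: H0_def intro!: exI[of _ "prim (\<lambda>x. y x $ i)"])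
  qed
  then show ?thesis by (simp add: X0_def)
qed

lemma prim_X01: "L2v y \<Longrightarrow> prim y 1 = 0 \<Longrightarrow> prim y \<in> X0 1"
  by (intro X01I[OF _ rep_prim] L2v_Om_measurable prim_L2v)

section \<open>Inner products and norms through representatives\<close>

lemma ip0_AE:
  assumes "\<phi> \<in> borel_measurable Om" "\<psi> \<in> borel_measurable Om" "L2v f" "L2v g"
    "AE x in Om. \<phi> x = f x" "AE x in Om. \<psi> x = g x"
  shows "ip0 \<phi> \<psi> = integral {-1..1} (\<lambda>x. f x \<bullet> g x)"
proof -
  have i: "(\<lambda>x. f x $ i * g x $ i) absolutely_integrable_on {-1..1}" for i
    by (rule L2v_bilinear_integrable[OF bounded_bilinear_mult L2v_nth[OF assms(3)] L2v_nth[OF assms(4)]])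
  have "(LINT x|Om. \<phi> x $ i * \<psi> x $ i) = integral {-1..1} (\<lambda>x. f x $ i * g x $ i)" for i
  proof (rule LINT_AE_eq[OF _ i])
    show "(\<lambda>x. \<phi> x $ i * \<psi> x $ i) \<in> borel_measurable Om"
      by (intro borel_measurable_times vec_nth_measurable assms)
    show "AE x in Om. \<phi> x $ i * \<psi> x $ i = f x $ i * g x $ i"
      using assms(5,6) by (auto elim: AE_mp)
  qed
  then have "ip0 \<phi> \<psi> = (\<Sum>i\<in>UNIV. integral {-1..1} (\<lambda>x. f x $ i * g x $ i))" by (simp add: ip0_def)
  also have "\<dots> = integral {-1..1} (\<lambda>x. \<Sum>i\<in>UNIV. f x $ i * g x $ i)"
    using i by (subst integral_sum) (auto simp: absolutely_integrable_on_def)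
  finally show ?thesis by (simp add: inner_vec_def)
qed

lemma norm0_AE:
  assumes "\<phi> \<in> borel_measurable Om" "L2v f" "AE x in Om. \<phi> x = f x"
  shows "norm0 \<phi> = n2 f"
  unfolding norm0_def n2_def using ip0_AE[OF assms(1,1,2,2,3,3)] by (simp add: power2_norm_eq_inner)

lemma vderiv_AE:
  assumes f: "L2v f" and w: "\<And>i. has_weak_deriv j (\<lambda>x. \<phi> x $ i) (\<lambda>x. f x $ i)"
  shows "vderiv j \<phi> \<in> borel_measurable Om" "AE x in Om. vderiv j \<phi> x = f x"
proof -
  note d = weak_deriv_AE[OF L2v_L2[OF L2v_nth[OF f]] w]
  show "vderiv j \<phi> \<in> borel_measurable Om"
    by (rule vec_measurable) (use d(1) in \<open>simp add: vderiv_def L2_def\<close>)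
  have "AE x in Om. \<forall>i. weak_deriv j (\<lambda>x. \<phi> x $ i) x = f x $ i" using d(2) by (simp add: AE_all_countable)
  then show "AE x in Om. vderiv j \<phi> x = f x" by (auto simp: vderiv_def vec_eq_iff elim!: AE_mp)
qed

lemma vderiv1_AE:
  assumes f: "L2v y" and m: "\<phi> \<in> borel_measurable Om" and w: "\<And>i. AE x in Om. \<phi> x $ i = c i + prim (\<lambda>x. y x $ i) x"
  shows "vderiv 1 \<phi> \<in> borel_measurable Om" "AE x in Om. vderiv 1 \<phi> x = y x"
proof -
  have "has_weak_deriv 1 (\<lambda>x. \<phi> x $ i) (\<lambda>x. y x $ i)" for i
    using has_weak_deriv_shift[OF vec_nth_measurable[OF m] L2v_nth[OF f] w, of 0] has_weak_deriv_0 by auto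
  from vderiv_AE[OF f this] show "vderiv 1 \<phi> \<in> borel_measurable Om" "AE x in Om. vderiv 1 \<phi> x = y x" by auto
qed

lemma vderiv0_AE:
  assumes f: "L2v f" and m: "\<phi> \<in> borel_measurable Om" and e: "AE x in Om. \<phi> x = f x"
  shows "vderiv 0 \<phi> \<in> borel_measurable Om" "AE x in Om. vderiv 0 \<phi> x = f x"
proof -
  have "has_weak_deriv 0 (\<lambda>x. \<phi> x $ i) (\<lambda>x. f x $ i)" for i
  proof -
    have "(LINT x|Om. \<phi> x $ i * \<psi> x) = (LINT x|Om. f x $ i * \<psi> x)" if t: "test_fun \<psi>" for \<psi>
      using e by (intro integral_cong_AE borel_measurable_times vec_nth_measurable m L2v_Om_measurable f test_fun_Om_measurable t)
        (auto elim!: AE_mp)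
    then show ?thesis by (simp add: has_weak_deriv_def)
  qed
  from vderiv_AE[OF f this] show "vderiv 0 \<phi> \<in> borel_measurable Om" "AE x in Om. vderiv 0 \<phi> x = f x" by auto
qed

lemma Xnorm1_rep:
  assumes m: "\<phi> \<in> borel_measurable Om" and r: "rep \<phi> y"
  shows "Xnorm 1 \<phi> = sqrt ((n2 (prim y))\<^sup>2 + (n2 y)\<^sup>2)"
proof -
  note y = rep_L2v[OF r]
  have 0: "norm0 (vderiv 0 \<phi>) = n2 (prim y)"
    using norm0_AE[OF _ prim_L2v[OF y]] vderiv0_AE[OF prim_L2v[OF y] m rep_AE[OF r]] by auto
  have 1: "norm0 (vderiv 1 \<phi>) = n2 y"
    using norm0_AE[OF _ y] vderiv1_AE[OF y m rep_nth_AE[OF r]] by auto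
  have "{..1::nat} = {0,1}" by auto
  then show ?thesis using 0 1 by (simp add: Xnorm_def)
qed

text \<open>Poincare's inequality makes the X^1 norm equivalent to the L^2 norm of the derivative:
  4^2 + 1 = 17 is below 25 = 5^2. From here on \<open>n2 y\<close> stands in for the norm of
  X_0^1.\<close>

lemma Xnorm1_bounds:
  assumes m: "\<phi> \<in> borel_measurable Om" and r: "rep \<phi> y"
  shows "n2 y \<le> Xnorm 1 \<phi>" "Xnorm 1 \<phi> \<le> 5 * n2 y"
proof -
  show "n2 y \<le> Xnorm 1 \<phi>" unfolding Xnorm1_rep[OF m r] by (rule real_le_rsqrt) simp
  have "(n2 (prim y))\<^sup>2 \<le> (4 * n2 y)\<^sup>2" by (rule power_mono[OF prim_n2[OF rep_L2v[OF r]] n2_nonneg])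
  moreover have "(4 * n2 y)\<^sup>2 = 16 * (n2 y)\<^sup>2" "(5 * n2 y)\<^sup>2 = 25 * (n2 y)\<^sup>2" by (simp_all add: power_mult_distrib)
  ultimately have "(n2 (prim y))\<^sup>2 + (n2 y)\<^sup>2 \<le> (5 * n2 y)\<^sup>2" using zero_le_power2[of "n2 y"] by linarith
  then have "sqrt ((n2 (prim y))\<^sup>2 + (n2 y)\<^sup>2) \<le> sqrt ((5 * n2 y)\<^sup>2)" by (rule real_sqrt_le_mono)
  also have "\<dots> = 5 * n2 y" using n2_nonneg[of y] unfolding real_sqrt_abs by simp
  finally show "Xnorm 1 \<phi> \<le> 5 * n2 y" unfolding Xnorm1_rep[OF m r] .
qed

lemma rep_diff:
  assumes "rep \<phi> y" "rep \<psi> z"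
  shows "rep (\<lambda>x. \<phi> x - \<psi> x) (\<lambda>x. y x - z x)"
proof -
  have "AE x in Om. \<phi> x - \<psi> x = prim (\<lambda>x. y x - z x) x"
    using rep_AE[OF assms(1)] rep_AE[OF assms(2)] AE_space
  proof eventually_elim
    case (elim x)
    then have "x \<in> {-1..1}" by (auto simp: space_restrict_space)
    then show ?case using elim prim_diff[OF rep_L2v[OF assms(1)] rep_L2v[OF assms(2)]] by simp
  qed
  then show ?thesis using assms prim_diff[OF rep_L2v[OF assms(1)] rep_L2v[OF assms(2)], of 1]
    by (simp add: rep_def L2v_diff)
qed

lemma rep_scaleR:
  assumes "rep \<phi> y" shows "rep (\<lambda>x. c *\<^sub>R \<phi> x) (\<lambda>x. c *\<^sub>R y x)"
  using assms by (auto simp: rep_def prim_scaleR L2v_scaleR elim!: AE_mp)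

section \<open>The weak problem for the derivative\<close>

lemma bounded_bilinear_I1:
  fixes prod :: "'a::real_normed_vector \<Rightarrow> 'b::real_normed_vector \<Rightarrow> 'c::real_normed_vector"
  assumes "\<And>a a' b. prod (a + a') b = prod a b + prod a' b" "\<And>a b b'. prod a (b + b') = prod a b + prod a b'"
    "\<And>r a b. prod (r *\<^sub>R a) b = r *\<^sub>R prod a b" "\<And>r a b. prod a (r *\<^sub>R b) = r *\<^sub>R prod a b"
    "\<And>a b. norm (prod a b) \<le> norm a * norm b"
  shows "bounded_bilinear prod"
  by (rule bounded_bilinear.intro) (use assms in \<open>auto intro!: exI[of _ 1]\<close>)

text \<open>The norm of a vector of rows is the Frobenius norm; Cauchy-Schwarz on each row is
  enough.\<close>

lemma norm_matrix_vector: "norm ((M::real^'n^'m) *v x) \<le> norm M * norm x"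
proof -
  have c: "\<bar>(M *v x) $ i\<bar> \<le> norm (M $ i) * norm x" for i
  proof -
    have "(M *v x) $ i = M $ i \<bullet> x" by (simp add: matrix_vector_mult_def inner_vec_def)
    then show ?thesis using Cauchy_Schwarz_ineq2 by metis
  qed
  have "norm (M *v x) \<le> L2_set (\<lambda>i. norm (M $ i) * norm x) UNIV"
    unfolding norm_vec_def[of "M *v x"] by (rule L2_set_mono) (use c in auto)
  also have "\<dots> = norm M * norm x" unfolding norm_vec_def[of M] by (rule L2_set_left_distrib[symmetric]) simp
  finally show ?thesis .
qed

lemma bounded_bilinear_matrix_vector: "bounded_bilinear (\<lambda>(M::real^'n^'m) x. M *v x)"
  by (rule bounded_bilinear_I1;
     (rule norm_matrix_vector | simp add: matrix_vector_mult_def vec_eq_iff sum_distrib_left sum.distrib algebra_simps))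

lemma L2v_continuous_mult:
  fixes prod :: "'a::euclidean_space \<Rightarrow> 'b::euclidean_space \<Rightarrow> 'c::euclidean_space"
  assumes bb: "bounded_bilinear prod" and c: "continuous_on {-1..1} M" and z: "L2v z"
  shows "L2v (\<lambda>x. prod (M x) (z x))"
proof -
  obtain C where "\<And>s. s \<in> {-1..1} \<Longrightarrow> norm (M s) \<le> C"
    using compact_imp_bounded[OF compact_continuous_image[OF c compact_Icc]]
    by (auto simp: bounded_iff simp del: atLeastAtMost_iff)
  then show ?thesis
    by (intro L2v_bilinear_bounded[OF bb continuous_imp_measurable_on_sets_lebesgue[OF c] _ z]) auto
qed

definition ip :: "(real \<Rightarrow> 'a::euclidean_space) \<Rightarrow> (real \<Rightarrow> 'a) \<Rightarrow> real" where
  "ip f g = integral {-1..1} (\<lambda>x. f x \<bullet> g x)"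

lemma ip_integrable: "L2v f \<Longrightarrow> L2v g \<Longrightarrow> (\<lambda>x. f x \<bullet> g x) integrable_on {-1..1}"
  using L2v_bilinear_integrable[OF bounded_bilinear_inner] by (auto simp: absolutely_integrable_on_def)

lemma ip_diff_left: "L2v f \<Longrightarrow> L2v f' \<Longrightarrow> L2v g \<Longrightarrow> ip (\<lambda>x. f x - f' x) g = ip f g - ip f' g"
  unfolding ip_def inner_diff_left by (rule Henstock_Kurzweil_Integration.integral_diff) (auto intro: ip_integrable)

lemma ip_add_left: "L2v f \<Longrightarrow> L2v f' \<Longrightarrow> L2v g \<Longrightarrow> ip (\<lambda>x. f x + f' x) g = ip f g + ip f' g"
  unfolding ip_def inner_add_left by (rule Henstock_Kurzweil_Integration.integral_add) (auto intro: ip_integrable)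

lemma ip_le: "L2v f \<Longrightarrow> L2v g \<Longrightarrow> ip f g \<le> n2 f * n2 g"
  unfolding ip_def by (rule integral_inner_le)

lemma ip_self: "ip f f = (n2 f)\<^sup>2"
  unfolding ip_def n2_sq by (simp add: power2_norm_eq_inner)

lemma ip_cong: "(\<And>x. x \<in> {-1..1} \<Longrightarrow> f x = f' x) \<Longrightarrow> (\<And>x. x \<in> {-1..1} \<Longrightarrow> g x = g' x) \<Longrightarrow> ip f g = ip f' g'"
  unfolding ip_def by (rule Henstock_Kurzweil_Integration.integral_cong) simp

lemma continuous_on_of_lipschitz:
  fixes F :: "'a::real_normed_vector \<Rightarrow> 'b::real_normed_vector"
  assumes "\<And>w w'. norm (F w - F w') \<le> K * norm (w - w')" "K \<ge> 0"
  shows "continuous_on S F"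
proof -
  have "K-lipschitz_on S F" by (rule lipschitz_onI) (use assms in \<open>auto simp: dist_norm\<close>)
  then show ?thesis by (rule lipschitz_on_continuous_on)
qed

text \<open>The form of the chain rule used below: the derivative of F is expanded in the basis, so
  the composite derivative is a finite sum of continuous functions times L^2 functions.\<close>

lemma chain_rule_L2v:
  fixes F :: "'a::euclidean_space \<Rightarrow> 'b::euclidean_space"
  assumes C: "C_k (Suc 0) F" and y: "L2v y" and u: "\<And>x. x \<in> {-1..1} \<Longrightarrow> u x = u (-1) + prim y x"
  shows "L2v (\<lambda>x. frechet_derivative F (at (u x)) (y x))"
    "\<And>x. x \<in> {-1..1} \<Longrightarrow> F (u x) = F (u (-1)) + prim (\<lambda>x. frechet_derivative F (at (u x)) (y x)) x"
proof -
  let ?D = "\<lambda>w. frechet_derivative F (at w)"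
  have cu: "continuous_on {-1..1} u"
    by (rule continuous_on_eq[OF _ u[symmetric]]) (intro continuous_intros prim_continuous[OF y])
  have cD: "continuous_on {-1..1} (\<lambda>x. ?D (u x) b)" for b
  proof (rule continuous_on_compose2[OF _ cu])
    show "continuous_on UNIV (\<lambda>w. ?D w b)" using C_k_frechet[OF C, of b] by simp
  qed auto
  have ex: "?D w v = (\<Sum>b\<in>Basis. (v \<bullet> b) *\<^sub>R ?D w b)" for w v
  proof -
    interpret bounded_linear "?D w" by (rule has_derivative_bounded_linear[OF C_kE[OF C]])
    have "?D w v = ?D w (\<Sum>b\<in>Basis. (v \<bullet> b) *\<^sub>R b)" by (simp add: euclidean_representation)
    also have "\<dots> = (\<Sum>b\<in>Basis. (v \<bullet> b) *\<^sub>R ?D w b)" by (simp add: sum scaleR)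
    finally show ?thesis .
  qed
  have yb: "L2v (\<lambda>x. y x \<bullet> b)" if "b \<in> Basis" for b
    by (rule L2v_dominated[OF y, where K=1])
       (use Basis_le_norm[OF that] in \<open>auto intro!: borel_measurable_inner L2v_meas[OF y]\<close>)
  have "L2v (\<lambda>x. \<Sum>b\<in>Basis. (y x \<bullet> b) *\<^sub>R ?D (u x) b)"
    by (rule L2v_sum, rule L2v_continuous_mult[OF bounded_bilinear.flip[OF bounded_bilinear_scaleR] cD yb])
  then show L: "L2v (\<lambda>x. ?D (u x) (y x))" by (simp only: ex[symmetric])
  show "F (u x) = F (u (-1)) + prim (\<lambda>x. ?D (u x) (y x)) x" if x: "x \<in> {-1..1}" for x
    unfolding prim_def
    by (rule chain_rule_prim[OF L2v_abs_int[OF y] u C_kE[OF C] C1_equicontinuous_derivative[OF C] L2v_int[OF L] x])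
qed

section \<open>Energy and stability estimates at a fixed time\<close>

locale coeffs =
  fixes A B :: "real^'d \<Rightarrow> real^'d^'d" and G \<gamma> :: "real^'d \<Rightarrow> real^'d" and \<alpha> K :: real
  assumes alpha: "\<alpha> > 0"
    and elliptic: "\<And>w \<xi>. \<xi> \<bullet> (A w *v \<xi>) \<ge> \<alpha> * (norm \<xi>)\<^sup>2"
    and K: "K \<ge> 0"
    and A_lip: "\<And>w w'. norm (A w - A w') \<le> K * norm (w - w')"
    and B_lip: "\<And>w w'. norm (B w - B w') \<le> K * norm (w - w')"
    and G_lip: "\<And>w w'. norm (G w - G w') \<le> K * norm (w - w')"
    and \<gamma>_lip: "\<And>w w'. norm (\<gamma> w - \<gamma> w') \<le> K * norm (w - w')"
    and B_bd: "\<And>w. norm (B w) \<le> K" and G_bd: "\<And>w. norm (G w) \<le> K" and \<gamma>_bd: "\<And>w. norm (\<gamma> w) \<le> K"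
    and G_C1: "C_k (Suc 0) G"
begin

lemma cont_coeffs: "continuous_on S A" "continuous_on S B" "continuous_on S G" "continuous_on S \<gamma>"
  using A_lip B_lip G_lip \<gamma>_lip K by (blast intro: continuous_on_of_lipschitz)+

lemma cont_comp:
  assumes "continuous_on S u"
  shows "continuous_on S (\<lambda>x. A (u x))" "continuous_on S (\<lambda>x. B (u x))"
    "continuous_on S (\<lambda>x. G (u x))" "continuous_on S (\<lambda>x. \<gamma> (u x))"
  by (rule continuous_on_compose2[OF _ assms], rule cont_coeffs[of UNIV], simp)+

lemma coeff_measurable:
  assumes "u \<in> borel_measurable M"
  shows "(\<lambda>x. A (u x)) \<in> borel_measurable M" "(\<lambda>x. B (u x)) \<in> borel_measurable M"
    "(\<lambda>x. G (u x)) \<in> borel_measurable M" "(\<lambda>x. \<gamma> (u x)) \<in> borel_measurable M"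
  by (rule borel_measurable_continuous_on[OF cont_coeffs(1) assms] borel_measurable_continuous_on[OF cont_coeffs(2) assms]
      borel_measurable_continuous_on[OF cont_coeffs(3) assms] borel_measurable_continuous_on[OF cont_coeffs(4) assms])+

lemma L2v_coeffs:
  assumes y: "L2v y"
  shows "\<And>z. L2v z \<Longrightarrow> L2v (\<lambda>x. A (prim y x) *v z x)" "\<And>z. L2v z \<Longrightarrow> L2v (\<lambda>x. B (prim y x) *v z x)"
    "L2v (\<lambda>x. G (prim y x))" "L2v (\<lambda>x. \<gamma> (prim y x))"
  by (rule L2v_continuous_mult[OF bounded_bilinear_matrix_vector cont_comp(1)[OF prim_continuous[OF y]]], assumption)
     (rule L2v_continuous_mult[OF bounded_bilinear_matrix_vector cont_comp(2)[OF prim_continuous[OF y]]], assumption,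
      rule L2v_continuous[OF cont_comp(3)[OF prim_continuous[OF y]]], rule L2v_continuous[OF cont_comp(4)[OF prim_continuous[OF y]]])

definition flux :: "(real \<Rightarrow> real^'d) \<Rightarrow> real \<Rightarrow> real^'d" where
  "flux y x = B (prim y x) *v y x - G (prim y x)"

lemma L2v_flux: "L2v y \<Longrightarrow> L2v (flux y)"
  unfolding flux_def[abs_def] by (intro L2v_diff L2v_coeffs)

text \<open>The weak equation at one time, for u = prim y, u_t = prim eta and the test function
  prim zeta; the term with G is integrated by parts into the flux.\<close>

definition WF :: "(real \<Rightarrow> real^'d) \<Rightarrow> (real \<Rightarrow> real^'d) \<Rightarrow> bool" where
  "WF y \<eta> \<longleftrightarrow> (\<forall>\<zeta>. L2v \<zeta> \<longrightarrow> prim \<zeta> 1 = 0 \<longrightarrow>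
     ip (prim \<eta>) (prim \<zeta>) + ip (\<lambda>x. A (prim y x) *v \<eta> x) \<zeta> =
     ip (flux y) \<zeta> + ip (\<lambda>x. \<gamma> (prim y x)) (prim \<zeta>))"

text \<open>The energy estimate: the test function is u_t itself, that is \<zeta> = \<eta>.
  Ellipticity leaves \<alpha> times the square of n2 \<eta> on the left. Boundedness of B, G and
  \<gamma> makes the right side linear in n2 y, which is what lets Gronwall's inequality reach any
  T. The 10 is 2 from G plus 2 * 4 from \<gamma> paired with prim \<eta>.\<close>

lemma WF_bound:
  assumes y: "L2v y" and e: "L2v \<eta>" "prim \<eta> 1 = 0" and w: "WF y \<eta>"
  shows "n2 \<eta> \<le> 10 * K / \<alpha> * (1 + n2 y)"
proof -
  have pe: "L2v (prim \<eta>)" by (rule prim_L2v[OF e(1)])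
  have ell: "\<alpha> * (n2 \<eta>)\<^sup>2 \<le> ip (\<lambda>x. A (prim y x) *v \<eta> x) \<eta>"
    unfolding n2_sq ip_def integral_mult_right[symmetric]
    by (rule Henstock_Kurzweil_Integration.integral_le)
       (use elliptic e L2v_coeffs(1)[OF y e(1)] in \<open>auto intro!: integrable_on_mult_right L2v_int_sq ip_integrable simp: inner_commute\<close>)
  have "n2 (flux y) \<le> n2 (\<lambda>x. B (prim y x) *v y x) + n2 (\<lambda>x. G (prim y x))"
    unfolding flux_def by (intro n2_diff L2v_coeffs y)
  also have "n2 (\<lambda>x. B (prim y x) *v y x) \<le> K * n2 y"
    by (rule n2_mono[OF L2v_coeffs(2)[OF y y] y K])
       (rule order_trans[OF norm_matrix_vector mult_right_mono[OF B_bd]], simp)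
  also have "n2 (\<lambda>x. G (prim y x)) \<le> 2 * K" by (rule n2_bound[OF L2v_coeffs(3)[OF y] K G_bd])
  finally have f: "n2 (flux y) \<le> K * n2 y + 2 * K" by simp
  have g: "n2 (\<lambda>x. \<gamma> (prim y x)) \<le> 2 * K" by (rule n2_bound[OF L2v_coeffs(4)[OF y] K \<gamma>_bd])
  have "\<alpha> * (n2 \<eta>)\<^sup>2 \<le> ip (prim \<eta>) (prim \<eta>) + ip (\<lambda>x. A (prim y x) *v \<eta> x) \<eta>"
    using ell zero_le_power2[of "n2 (prim \<eta>)"] unfolding ip_self by linarith
  also have "\<dots> = ip (flux y) \<eta> + ip (\<lambda>x. \<gamma> (prim y x)) (prim \<eta>)" using w e by (simp add: WF_def)
  also have "\<dots> \<le> n2 (flux y) * n2 \<eta> + n2 (\<lambda>x. \<gamma> (prim y x)) * n2 (prim \<eta>)"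
    by (intro add_mono ip_le L2v_flux L2v_coeffs prim_L2v y e)
  also have "\<dots> \<le> (K * n2 y + 2 * K) * n2 \<eta> + (2 * K) * (4 * n2 \<eta>)"
    using K by (intro add_mono mult_mono f g prim_n2 e order_refl n2_nonneg) (auto intro!: add_nonneg_nonneg mult_nonneg_nonneg n2_nonneg)
  also have "\<dots> \<le> 10 * K * (1 + n2 y) * n2 \<eta>"
  proof -
    have "0 \<le> K * n2 y * n2 \<eta>" using K n2_nonneg by (intro mult_nonneg_nonneg) auto
    then show ?thesis by (simp add: algebra_simps)
  qed
  finally have "(\<alpha> * n2 \<eta>) * n2 \<eta> \<le> (10 * K * (1 + n2 y)) * n2 \<eta>" by (simp add: power2_eq_square mult.assoc)
  then have "n2 \<eta> > 0 \<Longrightarrow> \<alpha> * n2 \<eta> \<le> 10 * K * (1 + n2 y)" by (rule mult_right_le_imp_le)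
  moreover have "0 \<le> 10 * K / \<alpha> * (1 + n2 y)" using K alpha n2_nonneg[of y] by simp
  ultimately show ?thesis using alpha n2_nonneg[of \<eta>] by (cases "n2 \<eta> = 0") (auto simp: field_simps)
qed

text \<open>Subtract the two equations and test with \<zeta> = \<eta> - \<eta>'. The coefficient
  differences are bounded in the supremum norm by the L^2 distance of y and y', and they multiply
  only the primed functions. Hence the constant involves the norms of y' and \<eta>' alone.\<close>

lemma WF_diff:
  assumes y: "L2v y" "L2v y'" and e: "L2v \<eta>" "prim \<eta> 1 = 0" "L2v \<eta>'" "prim \<eta>' 1 = 0"
    and w: "WF y \<eta>" "WF y' \<eta>'"
  shows "n2 (\<lambda>x. \<eta> x - \<eta>' x) \<le> 21 * K / \<alpha> * (1 + n2 y' + n2 \<eta>') * n2 (\<lambda>x. y x - y' x)"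
proof -
  define \<zeta> where "\<zeta> = (\<lambda>x. \<eta> x - \<eta>' x)"
  define D where "D = n2 (\<lambda>x. y x - y' x)"
  let ?u = "prim y" and ?u' = "prim y'"
  have D0: "D \<ge> 0" by (simp add: D_def n2_nonneg)
  have z: "L2v \<zeta>" unfolding \<zeta>_def by (rule L2v_diff[OF e(1,3)])
  have pz: "prim \<zeta> x = prim \<eta> x - prim \<eta>' x" if "x \<in> {-1..1}" for x unfolding \<zeta>_def by (rule prim_diff[OF e(1,3) that])
  have z1: "prim \<zeta> 1 = 0" using pz[of 1] e by simp
  have pL: "L2v (prim \<zeta>)" by (rule prim_L2v[OF z])
  have uu: "norm (?u x - ?u' x) \<le> 2 * D" if "x \<in> {-1..1}" for x
    using prim_bound[OF L2v_diff[OF y] that] prim_diff[OF y that] by (simp add: D_def)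
  have yy: "L2v (\<lambda>x. y x - y' x)" by (rule L2v_diff[OF y])
  have KD: "0 \<le> K * (2 * D)" using K D0 by simp
  \<comment> \<open>The five errors: \<open>V1\<close> and \<open>V2\<close> split the difference of
    B(u) y, \<open>V3\<close> comes from G, \<open>V4\<close> from A acting on \<eta>',
    \<open>V5\<close> from \<gamma>.\<close>
  define V1 where "V1 = (\<lambda>x. B (?u x) *v (y x - y' x))"
  define V2 where "V2 = (\<lambda>x. (B (?u x) - B (?u' x)) *v y' x)"
  define V3 where "V3 = (\<lambda>x. G (?u x) - G (?u' x))"
  define V4 where "V4 = (\<lambda>x. (A (?u x) - A (?u' x)) *v \<eta>' x)"
  define V5 where "V5 = (\<lambda>x. \<gamma> (?u x) - \<gamma> (?u' x))"
  have cu: "continuous_on {-1..1} ?u" "continuous_on {-1..1} ?u'" using y by (auto intro: prim_continuous)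
  have L: "L2v V1" "L2v V2" "L2v V3" "L2v V4" "L2v V5"
    unfolding V1_def V2_def V3_def V4_def V5_def
    using cu yy y e by (auto intro!: L2v_coeffs L2v_continuous_mult[OF bounded_bilinear_matrix_vector] continuous_on_diff cont_comp L2v_diff)
  have m2: "norm (M *v v) \<le> c * norm v" if "norm M \<le> c" for M :: "real^'d^'d" and v c
    by (rule order_trans[OF norm_matrix_vector mult_right_mono[OF that]]) simp
  have lip: "norm (F (?u x) - F (?u' x)) \<le> K * (2 * D)" if "x \<in> {-1..1}" "\<And>w w'. norm (F w - F w') \<le> K * norm (w - w')"
    for x and F :: "real^'d \<Rightarrow> 'z::real_normed_vector"
    by (rule order_trans[OF that(2) mult_left_mono[OF uu[OF that(1)] K]])
  have nV1: "n2 V1 \<le> K * D" unfolding D_def V1_def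
    by (rule n2_mono[OF _ yy K m2[OF B_bd]]) (rule L(1)[unfolded V1_def])
  have nV2: "n2 V2 \<le> K * (2 * D) * n2 y'" unfolding V2_def
    by (rule n2_mono[OF _ y(2) KD m2[OF lip[OF _ B_lip]]]) (rule L(2)[unfolded V2_def])
  have nV3: "n2 V3 \<le> 2 * (K * (2 * D))" unfolding V3_def
    by (rule n2_bound[OF _ KD lip[OF _ G_lip]]) (rule L(3)[unfolded V3_def])
  have nV4: "n2 V4 \<le> K * (2 * D) * n2 \<eta>'" unfolding V4_def
    by (rule n2_mono[OF _ e(3) KD m2[OF lip[OF _ A_lip]]]) (rule L(4)[unfolded V4_def])
  have nV5: "n2 V5 \<le> 2 * (K * (2 * D))" unfolding V5_def
    by (rule n2_bound[OF _ KD lip[OF _ \<gamma>_lip]]) (rule L(5)[unfolded V5_def])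
  have W1: "ip (prim \<eta>) (prim \<zeta>) + ip (\<lambda>x. A (?u x) *v \<eta> x) \<zeta> = ip (flux y) \<zeta> + ip (\<lambda>x. \<gamma> (?u x)) (prim \<zeta>)"
    using w(1) z z1 by (simp add: WF_def)
  have W2: "ip (prim \<eta>') (prim \<zeta>) + ip (\<lambda>x. A (?u' x) *v \<eta>' x) \<zeta> = ip (flux y') \<zeta> + ip (\<lambda>x. \<gamma> (?u' x)) (prim \<zeta>)"
    using w(2) z z1 by (simp add: WF_def)
  have 1: "ip (prim \<zeta>) (prim \<zeta>) = ip (prim \<eta>) (prim \<zeta>) - ip (prim \<eta>') (prim \<zeta>)"
    using ip_diff_left[OF prim_L2v[OF e(1)] prim_L2v[OF e(3)] pL] ip_cong[OF pz refl] by simp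
  have 2: "ip (\<lambda>x. A (?u x) *v \<eta> x) \<zeta> - ip (\<lambda>x. A (?u' x) *v \<eta>' x) \<zeta> = ip (\<lambda>x. A (?u x) *v \<zeta> x) \<zeta> + ip V4 \<zeta>"
  proof -
    have "ip (\<lambda>x. A (?u x) *v \<eta> x) \<zeta> - ip (\<lambda>x. A (?u' x) *v \<eta>' x) \<zeta> = ip (\<lambda>x. A (?u x) *v \<eta> x - A (?u' x) *v \<eta>' x) \<zeta>"
      by (intro ip_diff_left[symmetric] L2v_coeffs y e z)
    also have "\<dots> = ip (\<lambda>x. A (?u x) *v \<zeta> x + V4 x) \<zeta>"
      by (rule ip_cong) (simp_all add: \<zeta>_def V4_def matrix_vector_mult_diff_distrib matrix_vector_mult_diff_rdistrib)
    also have "\<dots> = ip (\<lambda>x. A (?u x) *v \<zeta> x) \<zeta> + ip V4 \<zeta>" by (intro ip_add_left L2v_coeffs y z L)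
    finally show ?thesis .
  qed
  have 3: "ip (flux y) \<zeta> - ip (flux y') \<zeta> = ip V1 \<zeta> + ip V2 \<zeta> - ip V3 \<zeta>"
  proof -
    have "ip (flux y) \<zeta> - ip (flux y') \<zeta> = ip (\<lambda>x. flux y x - flux y' x) \<zeta>"
      by (intro ip_diff_left[symmetric] L2v_flux y z)
    also have "\<dots> = ip (\<lambda>x. (V1 x + V2 x) - V3 x) \<zeta>"
      by (rule ip_cong) (simp_all add: flux_def V1_def V2_def V3_def matrix_vector_mult_diff_distrib matrix_vector_mult_diff_rdistrib)
    also have "\<dots> = ip V1 \<zeta> + ip V2 \<zeta> - ip V3 \<zeta>"
      using ip_diff_left[OF L2v_add[OF L(1,2)] L(3) z] ip_add_left[OF L(1,2) z] by simp
    finally show ?thesis .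
  qed
  have 4: "ip (\<lambda>x. \<gamma> (?u x)) (prim \<zeta>) - ip (\<lambda>x. \<gamma> (?u' x)) (prim \<zeta>) = ip V5 (prim \<zeta>)"
    unfolding V5_def by (intro ip_diff_left[symmetric] L2v_coeffs y pL)
  have ell: "\<alpha> * (n2 \<zeta>)\<^sup>2 \<le> ip (\<lambda>x. A (?u x) *v \<zeta> x) \<zeta>"
    unfolding n2_sq ip_def integral_mult_right[symmetric]
    by (rule Henstock_Kurzweil_Integration.integral_le)
       (use elliptic z L2v_coeffs(1)[OF y(1) z] in \<open>auto intro!: integrable_on_mult_right L2v_int_sq ip_integrable simp: inner_commute\<close>)
  have "ip (- V4) \<zeta> = - ip V4 \<zeta>" by (simp add: ip_def)
  moreover have "ip (- V3) \<zeta> = - ip V3 \<zeta>" by (simp add: ip_def)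
  moreover have "ip (- V4) \<zeta> \<le> n2 V4 * n2 \<zeta>" "ip (- V3) \<zeta> \<le> n2 V3 * n2 \<zeta>"
    using ip_le[OF L2v_uminus[OF L(4)] z] ip_le[OF L2v_uminus[OF L(3)] z] by (simp_all add: fun_Compl_def n2_minus)
  ultimately have m: "- ip V4 \<zeta> \<le> n2 V4 * n2 \<zeta>" "- ip V3 \<zeta> \<le> n2 V3 * n2 \<zeta>" by auto
  have "\<alpha> * (n2 \<zeta>)\<^sup>2 \<le> ip (prim \<zeta>) (prim \<zeta>) + ip (\<lambda>x. A (?u x) *v \<zeta> x) \<zeta>" using ell zero_le_power2[of "n2 (prim \<zeta>)"] unfolding ip_self by linarith
  also have "\<dots> = ip V1 \<zeta> + ip V2 \<zeta> - ip V3 \<zeta> - ip V4 \<zeta> + ip V5 (prim \<zeta>)" using W1 W2 1 2 3 4 by linarith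
  also have "\<dots> \<le> n2 V1 * n2 \<zeta> + n2 V2 * n2 \<zeta> + n2 V3 * n2 \<zeta> + n2 V4 * n2 \<zeta> + n2 V5 * n2 (prim \<zeta>)"
    using ip_le[OF L(1) z] ip_le[OF L(2) z] m ip_le[OF L(5) pL] by linarith
  also have "\<dots> \<le> (K * D) * n2 \<zeta> + (K * (2 * D) * n2 y') * n2 \<zeta> + (2 * (K * (2 * D))) * n2 \<zeta> + (K * (2 * D) * n2 \<eta>') * n2 \<zeta> + (2 * (K * (2 * D))) * (4 * n2 \<zeta>)"
    using KD by (intro add_mono mult_mono nV1 nV2 nV3 nV4 nV5 prim_n2[OF z] order_refl n2_nonneg) (auto intro: n2_nonneg mult_nonneg_nonneg K D0)
  \<comment> \<open>21 = 1 + 4 + 16 collects V1, V3 and V5, the last one paired with prim \<zeta> at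
    the cost of a factor 4; V2 and V4 enter with factor 2 and the norms of y' and \<eta>'.\<close>
  also have "\<dots> \<le> 21 * K * (1 + n2 y' + n2 \<eta>') * D * n2 \<zeta>"
  proof -
    have "0 \<le> K * D * n2 y' * n2 \<zeta>" "0 \<le> K * D * n2 \<eta>' * n2 \<zeta>" by (simp_all add: K D0 n2_nonneg)
    then show ?thesis by (simp add: algebra_simps)
  qed
  finally have "(\<alpha> * n2 \<zeta>) * n2 \<zeta> \<le> (21 * K * (1 + n2 y' + n2 \<eta>') * D) * n2 \<zeta>" by (simp add: power2_eq_square mult.assoc)
  then have "n2 \<zeta> > 0 \<Longrightarrow> \<alpha> * n2 \<zeta> \<le> 21 * K * (1 + n2 y' + n2 \<eta>') * D" by (rule mult_right_le_imp_le)
  moreover have "0 \<le> 21 * K / \<alpha> * (1 + n2 y' + n2 \<eta>') * D"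
    using K alpha D0 n2_nonneg[of y'] n2_nonneg[of \<eta>'] by (intro mult_nonneg_nonneg) auto
  ultimately have "n2 \<zeta> \<le> 21 * K / \<alpha> * (1 + n2 y' + n2 \<eta>') * D"
    using alpha n2_nonneg[of \<zeta>] by (cases "n2 \<zeta> = 0") (auto simp: field_simps)
  then show ?thesis by (simp add: \<zeta>_def D_def)
qed

section \<open>The weak problem expressed through derivatives\<close>

lemma aform_rep:
  assumes u: "u \<in> borel_measurable Om" "rep u y" and p: "\<phi> \<in> borel_measurable Om" "rep \<phi> \<eta>"
    and v: "v \<in> borel_measurable Om" "rep v \<zeta>"
  shows "aform A u \<phi> v = ip (prim \<eta>) (prim \<zeta>) + ip (\<lambda>x. A (prim y x) *v \<eta> x) \<zeta>"
proof -
  note d1 = vderiv1_AE[OF rep_L2v[OF p(2)] p(1) rep_nth_AE[OF p(2)]]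
  note d2 = vderiv1_AE[OF rep_L2v[OF v(2)] v(1) rep_nth_AE[OF v(2)]]
  have "ip0 \<phi> v = ip (prim \<eta>) (prim \<zeta>)"
    unfolding ip_def by (intro ip0_AE p(1) v(1) prim_L2v rep_L2v[OF p(2)] rep_L2v[OF v(2)] rep_AE p(2) v(2))
  moreover have "(LINT x|Om. (A (u x) *v vderiv 1 \<phi> x) \<bullet> vderiv 1 v x) = ip (\<lambda>x. A (prim y x) *v \<eta> x) \<zeta>"
    unfolding ip_def
  proof (rule LINT_AE_eq)
    show "(\<lambda>x. (A (u x) *v vderiv 1 \<phi> x) \<bullet> vderiv 1 v x) \<in> borel_measurable Om"
      by (intro borel_measurable_inner bilinear_measurable[OF bounded_bilinear_matrix_vector] coeff_measurable u d1 d2)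
    show "(\<lambda>x. (A (prim y x) *v \<eta> x) \<bullet> \<zeta> x) absolutely_integrable_on {-1..1}"
      by (intro L2v_bilinear_integrable[OF bounded_bilinear_inner] L2v_coeffs rep_L2v[OF u(2)] rep_L2v[OF p(2)] rep_L2v[OF v(2)])
    show "AE x in Om. (A (u x) *v vderiv 1 \<phi> x) \<bullet> vderiv 1 v x = (A (prim y x) *v \<eta> x) \<bullet> \<zeta> x"
      using rep_AE[OF u(2)] d1(2) d2(2) by eventually_elim simp
  qed
  ultimately show ?thesis by (simp add: aform_def)
qed

lemma bform_rep:
  assumes u: "u \<in> borel_measurable Om" "rep u y" and v: "v \<in> borel_measurable Om" "rep v \<zeta>"
  shows "bform B G \<gamma> u u v = ip (flux y) \<zeta> + ip (\<lambda>x. \<gamma> (prim y x)) (prim \<zeta>)"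
proof -
  note y = rep_L2v[OF u(2)] and z = rep_L2v[OF v(2)]
  note d1 = vderiv1_AE[OF y u(1) rep_nth_AE[OF u(2)]]
  note d2 = vderiv1_AE[OF z v(1) rep_nth_AE[OF v(2)]]
  have 1: "(LINT x|Om. (B (u x) *v vderiv 1 u x) \<bullet> vderiv 1 v x) = ip (\<lambda>x. B (prim y x) *v y x) \<zeta>"
    unfolding ip_def
  proof (rule LINT_AE_eq)
    show "(\<lambda>x. (B (u x) *v vderiv 1 u x) \<bullet> vderiv 1 v x) \<in> borel_measurable Om"
      by (intro borel_measurable_inner bilinear_measurable[OF bounded_bilinear_matrix_vector] coeff_measurable u d1 d2)
    show "(\<lambda>x. (B (prim y x) *v y x) \<bullet> \<zeta> x) absolutely_integrable_on {-1..1}"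
      by (intro L2v_bilinear_integrable[OF bounded_bilinear_inner] L2v_coeffs y z)
    show "AE x in Om. (B (u x) *v vderiv 1 u x) \<bullet> vderiv 1 v x = (B (prim y x) *v y x) \<bullet> \<zeta> x"
      using rep_AE[OF u(2)] d1(2) d2(2) by eventually_elim simp
  qed
  define g where "g = (\<lambda>x. frechet_derivative G (at (prim y x)) (y x))"
  have g: "L2v g" "\<And>x. x \<in> {-1..1} \<Longrightarrow> G (prim y x) = G (prim y (-1)) + prim g x"
    unfolding g_def by (rule chain_rule_L2v[OF G_C1 y], simp)+
  have 2: "ip0 (vderiv 1 (\<lambda>x. G (u x))) v = - ip (\<lambda>x. G (prim y x)) \<zeta>"
  proof -
    have "AE x in Om. G (u x) $ i = G (prim y (-1)) $ i + prim (\<lambda>x. g x $ i) x" for i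
      using rep_AE[OF u(2)] AE_space
    proof eventually_elim
      case (elim x)
      then have "x \<in> {-1..1}" by (auto simp: space_restrict_space)
      then show ?case using elim g(2)[of x] prim_nth[OF g(1), of x i] by simp
    qed
    note d = vderiv1_AE[OF g(1) coeff_measurable(3)[OF u(1)] this]
    have "ip0 (vderiv 1 (\<lambda>x. G (u x))) v = integral {-1..1} (\<lambda>x. g x \<bullet> prim \<zeta> x)"
      by (rule ip0_AE[OF d(1) v(1) g(1) prim_L2v[OF z] d(2) rep_AE[OF v(2)]])
    moreover have "integral {-1..1} (\<lambda>x. G (prim y x) \<bullet> \<zeta> x) = - integral {-1..1} (\<lambda>x. g x \<bullet> prim \<zeta> x)"
      by (rule integral_by_parts_prim[OF bounded_bilinear_inner g(1) z g(2)]) (simp_all add: rep_prim1[OF v(2)])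
    ultimately show ?thesis by (simp add: ip_def)
  qed
  have 3: "ip0 (\<lambda>x. \<gamma> (u x)) v = ip (\<lambda>x. \<gamma> (prim y x)) (prim \<zeta>)"
    unfolding ip_def
    by (rule ip0_AE[OF coeff_measurable(4)[OF u(1)] v(1) L2v_coeffs(4)[OF y] prim_L2v[OF z] _ rep_AE[OF v(2)]])
       (use rep_AE[OF u(2)] in \<open>auto elim!: AE_mp\<close>)
  have "ip (flux y) \<zeta> = ip (\<lambda>x. B (prim y x) *v y x) \<zeta> - ip (\<lambda>x. G (prim y x)) \<zeta>"
    unfolding flux_def[abs_def] by (intro ip_diff_left L2v_coeffs y z)
  then show ?thesis using 1 2 3 by (simp add: bform_def)
qed

text \<open>Up to null sets the test functions in X_0^1 are exactly the primitives of mean zero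
  \<zeta>, and both forms see them only almost everywhere.\<close>

lemma weak_form_iff:
  assumes u: "u \<in> borel_measurable Om" "rep u y" and p: "\<phi> \<in> borel_measurable Om" "rep \<phi> \<eta>"
  shows "(\<forall>v\<in>X0 1. aform A u \<phi> v = bform B G \<gamma> u u v) \<longleftrightarrow> WF y \<eta>"
proof
  assume a: "\<forall>v\<in>X0 1. aform A u \<phi> v = bform B G \<gamma> u u v"
  show "WF y \<eta>" unfolding WF_def
  proof (intro allI impI)
    fix \<zeta> :: "real \<Rightarrow> real^'d" assume z: "L2v \<zeta>" "prim \<zeta> 1 = 0"
    have "prim \<zeta> \<in> X0 1" by (rule prim_X01[OF z])
    then show "ip (prim \<eta>) (prim \<zeta>) + ip (\<lambda>x. A (prim y x) *v \<eta> x) \<zeta> = ip (flux y) \<zeta> + ip (\<lambda>x. \<gamma> (prim y x)) (prim \<zeta>)"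
      using a aform_rep[OF u p X01_measurable rep_prim[OF z]] bform_rep[OF u X01_measurable rep_prim[OF z]] by metis
  qed
next
  assume w: "WF y \<eta>"
  show "\<forall>v\<in>X0 1. aform A u \<phi> v = bform B G \<gamma> u u v"
  proof
    fix v :: "real \<Rightarrow> real^'d" assume v: "v \<in> X0 1"
    obtain \<zeta> where z: "rep v \<zeta>" using X01_rep[OF v] .
    show "aform A u \<phi> v = bform B G \<gamma> u u v"
      using w rep_L2v[OF z] rep_prim1[OF z] aform_rep[OF u p X01_measurable[OF v] z] bform_rep[OF u X01_measurable[OF v] z]
      by (simp add: WF_def)
  qed
qed

text \<open>The weak problem transported to y = u_x. As in \<open>weak_solution\<close>, \<eta> is
  constrained only for t > 0, while y is continuous in norm on all of [0,T].\<close>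

definition sol :: "real \<Rightarrow> (real \<Rightarrow> real \<Rightarrow> real^'d) \<Rightarrow> (real \<Rightarrow> real \<Rightarrow> real^'d) \<Rightarrow> bool" where
  "sol T y \<eta> \<longleftrightarrow> (\<forall>t\<in>{0..T}. L2v (y t) \<and> prim (y t) 1 = 0 \<and>
       ((\<lambda>s. n2 (\<lambda>x. y s x - y t x)) \<longlongrightarrow> 0) (at t within {0..T})) \<and>
     (\<forall>t\<in>{0<..T}. L2v (\<eta> t) \<and> prim (\<eta> t) 1 = 0 \<and> WF (y t) (\<eta> t) \<and>
       ((\<lambda>s. n2 (\<lambda>x. (1 / (s - t)) *\<^sub>R (y s x - y t x) - \<eta> t x)) \<longlongrightarrow> 0) (at t within {0..T}))"

lemma tendsto_0_equiv:
  fixes f g :: "real \<Rightarrow> real"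
  assumes "\<And>s. s \<in> S \<Longrightarrow> 0 \<le> f s \<and> f s \<le> g s \<and> g s \<le> c * f s"
  shows "(g \<longlongrightarrow> 0) (at t within S) \<longleftrightarrow> (f \<longlongrightarrow> 0) (at t within S)"
proof
  assume g: "(g \<longlongrightarrow> 0) (at t within S)"
  show "(f \<longlongrightarrow> 0) (at t within S)"
    by (rule Lim_null_comparison[OF _ g]) (use assms in \<open>auto simp: eventually_at_filter\<close>)
next
  assume f: "(f \<longlongrightarrow> 0) (at t within S)"
  then have "((\<lambda>s. c * f s) \<longlongrightarrow> 0) (at t within S)" by (rule tendsto_mult_right_zero)
  then show "(g \<longlongrightarrow> 0) (at t within S)"
  proof (rule Lim_null_comparison[rotated])
    have "norm (g s) \<le> c * f s" if "s \<in> S" for s using assms[OF that] by simp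
    then show "\<forall>\<^sub>F s in at t within S. norm (g s) \<le> c * f s" by (simp add: eventually_at_filter)
  qed
qed

lemma weak_solution_iff:
  assumes ux: "\<And>t. t \<in> {0..T} \<Longrightarrow> u t \<in> X0 1 \<and> rep (u t) (y t)"
    and utx: "\<And>t. t \<in> {0<..T} \<Longrightarrow> ut t \<in> X0 1 \<and> rep (ut t) (\<eta> t)"
  shows "weak_solution T A B G \<gamma> u0 u ut \<longleftrightarrow> (AE x in Om. u 0 x = u0 x) \<and> sol T y \<eta>"
proof -
  have m: "u t \<in> borel_measurable Om" if "t \<in> {0..T}" for t using ux[OF that] X01_measurable by blast
  have mt: "ut t \<in> borel_measurable Om" if "t \<in> {0<..T}" for t using utx[OF that] X01_measurable by blast
  have 1: "((\<lambda>s. Xnorm 1 (\<lambda>x. u s x - u t x)) \<longlongrightarrow> 0) (at t within {0..T}) \<longleftrightarrow>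
      ((\<lambda>s. n2 (\<lambda>x. y s x - y t x)) \<longlongrightarrow> 0) (at t within {0..T})" if t: "t \<in> {0..T}" for t
  proof (rule tendsto_0_equiv[where c=5])
    fix s assume s: "s \<in> {0..T}"
    have r: "rep (\<lambda>x. u s x - u t x) (\<lambda>x. y s x - y t x)" using ux[OF s] ux[OF t] rep_diff by blast
    have "(\<lambda>x. u s x - u t x) \<in> borel_measurable Om" by (intro borel_measurable_diff m s t)
    from Xnorm1_bounds[OF this r] n2_nonneg show "0 \<le> n2 (\<lambda>x. y s x - y t x) \<and> n2 (\<lambda>x. y s x - y t x) \<le> Xnorm 1 (\<lambda>x. u s x - u t x) \<and> Xnorm 1 (\<lambda>x. u s x - u t x) \<le> 5 * n2 (\<lambda>x. y s x - y t x)"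
      by auto
  qed
  have 2: "((\<lambda>s. Xnorm 1 (\<lambda>x. (1 / (s - t)) *\<^sub>R (u s x - u t x) - ut t x)) \<longlongrightarrow> 0) (at t within {0..T}) \<longleftrightarrow>
      ((\<lambda>s. n2 (\<lambda>x. (1 / (s - t)) *\<^sub>R (y s x - y t x) - \<eta> t x)) \<longlongrightarrow> 0) (at t within {0..T})" if t: "t \<in> {0<..T}" for t
  proof (rule tendsto_0_equiv[where c=5])
    fix s assume s: "s \<in> {0..T}"
    have t': "t \<in> {0..T}" using t by auto
    have r: "rep (\<lambda>x. (1 / (s - t)) *\<^sub>R (u s x - u t x) - ut t x) (\<lambda>x. (1 / (s - t)) *\<^sub>R (y s x - y t x) - \<eta> t x)"
      using ux[OF s] ux[OF t'] utx[OF t] rep_diff rep_scaleR by blast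
    have "(\<lambda>x. (1 / (s - t)) *\<^sub>R (u s x - u t x) - ut t x) \<in> borel_measurable Om"
      by (intro borel_measurable_diff borel_measurable_scaleR borel_measurable_const m mt s t t')
    from Xnorm1_bounds[OF this r] n2_nonneg
    show "0 \<le> n2 (\<lambda>x. (1 / (s - t)) *\<^sub>R (y s x - y t x) - \<eta> t x) \<and> n2 (\<lambda>x. (1 / (s - t)) *\<^sub>R (y s x - y t x) - \<eta> t x) \<le> Xnorm 1 (\<lambda>x. (1 / (s - t)) *\<^sub>R (u s x - u t x) - ut t x) \<and> Xnorm 1 (\<lambda>x. (1 / (s - t)) *\<^sub>R (u s x - u t x) - ut t x) \<le> 5 * n2 (\<lambda>x. (1 / (s - t)) *\<^sub>R (y s x - y t x) - \<eta> t x)"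
      by auto
  qed
  have 3: "(\<forall>v\<in>X0 1. aform A (u t) (ut t) v = bform B G \<gamma> (u t) (u t) v) \<longleftrightarrow> WF (y t) (\<eta> t)" if t: "t \<in> {0<..T}" for t
  proof -
    have t': "t \<in> {0..T}" using t by auto
    show ?thesis using weak_form_iff[OF m[OF t'] _ mt[OF t]] ux[OF t'] utx[OF t] by blast
  qed
  have "C_X01 T u \<longleftrightarrow> (\<forall>t\<in>{0..T}. L2v (y t) \<and> prim (y t) 1 = 0 \<and> ((\<lambda>s. n2 (\<lambda>x. y s x - y t x)) \<longlongrightarrow> 0) (at t within {0..T}))"
    unfolding C_X01_def using ux 1 by (auto simp: rep_def)
  moreover have "(time_deriv T u ut \<and> (\<forall>t\<in>{0<..T}. \<forall>v\<in>X0 1. aform A (u t) (ut t) v = bform B G \<gamma> (u t) (u t) v)) \<longleftrightarrow>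
     (\<forall>t\<in>{0<..T}. L2v (\<eta> t) \<and> prim (\<eta> t) 1 = 0 \<and> WF (y t) (\<eta> t) \<and>
       ((\<lambda>s. n2 (\<lambda>x. (1 / (s - t)) *\<^sub>R (y s x - y t x) - \<eta> t x)) \<longlongrightarrow> 0) (at t within {0..T}))"
    unfolding time_deriv_def using utx 2 3 by (auto simp: rep_def)
  ultimately show ?thesis unfolding weak_solution_def sol_def by blast
qed

lemma weak_solution_rep:
  assumes w: "weak_solution T A B G \<gamma> u0 u ut"
  obtains y \<eta> where "sol T y \<eta>" "AE x in Om. u 0 x = u0 x"
    "\<And>t. t \<in> {0..T} \<Longrightarrow> u t \<in> X0 1 \<and> rep (u t) (y t)"
    "\<And>t. t \<in> {0<..T} \<Longrightarrow> ut t \<in> X0 1 \<and> rep (ut t) (\<eta> t)"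
proof -
  have x: "u t \<in> X0 1" if "t \<in> {0..T}" for t using w that by (auto simp: weak_solution_def C_X01_def)
  have xt: "ut t \<in> X0 1" if "t \<in> {0<..T}" for t using w that by (auto simp: weak_solution_def time_deriv_def)
  have "\<forall>t. \<exists>y. t \<in> {0..T} \<longrightarrow> rep (u t) y" using X01_rep x by metis
  then obtain y where y: "\<And>t. t \<in> {0..T} \<Longrightarrow> rep (u t) (y t)" by metis
  have "\<forall>t. \<exists>y. t \<in> {0<..T} \<longrightarrow> rep (ut t) y" using X01_rep xt by metis
  then obtain \<eta> where e: "\<And>t. t \<in> {0<..T} \<Longrightarrow> rep (ut t) (\<eta> t)" by metis
  have "(AE x in Om. u 0 x = u0 x) \<and> sol T y \<eta>"
    using weak_solution_iff[of T u y ut \<eta> u0] x xt y e w by blast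
  then show ?thesis using that x xt y e by blast
qed

lemma sol_weak_solution:
  assumes s: "sol T y \<eta>" and u0: "AE x in Om. prim (y 0) x = u0 x"
  shows "weak_solution T A B G \<gamma> u0 (\<lambda>t. prim (y t)) (\<lambda>t. prim (\<eta> t))"
proof (subst weak_solution_iff)
  show "prim (y t) \<in> X0 1 \<and> rep (prim (y t)) (y t)" if "t \<in> {0..T}" for t
    using s that by (intro conjI prim_X01 rep_prim) (auto simp: sol_def)
  show "prim (\<eta> t) \<in> X0 1 \<and> rep (prim (\<eta> t)) (\<eta> t)" if "t \<in> {0<..T}" for t
    using s that by (intro conjI prim_X01 rep_prim) (auto simp: sol_def)
qed (use s u0 in auto)

end

text \<open>Norm convergence of the difference quotients gives no derivative of n2 (y t), but it
  does give the increment bound that \<open>dini_gronwall\<close> asks for.\<close>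

lemma n2_increment:
  fixes y :: "real \<Rightarrow> real \<Rightarrow> 'a::euclidean_space"
  assumes L: "\<And>s. s \<in> {0..T} \<Longrightarrow> L2v (y s)" and e: "L2v \<eta>" and t: "t \<in> {0..T}" and eps: "\<epsilon> > 0"
    and lim: "((\<lambda>s. n2 (\<lambda>x. (1 / (s - t)) *\<^sub>R (y s x - y t x) - \<eta> x)) \<longlongrightarrow> 0) (at t within {0..T})"
  shows "\<forall>\<^sub>F s in at t within {0..T}. n2 (y t) \<le> n2 (y s) + (n2 \<eta> + \<epsilon>) * \<bar>s - t\<bar>"
proof -
  have ev: "\<forall>\<^sub>F s in at t within {0..T}. s \<in> {0..T} \<and> s \<noteq> t" by (auto simp: eventually_at_filter)
  have "\<forall>\<^sub>F s in at t within {0..T}. n2 (\<lambda>x. (1 / (s - t)) *\<^sub>R (y s x - y t x) - \<eta> x) < \<epsilon>"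
    using order_tendstoD(2)[OF lim eps] .
  then show ?thesis using ev
  proof eventually_elim
    case (elim s)
    have d: "L2v (\<lambda>x. (1 / (s - t)) *\<^sub>R (y s x - y t x))" using elim by (intro L2v_scaleR L2v_diff L t) auto
    have "n2 (\<lambda>x. y s x - y t x) = \<bar>s - t\<bar> * n2 (\<lambda>x. (1 / (s - t)) *\<^sub>R (y s x - y t x))"
      using elim by (simp add: n2_scaleR)
    also have "\<dots> \<le> \<bar>s - t\<bar> * (n2 \<eta> + \<epsilon>)"
      using n2_triangle[OF d e] elim by (intro mult_left_mono) auto
    finally have "n2 (\<lambda>x. y s x - y t x) \<le> (n2 \<eta> + \<epsilon>) * \<bar>s - t\<bar>" by (simp add: mult.commute)
    then show ?case using n2_triangle[OF L[OF t] L[of s]] n2_commute[of "y t" "y s"] elim by simp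
  qed
qed

lemma n2_continuous:
  fixes y :: "real \<Rightarrow> real \<Rightarrow> 'a::euclidean_space"
  assumes L: "\<And>s. s \<in> S \<Longrightarrow> L2v (y s)"
    and c: "\<And>t. t \<in> S \<Longrightarrow> ((\<lambda>s. n2 (\<lambda>x. y s x - y t x)) \<longlongrightarrow> 0) (at t within S)"
  shows "continuous_on S (\<lambda>t. n2 (y t))"
  unfolding continuous_on_def
proof
  fix t assume t: "t \<in> S"
  have "((\<lambda>s. n2 (y s) - n2 (y t)) \<longlongrightarrow> 0) (at t within S)"
    by (rule Lim_null_comparison[OF _ c[OF t]])
       (use n2_triangle_abs[OF L L[OF t]] in \<open>auto simp: eventually_at_filter\<close>)
  then show "((\<lambda>s. n2 (y s)) \<longlongrightarrow> n2 (y t)) (at t within S)" by (rule LIM_zero_cancel)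
qed

section \<open>Growth, stability and time continuity of solutions\<close>

context coeffs
begin

definition E where "E = 10 * K / \<alpha>"

lemma E_nonneg: "E \<ge> 0" using K alpha by (simp add: E_def)

text \<open>What Gronwall's inequality gives for n2 (y t) up to time T from n2 (y 0) \<le> \<rho>,
  as the energy estimate bounds n2 \<eta> by E (1 + n2 y).\<close>

definition growth :: "real \<Rightarrow> real \<Rightarrow> real" where "growth T \<rho> = (\<rho> + E * T) * exp (E * T)"

lemma sol_eta_bound: "sol T y \<eta> \<Longrightarrow> t \<in> {0<..T} \<Longrightarrow> n2 (\<eta> t) \<le> E * (1 + n2 (y t))"
  unfolding E_def by (rule WF_bound) (auto simp: sol_def)

lemma sol_bound:
  assumes s: "sol T y \<eta>" and t: "t \<in> {0..T}"
  shows "n2 (y t) \<le> growth T (n2 (y 0))"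
proof -
  have "n2 (y t) \<le> (n2 (y 0) + E * t) * exp (E * t)"
  proof (rule dini_gronwall[where N="\<lambda>t. n2 (y t)" and T=T])
    show "continuous_on {0..T} (\<lambda>t. n2 (y t))"
      by (rule n2_continuous) (use s in \<open>auto simp: sol_def\<close>)
    fix t \<epsilon> :: real assume t: "0 < t" "t \<le> T" "\<epsilon> > 0"
    have "\<forall>\<^sub>F s in at t within {0..T}. n2 (y t) \<le> n2 (y s) + (n2 (\<eta> t) + \<epsilon>) * \<bar>s - t\<bar>"
      by (rule n2_increment) (use s t in \<open>auto simp: sol_def\<close>)
    then show "\<forall>\<^sub>F s in at t within {0..T}. n2 (y t) \<le> n2 (y s) + (E * n2 (y t) + E + \<epsilon>) * \<bar>s - t\<bar>"
    proof eventually_elim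
      case (elim s')
      have "(n2 (\<eta> t) + \<epsilon>) * \<bar>s' - t\<bar> \<le> (E * n2 (y t) + E + \<epsilon>) * \<bar>s' - t\<bar>"
        by (rule mult_right_mono) (use sol_eta_bound[OF s, of t] t in \<open>auto simp: algebra_simps\<close>)
      then show ?case using elim by linarith
    qed
  qed (use E_nonneg t n2_nonneg in auto)
  also have "\<dots> \<le> growth T (n2 (y 0))"
    unfolding growth_def using t E_nonneg n2_nonneg[of "y 0"]
    by (intro mult_mono add_mono) (auto intro: mult_left_mono)
  finally show ?thesis .
qed

text \<open>The Lipschitz constant of y \<mapsto> \<eta> at points with n2 y' \<le> \<rho>: the
  factor of \<open>WF_diff\<close> with n2 \<eta>' replaced by its energy bound. Only one of the two
  functions compared has to lie in the ball.\<close>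

definition stab :: "real \<Rightarrow> real" where "stab \<rho> = 21 * K / \<alpha> * (1 + \<rho> + E * (1 + \<rho>))"

lemma stab_nonneg: "\<rho> \<ge> 0 \<Longrightarrow> stab \<rho> \<ge> 0"
  using K alpha E_nonneg by (simp add: stab_def)

lemma WF_stab:
  assumes y: "L2v y" "L2v y'" and e: "L2v \<eta>" "prim \<eta> 1 = 0" "L2v \<eta>'" "prim \<eta>' 1 = 0"
    and w: "WF y \<eta>" "WF y' \<eta>'" and r: "n2 y' \<le> \<rho>"
  shows "n2 (\<lambda>x. \<eta> x - \<eta>' x) \<le> stab \<rho> * n2 (\<lambda>x. y x - y' x)"
proof -
  have "n2 \<eta>' \<le> E * (1 + n2 y')" unfolding E_def by (rule WF_bound[OF y(2) e(3,4) w(2)])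
  also have "\<dots> \<le> E * (1 + \<rho>)" using r E_nonneg by (intro mult_left_mono) auto
  finally have "21 * K / \<alpha> * (1 + n2 y' + n2 \<eta>') \<le> stab \<rho>"
    unfolding stab_def using r K alpha by (intro mult_left_mono) auto
  then have "21 * K / \<alpha> * (1 + n2 y' + n2 \<eta>') * n2 (\<lambda>x. y x - y' x) \<le> stab \<rho> * n2 (\<lambda>x. y x - y' x)"
    by (intro mult_right_mono n2_nonneg)
  then show ?thesis using WF_diff[OF y e w] by linarith
qed

text \<open>Continuity of u_t in time is inherited from that of u through \<open>WF_stab\<close>. It
  is what makes the norm of u_t a measurable function of time in the essential supremum.\<close>

lemma sol_eta_continuous:
  assumes s: "sol T y \<eta>" and t: "t \<in> {0<..T}"
  shows "((\<lambda>s. n2 (\<lambda>x. \<eta> s x - \<eta> t x)) \<longlongrightarrow> 0) (at t within {0<..T})"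
proof -
  define C where "C = stab (n2 (y t))"
  have "((\<lambda>s. n2 (\<lambda>x. y s x - y t x)) \<longlongrightarrow> 0) (at t within {0..T})"
    using s t by (auto simp: sol_def)
  then have "((\<lambda>s. n2 (\<lambda>x. y s x - y t x)) \<longlongrightarrow> 0) (at t within {0<..T})"
    by (rule tendsto_within_subset) auto
  then have lim: "((\<lambda>s. C * n2 (\<lambda>x. y s x - y t x)) \<longlongrightarrow> 0) (at t within {0<..T})" by (rule tendsto_mult_right_zero)
  have "\<forall>\<^sub>F s' in at t within {0<..T}. norm (n2 (\<lambda>x. \<eta> s' x - \<eta> t x)) \<le> C * n2 (\<lambda>x. y s' x - y t x)"
    unfolding eventually_at_filter
  proof (intro always_eventually allI impI)
    fix s' assume "s' \<noteq> t" "s' \<in> {0<..T}"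
    then have "n2 (\<lambda>x. \<eta> s' x - \<eta> t x) \<le> C * n2 (\<lambda>x. y s' x - y t x)"
      unfolding C_def by (intro WF_stab) (use s t in \<open>auto simp: sol_def\<close>)
    then show "norm (n2 (\<lambda>x. \<eta> s' x - \<eta> t x)) \<le> C * n2 (\<lambda>x. y s' x - y t x)" by (simp add: n2_nonneg)
  qed
  then show ?thesis by (rule Lim_null_comparison[OF _ lim])
qed

text \<open>Gronwall's inequality for the difference, with the rate taken from y' alone. This
  asymmetry lets continuous dependence choose its \<delta> from one initial value.\<close>

lemma sol_diff:
  assumes s: "sol T y \<eta>" and s': "sol T y' \<eta>'" and t: "t \<in> {0..T}"
  shows "n2 (\<lambda>x. y t x - y' t x) \<le> n2 (\<lambda>x. y 0 x - y' 0 x) * exp (stab (growth T (n2 (y' 0))) * t)"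
proof -
  define C where "C = stab (growth T (n2 (y' 0)))"
  have g0: "growth T (n2 (y' 0)) \<ge> 0" using n2_nonneg order_trans sol_bound[OF s' t] by blast
  have C: "C \<ge> 0" unfolding C_def by (rule stab_nonneg[OF g0])
  have Ly: "L2v (y t)" "L2v (y' t)" if "t \<in> {0..T}" for t using s s' that by (auto simp: sol_def)
  have Le: "L2v (\<eta> t)" "L2v (\<eta>' t)" if "t \<in> {0<..T}" for t using s s' that by (auto simp: sol_def)
  have "n2 (\<lambda>x. y t x - y' t x) \<le> (n2 (\<lambda>x. y 0 x - y' 0 x) + 0 * t) * exp (C * t)"
  proof (rule dini_gronwall[where N="\<lambda>t. n2 (\<lambda>x. y t x - y' t x)" and T=T])
    show "continuous_on {0..T} (\<lambda>t. n2 (\<lambda>x. y t x - y' t x))"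
    proof (rule n2_continuous)
      fix t assume t: "t \<in> {0..T}"
      have "((\<lambda>s. n2 (\<lambda>x. y s x - y t x) + n2 (\<lambda>x. y' s x - y' t x)) \<longlongrightarrow> 0 + 0) (at t within {0..T})"
        using s s' t by (intro tendsto_add) (auto simp: sol_def)
      then have lim: "((\<lambda>s. n2 (\<lambda>x. y s x - y t x) + n2 (\<lambda>x. y' s x - y' t x)) \<longlongrightarrow> 0) (at t within {0..T})" by simp
      have "\<forall>\<^sub>F s in at t within {0..T}. norm (n2 (\<lambda>x. y s x - y' s x - (y t x - y' t x))) \<le> n2 (\<lambda>x. y s x - y t x) + n2 (\<lambda>x. y' s x - y' t x)"
        unfolding eventually_at_filter
      proof (intro always_eventually allI impI)
        fix r assume "r \<in> {0..T}"
        then have "n2 (\<lambda>x. (y r x - y t x) - (y' r x - y' t x)) \<le> n2 (\<lambda>x. y r x - y t x) + n2 (\<lambda>x. y' r x - y' t x)"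
          by (intro n2_diff L2v_diff Ly t)
        moreover have "(\<lambda>x. (y r x - y t x) - (y' r x - y' t x)) = (\<lambda>x. y r x - y' r x - (y t x - y' t x))" by (simp add: algebra_simps)
        ultimately show "norm (n2 (\<lambda>x. y r x - y' r x - (y t x - y' t x))) \<le> n2 (\<lambda>x. y r x - y t x) + n2 (\<lambda>x. y' r x - y' t x)"
          by (simp add: n2_nonneg)
      qed
      then show "((\<lambda>s. n2 (\<lambda>x. y s x - y' s x - (y t x - y' t x))) \<longlongrightarrow> 0) (at t within {0..T})"
        by (rule Lim_null_comparison[OF _ lim])
    qed (intro L2v_diff Ly)
    fix t \<epsilon> :: real assume t: "0 < t" "t \<le> T" "\<epsilon> > 0"
    then have t1: "t \<in> {0..T}" and t2: "t \<in> {0<..T}" by auto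
    have "\<forall>\<^sub>F s in at t within {0..T}. n2 (\<lambda>x. y t x - y' t x) \<le> n2 (\<lambda>x. y s x - y' s x) + (n2 (\<lambda>x. \<eta> t x - \<eta>' t x) + \<epsilon>) * \<bar>s - t\<bar>"
    proof (rule n2_increment[where y="\<lambda>s x. y s x - y' s x"])
      have "((\<lambda>s. n2 (\<lambda>x. (1 / (s - t)) *\<^sub>R (y s x - y t x) - \<eta> t x) + n2 (\<lambda>x. (1 / (s - t)) *\<^sub>R (y' s x - y' t x) - \<eta>' t x)) \<longlongrightarrow> 0 + 0) (at t within {0..T})"
        using s s' t2 by (intro tendsto_add) (auto simp: sol_def)
      then have lim: "((\<lambda>s. n2 (\<lambda>x. (1 / (s - t)) *\<^sub>R (y s x - y t x) - \<eta> t x) + n2 (\<lambda>x. (1 / (s - t)) *\<^sub>R (y' s x - y' t x) - \<eta>' t x)) \<longlongrightarrow> 0) (at t within {0..T})" by simp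
      have "\<forall>\<^sub>F s in at t within {0..T}. norm (n2 (\<lambda>x. (1 / (s - t)) *\<^sub>R (y s x - y' s x - (y t x - y' t x)) - (\<eta> t x - \<eta>' t x)))
         \<le> n2 (\<lambda>x. (1 / (s - t)) *\<^sub>R (y s x - y t x) - \<eta> t x) + n2 (\<lambda>x. (1 / (s - t)) *\<^sub>R (y' s x - y' t x) - \<eta>' t x)"
        unfolding eventually_at_filter
      proof (intro always_eventually allI impI)
        fix r assume "r \<in> {0..T}"
        then have "n2 (\<lambda>x. ((1 / (r - t)) *\<^sub>R (y r x - y t x) - \<eta> t x) - ((1 / (r - t)) *\<^sub>R (y' r x - y' t x) - \<eta>' t x)) \<le> n2 (\<lambda>x. (1 / (r - t)) *\<^sub>R (y r x - y t x) - \<eta> t x) + n2 (\<lambda>x. (1 / (r - t)) *\<^sub>R (y' r x - y' t x) - \<eta>' t x)"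
          by (intro n2_diff L2v_diff L2v_scaleR Ly Le t1 t2)
        moreover have "(\<lambda>x. ((1 / (r - t)) *\<^sub>R (y r x - y t x) - \<eta> t x) - ((1 / (r - t)) *\<^sub>R (y' r x - y' t x) - \<eta>' t x)) = (\<lambda>x. (1 / (r - t)) *\<^sub>R (y r x - y' r x - (y t x - y' t x)) - (\<eta> t x - \<eta>' t x))"
          by (simp add: scaleR_diff_right algebra_simps)
        ultimately show "norm (n2 (\<lambda>x. (1 / (r - t)) *\<^sub>R (y r x - y' r x - (y t x - y' t x)) - (\<eta> t x - \<eta>' t x)))
         \<le> n2 (\<lambda>x. (1 / (r - t)) *\<^sub>R (y r x - y t x) - \<eta> t x) + n2 (\<lambda>x. (1 / (r - t)) *\<^sub>R (y' r x - y' t x) - \<eta>' t x)"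
          by (simp add: n2_nonneg)
      qed
      then show "((\<lambda>s. n2 (\<lambda>x. (1 / (s - t)) *\<^sub>R (y s x - y' s x - (y t x - y' t x)) - (\<eta> t x - \<eta>' t x))) \<longlongrightarrow> 0) (at t within {0..T})"
        by (rule Lim_null_comparison[OF _ lim])
    qed (use t t1 t2 in \<open>auto intro!: L2v_diff Ly Le\<close>)
    then show "\<forall>\<^sub>F s in at t within {0..T}. n2 (\<lambda>x. y t x - y' t x) \<le> n2 (\<lambda>x. y s x - y' s x) + (C * n2 (\<lambda>x. y t x - y' t x) + 0 + \<epsilon>) * \<bar>s - t\<bar>"
    proof eventually_elim
      case (elim r)
      have "n2 (\<lambda>x. \<eta> t x - \<eta>' t x) \<le> C * n2 (\<lambda>x. y t x - y' t x)"
        unfolding C_def by (rule WF_stab[OF _ _ _ _ _ _ _ _ sol_bound[OF s' t1]]) (use s s' t1 t2 in \<open>auto simp: sol_def\<close>)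
      then have "(n2 (\<lambda>x. \<eta> t x - \<eta>' t x) + \<epsilon>) * \<bar>r - t\<bar> \<le> (C * n2 (\<lambda>x. y t x - y' t x) + 0 + \<epsilon>) * \<bar>r - t\<bar>"
        by (intro mult_right_mono) auto
      then show ?case using elim by linarith
    qed
  qed (use C n2_nonneg t in auto)
  then show ?thesis by (simp add: C_def)
qed

end

section \<open>The elliptic problem\<close>

lemma norm_vector_matrix: "norm ((x::real^'n) v* M) \<le> norm x * norm (M::real^'m^'n)"
proof -
  have e: "x v* M = (\<Sum>k\<in>UNIV. (x $ k) *\<^sub>R (M $ k))"
    by (simp add: vec_eq_iff vector_matrix_mult_def mult.commute)
  have "norm (x v* M) \<le> (\<Sum>k\<in>UNIV. \<bar>x $ k\<bar> * \<bar>norm (M $ k)\<bar>)"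
    unfolding e by (rule sum_norm_le) simp
  also have "\<dots> \<le> L2_set (\<lambda>k. x $ k) UNIV * L2_set (\<lambda>k. norm (M $ k)) UNIV" by (rule L2_set_mult_ineq)
  also have "L2_set (\<lambda>k. x $ k) UNIV = norm x" by (simp add: norm_vec_def L2_set_def)
  finally show ?thesis by (simp add: norm_vec_def[of M])
qed

lemma norm_matrix_matrix: "norm ((M::real^'n^'m) ** (N::real^'p^'n)) \<le> norm M * norm N"
proof -
  have r: "(M ** N) $ i = (M $ i) v* N" for i
    by (simp add: vec_eq_iff vector_matrix_mult_def matrix_matrix_mult_def mult.commute)
  have "norm (M ** N) \<le> L2_set (\<lambda>i. norm (M $ i) * norm N) UNIV"
    unfolding norm_vec_def[of "M ** N"] by (rule L2_set_mono) (simp_all add: r norm_vector_matrix)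
  also have "\<dots> = norm M * norm N" unfolding norm_vec_def[of M] by (rule L2_set_left_distrib[symmetric]) simp
  finally show ?thesis .
qed

lemma bounded_bilinear_matrix_matrix: "bounded_bilinear (\<lambda>(M::real^'n^'m) (N::real^'p^'n). M ** N)"
  by (rule bounded_bilinear_I1;
     (rule norm_matrix_matrix | simp add: matrix_matrix_mult_def vec_eq_iff sum_distrib_left sum.distrib algebra_simps))

lemma norm_fst_snd_le: "norm (fst a) \<le> norm a" "norm (snd a) \<le> norm a"
  using norm_fst_le[of "fst a" "snd a"] norm_snd_le[of "snd a" "fst a"] by simp_all

text \<open>The elliptic equation as a first-order system in x, solved as an initial value problem
  from x = -1. The free datum q is the shooting parameter.\<close>

lemma lin_system:
  fixes N :: "real \<Rightarrow> real^'d^'d" and k :: "real \<Rightarrow> real^'d"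
  assumes N: "continuous_on {-1..1} N" and k: "continuous_on {-1..1} k"
  obtains \<phi> p where "\<phi> (-1) = 0" "p (-1) = q"
    "\<And>x. x \<in> {-1..1} \<Longrightarrow> (\<phi> has_vector_derivative N x *v p x) (at x within {-1..1})"
    "\<And>x. x \<in> {-1..1} \<Longrightarrow> (p has_vector_derivative \<phi> x + k x) (at x within {-1..1})"
proof -
  obtain C where C: "\<And>s. s \<in> {-1..1} \<Longrightarrow> norm (N s) \<le> C"
    using compact_imp_bounded[OF compact_continuous_image[OF N compact_Icc]]
    by (auto simp: bounded_iff simp del: atLeastAtMost_iff)
  have C0: "C \<ge> 0" using C[of 0] norm_ge_zero[of "N 0"] by (simp del: norm_ge_zero)
  define f where "f = (\<lambda>x (z :: (real^'d) \<times> (real^'d)). (N x *v snd z, fst z + k x))"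
  obtain z where z: "z (-1) = (0, q)" "\<And>t. t \<in> {-1..1} \<Longrightarrow> (z has_vector_derivative f t (z t)) (at t within {-1..1})"
  proof (rule picard[of "-1" 1 "C + 1" f])
    show "continuous_on {-1..1} (\<lambda>t. f t y)" for y
      unfolding f_def
      by (intro continuous_intros bounded_bilinear.continuous_on[OF bounded_bilinear_matrix_vector] N k)
    fix t y z assume t: "t \<in> {-1..1::real}"
    have "norm (f t y - f t z) \<le> norm (N t *v snd y - N t *v snd z) + norm (fst y + k t - (fst z + k t))"
      unfolding f_def diff_Pair by (rule norm_Pair_le)
    also have "N t *v snd y - N t *v snd z = N t *v snd (y - z)" by (simp add: matrix_vector_mult_diff_distrib)
    also have "fst y + k t - (fst z + k t) = fst (y - z)" by simp
    also have "norm (N t *v snd (y - z)) + norm (fst (y - z)) \<le> C * norm (y - z) + norm (y - z)"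
    proof (rule add_mono)
      have "norm (N t *v snd (y - z)) \<le> norm (N t) * norm (snd (y - z))" by (rule norm_matrix_vector)
      also have "\<dots> \<le> C * norm (y - z)"
        by (intro mult_mono C t C0 norm_fst_snd_le norm_ge_zero)
      finally show "norm (N t *v snd (y - z)) \<le> C * norm (y - z)" .
      show "norm (fst (y - z)) \<le> norm (y - z)" by (rule norm_fst_snd_le)
    qed
    finally show "norm (f t y - f t z) \<le> (C + 1) * norm (y - z)" by (simp add: algebra_simps)
  qed (use C0 in auto)
  have fst: "((\<lambda>x. fst (z x)) has_vector_derivative fst (f t (z t))) (at t within {-1..1})"
    and snd: "((\<lambda>x. snd (z x)) has_vector_derivative snd (f t (z t))) (at t within {-1..1})" if "t \<in> {-1..1}" for t
    using bounded_linear.has_vector_derivative[OF bounded_linear_fst z(2)[OF that]]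
      bounded_linear.has_vector_derivative[OF bounded_linear_snd z(2)[OF that]] by auto
  show thesis
    by (rule that[of "\<lambda>x. fst (z x)" "\<lambda>x. snd (z x)"]) (use z fst snd in \<open>auto simp: f_def\<close>)
qed

text \<open>The derivative of \<phi> \<bullet> p is |\<phi>|^2 + (N p) \<bullet> p, a nonnegative
  continuous function, and its integral vanishes by the boundary values of \<phi>. So N p is zero,
  in particular at -1. This is the injectivity of the shooting map.\<close>

lemma homogeneous_system_zero:
  fixes N :: "real \<Rightarrow> real^'d^'d"
  assumes N: "continuous_on {-1..1} N" and a: "\<alpha> > 0"
    and pos: "\<And>x v. v \<bullet> (N x *v v) \<ge> \<alpha> * (norm (N x *v v))\<^sup>2" and inj: "\<And>x v. N x *v v = 0 \<Longrightarrow> v = 0"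
    and f: "\<And>x. x \<in> {-1..1} \<Longrightarrow> (\<phi> has_vector_derivative N x *v p x) (at x within {-1..1})"
    and p: "\<And>x. x \<in> {-1..1} \<Longrightarrow> (p has_vector_derivative \<phi> x) (at x within {-1..1})"
    and b: "\<phi> (-1) = 0" "\<phi> 1 = 0"
  shows "p (-1) = 0"
proof -
  define g where "g = (\<lambda>x. \<phi> x \<bullet> \<phi> x + (N x *v p x) \<bullet> p x)"
  have cf: "continuous_on {-1..1} \<phi>" "continuous_on {-1..1} p"
    using f p by (meson continuous_on_eq_continuous_within has_vector_derivative_continuous)+
  have "(g has_integral (\<phi> 1 \<bullet> p 1 - \<phi> (-1) \<bullet> p (-1))) {-1..1}"
    unfolding g_def
    by (rule fundamental_theorem_of_calculus)
       (auto intro!: bounded_bilinear.has_vector_derivative[OF bounded_bilinear_inner f p])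
  then have i: "integral {-1..1} g = 0" using b by (simp add: integral_unique)
  have cg: "continuous_on {-1..1} g" unfolding g_def
    by (intro continuous_intros bounded_bilinear.continuous_on[OF bounded_bilinear_matrix_vector] N cf)
  have g0: "g x \<ge> \<alpha> * (norm (N x *v p x))\<^sup>2" for x
    using pos[where v="p x" and x=x] unfolding g_def inner_commute[of "N x *v p x" "p x"] by (simp add: add_increasing)
  then have "g x \<ge> 0" for x using a by (meson less_imp_le order_trans mult_nonneg_nonneg zero_le_power2)
  then have "g (-1) = 0" using integral_eq_0_iff[OF cg] i by auto
  then have "\<alpha> * (norm (N (-1) *v p (-1)))\<^sup>2 \<le> 0" using g0[of "-1"] by simp
  then have "N (-1) *v p (-1) = 0" using a by (simp add: mult_le_0_iff)
  then show ?thesis by (rule inj)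
qed

lemma prim_of_derivative:
  fixes \<phi> :: "real \<Rightarrow> 'a::euclidean_space"
  assumes "\<And>x. x \<in> {-1..1} \<Longrightarrow> (\<phi> has_vector_derivative \<phi>' x) (at x within {-1..1})" "x \<in> {-1..1}"
  shows "\<phi> x = \<phi> (-1) + prim \<phi>' x"
proof -
  have "(\<phi>' has_integral \<phi> x - \<phi> (-1)) {-1..x}"
  proof (rule fundamental_theorem_of_calculus)
    fix s assume "s \<in> {-1..x}"
    then have "(\<phi> has_vector_derivative \<phi>' s) (at s within {-1..1})" using assms by auto
    then show "(\<phi> has_vector_derivative \<phi>' s) (at s within {-1..x})"
      by (rule has_vector_derivative_within_subset) (use assms(2) in auto)
  qed (use assms(2) in auto)
  then show ?thesis by (simp add: prim_def integral_unique)
qed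

text \<open>Linear shooting: a particular solution plus combinations of the homogeneous ones started
  at the unit vectors. The map from q to the value at x = 1 is linear and injective on a
  finite-dimensional space, hence onto, so the condition at 1 can be met.\<close>

lemma elliptic_system_exists:
  fixes N :: "real \<Rightarrow> real^'d^'d"
  assumes N: "continuous_on {-1..1} N" and a: "\<alpha> > 0"
    and pos: "\<And>x v. v \<bullet> (N x *v v) \<ge> \<alpha> * (norm (N x *v v))\<^sup>2" and inj: "\<And>x v. N x *v v = 0 \<Longrightarrow> v = 0"
    and f: "L2v f" and g: "continuous_on {-1..1} g"
  obtains p \<eta> where "continuous_on {-1..1} p" "L2v \<eta>" "\<And>x. x \<in> {-1..1} \<Longrightarrow> \<eta> x = N x *v (f x + p x)" "prim \<eta> 1 = 0"
    "\<And>x. x \<in> {-1..1} \<Longrightarrow> p x = p (-1) + prim (\<lambda>x. prim \<eta> x - g x) x"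
proof -
  \<comment> \<open>As f is only square integrable, N f cannot be a forcing term of a classical
    system. Subtracting its primitive F from prim \<eta> leaves a system with continuous
    coefficients and forcing.\<close>
  define F where "F = prim (\<lambda>x. N x *v f x)"
  have Nf: "L2v (\<lambda>x. N x *v f x)" by (rule L2v_continuous_mult[OF bounded_bilinear_matrix_vector N f])
  have cF: "continuous_on {-1..1} F" unfolding F_def by (rule prim_continuous[OF Nf])
  obtain \<phi>0 p0 where 0: "\<phi>0 (-1) = 0" "p0 (-1) = 0"
    "\<And>x. x \<in> {-1..1} \<Longrightarrow> (\<phi>0 has_vector_derivative N x *v p0 x) (at x within {-1..1})"
    "\<And>x. x \<in> {-1..1} \<Longrightarrow> (p0 has_vector_derivative \<phi>0 x + (F x - g x)) (at x within {-1..1})"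
    using lin_system[OF N continuous_on_diff[OF cF g], of 0] by metis
  have "\<exists>\<phi> p. \<phi> (-1) = 0 \<and> p (-1) = axis b 1 \<and>
    (\<forall>x\<in>{-1..1}. (\<phi> has_vector_derivative N x *v p x) (at x within {-1..1})) \<and>
    (\<forall>x\<in>{-1..1}. (p has_vector_derivative \<phi> x) (at x within {-1..1}))" for b :: 'd
    using lin_system[OF N continuous_on_const[of _ 0], of "axis b 1"] by (metis add.right_neutral)
  then obtain \<phi> p where b: "\<And>b :: 'd. \<phi> b (-1) = 0" "\<And>b. p b (-1) = axis b 1"
    "\<And>b x. x \<in> {-1..1} \<Longrightarrow> (\<phi> b has_vector_derivative N x *v p b x) (at x within {-1..1})"
    "\<And>b x. x \<in> {-1..1} \<Longrightarrow> (p b has_vector_derivative \<phi> b x) (at x within {-1..1})"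
    by metis
  define S where "S = (\<lambda>(q::real^'d) x. \<Sum>b\<in>UNIV. (q $ b) *\<^sub>R \<phi> b x)"
  define P where "P = (\<lambda>(q::real^'d) x. \<Sum>b\<in>UNIV. (q $ b) *\<^sub>R p b x)"
  have dS: "(S q has_vector_derivative N x *v P q x) (at x within {-1..1})" if "x \<in> {-1..1}" for q x
  proof -
    have "(S q has_vector_derivative (\<Sum>b\<in>UNIV. (q $ b) *\<^sub>R (N x *v p b x))) (at x within {-1..1})"
      unfolding S_def by (intro has_vector_derivative_sum bounded_linear.has_vector_derivative[OF bounded_linear_scaleR_right] b(3) that)
    moreover have "(\<Sum>b\<in>UNIV. (q $ b) *\<^sub>R (N x *v p b x)) = N x *v P q x"
      unfolding P_def bounded_bilinear.sum_right[OF bounded_bilinear_matrix_vector] bounded_bilinear.scaleR_right[OF bounded_bilinear_matrix_vector] ..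
    ultimately show ?thesis by simp
  qed
  have dP: "(P q has_vector_derivative S q x) (at x within {-1..1})" if "x \<in> {-1..1}" for q x
    unfolding S_def P_def by (intro has_vector_derivative_sum bounded_linear.has_vector_derivative[OF bounded_linear_scaleR_right] b(4) that)
  have Sm: "S q (-1) = 0" for q by (simp add: S_def b)
  have Pm: "P q (-1) = q" for q by (simp add: P_def b axis_expansion[symmetric])
  have lin: "linear (\<lambda>q. S q 1)"
    by (rule linearI) (simp_all add: S_def scaleR_add_left sum.distrib scaleR_sum_right)
  have "inj (\<lambda>q. S q 1)"
  proof (subst linear_injective_0[OF lin], intro allI impI)
    fix q assume "S q 1 = 0"
    from homogeneous_system_zero[OF N a pos inj dS dP Sm this] show "q = 0" by (simp add: Pm)
  qed
  then have "surj (\<lambda>q. S q 1)" by (rule linear_injective_imp_surjective[OF lin]) simp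
  \<comment> \<open>Since prim \<eta> is \<phi>0 + S q + F, this q gives prim \<eta> 1 = 0.\<close>
  then obtain q where q: "S q 1 = - \<phi>0 1 - F 1" by (metis surjD)
  define pp where "pp = (\<lambda>x. p0 x + P q x)"
  define ph where "ph = (\<lambda>x. \<phi>0 x + S q x)"
  define \<eta> where "\<eta> = (\<lambda>x. N x *v (f x + pp x))"
  have d1: "(ph has_vector_derivative N x *v pp x) (at x within {-1..1})" if "x \<in> {-1..1}" for x
    unfolding ph_def pp_def matrix_vector_right_distrib by (intro has_vector_derivative_add 0 dS that)
  have d2: "(pp has_vector_derivative (ph x + F x) - g x) (at x within {-1..1})" if "x \<in> {-1..1}" for x
  proof -
    have "(pp has_vector_derivative (\<phi>0 x + (F x - g x)) + S q x) (at x within {-1..1})"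
      unfolding pp_def by (intro has_vector_derivative_add 0 dP that)
    then show ?thesis by (simp add: ph_def algebra_simps)
  qed
  have cpp: "continuous_on {-1..1} pp" using d2 by (meson continuous_on_eq_continuous_within has_vector_derivative_continuous)
  have Np: "L2v (\<lambda>x. N x *v pp x)" by (rule L2v_continuous_mult[OF bounded_bilinear_matrix_vector N L2v_continuous[OF cpp]])
  have eta: "\<eta> = (\<lambda>x. N x *v f x + N x *v pp x)" by (simp add: \<eta>_def matrix_vector_right_distrib)
  have eL: "L2v \<eta>" unfolding eta by (rule L2v_add[OF Nf Np])
  have ph0: "ph (-1) = 0" by (simp add: ph_def 0 Sm)
  have pe: "prim \<eta> x = ph x + F x" if "x \<in> {-1..1}" for x
    unfolding eta using prim_add[OF Nf Np that] prim_of_derivative[OF d1 that] ph0 by (simp add: F_def)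
  show thesis
  proof (rule that[OF cpp eL])
    show "prim \<eta> 1 = 0" using pe[of 1] q by (simp add: ph_def)
    fix x :: real assume x: "x \<in> {-1..1}"
    show "\<eta> x = N x *v (f x + pp x)" by (simp add: \<eta>_def)
    have "prim (\<lambda>x. prim \<eta> x - g x) x = prim (\<lambda>x. (ph x + F x) - g x) x"
      unfolding prim_def[of _ x] by (rule Henstock_Kurzweil_Integration.integral_cong) (use pe x in auto)
    then show "pp x = pp (-1) + prim (\<lambda>x. prim \<eta> x - g x) x" using prim_of_derivative[OF d2 x] by simp
  qed
qed

text \<open>The value at x differs from the value at any z by at most 4 n2 r; averaging over z
  bounds it by the mean of |p|. The length 2 of the interval cancels the factor 2 in
  \<open>integral_norm_le_n2\<close>.\<close>

lemma sup_le_n2: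
  fixes p r :: "real \<Rightarrow> 'a::euclidean_space"
  assumes r: "L2v r" and p: "\<And>x. x \<in> {-1..1} \<Longrightarrow> p x = p (-1) + prim r x" and x: "x \<in> {-1..1}"
  shows "norm (p x) \<le> n2 p + 4 * n2 r"
proof -
  have pL: "L2v p" by (rule L2v_continuous, rule continuous_on_eq[OF _ p[symmetric]]) (intro continuous_intros prim_continuous[OF r])
  have n: "norm (p x) - 4 * n2 r \<le> norm (p z)" if z: "z \<in> {-1..1}" for z
  proof -
    have "p x = p z + (prim r x - prim r z)" using p[OF x] p[OF z] by simp
    then have "norm (p x) \<le> norm (p z) + norm (prim r x - prim r z)" by (metis norm_triangle_ineq)
    also have "norm (prim r x - prim r z) \<le> norm (prim r x) + norm (prim r z)" by (rule norm_triangle_ineq4)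
    finally show ?thesis using prim_bound[OF r x] prim_bound[OF r z] by simp
  qed
  have "integral {-1..1} (\<lambda>z::real. norm (p x) - 4 * n2 r) \<le> integral {-1..1} (\<lambda>z. norm (p z))"
    by (rule Henstock_Kurzweil_Integration.integral_le) (use n L2v_int[OF L2v_norm[OF pL]] in auto)
  also have "\<dots> \<le> 2 * n2 p" by (rule integral_norm_le_n2[OF pL]) auto
  finally show ?thesis by simp
qed

section \<open>The inverse matrix and the integrated equation\<close>

context coeffs
begin

definition N :: "real^'d \<Rightarrow> real^'d^'d" where "N w = matrix_inv (A w)"

lemma N_inverse: "A w ** N w = mat 1" "N w ** A w = mat 1"
proof -
  have "inj ((*v) (A w))"
  proof (rule injI)
    fix x y assume "A w *v x = A w *v y"
    then have "A w *v (x - y) = 0" by (simp add: matrix_vector_mult_diff_distrib)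
    then have "\<alpha> * (norm (x - y))\<^sup>2 \<le> 0" using elliptic[where w=w and \<xi>="x - y"] by simp
    then show "x = y" using alpha by (simp add: mult_le_0_iff)
  qed
  then have "invertible (A w)" using invertible_left_inverse matrix_left_invertible_injective by blast
  then have "\<exists>A'. A w ** A' = mat 1 \<and> A' ** A w = mat 1" by (simp add: invertible_def)
  from someI_ex[OF this] show "A w ** N w = mat 1" "N w ** A w = mat 1"
    by (auto simp: N_def matrix_inv_def)
qed

lemma A_N: "A w *v (N w *v v) = v" and N_A: "N w *v (A w *v v) = v"
  by (simp_all add: matrix_vector_mul_assoc N_inverse)

text \<open>Ellipticity at \<xi> = N w v, for which A w \<xi> = v.\<close>

lemma N_pos: "v \<bullet> (N w *v v) \<ge> \<alpha> * (norm (N w *v v))\<^sup>2"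
  using elliptic[where w=w and \<xi>="N w *v v"] by (simp add: A_N inner_commute)

lemma N_inj: "N w *v v = 0 \<Longrightarrow> v = 0"
  by (metis A_N matrix_vector_mult_0_right)

lemma N_vector_bound: "norm (N w *v v) \<le> norm v / \<alpha>"
proof (cases "N w *v v = 0")
  case False
  have "\<alpha> * (norm (N w *v v))\<^sup>2 \<le> norm v * norm (N w *v v)"
    by (rule order_trans[OF N_pos norm_cauchy_schwarz])
  then have "\<alpha> * norm (N w *v v) \<le> norm v" using False by (simp add: power2_eq_square)
  then show ?thesis using alpha by (simp add: field_simps)
qed (use alpha in simp)

text \<open>Each entry of the inverse is at most 1/\<alpha>, by \<open>N_vector_bound\<close> on
  unit vectors; the Frobenius norm is at most the sum of the absolute entries.\<close>

definition KN :: real where "KN = (real CARD('d))\<^sup>2 / \<alpha>"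

lemma KN_nonneg: "KN \<ge> 0" using alpha by (simp add: KN_def)

lemma N_bound: "norm (N w) \<le> KN"
proof -
  have e: "\<bar>N w $ i $ j\<bar> \<le> 1 / \<alpha>" for i j
  proof -
    have "N w $ i $ j = (N w *v axis j 1) $ i" by (simp add: matrix_vector_mult_basis column_def)
    then have "\<bar>N w $ i $ j\<bar> \<le> norm (N w *v axis j 1)" by (metis component_le_norm_cart)
    also have "\<dots> \<le> 1 / \<alpha>" using N_vector_bound[of w "axis j 1"] by (simp add: norm_axis_1)
    finally show ?thesis .
  qed
  have "norm (N w) \<le> (\<Sum>i\<in>UNIV. norm (N w $ i))" by (simp add: norm_vec_def L2_set_le_sum)
  also have "\<dots> \<le> (\<Sum>i\<in>(UNIV::'d set). \<Sum>j\<in>(UNIV::'d set). 1 / \<alpha>)"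
    by (intro sum_mono order_trans[OF norm_le_l1_cart] e)
  finally show ?thesis by (simp add: KN_def power2_eq_square)
qed

text \<open>The resolvent identity N w - N w' = N w (A w' - A w) N w' together with the uniform
  bound on N.\<close>

lemma N_lip: "norm (N w - N w') \<le> KN * K * KN * norm (w - w')"
proof -
  have "N w ** ((A w' - A w) ** N w') = N w ** (A w' ** N w') - (N w ** A w) ** N w'"
    by (simp add: bounded_bilinear.diff_left[OF bounded_bilinear_matrix_matrix] bounded_bilinear.diff_right[OF bounded_bilinear_matrix_matrix] matrix_mul_assoc)
  then have "N w - N w' = N w ** ((A w' - A w) ** N w')" by (simp add: N_inverse)
  then have "norm (N w - N w') \<le> norm (N w) * norm ((A w' - A w) ** N w')" by (simp add: norm_matrix_matrix)
  also have "\<dots> \<le> KN * (norm (A w' - A w) * norm (N w'))"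
    by (intro mult_mono N_bound norm_matrix_matrix KN_nonneg norm_ge_zero)
  also have "\<dots> \<le> KN * ((K * norm (w - w')) * KN)"
    using A_lip[of w' w] by (intro mult_left_mono mult_mono N_bound KN_nonneg) (auto simp: norm_minus_commute K)
  finally show ?thesis by (simp add: ac_simps)
qed

lemma N_continuous: "continuous_on S N"
  by (rule continuous_on_of_lipschitz[OF N_lip]) (intro mult_nonneg_nonneg KN_nonneg K)

lemma N_cont_comp: "continuous_on S u \<Longrightarrow> continuous_on S (\<lambda>x. N (u x))"
  by (rule continuous_on_compose2[OF N_continuous[of UNIV]]) auto

text \<open>The weak equation, integrated once: p is the flux A(u) u_{tx} - B(u) u_x + G(u), whose
  derivative is u_t - gamma(u).\<close>

definition ell :: "(real \<Rightarrow> real^'d) \<Rightarrow> (real \<Rightarrow> real^'d) \<Rightarrow> (real \<Rightarrow> real^'d) \<Rightarrow> bool" where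
  "ell y \<eta> p \<longleftrightarrow> continuous_on {-1..1} p \<and> L2v \<eta> \<and> prim \<eta> 1 = 0 \<and>
     (\<forall>x\<in>{-1..1}. p x = p (-1) + prim (\<lambda>x. prim \<eta> x - \<gamma> (prim y x)) x) \<and>
     (\<forall>x\<in>{-1..1}. \<eta> x = N (prim y x) *v (flux y x + p x))"

lemma ell_exists:
  assumes y: "L2v y" obtains \<eta> p where "ell y \<eta> p"
proof -
  have c: "continuous_on {-1..1} (prim y)" by (rule prim_continuous[OF y])
  show thesis
  proof (rule elliptic_system_exists[where N="\<lambda>x. N (prim y x)", OF N_cont_comp[OF c] alpha _ _ L2v_flux[OF y] cont_comp(4)[OF c]])
    show "v \<bullet> (N (prim y x) *v v) \<ge> \<alpha> * (norm (N (prim y x) *v v))\<^sup>2" for x v by (rule N_pos)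
    show "v = 0" if "N (prim y x) *v v = 0" for x v by (rule N_inj[OF that])
  next
    fix p \<eta> assume "continuous_on {-1..1} p" "L2v \<eta>" "\<And>x. x \<in> {-1..1} \<Longrightarrow> \<eta> x = N (prim y x) *v (flux y x + p x)" "prim \<eta> 1 = 0"
      "\<And>x. x \<in> {-1..1} \<Longrightarrow> p x = p (-1) + prim (\<lambda>x. prim \<eta> x - \<gamma> (prim y x)) x"
    then have "ell y \<eta> p" unfolding ell_def by blast
    then show thesis by (rule that)
  qed
qed

lemma ellD:
  assumes "ell y \<eta> p"
  shows "continuous_on {-1..1} p" "L2v \<eta>" "prim \<eta> 1 = 0"
    "\<And>x. x \<in> {-1..1} \<Longrightarrow> p x = p (-1) + prim (\<lambda>x. prim \<eta> x - \<gamma> (prim y x)) x"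
    "\<And>x. x \<in> {-1..1} \<Longrightarrow> \<eta> x = N (prim y x) *v (flux y x + p x)"
  using assms unfolding ell_def by blast+

lemma ell_p_eq:
  assumes "ell y \<eta> p" "x \<in> {-1..1}"
  shows "p x = A (prim y x) *v \<eta> x - flux y x"
  using ellD(5)[OF assms] by (simp add: A_N)

text \<open>A(u) \<eta> is the flux plus p. Pairing p with \<zeta> and integrating by parts turns it
  into the terms with u_t and \<gamma>(u), since prim \<zeta> vanishes at both ends.\<close>

lemma ell_WF:
  assumes y: "L2v y" and e: "ell y \<eta> p"
  shows "WF y \<eta>"
  unfolding WF_def
proof (intro allI impI)
  fix \<zeta> :: "real \<Rightarrow> real^'d" assume z: "L2v \<zeta>" "prim \<zeta> 1 = 0"
  note eL = ellD(2)[OF e] and pc = ellD(1)[OF e]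
  have pL: "L2v p" by (rule L2v_continuous[OF pc])
  have pz: "L2v (prim \<zeta>)" "L2v (prim \<eta>)" by (rule prim_L2v[OF z(1)], rule prim_L2v[OF eL])
  have g: "L2v (\<lambda>x. \<gamma> (prim y x))" by (rule L2v_coeffs(4)[OF y])
  have r: "L2v (\<lambda>x. prim \<eta> x - \<gamma> (prim y x))" by (rule L2v_diff[OF pz(2) g])
  have "ip (\<lambda>x. A (prim y x) *v \<eta> x) \<zeta> = ip (\<lambda>x. flux y x + p x) \<zeta>"
    by (rule ip_cong) (simp_all add: ell_p_eq[OF e])
  also have "\<dots> = ip (flux y) \<zeta> + ip p \<zeta>" by (rule ip_add_left[OF L2v_flux[OF y] pL z(1)])
  also have "ip p \<zeta> = - ip (\<lambda>x. prim \<eta> x - \<gamma> (prim y x)) (prim \<zeta>)"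
    unfolding ip_def
    by (rule integral_by_parts_prim[OF bounded_bilinear_inner r z(1) ellD(4)[OF e]]) (use z in auto)
  also have "ip (\<lambda>x. prim \<eta> x - \<gamma> (prim y x)) (prim \<zeta>) = ip (prim \<eta>) (prim \<zeta>) - ip (\<lambda>x. \<gamma> (prim y x)) (prim \<zeta>)"
    by (rule ip_diff_left[OF pz(2) g pz(1)])
  finally show "ip (prim \<eta>) (prim \<zeta>) + ip (\<lambda>x. A (prim y x) *v \<eta> x) \<zeta> = ip (flux y) \<zeta> + ip (\<lambda>x. \<gamma> (prim y x)) (prim \<zeta>)"
    by simp
qed

lemma A_bound:
  assumes y: "L2v y" and r: "n2 y \<le> \<rho>" and x: "x \<in> {-1..1}"
  shows "norm (A (prim y x)) \<le> norm (A 0) + 2 * K * \<rho>"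
proof -
  have "norm (A (prim y x)) \<le> norm (A 0) + norm (A (prim y x) - A 0)" by (rule norm_triangle_sub)
  also have "norm (A (prim y x) - A 0) \<le> K * norm (prim y x)" using A_lip[of "prim y x" 0] by simp
  also have "K * norm (prim y x) \<le> K * (2 * \<rho>)" using prim_bound[OF y x] r K by (intro mult_left_mono) auto
  finally show ?thesis by simp
qed

lemma flux_bound:
  assumes y: "L2v y" shows "n2 (flux y) \<le> K * n2 y + 2 * K"
proof -
  have "n2 (flux y) \<le> n2 (\<lambda>x. B (prim y x) *v y x) + n2 (\<lambda>x. G (prim y x))"
    unfolding flux_def by (intro n2_diff L2v_coeffs y)
  also have "n2 (\<lambda>x. B (prim y x) *v y x) \<le> K * n2 y"
    by (rule n2_mono[OF L2v_coeffs(2)[OF y y] y K])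
       (rule order_trans[OF norm_matrix_vector mult_right_mono[OF B_bd]], simp)
  also have "n2 (\<lambda>x. G (prim y x)) \<le> 2 * K" by (rule n2_bound[OF L2v_coeffs(3)[OF y] K G_bd])
  finally show ?thesis by simp
qed

lemma flux_diff:
  assumes y: "L2v y" "L2v y'"
  shows "n2 (\<lambda>x. flux y x - flux y' x) \<le> (5 * K + 2 * K * n2 y') * n2 (\<lambda>x. y x - y' x)"
proof -
  define D where "D = n2 (\<lambda>x. y x - y' x)"
  let ?u = "prim y" and ?u' = "prim y'"
  have D0: "D \<ge> 0" by (simp add: D_def n2_nonneg)
  have uu: "norm (?u x - ?u' x) \<le> 2 * D" if "x \<in> {-1..1}" for x
    using prim_bound[OF L2v_diff[OF y] that] prim_diff[OF y that] by (simp add: D_def)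
  have KD: "0 \<le> K * (2 * D)" using K D0 by simp
  have yy: "L2v (\<lambda>x. y x - y' x)" by (rule L2v_diff[OF y])
  have cu: "continuous_on {-1..1} ?u" "continuous_on {-1..1} ?u'" using y by (auto intro: prim_continuous)
  define V1 where "V1 = (\<lambda>x. B (?u x) *v (y x - y' x))"
  define V2 where "V2 = (\<lambda>x. (B (?u x) - B (?u' x)) *v y' x)"
  define V3 where "V3 = (\<lambda>x. G (?u x) - G (?u' x))"
  have L: "L2v V1" "L2v V2" "L2v V3"
    unfolding V1_def V2_def V3_def
    using cu yy y by (auto intro!: L2v_coeffs L2v_continuous_mult[OF bounded_bilinear_matrix_vector] continuous_on_diff cont_comp L2v_diff)
  have lip: "norm (F (?u x) - F (?u' x)) \<le> K * (2 * D)" if "x \<in> {-1..1}" "\<And>w w'. norm (F w - F w') \<le> K * norm (w - w')"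
    for x and F :: "real^'d \<Rightarrow> 'z::real_normed_vector"
    by (rule order_trans[OF that(2) mult_left_mono[OF uu[OF that(1)] K]])
  have "n2 (\<lambda>x. flux y x - flux y' x) = n2 (\<lambda>x. (V1 x + V2 x) - V3 x)"
    by (rule n2_cong) (simp add: flux_def V1_def V2_def V3_def matrix_vector_mult_diff_distrib matrix_vector_mult_diff_rdistrib)
  also have "\<dots> \<le> (n2 V1 + n2 V2) + n2 V3"
    by (rule order_trans[OF n2_diff[OF L2v_add[OF L(1,2)] L(3)] add_right_mono[OF n2_add[OF L(1,2)]]])
  also have "n2 V1 \<le> K * D" unfolding D_def
    by (rule n2_mono[OF L(1) yy K]) (unfold V1_def, rule order_trans[OF norm_matrix_vector mult_right_mono[OF B_bd]], simp)
  also have "n2 V2 \<le> K * (2 * D) * n2 y'"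
    by (rule n2_mono[OF L(2) y(2) KD]) (unfold V2_def, rule order_trans[OF norm_matrix_vector mult_right_mono[OF lip[OF _ B_lip]]], simp_all)
  also have "n2 V3 \<le> 2 * (K * (2 * D))"
    by (rule n2_bound[OF L(3) KD]) (unfold V3_def, rule lip[OF _ G_lip])
  finally show ?thesis by (simp add: D_def algebra_simps)
qed

text \<open>The boundary value p(-1) is not known directly. But p is bounded in L^2 through p = A(u)
  \<eta> - flux, and its derivative u_t - \<gamma>(u) is bounded in L^2 as well, so
  \<open>sup_le_n2\<close> applies. A has linear growth and u is bounded on the ball, whence the
  dependence on \<rho>.\<close>

lemma ell_p_bound:
  assumes "\<rho> \<ge> 0"
  shows "\<exists>C\<ge>0. \<forall>y \<eta> p. L2v y \<longrightarrow> n2 y \<le> \<rho> \<longrightarrow> ell y \<eta> p \<longrightarrow> (\<forall>x\<in>{-1..1}. norm (p x) \<le> C)"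
proof -
  define a where "a = norm (A 0) + 2 * K * \<rho>"
  have a: "a \<ge> 0" using assms K by (simp add: a_def)
  define C where "C = (a * (E * (1 + \<rho>)) + (K * \<rho> + 2 * K)) + 4 * (4 * (E * (1 + \<rho>)) + 2 * K)"
  have "norm (p x) \<le> C" if y: "L2v y" "n2 y \<le> \<rho>" and e: "ell y \<eta> p" and x: "x \<in> {-1..1}" for y \<eta> p x
  proof -
    note eL = ellD(2,3)[OF e]
    have "n2 \<eta> \<le> E * (1 + n2 y)" unfolding E_def by (rule WF_bound[OF y(1) eL ell_WF[OF y(1) e]])
    also have "\<dots> \<le> E * (1 + \<rho>)" using y E_nonneg by (intro mult_left_mono) auto
    finally have ne: "n2 \<eta> \<le> E * (1 + \<rho>)" .
    have g: "L2v (\<lambda>x. \<gamma> (prim y x))" by (rule L2v_coeffs(4)[OF y(1)])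
    have "n2 p = n2 (\<lambda>x. A (prim y x) *v \<eta> x - flux y x)" by (rule n2_cong) (rule ell_p_eq[OF e])
    also have "\<dots> \<le> n2 (\<lambda>x. A (prim y x) *v \<eta> x) + n2 (flux y)" by (intro n2_diff L2v_coeffs L2v_flux y eL)
    also have "n2 (\<lambda>x. A (prim y x) *v \<eta> x) \<le> a * n2 \<eta>"
      by (rule n2_mono[OF L2v_coeffs(1)[OF y(1) eL(1)] eL(1) a])
         (unfold a_def, rule order_trans[OF norm_matrix_vector mult_right_mono[OF A_bound[OF y]]], simp_all)
    also have "a * n2 \<eta> \<le> a * (E * (1 + \<rho>))" by (rule mult_left_mono[OF ne a])
    also have "n2 (flux y) \<le> K * \<rho> + 2 * K" using flux_bound[OF y(1)] mult_left_mono[OF y(2) K] by simp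
    finally have np: "n2 p \<le> a * (E * (1 + \<rho>)) + (K * \<rho> + 2 * K)" by simp
    have "n2 (\<lambda>x. prim \<eta> x - \<gamma> (prim y x)) \<le> n2 (prim \<eta>) + n2 (\<lambda>x. \<gamma> (prim y x))"
      by (rule n2_diff[OF prim_L2v[OF eL(1)] g])
    also have "\<dots> \<le> 4 * (E * (1 + \<rho>)) + 2 * K"
      using prim_n2[OF eL(1)] ne n2_bound[OF g K \<gamma>_bd] by simp
    finally have nr: "n2 (\<lambda>x. prim \<eta> x - \<gamma> (prim y x)) \<le> 4 * (E * (1 + \<rho>)) + 2 * K" .
    have "norm (p x) \<le> n2 p + 4 * n2 (\<lambda>x. prim \<eta> x - \<gamma> (prim y x))"
      by (rule sup_le_n2[OF L2v_diff[OF prim_L2v[OF eL(1)] g] ellD(4)[OF e] x])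
    then show ?thesis unfolding C_def
      by (rule order_trans[OF _ add_mono[OF np mult_left_mono[OF nr]]]) simp
  qed
  moreover have "C \<ge> 0" using a assms K E_nonneg by (simp add: C_def)
  ultimately show ?thesis by blast
qed

text \<open>The same two bounds for differences. The gain is that p is Lipschitz in the supremum
  norm with respect to the L^2 norm of y; in particular y determines p on [-1,1].\<close>

lemma ell_p_lip:
  assumes "\<rho> \<ge> 0"
  shows "\<exists>C\<ge>0. \<forall>y \<eta> p y' \<eta>' p'. L2v y \<longrightarrow> n2 y \<le> \<rho> \<longrightarrow> ell y \<eta> p \<longrightarrow> L2v y' \<longrightarrow> n2 y' \<le> \<rho> \<longrightarrow> ell y' \<eta>' p' \<longrightarrow>
     (\<forall>x\<in>{-1..1}. norm (p x - p' x) \<le> C * n2 (\<lambda>x. y x - y' x))"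
proof -
  define a where "a = norm (A 0) + 2 * K * \<rho>"
  have a: "a \<ge> 0" using assms K by (simp add: a_def)
  define C where "C = (a * stab \<rho> + 2 * K * (E * (1 + \<rho>)) + (5 * K + 2 * K * \<rho>)) + 4 * (4 * stab \<rho> + 4 * K)"
  have "norm (p x - p' x) \<le> C * n2 (\<lambda>x. y x - y' x)"
    if y: "L2v y" "n2 y \<le> \<rho>" and e: "ell y \<eta> p" and y': "L2v y'" "n2 y' \<le> \<rho>" and e': "ell y' \<eta>' p'" and x: "x \<in> {-1..1}" for y \<eta> p y' \<eta>' p' x
  proof -
    define D where "D = n2 (\<lambda>x. y x - y' x)"
    have D0: "D \<ge> 0" by (simp add: D_def n2_nonneg)
    note eL = ellD(2,3)[OF e] ellD(2,3)[OF e']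
    have "n2 \<eta>' \<le> E * (1 + n2 y')" unfolding E_def by (rule WF_bound[OF y'(1) eL(3,4) ell_WF[OF y'(1) e']])
    also have "\<dots> \<le> E * (1 + \<rho>)" using y' E_nonneg by (intro mult_left_mono) auto
    finally have ne: "n2 \<eta>' \<le> E * (1 + \<rho>)" .
    have d: "n2 (\<lambda>x. \<eta> x - \<eta>' x) \<le> stab \<rho> * D"
      unfolding D_def by (rule WF_stab[OF y(1) y'(1) eL ell_WF[OF y(1) e] ell_WF[OF y'(1) e'] y'(2)])
    have dL: "L2v (\<lambda>x. \<eta> x - \<eta>' x)" by (rule L2v_diff[OF eL(1,3)])
    have uu: "norm (prim y x - prim y' x) \<le> 2 * D" if "x \<in> {-1..1}" for x
      using prim_bound[OF L2v_diff[OF y(1) y'(1)] that] prim_diff[OF y(1) y'(1) that] by (simp add: D_def)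
    have KD: "0 \<le> K * (2 * D)" using K D0 by simp
    have cu: "continuous_on {-1..1} (prim y)" "continuous_on {-1..1} (prim y')" using y y' by (auto intro: prim_continuous)
    define W1 where "W1 = (\<lambda>x. A (prim y x) *v (\<eta> x - \<eta>' x))"
    define W2 where "W2 = (\<lambda>x. (A (prim y x) - A (prim y' x)) *v \<eta>' x)"
    define W3 where "W3 = (\<lambda>x. flux y x - flux y' x)"
    have L: "L2v W1" "L2v W2" "L2v W3"
      unfolding W1_def W2_def W3_def
      using cu y y' eL dL by (auto intro!: L2v_coeffs L2v_continuous_mult[OF bounded_bilinear_matrix_vector] continuous_on_diff cont_comp L2v_diff L2v_flux)
    have "n2 (\<lambda>x. p x - p' x) = n2 (\<lambda>x. (W1 x + W2 x) - W3 x)"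
      by (rule n2_cong) (simp add: ell_p_eq[OF e] ell_p_eq[OF e'] W1_def W2_def W3_def matrix_vector_mult_diff_distrib matrix_vector_mult_diff_rdistrib)
    also have "\<dots> \<le> (n2 W1 + n2 W2) + n2 W3"
      by (rule order_trans[OF n2_diff[OF L2v_add[OF L(1,2)] L(3)] add_right_mono[OF n2_add[OF L(1,2)]]])
    also have "n2 W1 \<le> a * n2 (\<lambda>x. \<eta> x - \<eta>' x)"
      by (rule n2_mono[OF L(1) dL a]) (unfold W1_def a_def, rule order_trans[OF norm_matrix_vector mult_right_mono[OF A_bound[OF y]]], simp_all)
    also have "a * n2 (\<lambda>x. \<eta> x - \<eta>' x) \<le> a * (stab \<rho> * D)" by (rule mult_left_mono[OF d a])
    also have "n2 W2 \<le> K * (2 * D) * n2 \<eta>'"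
    proof (rule n2_mono[OF L(2) eL(3) KD])
      fix x :: real assume x: "x \<in> {-1..1}"
      show "norm (W2 x) \<le> K * (2 * D) * norm (\<eta>' x)"
        unfolding W2_def
        by (rule order_trans[OF norm_matrix_vector mult_right_mono[OF order_trans[OF A_lip mult_left_mono[OF uu[OF x] K]]]]) simp
    qed
    also have "K * (2 * D) * n2 \<eta>' \<le> K * (2 * D) * (E * (1 + \<rho>))" by (rule mult_left_mono[OF ne KD])
    also have "n2 W3 \<le> (5 * K + 2 * K * n2 y') * D" unfolding W3_def D_def by (rule flux_diff[OF y(1) y'(1)])
    also have "(5 * K + 2 * K * n2 y') * D \<le> (5 * K + 2 * K * \<rho>) * D"
      using y'(2) K D0 by (intro mult_right_mono add_left_mono mult_left_mono) auto
    finally have np: "n2 (\<lambda>x. p x - p' x) \<le> (a * stab \<rho> + 2 * K * (E * (1 + \<rho>)) + (5 * K + 2 * K * \<rho>)) * D"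
      by (simp add: algebra_simps)
    define r where "r = (\<lambda>y \<eta> x. prim \<eta> x - \<gamma> (prim y x))"
    have gL: "L2v (\<lambda>x. \<gamma> (prim y x))" "L2v (\<lambda>x. \<gamma> (prim y' x))" by (rule L2v_coeffs(4)[OF y(1)], rule L2v_coeffs(4)[OF y'(1)])
    have rL: "L2v (r y \<eta>)" "L2v (r y' \<eta>')" unfolding r_def by (intro L2v_diff prim_L2v eL gL)+
    have "n2 (\<lambda>x. r y \<eta> x - r y' \<eta>' x) = n2 (\<lambda>x. prim (\<lambda>x. \<eta> x - \<eta>' x) x - (\<gamma> (prim y x) - \<gamma> (prim y' x)))"
      by (rule n2_cong) (simp add: r_def prim_diff[OF eL(1,3)])
    also have "\<dots> \<le> n2 (prim (\<lambda>x. \<eta> x - \<eta>' x)) + n2 (\<lambda>x. \<gamma> (prim y x) - \<gamma> (prim y' x))"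
      by (intro n2_diff prim_L2v dL L2v_diff gL)
    also have "\<dots> \<le> 4 * (stab \<rho> * D) + 2 * (K * (2 * D))"
    proof (rule add_mono)
      show "n2 (prim (\<lambda>x. \<eta> x - \<eta>' x)) \<le> 4 * (stab \<rho> * D)" using prim_n2[OF dL] d by simp
      show "n2 (\<lambda>x. \<gamma> (prim y x) - \<gamma> (prim y' x)) \<le> 2 * (K * (2 * D))"
        by (rule n2_bound[OF L2v_diff[OF gL] KD]) (rule order_trans[OF \<gamma>_lip mult_left_mono[OF uu K]])
    qed
    finally have nr: "n2 (\<lambda>x. r y \<eta> x - r y' \<eta>' x) \<le> (4 * stab \<rho> + 4 * K) * D" by (simp add: algebra_simps)
    have "norm (p x - p' x) \<le> n2 (\<lambda>x. p x - p' x) + 4 * n2 (\<lambda>x. r y \<eta> x - r y' \<eta>' x)"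
    proof (rule sup_le_n2[where p="\<lambda>x. p x - p' x", OF L2v_diff[OF rL] _ x])
      fix x :: real assume x: "x \<in> {-1..1}"
      have "p x = p (-1) + prim (r y \<eta>) x" "p' x = p' (-1) + prim (r y' \<eta>') x"
        unfolding r_def by (rule ellD(4)[OF e x], rule ellD(4)[OF e' x])
      then show "p x - p' x = p (-1) - p' (-1) + prim (\<lambda>x. r y \<eta> x - r y' \<eta>' x) x"
        unfolding prim_diff[OF rL x] by (metis add_diff_add)
    qed
    then have "norm (p x - p' x) \<le> C * D" using np nr by (simp add: C_def algebra_simps)
    then show ?thesis by (simp add: D_def)
  qed
  moreover have "C \<ge> 0" using a assms K E_nonneg stab_nonneg[OF assms] by (simp add: C_def)
  ultimately show ?thesis by blast
qed

end

section \<open>Existence\<close>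

text \<open>The radial retraction onto the ball of radius R, used to turn a locally Lipschitz vector
  field into a globally Lipschitz one.\<close>

definition retr :: "real \<Rightarrow> 'a::real_normed_vector \<Rightarrow> 'a" where
  "retr R e = (R / max R (norm e)) *\<^sub>R e"

lemma retr_id: "R > 0 \<Longrightarrow> norm e \<le> R \<Longrightarrow> retr R e = e"
  by (simp add: retr_def max_def)

lemma retr_norm: "R > 0 \<Longrightarrow> norm (retr R e) \<le> R"
proof -
  assume R: "R > 0"
  have "R * norm e \<le> R * max R (norm e)" using R by (intro mult_left_mono) auto
  then show ?thesis using R by (simp add: retr_def divide_simps max_def)
qed

text \<open>In a general normed space the constant 2 splits as one for moving the point at fixed
  scale R / m and one for the change of scale.\<close>

lemma retr_lip:
  assumes R: "R > 0"
  shows "norm (retr R e - retr R e') \<le> 2 * norm (e - e')"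
proof -
  define m where "m = max R (norm e)"
  define m' where "m' = max R (norm e')"
  have m: "m \<ge> R" "m' \<ge> R" "norm e' \<le> m'" "m > 0" "m' > 0" using R by (auto simp: m_def m'_def)
  have mm: "\<bar>m' - m\<bar> \<le> norm (e - e')"
    using norm_triangle_ineq3[of e e'] by (auto simp: m_def m'_def max_def abs_if split: if_splits)
  have "retr R e - retr R e' = (R / m) *\<^sub>R (e - e') + (R / m - R / m') *\<^sub>R e'"
    by (simp add: retr_def m_def m'_def algebra_simps)
  then have "norm (retr R e - retr R e') \<le> norm ((R / m) *\<^sub>R (e - e')) + norm ((R / m - R / m') *\<^sub>R e')"
    by (metis norm_triangle_ineq)
  also have "norm ((R / m) *\<^sub>R (e - e')) \<le> 1 * norm (e - e')"
    unfolding norm_scaleR using m R by (intro mult_right_mono) auto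
  also have "norm ((R / m - R / m') *\<^sub>R e') \<le> norm (e - e')"
  proof -
    have "R / m - R / m' = (R / m) * ((m' - m) / m')" using m by (simp add: field_simps)
    then have "norm ((R / m - R / m') *\<^sub>R e') = (R / m) * (\<bar>m' - m\<bar> * (norm e' / m'))"
      using m R by (simp add: abs_mult)
    also have "\<dots> \<le> 1 * (\<bar>m' - m\<bar> * 1)" using m R by (intro mult_mono) auto
    finally show ?thesis using mm by simp
  qed
  finally show ?thesis by simp
qed

text \<open>The field is truncated at radius R + 1, one above the a priori bound, and the truncated
  equation is solved on [0,T]. Up to the first time at which the norm reaches R + 1 the truncation
  is inactive, so the a priori bound gives norm at most R there: that time does not exist. For this
  the a priori hypothesis must cover every shorter interval [0,\<tau>].\<close>

lemma global_ode:
  fixes F :: "'a::banach \<Rightarrow> 'a"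
  assumes T: "T \<ge> 0" and e0: "norm e0 \<le> R"
    and lip: "\<And>r. r > 0 \<Longrightarrow> \<exists>C\<ge>0. \<forall>e e'. norm e \<le> r \<longrightarrow> norm e' \<le> r \<longrightarrow> norm (F e - F e') \<le> C * norm (e - e')"
    and apriori: "\<And>\<tau> e t. \<lbrakk>0 \<le> \<tau>; \<tau> \<le> T; e 0 = e0;
        \<And>t. t \<in> {0..\<tau>} \<Longrightarrow> (e has_vector_derivative F (e t)) (at t within {0..\<tau>}); t \<in> {0..\<tau>}\<rbrakk> \<Longrightarrow> norm (e t) \<le> R"
  obtains e where "e 0 = e0" "\<And>t. t \<in> {0..T} \<Longrightarrow> (e has_vector_derivative F (e t)) (at t within {0..T})"
    "\<And>t. t \<in> {0..T} \<Longrightarrow> norm (e t) \<le> R"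
proof -
  define R' where "R' = R + 1"
  have R0: "R \<ge> 0" using e0 norm_ge_zero order_trans by blast
  have R': "R' > 0" using R0 by (simp add: R'_def)
  obtain C where C: "C \<ge> 0" "\<And>e e'. norm e \<le> R' \<Longrightarrow> norm e' \<le> R' \<Longrightarrow> norm (F e - F e') \<le> C * norm (e - e')"
    using lip[OF R'] by blast
  obtain e where e: "e 0 = e0" "\<And>t. t \<in> {0..T} \<Longrightarrow> (e has_vector_derivative F (retr R' (e t))) (at t within {0..T})"
  proof (rule picard[of 0 T "C * 2" "\<lambda>t e. F (retr R' e)" e0])
    fix t y z
    have "norm (F (retr R' y) - F (retr R' z)) \<le> C * norm (retr R' y - retr R' z)" by (intro C retr_norm R')
    also have "\<dots> \<le> C * (2 * norm (y - z))" by (intro mult_left_mono retr_lip R' C)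
    finally show "norm (F (retr R' y) - F (retr R' z)) \<le> C * 2 * norm (y - z)" by simp
  qed (use T C in auto)
  have small: "norm (e t) < R'" if t: "t \<in> {0..T}" for t
  proof (rule ccontr)
    assume "\<not> norm (e t) < R'"
    define S where "S = {s \<in> {0..T}. norm (e s) \<in> {R'..}}"
    have ce: "continuous_on {0..T} (\<lambda>s. norm (e s))"
      using e(2) by (intro continuous_on_norm) (meson continuous_on_eq_continuous_within has_vector_derivative_continuous)
    have clS: "closed S"
      using continuous_closed_preimage[OF ce closed_atLeastAtMost closed_atLeast[of R']]
      by (simp add: S_def vimage_def Int_def)
    have neS: "S \<noteq> {}" using t \<open>\<not> norm (e t) < R'\<close> by (auto simp: S_def intro!: exI[of _ t])
    have bdS: "bdd_below S" by (rule bdd_belowI[of _ 0]) (auto simp: S_def)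
    define u where "u = Inf S"
    have uS: "u \<in> S" unfolding u_def by (rule closed_contains_Inf[OF neS bdS clS])
    have less: "norm (e s) < R'" if "0 \<le> s" "s < u" for s
    proof (rule ccontr)
      assume "\<not> norm (e s) < R'"
      then have "s \<in> S" using that uS by (auto simp: S_def)
      then have "u \<le> s" unfolding u_def by (rule cInf_lower[OF _ bdS])
      then show False using that by simp
    qed
    have u: "0 \<le> u" "u \<le> T" using uS by (auto simp: S_def)
    have le: "norm (e s) \<le> R'" if s: "s \<in> {0..u}" for s
    proof (cases "s = u")
      case True
      show ?thesis
      proof (cases "u = 0")
        case True
        then show ?thesis using e(1) e0 \<open>s = u\<close> by (simp add: R'_def)
      next
        case False
        then have u0: "u > 0" using u by simp
        have fm: "at_left u \<le> at u within {0..T}"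
          using at_le[of "{0..u}" "{0..T}" u] u u0 by (simp add: at_within_Icc_at_left)
        have "((\<lambda>s. norm (e s)) \<longlongrightarrow> norm (e u)) (at_left u)"
          using ce u fm unfolding continuous_on_def by (auto intro: tendsto_mono)
        moreover have "\<forall>\<^sub>F s in at_left u. norm (e s) \<le> R'"
          by (rule eventually_at_leftI[OF _ u0]) (auto intro!: less_imp_le less)
        ultimately have "norm (e u) \<le> R'" by (rule tendsto_upperbound) simp
        then show ?thesis using \<open>s = u\<close> by simp
      qed
    next
      case False
      then show ?thesis using less[of s] s by simp
    qed
    have "norm (e u) \<le> R"
    proof (rule apriori[where e=e and \<tau>=u and t=u, OF u e(1)])
      fix s assume s: "s \<in> {0..u}"
      then have "(e has_vector_derivative F (retr R' (e s))) (at s within {0..T})" using e(2)[of s] u by auto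
      then have "(e has_vector_derivative F (retr R' (e s))) (at s within {0..u})"
        by (rule has_vector_derivative_within_subset) (use u in auto)
      then show "(e has_vector_derivative F (e s)) (at s within {0..u})" using le[OF s] R' by (simp add: retr_id)
    qed (use u in auto)
    then show False using uS by (simp add: S_def R'_def)
  qed
  have d: "(e has_vector_derivative F (e t)) (at t within {0..T})" if "t \<in> {0..T}" for t
    using e(2)[OF that] small[OF that] R' by (simp add: retr_id)
  show thesis
    by (rule that[OF e(1) d]) (auto intro!: apriori[where e=e and \<tau>=T, OF T order_refl e(1) d])
qed

lemma has_vector_derivative_quotient:
  fixes e :: "real \<Rightarrow> 'a::real_normed_vector"
  assumes "(e has_vector_derivative e') (at t within S)"
  shows "((\<lambda>s. norm ((1 / (s - t)) *\<^sub>R (e s - e t) - e')) \<longlongrightarrow> 0) (at t within S)"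
proof -
  have "((\<lambda>s. norm (e s - e t - (s - t) *\<^sub>R e') / norm (s - t)) \<longlongrightarrow> 0) (at t within S)"
    using assms unfolding has_vector_derivative_def has_derivative_iff_norm by blast
  then show ?thesis
  proof (rule Lim_transform_eventually)
    show "\<forall>\<^sub>F s in at t within S. norm (e s - e t - (s - t) *\<^sub>R e') / norm (s - t) = norm ((1 / (s - t)) *\<^sub>R (e s - e t) - e')"
      unfolding eventually_at_filter
    proof (intro always_eventually allI impI)
      fix s assume "s \<noteq> t" "s \<in> S"
      then have "(1 / (s - t)) *\<^sub>R (e s - e t) - e' = (1 / (s - t)) *\<^sub>R (e s - e t - (s - t) *\<^sub>R e')"
        by (simp add: scaleR_diff_right)
      then show "norm (e s - e t - (s - t) *\<^sub>R e') / norm (s - t) = norm ((1 / (s - t)) *\<^sub>R (e s - e t) - e')"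
        by simp
    qed
  qed
qed

section \<open>The state space of matrix multipliers and offsets\<close>

definition clampJ :: "real \<Rightarrow> real" where "clampJ x = max (-1) (min 1 x)"

lemma clampJ: "clampJ x \<in> {-1..1}" "x \<in> {-1..1} \<Longrightarrow> clampJ x = x"
  by (auto simp: clampJ_def)

lemma bcontfun_clampJ:
  fixes g :: "real \<Rightarrow> 'a::real_normed_vector"
  assumes "continuous_on {-1..1} g"
  shows "apply_bcontfun (Bcontfun (\<lambda>x. g (clampJ x))) x = g (clampJ x)"
proof -
  have c: "continuous_on UNIV (\<lambda>x. g (clampJ x))"
  proof (rule continuous_on_compose2[OF assms])
    show "continuous_on UNIV clampJ" unfolding clampJ_def by (intro continuous_intros)
  qed (use clampJ in auto)
  obtain K where K: "\<And>s. s \<in> {-1..1} \<Longrightarrow> norm (g s) \<le> K"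
    using compact_imp_bounded[OF compact_continuous_image[OF assms compact_Icc]]
    by (auto simp: bounded_iff simp del: atLeastAtMost_iff)
  have "(\<lambda>x. g (clampJ x)) \<in> bcontfun" by (rule bcontfun_normI[OF c, of K]) (rule K[OF clampJ(1)])
  then show ?thesis by (simp add: Bcontfun_inverse)
qed

instance bcontfun :: (metric_space, banach) banach ..

type_synonym 'd state = "real \<Rightarrow>\<^sub>C ((real^'d^'d) \<times> (real^'d))"

text \<open>A state e = (P, r) represents the function P(x) y_0(x) + r(x). In these coordinates the right-hand
  side is locally Lipschitz for the supremum norm, although y itself is only square integrable.\<close>

definition Yop :: "(real \<Rightarrow> real^'d) \<Rightarrow> ('d::finite) state \<Rightarrow> real \<Rightarrow> real^'d" where
  "Yop y0 e x = fst (apply_bcontfun e x) *v y0 x + snd (apply_bcontfun e x)"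

lemma Yop_L2v:
  fixes e :: "('d::finite) state"
  assumes "L2v y0" shows "L2v (Yop y0 e)"
  unfolding Yop_def[abs_def]
  by (intro L2v_add L2v_continuous L2v_continuous_mult[OF bounded_bilinear_matrix_vector] continuous_intros assms
      continuous_on_apply_bcontfun)

lemma Yop_linear: "Yop y0 (e + e') x = Yop y0 e x + Yop y0 e' x" "Yop y0 (r *\<^sub>R e) x = r *\<^sub>R Yop y0 e x"
  "Yop y0 (e - e') x = Yop y0 e x - Yop y0 e' x"
  by (simp_all add: Yop_def plus_bcontfun.rep_eq minus_bcontfun.rep_eq scaleR_bcontfun.rep_eq
      matrix_vector_mult_add_rdistrib matrix_vector_mult_diff_rdistrib algebra_simps
      bounded_bilinear.scaleR_left[OF bounded_bilinear_matrix_vector])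

lemma Yop_pointwise: "norm (Yop y0 e x) \<le> norm (e :: ('d::finite) state) * (norm (y0 x) + 1)"
proof -
  have "norm (Yop y0 e x) \<le> norm (fst (apply_bcontfun e x)) * norm (y0 x) + norm (snd (apply_bcontfun e x))"
    unfolding Yop_def by (rule norm_triangle_le) (rule add_right_mono[OF norm_matrix_vector])
  also have "\<dots> \<le> norm e * norm (y0 x) + norm e"
    by (intro add_mono mult_right_mono norm_ge_zero order_trans[OF norm_fst_snd_le(1) norm_bounded] order_trans[OF norm_fst_snd_le(2) norm_bounded])
  finally show ?thesis by (simp add: algebra_simps)
qed

text \<open>The L^2 norm of y is controlled by the supremum norm of the state, with factor the norm
  of |y_0| + 1. This links the estimates in L^2 to the state space.\<close>

lemma Yop_n2:
  fixes e :: "('d::finite) state"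
  assumes y0: "L2v y0" shows "n2 (Yop y0 e) \<le> norm e * (n2 y0 + 2)"
proof -
  have one: "L2v (\<lambda>x::real. 1::real)" by (rule L2v_continuous) simp
  have L: "L2v (\<lambda>x. norm (y0 x) + 1)" by (rule L2v_add[OF L2v_norm[OF y0] one])
  have "n2 (Yop y0 e) \<le> norm e * n2 (\<lambda>x. norm (y0 x) + 1)"
    by (rule n2_mono[OF Yop_L2v[OF y0] L]) (use Yop_pointwise[of y0 e] in auto)
  also have "n2 (\<lambda>x. norm (y0 x) + 1) \<le> n2 (\<lambda>x. norm (y0 x)) + n2 (\<lambda>x::real. 1::real)"
    by (rule n2_add[OF L2v_norm[OF y0] one])
  also have "n2 (\<lambda>x::real. 1::real) \<le> 2" using n2_bound[OF one, of 1] by simp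
  finally show ?thesis by (simp add: mult_left_mono)
qed

lemma Yop_n2_diff:
  fixes e :: "('d::finite) state"
  assumes y0: "L2v y0" shows "n2 (\<lambda>x. Yop y0 e x - Yop y0 e' x) \<le> norm (e - e') * (n2 y0 + 2)"
  using Yop_n2[OF y0, of "e - e'"] by (simp add: Yop_linear(3)[abs_def])

context coeffs
begin

text \<open>A choice of (\<eta>, p) for each y; by \<open>ell_p_lip\<close> the component p, and
  with it \<eta>, is unique on [-1,1].\<close>

definition ellS :: "(real \<Rightarrow> real^'d) \<Rightarrow> (real \<Rightarrow> real^'d) \<times> (real \<Rightarrow> real^'d)" where
  "ellS y = (SOME z. ell y (fst z) (snd z))"

lemma ellS: "L2v y \<Longrightarrow> ell y (fst (ellS y)) (snd (ellS y))"
proof -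
  assume "L2v y"
  then obtain \<eta> p where "ell y \<eta> p" by (rule ell_exists)
  then have "\<exists>z. ell y (fst z) (snd z)" by auto
  then show ?thesis unfolding ellS_def by (rule someI_ex)
qed

definition Mc :: "real^'d \<Rightarrow> real^'d^'d" where "Mc w = N w ** B w"

lemma Mc_bound: "norm (Mc w) \<le> KN * K"
  unfolding Mc_def by (rule order_trans[OF norm_matrix_matrix]) (intro mult_mono N_bound B_bd KN_nonneg norm_ge_zero)

definition LM :: real where "LM = KN * K * KN * K + KN * K"

lemma LM_nonneg: "LM \<ge> 0" using K KN_nonneg by (simp add: LM_def)

lemma Mc_lip: "norm (Mc w - Mc w') \<le> LM * norm (w - w')"
proof -
  have "Mc w - Mc w' = (N w - N w') ** B w + N w' ** (B w - B w')"
    unfolding Mc_def bounded_bilinear.diff_left[OF bounded_bilinear_matrix_matrix] bounded_bilinear.diff_right[OF bounded_bilinear_matrix_matrix]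
    by simp
  then have "norm (Mc w - Mc w') \<le> norm ((N w - N w') ** B w) + norm (N w' ** (B w - B w'))" by (simp add: norm_triangle_ineq)
  also have "\<dots> \<le> (KN * K * KN * norm (w - w')) * K + KN * (K * norm (w - w'))"
    by (intro add_mono order_trans[OF norm_matrix_matrix] mult_mono N_lip B_bd N_bound B_lip norm_ge_zero KN_nonneg mult_nonneg_nonneg K)
  finally show ?thesis by (simp add: LM_def algebra_simps)
qed

lemma Mc_continuous: "continuous_on S u \<Longrightarrow> continuous_on S (\<lambda>x. Mc (u x))"
  unfolding Mc_def by (intro bounded_bilinear.continuous_on[OF bounded_bilinear_matrix_matrix] N_cont_comp cont_comp)

text \<open>The pointwise equation y_t = \<open>Mc\<close> y + N (p - G) distributed over y = P y_0
  + r: P is multiplied by Mc, and r receives everything that does not contain y_0. That the result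
  represents \<eta> is \<open>Yop_Fop\<close>.\<close>

definition rhs :: "(real \<Rightarrow> real^'d) \<Rightarrow> 'd state \<Rightarrow> real \<Rightarrow> (real^'d^'d) \<times> (real^'d)" where
  "rhs y0 e x = (let y = Yop y0 e; w = prim y x in
     (Mc w ** fst (apply_bcontfun e x), Mc w *v snd (apply_bcontfun e x) + N w *v (snd (ellS y) x - G w)))"

lemma rhs_continuous:
  assumes y0: "L2v y0" shows "continuous_on {-1..1} (rhs y0 e)"
proof -
  note c = prim_continuous[OF Yop_L2v[OF y0], of e]
  show ?thesis unfolding rhs_def[abs_def] Let_def
    by (intro continuous_intros bounded_bilinear.continuous_on[OF bounded_bilinear_matrix_vector]
        bounded_bilinear.continuous_on[OF bounded_bilinear_matrix_matrix] Mc_continuous N_cont_comp cont_comp c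
        continuous_on_apply_bcontfun ellD(1)[OF ellS[OF Yop_L2v[OF y0]]])
qed

text \<open>Bounded continuous functions on the whole line replace those on [-1,1]; outside the interval
  they are extended by their boundary values.\<close>

definition Fop :: "(real \<Rightarrow> real^'d) \<Rightarrow> 'd state \<Rightarrow> 'd state" where
  "Fop y0 e = Bcontfun (\<lambda>x. rhs y0 e (clampJ x))"

lemma Fop_apply: "L2v y0 \<Longrightarrow> apply_bcontfun (Fop y0 e) x = rhs y0 e (clampJ x)"
  unfolding Fop_def by (rule bcontfun_clampJ[OF rhs_continuous])

lemma Yop_Fop:
  assumes y0: "L2v y0" and x: "x \<in> {-1..1}"
  shows "Yop y0 (Fop y0 e) x = fst (ellS (Yop y0 e)) x"
proof -
  note e = ellD(5)[OF ellS[OF Yop_L2v[OF y0]] x, of e]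
  define w where "w = prim (Yop y0 e) x"
  have "Yop y0 (Fop y0 e) x = (Mc w ** fst (apply_bcontfun e x)) *v y0 x + (Mc w *v snd (apply_bcontfun e x) + N w *v (snd (ellS (Yop y0 e)) x - G w))"
    unfolding Yop_def[of _ "Fop y0 e"] Fop_apply[OF y0] clampJ(2)[OF x] rhs_def Let_def w_def by simp
  also have "\<dots> = N w *v (B w *v Yop y0 e x - G w + snd (ellS (Yop y0 e)) x)"
    by (simp add: Mc_def matrix_vector_mul_assoc[symmetric] Yop_def matrix_vector_right_distrib matrix_vector_mult_diff_distrib)
  finally show ?thesis unfolding e by (simp add: flux_def w_def)
qed

text \<open>Once p is bounded the field grows linearly in the state, with coefficients that do not
  involve y_0.\<close>

lemma Fop_bound:
  assumes y0: "L2v y0" and p: "\<And>x. x \<in> {-1..1} \<Longrightarrow> norm (snd (ellS (Yop y0 e)) x) \<le> C"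
  shows "norm (Fop y0 e) \<le> (2 * (KN * K)) * norm e + KN * (C + K)"
proof (rule norm_bound)
  fix x
  define c where "c = clampJ x"
  have c: "c \<in> {-1..1}" unfolding c_def by (rule clampJ)
  define w where "w = prim (Yop y0 e) c"
  have "norm (apply_bcontfun (Fop y0 e) x) \<le> norm (Mc w ** fst (apply_bcontfun e c)) + norm (Mc w *v snd (apply_bcontfun e c) + N w *v (snd (ellS (Yop y0 e)) c - G w))"
    unfolding Fop_apply[OF y0] rhs_def Let_def c_def[symmetric] w_def[symmetric] by (rule norm_Pair_le)
  also have "\<dots> \<le> (KN * K) * norm e + ((KN * K) * norm e + KN * (C + K))"
  proof (intro add_mono norm_triangle_le)
    show "norm (Mc w ** fst (apply_bcontfun e c)) \<le> KN * K * norm e"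
      by (rule order_trans[OF norm_matrix_matrix]) (intro mult_mono Mc_bound order_trans[OF norm_fst_snd_le(1) norm_bounded] norm_ge_zero mult_nonneg_nonneg KN_nonneg K)
    show "norm (Mc w *v snd (apply_bcontfun e c)) \<le> KN * K * norm e"
      by (rule order_trans[OF norm_matrix_vector]) (intro mult_mono Mc_bound order_trans[OF norm_fst_snd_le(2) norm_bounded] norm_ge_zero mult_nonneg_nonneg KN_nonneg K)
    show "norm (N w *v (snd (ellS (Yop y0 e)) c - G w)) \<le> KN * (C + K)"
      by (rule order_trans[OF norm_matrix_vector]) (intro mult_mono N_bound norm_ge_zero KN_nonneg order_trans[OF norm_triangle_ineq4] add_mono p c G_bd)
  qed
  finally show "norm (apply_bcontfun (Fop y0 e) x) \<le> (2 * (KN * K)) * norm e + KN * (C + K)" by (simp add: algebra_simps)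
qed

lemma bilinear_diff_bound:
  fixes prod :: "'a::real_normed_vector \<Rightarrow> 'b::real_normed_vector \<Rightarrow> 'c::real_normed_vector"
  assumes bb: "bounded_bilinear prod" and k: "\<And>a b. norm (prod a b) \<le> norm a * norm b"
    and b: "norm (a - a') \<le> da" "norm b \<le> mb" "norm a' \<le> ma" "norm (b - b') \<le> db"
  shows "norm (prod a b - prod a' b') \<le> da * mb + ma * db"
proof -
  have nn: "0 \<le> da" "0 \<le> mb" "0 \<le> ma" "0 \<le> db"
    using b norm_ge_zero order_trans by blast+
  have "prod a b - prod a' b' = prod (a - a') b + prod a' (b - b')"
    by (simp add: bounded_bilinear.diff_left[OF bb] bounded_bilinear.diff_right[OF bb])
  then have "norm (prod a b - prod a' b') \<le> norm (prod (a - a') b) + norm (prod a' (b - b'))" by (simp add: norm_triangle_ineq)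
  also have "\<dots> \<le> da * mb + ma * db"
    by (intro add_mono order_trans[OF k] mult_mono b nn norm_ge_zero)
  finally show ?thesis .
qed

text \<open>Apart from the state itself the field depends on e only through the values of prim y and
  p, both of which are Lipschitz in the supremum norm with respect to the L^2 norm of y, hence with
  respect to e.\<close>

lemma Fop_lip:
  assumes y0: "L2v y0" and R: "R > 0"
  shows "\<exists>C\<ge>0. \<forall>e e'. norm e \<le> R \<longrightarrow> norm e' \<le> R \<longrightarrow> norm (Fop y0 e - Fop y0 e') \<le> C * norm (e - e')"
proof -
  define q where "q = n2 y0 + 2"
  have q: "q \<ge> 0" using n2_nonneg[of y0] by (simp add: q_def)
  define \<rho> where "\<rho> = R * q"
  have r: "\<rho> \<ge> 0" using R q by (simp add: \<rho>_def)
  obtain C1 where C1a: "0 \<le> C1" and C1b: "\<forall>y \<eta> p. L2v y \<longrightarrow> n2 y \<le> \<rho> \<longrightarrow> ell y \<eta> p \<longrightarrow> (\<forall>x\<in>{-1..1}. norm (p x) \<le> C1)"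
    using ell_p_bound[OF r] by blast
  note C1 = C1a C1b[rule_format]
  obtain C2 where C2a: "0 \<le> C2" and C2b: "\<forall>y \<eta> p y' \<eta>' p'. L2v y \<longrightarrow> n2 y \<le> \<rho> \<longrightarrow> ell y \<eta> p \<longrightarrow> L2v y' \<longrightarrow> n2 y' \<le> \<rho> \<longrightarrow> ell y' \<eta>' p' \<longrightarrow>
     (\<forall>x\<in>{-1..1}. norm (p x - p' x) \<le> C2 * n2 (\<lambda>x. y x - y' x))"
    using ell_p_lip[OF r] by blast
  note C2 = C2a C2b[rule_format]
  define a where "a = LM * (2 * q) * R + KN * K"
  define b where "b = (KN * K * KN * (2 * q)) * (C1 + K) + KN * (C2 * q + K * (2 * q))"
  have ab: "a \<ge> 0" "b \<ge> 0" using K KN_nonneg LM_nonneg q R C1(1) C2(1) by (auto simp: a_def b_def)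
  have "norm (Fop y0 e - Fop y0 e') \<le> (2 * a + b) * norm (e - e')" if e: "norm e \<le> R" and e': "norm e' \<le> R" for e e'
  proof (rule norm_bound)
    fix x
    define c where "c = clampJ x"
    have c: "c \<in> {-1..1}" unfolding c_def by (rule clampJ)
    define d where "d = norm (e - e')"
    have d0: "d \<ge> 0" by (simp add: d_def)
    define y where "y = Yop y0 e"
    define y' where "y' = Yop y0 e'"
    have yL: "L2v y" "L2v y'" unfolding y_def y'_def by (rule Yop_L2v[OF y0])+
    have ny: "n2 y \<le> \<rho>" "n2 y' \<le> \<rho>" unfolding y_def y'_def \<rho>_def
      using Yop_n2[OF y0, of e] Yop_n2[OF y0, of e'] mult_right_mono[OF e q] mult_right_mono[OF e' q] unfolding q_def by linarith+
    have D: "n2 (\<lambda>x. y x - y' x) \<le> d * q" unfolding y_def y'_def d_def q_def by (rule Yop_n2_diff[OF y0])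
    define w where "w = prim y c"
    define w' where "w' = prim y' c"
    have ww: "norm (w - w') \<le> 2 * q * d"
    proof -
      have "norm (w - w') \<le> 2 * n2 (\<lambda>x. y x - y' x)"
        using prim_bound[OF L2v_diff[OF yL] c] prim_diff[OF yL c] by (simp add: w_def w'_def)
      then have "norm (w - w') \<le> 2 * (d * q)" using D by linarith
      then show ?thesis by (simp add: ac_simps)
    qed
    define p where "p = snd (ellS y) c"
    define p' where "p' = snd (ellS y') c"
    have pp: "norm (p - p') \<le> C2 * q * d"
    proof -
      have "norm (p - p') \<le> C2 * n2 (\<lambda>x. y x - y' x)"
        unfolding p_def p'_def by (rule C2(2)[OF yL(1) ny(1) ellS[OF yL(1)] yL(2) ny(2) ellS[OF yL(2)] c])
      also have "\<dots> \<le> C2 * (d * q)" by (rule mult_left_mono[OF D C2(1)])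
      finally show ?thesis by (simp add: ac_simps)
    qed
    have pb: "norm p \<le> C1" unfolding p_def by (rule C1(2)[OF yL(1) ny(1) ellS[OF yL(1)] c])
    have Mw: "norm (Mc w - Mc w') \<le> LM * (2 * q) * d"
      using order_trans[OF Mc_lip mult_left_mono[OF ww LM_nonneg]] by (simp add: ac_simps)
    have Nw: "norm (N w - N w') \<le> KN * K * KN * (2 * q) * d"
    proof -
      have "0 \<le> KN * K * KN" using K KN_nonneg by simp
      from order_trans[OF N_lip mult_left_mono[OF ww this]] show ?thesis by (simp add: ac_simps)
    qed
    have Gw: "norm ((p - G w) - (p' - G w')) \<le> C2 * q * d + K * (2 * q) * d"
    proof -
      have "norm ((p - G w) - (p' - G w')) \<le> norm (p - p') + norm (G w - G w')"
        using norm_triangle_ineq4[of "p - p'" "G w - G w'"] by (simp add: algebra_simps)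
      also have "norm (G w - G w') \<le> K * (2 * q * d)" by (rule order_trans[OF G_lip mult_left_mono[OF ww K]])
      finally show ?thesis using pp by (simp add: ac_simps)
    qed
    have pG: "norm (p - G w) \<le> C1 + K" by (rule order_trans[OF norm_triangle_ineq4 add_mono[OF pb G_bd]])
    have de: "norm (apply_bcontfun e c - apply_bcontfun e' c) \<le> d"
      using norm_bounded[of "e - e'" c] by (simp add: d_def minus_bcontfun.rep_eq)
    have dfst: "norm (fst (apply_bcontfun e c) - fst (apply_bcontfun e' c)) \<le> d"
      using norm_fst_snd_le(1)[of "apply_bcontfun e c - apply_bcontfun e' c"] de by simp
    have dsnd: "norm (snd (apply_bcontfun e c) - snd (apply_bcontfun e' c)) \<le> d"
      using norm_fst_snd_le(2)[of "apply_bcontfun e c - apply_bcontfun e' c"] de by simp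
    have bfst: "norm (fst (apply_bcontfun e c)) \<le> R" "norm (snd (apply_bcontfun e c)) \<le> R"
      using order_trans[OF norm_fst_snd_le(1) order_trans[OF norm_bounded e]] order_trans[OF norm_fst_snd_le(2) order_trans[OF norm_bounded e]] by auto
    have "apply_bcontfun (Fop y0 e - Fop y0 e') x = rhs y0 e c - rhs y0 e' c"
      by (simp add: minus_bcontfun.rep_eq Fop_apply[OF y0] c_def)
    also have "\<dots> = (Mc w ** fst (apply_bcontfun e c) - Mc w' ** fst (apply_bcontfun e' c),
       (Mc w *v snd (apply_bcontfun e c) - Mc w' *v snd (apply_bcontfun e' c)) + (N w *v (p - G w) - N w' *v (p' - G w')))"
      unfolding rhs_def Let_def y_def[symmetric] y'_def[symmetric] w_def[symmetric] w'_def[symmetric] p_def[symmetric] p'_def[symmetric]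
      by simp
    finally have eq: "apply_bcontfun (Fop y0 e - Fop y0 e') x = \<dots>" .
    have "norm (apply_bcontfun (Fop y0 e - Fop y0 e') x) \<le> norm (Mc w ** fst (apply_bcontfun e c) - Mc w' ** fst (apply_bcontfun e' c)) +
       norm ((Mc w *v snd (apply_bcontfun e c) - Mc w' *v snd (apply_bcontfun e' c)) + (N w *v (p - G w) - N w' *v (p' - G w')))"
      unfolding eq by (rule norm_Pair_le)
    also have "\<dots> \<le> ((LM * (2 * q) * d) * R + (KN * K) * d) + (((LM * (2 * q) * d) * R + (KN * K) * d) +
       ((KN * K * KN * (2 * q) * d) * (C1 + K) + KN * (C2 * q * d + K * (2 * q) * d)))"
      by (intro add_mono norm_triangle_le bilinear_diff_bound[OF bounded_bilinear_matrix_matrix norm_matrix_matrix]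
          bilinear_diff_bound[OF bounded_bilinear_matrix_vector norm_matrix_vector] Mw Nw Gw pG dfst dsnd bfst Mc_bound N_bound)
    also have "\<dots> = (2 * a + b) * d" by (simp add: a_def b_def algebra_simps)
    finally show "norm (apply_bcontfun (Fop y0 e - Fop y0 e') x) \<le> (2 * a + b) * norm (e - e')" by (simp add: d_def)
  qed
  then show ?thesis using ab by (intro exI[of _ "2 * a + b"]) auto
qed

text \<open>P is the identity and r is zero, so this state represents y_0 whatever y_0 is.\<close>

definition e0 :: "'d state" where "e0 = const_bcontfun (mat 1, 0)"

lemma Yop_e0: "Yop y0 e0 x = y0 x"
  by (simp add: Yop_def e0_def const_bcontfun.rep_eq)

lemma bounded_linear_prim_Yop:
  fixes y0 :: "real \<Rightarrow> real^'d"
  assumes y0: "L2v y0" and x: "x \<in> {-1..1}"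
  shows "bounded_linear (\<lambda>e. prim (Yop y0 e) x)"
proof (rule bounded_linear_intro[where K="2 * (n2 y0 + 2)"])
  fix e e' :: "'d state" and r :: real
  have "Yop y0 (e + e') = (\<lambda>x. Yop y0 e x + Yop y0 e' x)" by (rule ext) (rule Yop_linear)
  then show "prim (Yop y0 (e + e')) x = prim (Yop y0 e) x + prim (Yop y0 e') x"
    using prim_add[OF Yop_L2v[OF y0] Yop_L2v[OF y0] x] by simp
  have "Yop y0 (r *\<^sub>R e) = (\<lambda>x. r *\<^sub>R Yop y0 e x)" by (rule ext) (rule Yop_linear)
  then show "prim (Yop y0 (r *\<^sub>R e)) x = r *\<^sub>R prim (Yop y0 e) x" by (simp add: prim_scaleR)
  show "norm (prim (Yop y0 e) x) \<le> norm e * (2 * (n2 y0 + 2))"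
    using order_trans[OF prim_bound[OF Yop_L2v[OF y0] x, of e] mult_left_mono[OF Yop_n2[OF y0, of e], of 2]]
    by (simp only: mult.left_commute)
qed

lemma state_solution:
  assumes y0: "L2v y0" "prim y0 1 = 0" and e0: "e 0 = e0"
    and d: "\<And>t. t \<in> {0..\<tau>} \<Longrightarrow> (e has_vector_derivative Fop y0 (e t)) (at t within {0..\<tau>})"
  shows "sol \<tau> (\<lambda>t. Yop y0 (e t)) (\<lambda>t. fst (ellS (Yop y0 (e t))))"
proof -
  define y where "y = (\<lambda>t. Yop y0 (e t))"
  define \<eta> where "\<eta> = (\<lambda>t. fst (ellS (Yop y0 (e t))))"
  have yL: "L2v (y t)" for t unfolding y_def by (rule Yop_L2v[OF y0(1)])
  have E: "ell (y t) (\<eta> t) (snd (ellS (y t)))" for t unfolding \<eta>_def y_def by (rule ellS[OF Yop_L2v[OF y0(1)]])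
  define q where "q = n2 y0 + 2"
  have q: "q \<ge> 0" using n2_nonneg[of y0] by (simp add: q_def)
  have c: "((\<lambda>s. n2 (\<lambda>x. y s x - y t x)) \<longlongrightarrow> 0) (at t within {0..\<tau>})" if t: "t \<in> {0..\<tau>}" for t
  proof -
    have "(e \<longlongrightarrow> e t) (at t within {0..\<tau>})"
      using has_vector_derivative_continuous[OF d[OF t]] by (simp add: continuous_within)
    then have "((\<lambda>s. norm (e s - e t)) \<longlongrightarrow> 0) (at t within {0..\<tau>})"
      by (intro tendsto_norm_zero) (rule LIM_zero)
    then have l: "((\<lambda>s. norm (e s - e t) * q) \<longlongrightarrow> 0) (at t within {0..\<tau>})" by (rule tendsto_mult_left_zero)
    show ?thesis
      by (rule Lim_null_comparison[OF _ l])
         (use Yop_n2_diff[OF y0(1)] in \<open>auto simp: n2_nonneg y_def q_def intro!: always_eventually\<close>)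
  qed
  have dd: "((\<lambda>s. n2 (\<lambda>x. (1 / (s - t)) *\<^sub>R (y s x - y t x) - \<eta> t x)) \<longlongrightarrow> 0) (at t within {0..\<tau>})" if t: "t \<in> {0..\<tau>}" for t
  proof -
    have l: "((\<lambda>s. norm ((1 / (s - t)) *\<^sub>R (e s - e t) - Fop y0 (e t)) * q) \<longlongrightarrow> 0) (at t within {0..\<tau>})"
      by (rule tendsto_mult_left_zero[OF has_vector_derivative_quotient[OF d[OF t]]])
    have "n2 (\<lambda>x. (1 / (s - t)) *\<^sub>R (y s x - y t x) - \<eta> t x) \<le> norm ((1 / (s - t)) *\<^sub>R (e s - e t) - Fop y0 (e t)) * q" for s
    proof -
      \<comment> \<open>By linearity of \<open>Yop\<close> and \<open>Yop_Fop\<close> the residual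
        in L^2 is the image of the residual in the state space.\<close>
      have "n2 (\<lambda>x. (1 / (s - t)) *\<^sub>R (y s x - y t x) - \<eta> t x) = n2 (Yop y0 ((1 / (s - t)) *\<^sub>R (e s - e t) - Fop y0 (e t)))"
        by (rule n2_cong) (simp only: Yop_linear Yop_Fop[OF y0(1)] y_def \<eta>_def)
      also have "\<dots> \<le> norm ((1 / (s - t)) *\<^sub>R (e s - e t) - Fop y0 (e t)) * q" unfolding q_def by (rule Yop_n2[OF y0(1)])
      finally show ?thesis .
    qed
    then show ?thesis
      by (intro Lim_null_comparison[OF _ l]) (auto simp: n2_nonneg intro!: always_eventually)
  qed
  \<comment> \<open>The mean value zero is preserved: prim (y t) 1 has time derivative prim \<eta> 1
    = 0 and vanishes initially. It is not built into the state space.\<close>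
  have b: "prim (y t) 1 = 0" if t: "t \<in> {0..\<tau>}" for t
  proof -
    have "((\<lambda>t. prim (Yop y0 (e t)) 1) has_vector_derivative prim (Yop y0 (Fop y0 (e s))) 1) (at s within {0..\<tau>})" if "s \<in> {0..\<tau>}" for s
      by (rule bounded_linear.has_vector_derivative[OF bounded_linear_prim_Yop[OF y0(1)] d[OF that]]) simp
    moreover have "prim (Yop y0 (Fop y0 (e s))) 1 = prim (\<eta> s) 1" for s
      unfolding prim_def by (rule Henstock_Kurzweil_Integration.integral_cong) (simp add: Yop_Fop[OF y0(1)] \<eta>_def)
    ultimately have z: "((\<lambda>t. prim (Yop y0 (e t)) 1) has_vector_derivative 0) (at s within {0..\<tau>})" if "s \<in> {0..\<tau>}" for s
      using that ellD(3)[OF E] by simp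
    have "\<exists>c. \<forall>s\<in>{0..\<tau>}. prim (Yop y0 (e s)) 1 = c"
      using has_vector_derivative_zero_constant[OF convex_real_interval(5) z] by metis
    then have "prim (Yop y0 (e t)) 1 = prim (Yop y0 (e 0)) 1" using t by fastforce
    also have "Yop y0 (e 0) = y0" unfolding e0 by (rule ext) (rule Yop_e0)
    finally show ?thesis using y0(2) by (simp add: y_def)
  qed
  have "sol \<tau> y \<eta>"
    unfolding sol_def using yL c dd b ellD(2,3)[OF E] ell_WF[OF yL E] by auto
  then show ?thesis by (simp add: y_def \<eta>_def)
qed

lemma growth_mono:
  assumes "0 \<le> t" "t \<le> T" "0 \<le> r" "r \<le> \<rho>"
  shows "growth t r \<le> growth T \<rho>"
  unfolding growth_def using assms E_nonneg
  by (intro mult_mono add_mono) (auto intro: mult_left_mono add_nonneg_nonneg)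

text \<open>Two levels: the state equation yields a solution in the sense of \<open>sol\<close>,
  whose L^2 norm is bounded by \<open>growth\<close> irrespective of the size of the state. This
  bounds p, so the field grows linearly and Gronwall's inequality bounds the state. R depends on the
  datum only through \<rho>.\<close>

lemma state_apriori:
  assumes T: "T \<ge> 0" and r: "\<rho> \<ge> 0"
  shows "\<exists>R. norm e0 \<le> R \<and> (\<forall>y0 \<tau> e. L2v y0 \<longrightarrow> prim y0 1 = 0 \<longrightarrow> n2 y0 \<le> \<rho> \<longrightarrow> 0 \<le> \<tau> \<longrightarrow> \<tau> \<le> T \<longrightarrow> e 0 = e0 \<longrightarrow>
      (\<forall>t\<in>{0..\<tau>}. (e has_vector_derivative Fop y0 (e t)) (at t within {0..\<tau>})) \<longrightarrow> (\<forall>t\<in>{0..\<tau>}. norm (e t) \<le> R))"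
proof -
  have g: "growth T \<rho> \<ge> 0" using T r E_nonneg by (simp add: growth_def)
  obtain C where Ca: "0 \<le> C" and Cb: "\<forall>y \<eta> p. L2v y \<longrightarrow> n2 y \<le> growth T \<rho> \<longrightarrow> ell y \<eta> p \<longrightarrow> (\<forall>x\<in>{-1..1}. norm (p x) \<le> C)"
    using ell_p_bound[OF g] by blast
  note C = Ca Cb[rule_format]
  define a where "a = 2 * (KN * K)"
  define c where "c = KN * (C + K)"
  have ac: "a \<ge> 0" "c \<ge> 0" using K KN_nonneg C(1) by (auto simp: a_def c_def)
  define R where "R = (norm e0 + c * T) * exp (a * T)"
  have "norm (e t) \<le> R" if h: "L2v y0" "prim y0 1 = 0" "n2 y0 \<le> \<rho>" "0 \<le> \<tau>" "\<tau> \<le> T" "e 0 = e0"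
      "\<And>t. t \<in> {0..\<tau>} \<Longrightarrow> (e has_vector_derivative Fop y0 (e t)) (at t within {0..\<tau>})" "t \<in> {0..\<tau>}" for y0 \<tau> e t
  proof -
    note s = state_solution[OF h(1,2,6,7)]
    have Y0: "Yop y0 (e 0) = y0" unfolding h(6) by (rule ext) (rule Yop_e0)
    have n: "n2 (Yop y0 (e t)) \<le> growth T \<rho>" if "t \<in> {0..\<tau>}" for t
      using order_trans[OF sol_bound[OF s that] growth_mono[OF h(4,5) n2_nonneg]] h(3) by (simp add: Y0)
    have "norm (e t) \<le> (norm (e 0) + c * t) * exp (a * t)"
    proof (rule ode_bound[OF h(7)])
      fix t assume t: "t \<in> {0..\<tau>}"
      show "norm (Fop y0 (e t)) \<le> a * norm (e t) + c"
        unfolding a_def c_def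
        by (rule Fop_bound[OF h(1)]) (rule C(2)[OF Yop_L2v[OF h(1)] n[OF t] ellS[OF Yop_L2v[OF h(1)]]])
    qed (use ac h in auto)
    also have "\<dots> \<le> R" unfolding R_def h(6) using h ac T
      by (intro mult_mono add_mono) (auto intro: mult_left_mono add_nonneg_nonneg)
    finally show ?thesis .
  qed
  moreover have "norm e0 \<le> R"
  proof -
    have "norm e0 * 1 \<le> (norm e0 + c * T) * exp (a * T)" using ac T by (intro mult_mono) auto
    then show ?thesis by (simp add: R_def)
  qed
  ultimately show ?thesis by blast
qed

text \<open>Besides solving the problem, this records what the regularity proof needs: the equation
  at every x, domination of y by the datum, and bounds for p, all with one constant for the data
  with norm at most \<rho>.\<close>

lemma existence:
  assumes T: "T > 0" and r: "\<rho> \<ge> 0"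
  shows "\<exists>C\<ge>0. \<forall>y0. L2v y0 \<longrightarrow> prim y0 1 = 0 \<longrightarrow> n2 y0 \<le> \<rho> \<longrightarrow> (\<exists>y \<eta> p. sol T y \<eta> \<and> y 0 = y0 \<and>
     (\<forall>t. L2v (y t) \<and> ell (y t) (\<eta> t) (p t)) \<and>
     (\<forall>t\<in>{0..T}. \<forall>x\<in>{-1..1}. norm (y t x) \<le> C * (norm (y0 x) + 1) \<and> norm (p t x) \<le> C \<and>
        ((\<lambda>t. y t x) has_vector_derivative \<eta> t x) (at t within {0..T})) \<and>
     (\<forall>t\<in>{0..T}. n2 (y t) \<le> C) \<and> (\<forall>x\<in>{-1..1}. continuous_on {0..T} (\<lambda>t. p t x)))"
proof -
  have T0: "T \<ge> 0" using T by simp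
  have g: "growth T \<rho> \<ge> 0" using T r E_nonneg by (simp add: growth_def)
  obtain R where Ra: "norm e0 \<le> R" and Rb: "\<forall>y0 \<tau> e. L2v y0 \<longrightarrow> prim y0 1 = 0 \<longrightarrow> n2 y0 \<le> \<rho> \<longrightarrow> 0 \<le> \<tau> \<longrightarrow> \<tau> \<le> T \<longrightarrow> e 0 = e0 \<longrightarrow>
      (\<forall>t\<in>{0..\<tau>}. (e has_vector_derivative Fop y0 (e t)) (at t within {0..\<tau>})) \<longrightarrow> (\<forall>t\<in>{0..\<tau>}. norm (e t) \<le> R)"
    using state_apriori[OF T0 r] by blast
  note R = Rb[rule_format] Ra
  obtain C1 where C1a: "0 \<le> C1" and C1b: "\<forall>y \<eta> p. L2v y \<longrightarrow> n2 y \<le> growth T \<rho> \<longrightarrow> ell y \<eta> p \<longrightarrow> (\<forall>x\<in>{-1..1}. norm (p x) \<le> C1)"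
    using ell_p_bound[OF g] by blast
  note C1 = C1a C1b[rule_format]
  obtain C2 where C2a: "0 \<le> C2" and C2b: "\<forall>y \<eta> p y' \<eta>' p'. L2v y \<longrightarrow> n2 y \<le> growth T \<rho> \<longrightarrow> ell y \<eta> p \<longrightarrow> L2v y' \<longrightarrow> n2 y' \<le> growth T \<rho> \<longrightarrow> ell y' \<eta>' p' \<longrightarrow>
     (\<forall>x\<in>{-1..1}. norm (p x - p' x) \<le> C2 * n2 (\<lambda>x. y x - y' x))"
    using ell_p_lip[OF g] by blast
  note C2 = C2a C2b[rule_format]
  define C where "C = R + C1 + growth T \<rho>"
  have R0: "R \<ge> 0" by (rule order_trans[OF norm_ge_zero R(2)])
  have "C \<ge> 0" using R0 C1(1) g by (simp add: C_def)
  moreover have "\<exists>y \<eta> p. sol T y \<eta> \<and> y 0 = y0 \<and>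
     (\<forall>t. L2v (y t) \<and> ell (y t) (\<eta> t) (p t)) \<and>
     (\<forall>t\<in>{0..T}. \<forall>x\<in>{-1..1}. norm (y t x) \<le> C * (norm (y0 x) + 1) \<and> norm (p t x) \<le> C \<and>
        ((\<lambda>t. y t x) has_vector_derivative \<eta> t x) (at t within {0..T})) \<and>
     (\<forall>t\<in>{0..T}. n2 (y t) \<le> C) \<and> (\<forall>x\<in>{-1..1}. continuous_on {0..T} (\<lambda>t. p t x))"
    if y0: "L2v y0" "prim y0 1 = 0" "n2 y0 \<le> \<rho>" for y0
  proof -
    obtain e where e: "e 0 = e0" "\<And>t. t \<in> {0..T} \<Longrightarrow> (e has_vector_derivative Fop y0 (e t)) (at t within {0..T})"
      "\<And>t. t \<in> {0..T} \<Longrightarrow> norm (e t) \<le> R"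
    proof (rule global_ode[OF T0 R(2)])
      show "\<exists>C\<ge>0. \<forall>e e'. norm e \<le> r \<longrightarrow> norm e' \<le> r \<longrightarrow> norm (Fop y0 e - Fop y0 e') \<le> C * norm (e - e')" if "r > 0" for r
        by (rule Fop_lip[OF y0(1) that])
    next
      fix \<tau> e t assume h: "0 \<le> \<tau>" "\<tau> \<le> T" "e 0 = e0" "\<And>t. t \<in> {0..\<tau>} \<Longrightarrow> (e has_vector_derivative Fop y0 (e t)) (at t within {0..\<tau>})" "t \<in> {0..\<tau>}"
      show "norm (e t) \<le> R" by (rule R(1)[OF y0 h])
    qed blast
    define y where "y = (\<lambda>t. Yop y0 (e t))"
    define \<eta> where "\<eta> = (\<lambda>t. fst (ellS (y t)))"
    define p where "p = (\<lambda>t. snd (ellS (y t)))"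
    have yL: "L2v (y t)" for t unfolding y_def by (rule Yop_L2v[OF y0(1)])
    have E: "ell (y t) (\<eta> t) (p t)" for t unfolding \<eta>_def p_def by (rule ellS[OF yL])
    have s: "sol T y \<eta>" unfolding \<eta>_def y_def by (rule state_solution[OF y0(1,2) e(1,2)])
    have Y0: "y 0 = y0" unfolding y_def e(1) by (rule ext) (rule Yop_e0)
    have n: "n2 (y t) \<le> growth T \<rho>" if "t \<in> {0..T}" for t
      by (rule order_trans[OF sol_bound[OF s that, unfolded Y0] growth_mono[OF T0 order_refl n2_nonneg y0(3)]])
    have pw: "norm (y t x) \<le> C * (norm (y0 x) + 1) \<and> norm (p t x) \<le> C \<and> ((\<lambda>t. y t x) has_vector_derivative \<eta> t x) (at t within {0..T})"
      if t: "t \<in> {0..T}" and x: "x \<in> {-1..1}" for t x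
    proof (intro conjI)
      have "norm (y t x) \<le> norm (e t) * (norm (y0 x) + 1)" unfolding y_def by (rule Yop_pointwise)
      also have "\<dots> \<le> C * (norm (y0 x) + 1)"
        using e(3)[OF t] C1(1) g by (intro mult_right_mono) (auto simp: C_def)
      finally show "norm (y t x) \<le> C * (norm (y0 x) + 1)" .
      show "norm (p t x) \<le> C" using C1(2)[OF yL n[OF t] E x] R0 g by (simp add: C_def)
      have bl: "bounded_linear (\<lambda>e. Yop y0 e x)"
        by (rule bounded_linear_intro[where K="norm (y0 x) + 1"]) (simp_all add: Yop_linear Yop_pointwise)
      show "((\<lambda>t. y t x) has_vector_derivative \<eta> t x) (at t within {0..T})"
        using bounded_linear.has_vector_derivative[OF bl e(2)[OF t]] by (simp add: y_def \<eta>_def Yop_Fop[OF y0(1) x])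
    qed
    \<comment> \<open>\<open>ell_p_lip\<close> converts norm continuity of y in time into continuity
      of p in time at each fixed x.\<close>
    have pc: "continuous_on {0..T} (\<lambda>t. p t x)" if x: "x \<in> {-1..1}" for x
      unfolding continuous_on_def
    proof
      fix t assume t: "t \<in> {0..T}"
      have "((\<lambda>s. n2 (\<lambda>x. y s x - y t x)) \<longlongrightarrow> 0) (at t within {0..T})" using s t by (simp add: sol_def)
      then have l: "((\<lambda>s. C2 * n2 (\<lambda>x. y s x - y t x)) \<longlongrightarrow> 0) (at t within {0..T})" by (rule tendsto_mult_right_zero)
      have "((\<lambda>s. p s x - p t x) \<longlongrightarrow> 0) (at t within {0..T})"
        by (rule Lim_null_comparison[OF _ l])
           (use C2(2)[OF yL n E yL n[OF t] E x] in \<open>auto simp: eventually_at_filter\<close>)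
      then show "((\<lambda>t. p t x) \<longlongrightarrow> p t x) (at t within {0..T})" by (rule LIM_zero_cancel)
    qed
    show ?thesis
    proof (intro exI conjI)
      show "sol T y \<eta>" by (rule s)
      show "y 0 = y0" by (rule Y0)
      show "\<forall>t. L2v (y t) \<and> ell (y t) (\<eta> t) (p t)" using yL E by blast
      show "\<forall>t\<in>{0..T}. \<forall>x\<in>{-1..1}. norm (y t x) \<le> C * (norm (y0 x) + 1) \<and> norm (p t x) \<le> C \<and>
        ((\<lambda>t. y t x) has_vector_derivative \<eta> t x) (at t within {0..T})" using pw by blast
      show "\<forall>t\<in>{0..T}. n2 (y t) \<le> C"
      proof
        fix t assume t: "t \<in> {0..T}"
        show "n2 (y t) \<le> C" using n[OF t] R0 C1(1) by (simp add: C_def)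
      qed
      show "\<forall>x\<in>{-1..1}. continuous_on {0..T} (\<lambda>t. p t x)" using pc by blast
    qed
  qed
  ultimately show ?thesis by blast
qed

end

section \<open>Families of functions with uniform bounds\<close>

text \<open>A function measurable in x and continuous in s is jointly measurable, as the pointwise
  limit of its time discretisations. Integration in s then preserves measurability in x.\<close>

lemma measurable_time_integral:
  fixes h :: "real \<Rightarrow> real \<Rightarrow> 'a::euclidean_space"
  assumes t: "t \<ge> 0" and m: "\<And>s. s \<in> {0..t} \<Longrightarrow> h s \<in> borel_measurable (lebesgue_on {-1..1})"
    and c: "\<And>x. x \<in> {-1..1} \<Longrightarrow> continuous_on {0..t} (\<lambda>s. h s x)"
  shows "(\<lambda>x. integral {0..t} (\<lambda>s. h s x)) \<in> borel_measurable (lebesgue_on {-1..1})"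
proof -
  let ?M = "lebesgue_on {-1..1::real}"
  define cl where "cl r = max 0 (min t r)" for r
  have cl: "cl r \<in> {0..t}" "r \<in> {0..t} \<Longrightarrow> cl r = r" for r using t by (auto simp: cl_def)
  \<comment> \<open>Time is rounded down to a multiple of 1/(n+1) and clamped to [0,t], so
    \<open>q n\<close> involves only countably many sections of h.\<close>
  define q where "q n z = h (cl (real_of_int \<lfloor>real (Suc n) * snd z\<rfloor> / real (Suc n))) (fst z)" for n :: nat and z :: "real \<times> real"
  have qm: "q n \<in> borel_measurable (?M \<Otimes>\<^sub>M lborel)" for n
    unfolding q_def
  proof (rule measurable_compose_countable[where f="\<lambda>k z. h (cl (real_of_int k / real (Suc n))) (fst z)" and g="\<lambda>z. \<lfloor>real (Suc n) * snd z\<rfloor>"])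
    show "(\<lambda>z. h (cl (real_of_int k / real (Suc n))) (fst z)) \<in> borel_measurable (?M \<Otimes>\<^sub>M lborel)" for k
      by (rule measurable_compose[OF measurable_fst m[OF cl(1)]])
    show "(\<lambda>z. \<lfloor>real (Suc n) * snd z\<rfloor>) \<in> ?M \<Otimes>\<^sub>M lborel \<rightarrow>\<^sub>M count_space UNIV" by measurable
  qed
  define F where "F z = indicator {0..t} (snd z) *\<^sub>R h (snd z) (fst z)" for z :: "real \<times> real"
  have "F \<in> borel_measurable (?M \<Otimes>\<^sub>M lborel)"
  proof (rule borel_measurable_LIMSEQ_metric[where f="\<lambda>n z. indicator {0..t} (snd z) *\<^sub>R q n z"])
    show "(\<lambda>z. indicator {0..t} (snd z) *\<^sub>R q n z) \<in> borel_measurable (?M \<Otimes>\<^sub>M lborel)" for n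
      using qm[of n] by measurable
    fix z :: "real \<times> real" assume "z \<in> space (?M \<Otimes>\<^sub>M lborel)"
    then have x: "fst z \<in> {-1..1}" by (auto simp: space_pair_measure)
    show "(\<lambda>n. indicator {0..t} (snd z) *\<^sub>R q n z) \<longlonglongrightarrow> F z"
    proof (cases "snd z \<in> {0..t}")
      case True
      define s where "s = snd z"
      have "(\<lambda>n. real_of_int \<lfloor>real (Suc n) * s\<rfloor> / real (Suc n)) \<longlonglongrightarrow> s"
      proof (rule LIM_zero_cancel, rule Lim_null_comparison[OF always_eventually LIMSEQ_inverse_real_of_nat], intro allI)
        fix n
        have "\<bar>real_of_int \<lfloor>real (Suc n) * s\<rfloor> - real (Suc n) * s\<bar> \<le> 1" by linarith
        then have "\<bar>real_of_int \<lfloor>real (Suc n) * s\<rfloor> - real (Suc n) * s\<bar> / real (Suc n) \<le> 1 / real (Suc n)"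
          by (rule divide_right_mono) simp
        moreover have "real_of_int \<lfloor>real (Suc n) * s\<rfloor> / real (Suc n) - s = (real_of_int \<lfloor>real (Suc n) * s\<rfloor> - real (Suc n) * s) / real (Suc n)"
          by (simp add: diff_divide_distrib)
        ultimately show "norm (real_of_int \<lfloor>real (Suc n) * s\<rfloor> / real (Suc n) - s) \<le> inverse (real (Suc n))"
          by (simp add: inverse_eq_divide)
      qed
      moreover have "continuous_on UNIV cl" unfolding cl_def[abs_def] by (intro continuous_intros)
      ultimately have "(\<lambda>n. cl (real_of_int \<lfloor>real (Suc n) * s\<rfloor> / real (Suc n))) \<longlonglongrightarrow> cl s"
        by (intro continuous_on_tendsto_compose[of UNIV cl]) auto
      moreover have "cl s = s" using cl(2) True by (simp add: s_def)
      ultimately have "(\<lambda>n. h (cl (real_of_int \<lfloor>real (Suc n) * s\<rfloor> / real (Suc n))) (fst z)) \<longlonglongrightarrow> h s (fst z)"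
        using True cl(1) by (intro continuous_on_tendsto_compose[OF c[OF x]]) (auto simp: s_def)
      then show ?thesis using True by (simp add: q_def F_def s_def)
    qed (simp add: F_def)
  qed
  then have "(\<lambda>(x, s). indicator {0..t} s *\<^sub>R h s x) \<in> borel_measurable (?M \<Otimes>\<^sub>M lborel)"
    by (simp add: F_def[abs_def] case_prod_beta')
  then have "(\<lambda>x. LINT s|lborel. indicator {0..t} s *\<^sub>R h s x) \<in> borel_measurable ?M"
    by (rule lborel.borel_measurable_lebesgue_integral)
  moreover have "(LINT s|lborel. indicator {0..t} s *\<^sub>R h s x) = integral {0..t} (\<lambda>s. h s x)" if "x \<in> {-1..1}" for x
    using set_borel_integral_eq_integral(2)[OF borel_integrable_compact[OF compact_Icc c[OF that], folded set_integrable_def]]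
    by (simp add: set_lebesgue_integral_def)
  ultimately show ?thesis by (subst measurable_lebesgue_cong[symmetric]) auto
qed

lemma has_vector_derivative_iff_quotient:
  fixes e :: "real \<Rightarrow> 'a::real_normed_vector"
  shows "(e has_vector_derivative e') (at t within S) \<longleftrightarrow>
    ((\<lambda>s. (1 / (s - t)) *\<^sub>R (e s - e t)) \<longlongrightarrow> e') (at t within S)"
proof
  assume "(e has_vector_derivative e') (at t within S)"
  from has_vector_derivative_quotient[OF this] show "((\<lambda>s. (1 / (s - t)) *\<^sub>R (e s - e t)) \<longlongrightarrow> e') (at t within S)"
    by (rule LIM_zero_cancel[OF tendsto_norm_zero_cancel])
next
  assume "((\<lambda>s. (1 / (s - t)) *\<^sub>R (e s - e t)) \<longlongrightarrow> e') (at t within S)"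
  then have "((\<lambda>s. norm ((1 / (s - t)) *\<^sub>R (e s - e t) - e')) \<longlongrightarrow> 0) (at t within S)"
    by (intro tendsto_norm_zero LIM_zero)
  then have "((\<lambda>s. norm (e s - e t - (s - t) *\<^sub>R e') / norm (s - t)) \<longlongrightarrow> 0) (at t within S)"
  proof (rule Lim_transform_eventually)
    show "\<forall>\<^sub>F s in at t within S. norm ((1 / (s - t)) *\<^sub>R (e s - e t) - e') = norm (e s - e t - (s - t) *\<^sub>R e') / norm (s - t)"
      unfolding eventually_at_filter
    proof (intro always_eventually allI impI)
      fix s assume "s \<noteq> t" "s \<in> S"
      then have "(1 / (s - t)) *\<^sub>R (e s - e t) - e' = (1 / (s - t)) *\<^sub>R (e s - e t - (s - t) *\<^sub>R e')"
        by (simp add: scaleR_diff_right)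
      then show "norm ((1 / (s - t)) *\<^sub>R (e s - e t) - e') = norm (e s - e t - (s - t) *\<^sub>R e') / norm (s - t)"
        by simp
    qed
  qed
  then show "(e has_vector_derivative e') (at t within S)"
    unfolding has_vector_derivative_def has_derivative_iff_norm by (auto intro: bounded_linear_scaleR_left)
qed

lemma prim_time_continuous:
  fixes r :: "real \<Rightarrow> real \<Rightarrow> 'a::euclidean_space"
  assumes L: "\<And>t. t \<in> S \<Longrightarrow> L2v (r t)" and c: "\<And>x. x \<in> {-1..1} \<Longrightarrow> continuous_on S (\<lambda>t. r t x)"
    and g: "L2v g" "\<And>t x. t \<in> S \<Longrightarrow> x \<in> {-1..1} \<Longrightarrow> norm (r t x) \<le> (g x :: real)" and x: "x \<in> {-1..1}"
  shows "continuous_on S (\<lambda>t. prim (r t) x)"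
proof (rule continuous_on_sequentiallyI)
  fix u a assume u: "\<forall>n. u n \<in> S" "a \<in> S" "u \<longlonglongrightarrow> a"
  show "(\<lambda>n. prim (r (u n)) x) \<longlonglongrightarrow> prim (r a) x"
    unfolding prim_def
  proof (rule dominated_convergence(2)[where h=g])
    show "r (u k) integrable_on {-1..x}" for k using L u x by (intro L2v_int_sub) auto
    show "g integrable_on {-1..x}" using g x by (intro L2v_int_sub) auto
    fix \<xi> assume \<xi>: "\<xi> \<in> {-1..x}"
    then have xi: "\<xi> \<in> {-1..1}" using x by auto
    show "norm (r (u k) \<xi>) \<le> g \<xi>" for k using g(2) u xi by blast
    show "(\<lambda>k. r (u k) \<xi>) \<longlonglongrightarrow> r a \<xi>"
      using u by (intro continuous_on_tendsto_compose[OF c[OF xi]]) auto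
  qed
qed

text \<open>Differentiation under the integral sign: by the mean value inequality g dominates the
  difference quotients, so dominated convergence along sequences applies.\<close>

lemma prim_time_derivative:
  fixes q q' :: "real \<Rightarrow> real \<Rightarrow> 'a::euclidean_space"
  assumes L: "\<And>t. t \<in> {0..T} \<Longrightarrow> L2v (q t)"
    and d: "\<And>x t. x \<in> {-1..1} \<Longrightarrow> t \<in> {0..T} \<Longrightarrow> ((\<lambda>t. q t x) has_vector_derivative q' t x) (at t within {0..T})"
    and g: "L2v g" "\<And>t x. t \<in> {0..T} \<Longrightarrow> x \<in> {-1..1} \<Longrightarrow> norm (q' t x) \<le> (g x :: real)"
    and x: "x \<in> {-1..1}" and t: "t \<in> {0..T}"
  shows "((\<lambda>t. prim (q t) x) has_vector_derivative prim (q' t) x) (at t within {0..T})"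
  unfolding has_vector_derivative_iff_quotient tendsto_at_iff_sequentially
proof (intro allI impI)
  fix X assume X: "\<forall>i. X i \<in> {0..T} - {t}" "X \<longlonglongrightarrow> t"
  have A: "(\<lambda>k. integral {-1..x} (\<lambda>\<xi>. (1 / (X k - t)) *\<^sub>R (q (X k) \<xi> - q t \<xi>))) \<longlonglongrightarrow> integral {-1..x} (q' t)"
  proof (rule dominated_convergence(2)[where h=g])
    show "(\<lambda>\<xi>. (1 / (X k - t)) *\<^sub>R (q (X k) \<xi> - q t \<xi>)) integrable_on {-1..x}" for k
      using X x t by (intro L2v_int_sub L2v_scaleR L2v_diff L) auto
    show "g integrable_on {-1..x}" using g x by (intro L2v_int_sub) auto
    fix \<xi> assume \<xi>: "\<xi> \<in> {-1..x}"
    then have xi: "\<xi> \<in> {-1..1}" using x by auto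
    show "norm ((1 / (X k - t)) *\<^sub>R (q (X k) \<xi> - q t \<xi>)) \<le> g \<xi>" for k
    proof -
      have Xk: "X k \<in> {0..T}" "X k \<noteq> t" using X by auto
      have "norm (q (X k) \<xi> - q t \<xi>) \<le> g \<xi> * norm (X k - t)"
      proof (rule differentiable_bound[of "{0..T}" "\<lambda>t. q t \<xi>" "\<lambda>s h. h *\<^sub>R q' s \<xi>"])
        fix s assume s: "s \<in> {0..T}"
        show "((\<lambda>t. q t \<xi>) has_derivative (\<lambda>h. h *\<^sub>R q' s \<xi>)) (at s within {0..T})"
          using d[OF xi s] by (simp add: has_vector_derivative_def)
        show "onorm (\<lambda>h. h *\<^sub>R q' s \<xi>) \<le> g \<xi>"
          by (rule onorm_le) (use g(2)[OF s xi] in \<open>simp add: mult.commute mult_left_mono\<close>)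
      qed (use Xk t in auto)
      then have "\<bar>1 / (X k - t)\<bar> * norm (q (X k) \<xi> - q t \<xi>) \<le> \<bar>1 / (X k - t)\<bar> * (g \<xi> * norm (X k - t))"
        by (rule mult_left_mono) simp
      also have "\<dots> = g \<xi>" using Xk by simp
      finally show ?thesis unfolding norm_scaleR real_norm_def .
    qed
    show "(\<lambda>k. (1 / (X k - t)) *\<^sub>R (q (X k) \<xi> - q t \<xi>)) \<longlonglongrightarrow> q' t \<xi>"
      using d[OF xi t, unfolded has_vector_derivative_iff_quotient tendsto_at_iff_sequentially, rule_format, OF _ X(2)] X(1)
      by (simp add: o_def)
  qed
  have B: "integral {-1..x} (\<lambda>\<xi>. (1 / (X k - t)) *\<^sub>R (q (X k) \<xi> - q t \<xi>)) = (1 / (X k - t)) *\<^sub>R (prim (q (X k)) x - prim (q t) x)" for k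
  proof -
    have "q (X k) integrable_on {-1..x}" "q t integrable_on {-1..x}" using X x t by (auto intro!: L2v_int_sub L)
    then show ?thesis unfolding prim_def by (simp add: Henstock_Kurzweil_Integration.integral_diff)
  qed
  show "((\<lambda>s. (1 / (s - t)) *\<^sub>R (prim (q s) x - prim (q t) x)) \<circ> X) \<longlonglongrightarrow> prim (q' t) x"
    using A[unfolded B] unfolding o_def prim_def[of "q' t" x] .
qed

locale family =
  fixes I :: "'i set" and T :: real
  assumes Tpos: "T > 0"
begin

text \<open>Caratheodory functions: measurable in x for each t and continuous in t for each
  x.\<close>

definition car :: "('i \<Rightarrow> real \<Rightarrow> real \<Rightarrow> 'a::euclidean_space) \<Rightarrow> bool" where
  "car q \<longleftrightarrow> (\<forall>i\<in>I. (\<forall>t\<in>{0..T}. q i t \<in> borel_measurable (lebesgue_on {-1..1})) \<and>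
     (\<forall>x\<in>{-1..1}. continuous_on {0..T} (\<lambda>t. q i t x)))"

definition BM :: "('i \<Rightarrow> real \<Rightarrow> real \<Rightarrow> 'a::euclidean_space) \<Rightarrow> bool" where
  "BM q \<longleftrightarrow> car q \<and> (\<exists>K. \<forall>i\<in>I. \<forall>t\<in>{0..T}. \<forall>x\<in>{-1..1}. norm (q i t x) \<le> K)"

text \<open>RR j q expresses that j space derivatives of the functions q i t are dominated by square
  integrable functions whose norms are bounded uniformly in i and t. The index set I is used to obtain
  constants that do not depend on the solution.\<close>

primrec RR :: "nat \<Rightarrow> ('i \<Rightarrow> real \<Rightarrow> real \<Rightarrow> 'a::euclidean_space) \<Rightarrow> bool" where
  "RR 0 q = (car q \<and> (\<exists>g K. \<forall>i\<in>I. L2v (g i) \<and> n2 (g i) \<le> K \<and> (\<forall>t\<in>{0..T}. \<forall>x\<in>{-1..1}. norm (q i t x) \<le> (g i x :: real))))"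
| "RR (Suc j) q = (\<exists>r K. RR j r \<and> (\<forall>i\<in>I. continuous_on {0..T} (\<lambda>t. q i t (-1)) \<and>
     (\<forall>t\<in>{0..T}. norm (q i t (-1)) \<le> K \<and> (\<forall>x\<in>{-1..1}. q i t x = q i t (-1) + prim (r i t) x))))"

lemma car_measurable: "car q \<Longrightarrow> i \<in> I \<Longrightarrow> t \<in> {0..T} \<Longrightarrow> q i t \<in> borel_measurable (lebesgue_on {-1..1})"
  and car_continuous: "car q \<Longrightarrow> i \<in> I \<Longrightarrow> x \<in> {-1..1} \<Longrightarrow> continuous_on {0..T} (\<lambda>t. q i t x)"
  by (auto simp: car_def)

lemma BM_car: "BM q \<Longrightarrow> car q" and R0_car: "RR 0 q \<Longrightarrow> car q"
  by (auto simp: BM_def)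

lemma BM_E:
  assumes "BM q"
  obtains K where "K \<ge> 0" "\<And>i t x. i \<in> I \<Longrightarrow> t \<in> {0..T} \<Longrightarrow> x \<in> {-1..1} \<Longrightarrow> norm (q i t x) \<le> K"
proof -
  obtain K where K: "\<forall>i\<in>I. \<forall>t\<in>{0..T}. \<forall>x\<in>{-1..1}. norm (q i t x) \<le> K" using assms unfolding BM_def by blast
  have "norm (q i t x) \<le> max 0 K" if "i \<in> I" "t \<in> {0..T}" "x \<in> {-1..1}" for i t x
    using K that by (meson max.coboundedI2)
  then show thesis by (intro that[of "max 0 K"]) auto
qed

lemma R0_E:
  assumes "RR 0 q"
  obtains g K where "K \<ge> 0" "\<And>i. i \<in> I \<Longrightarrow> L2v (g i)" "\<And>i. i \<in> I \<Longrightarrow> n2 (g i) \<le> K"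
    "\<And>i t x. i \<in> I \<Longrightarrow> t \<in> {0..T} \<Longrightarrow> x \<in> {-1..1} \<Longrightarrow> norm (q i t x) \<le> (g i x :: real)"
proof -
  obtain g K where K: "\<forall>i\<in>I. L2v (g i) \<and> n2 (g i) \<le> K \<and> (\<forall>t\<in>{0..T}. \<forall>x\<in>{-1..1}. norm (q i t x) \<le> (g i x :: real))"
    using assms unfolding RR.simps by blast
  have "n2 (g i) \<le> max 0 K" if "i \<in> I" for i using K that by (meson max.coboundedI2)
  then show thesis using K by (intro that[of "max 0 K" g]) auto
qed

lemma R0_I:
  assumes "car q" "\<And>i. i \<in> I \<Longrightarrow> L2v (g i)" "\<And>i. i \<in> I \<Longrightarrow> n2 (g i) \<le> K"
    "\<And>i t x. i \<in> I \<Longrightarrow> t \<in> {0..T} \<Longrightarrow> x \<in> {-1..1} \<Longrightarrow> norm (q i t x) \<le> (g i x :: real)"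
  shows "RR 0 q"
  unfolding RR.simps using assms by blast

lemma R0_L2v:
  assumes "RR 0 q" "i \<in> I" "t \<in> {0..T}"
  shows "L2v (q i t)"
proof (rule R0_E[OF assms(1)])
  fix g :: "'i \<Rightarrow> real \<Rightarrow> real" and K
  assume g: "\<And>i. i \<in> I \<Longrightarrow> L2v (g i)" "\<And>i t x. i \<in> I \<Longrightarrow> t \<in> {0..T} \<Longrightarrow> x \<in> {-1..1} \<Longrightarrow> norm (q i t x) \<le> g i x"
  show ?thesis
  proof (rule L2v_dominated[OF g(1)[OF assms(2)] car_measurable[OF R0_car[OF assms(1)] assms(2,3)], where K=1])
    fix x :: real assume "x \<in> {-1..1}"
    then show "norm (q i t x) \<le> 1 * norm (g i x)" using g(2)[OF assms(2,3), of x] by simp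
  qed
qed

lemma R0_dom:
  fixes q :: "'i \<Rightarrow> real \<Rightarrow> real \<Rightarrow> 'a::euclidean_space" and q' :: "'i \<Rightarrow> real \<Rightarrow> real \<Rightarrow> 'b::euclidean_space"
  assumes c: "car q" and q': "RR 0 q'" and C: "C \<ge> 0"
    and le: "\<And>i t x. i \<in> I \<Longrightarrow> t \<in> {0..T} \<Longrightarrow> x \<in> {-1..1} \<Longrightarrow> norm (q i t x) \<le> C * norm (q' i t x)"
  shows "RR 0 q"
proof (rule R0_E[OF q'])
  fix g :: "'i \<Rightarrow> real \<Rightarrow> real" and K
  assume g: "K \<ge> 0" "\<And>i. i \<in> I \<Longrightarrow> L2v (g i)" "\<And>i. i \<in> I \<Longrightarrow> n2 (g i) \<le> K"
    "\<And>i t x. i \<in> I \<Longrightarrow> t \<in> {0..T} \<Longrightarrow> x \<in> {-1..1} \<Longrightarrow> norm (q' i t x) \<le> g i x"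
  show ?thesis
  proof (rule R0_I[OF c, where g="\<lambda>i x. C *\<^sub>R g i x" and K="C * K"])
    fix i assume i: "i \<in> I"
    show "L2v (\<lambda>x. C *\<^sub>R g i x)" by (rule L2v_scaleR[OF g(2)[OF i]])
    show "n2 (\<lambda>x. C *\<^sub>R g i x) \<le> C * K" using C mult_left_mono[OF g(3)[OF i] C] by (simp only: n2_scaleR abs_of_nonneg)
    fix t x :: real assume tx: "t \<in> {0..T}" "x \<in> {-1..1}"
    show "norm (q i t x) \<le> C *\<^sub>R g i x" using le[OF i tx] mult_left_mono[OF g(4)[OF i tx] C] by simp
  qed
qed

lemma car_cong:
  assumes "car q" "\<And>i t x. i \<in> I \<Longrightarrow> t \<in> {0..T} \<Longrightarrow> x \<in> {-1..1} \<Longrightarrow> q' i t x = q i t x"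
  shows "car q'"
  unfolding car_def
proof (intro ballI conjI)
  fix i t assume i: "i \<in> I" "t \<in> {0..T}"
  show "q' i t \<in> borel_measurable (lebesgue_on {-1..1})"
    using car_measurable[OF assms(1) i] assms(2)[OF i] by (subst measurable_lebesgue_cong) auto
next
  fix i and x :: real assume i: "i \<in> I" "x \<in> {-1..1}"
  show "continuous_on {0..T} (\<lambda>t. q' i t x)"
    by (rule continuous_on_eq[OF car_continuous[OF assms(1) i]]) (simp add: assms(2)[OF i(1) _ i(2)])
qed

lemma RR_cong:
  assumes "RR j q" "\<And>i t x. i \<in> I \<Longrightarrow> t \<in> {0..T} \<Longrightarrow> x \<in> {-1..1} \<Longrightarrow> q' i t x = q i t x"
  shows "RR j q'"
proof (cases j)
  case 0
  then have q0: "RR 0 q" using assms(1) by (simp only:)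
  show ?thesis unfolding 0
  proof (rule R0_dom[OF _ q0, of _ 1])
    show "car q'" by (rule car_cong[OF R0_car[OF q0] assms(2)])
  qed (use assms(2) in auto)
next
  case (Suc k)
  obtain r K where r: "RR k r" "\<forall>i\<in>I. continuous_on {0..T} (\<lambda>t. q i t (-1)) \<and>
     (\<forall>t\<in>{0..T}. norm (q i t (-1)) \<le> K \<and> (\<forall>x\<in>{-1..1}. q i t x = q i t (-1) + prim (r i t) x))"
    using assms(1)[unfolded Suc RR.simps(2)] by blast
  have e: "q' i t x = q i t x" if "i \<in> I" "t \<in> {0..T}" "x \<in> {-1..1}" for i t x using assms(2) that by blast
  have "\<forall>i\<in>I. continuous_on {0..T} (\<lambda>t. q' i t (-1)) \<and>
     (\<forall>t\<in>{0..T}. norm (q' i t (-1)) \<le> K \<and> (\<forall>x\<in>{-1..1}. q' i t x = q' i t (-1) + prim (r i t) x))"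
  proof (intro ballI conjI)
    fix i assume i: "i \<in> I"
    have "continuous_on {0..T} (\<lambda>t. q i t (-1))" using r(2) i by blast
    then show "continuous_on {0..T} (\<lambda>t. q' i t (-1))"
      by (rule continuous_on_eq) (simp add: e[OF i])
    fix t assume t: "t \<in> {0..T}"
    have "norm (q i t (-1)) \<le> K" using r(2) i t by blast
    then show "norm (q' i t (-1)) \<le> K" using e[OF i t, of "-1"] by simp
    fix x :: real assume x: "x \<in> {-1..1}"
    have "q i t x = q i t (-1) + prim (r i t) x" using r(2) i t x by blast
    then show "q' i t x = q' i t (-1) + prim (r i t) x" using e[OF i t x] e[OF i t, of "-1"] by simp
  qed
  then show ?thesis unfolding Suc RR.simps using r(1) by blast
qed

lemma car_add: "car q \<Longrightarrow> car q' \<Longrightarrow> car (\<lambda>i t x. q i t x + q' i t x)"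
  unfolding car_def by (auto intro!: continuous_on_add borel_measurable_add)

lemma car_bilinear:
  fixes prod :: "'a::euclidean_space \<Rightarrow> 'b::euclidean_space \<Rightarrow> 'c::euclidean_space"
  assumes "bounded_bilinear prod" "car a" "car b"
  shows "car (\<lambda>i t x. prod (a i t x) (b i t x))"
  unfolding car_def
proof (intro ballI conjI)
  show "(\<lambda>x. prod (a i t x) (b i t x)) \<in> borel_measurable (lebesgue_on {-1..1})" if "i \<in> I" "t \<in> {0..T}" for i t
    by (rule bilinear_measurable[OF assms(1) car_measurable[OF assms(2) that] car_measurable[OF assms(3) that]])
  show "continuous_on {0..T} (\<lambda>t. prod (a i t x) (b i t x))" if "i \<in> I" "x \<in> {-1..1}" for i x
    by (rule bounded_bilinear.continuous_on[OF assms(1) car_continuous[OF assms(2) that] car_continuous[OF assms(3) that]])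
qed

lemma car_comp:
  fixes F :: "'a::euclidean_space \<Rightarrow> 'b::euclidean_space"
  assumes F: "continuous_on UNIV F" and q: "car q"
  shows "car (\<lambda>i t x. F (q i t x))"
  unfolding car_def
proof (intro ballI conjI)
  fix i t assume "i \<in> I" "t \<in> {0..T}"
  then show "(\<lambda>x. F (q i t x)) \<in> borel_measurable (lebesgue_on {-1..1})"
    by (intro borel_measurable_continuous_on[OF F] car_measurable[OF q])
next
  fix i and x :: real assume "i \<in> I" "x \<in> {-1..1}"
  from continuous_on_compose2[OF F car_continuous[OF q this]]
  show "continuous_on {0..T} (\<lambda>t. F (q i t x))" by simp
qed

lemma BM_comp:
  fixes F :: "'a::euclidean_space \<Rightarrow> 'b::euclidean_space"
  assumes F: "continuous_on UNIV F" and q: "BM q"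
  shows "BM (\<lambda>i t x. F (q i t x))"
proof (rule BM_E[OF q])
  fix K assume K: "\<And>i t x. i \<in> I \<Longrightarrow> t \<in> {0..T} \<Longrightarrow> x \<in> {-1..1} \<Longrightarrow> norm (q i t x) \<le> K"
  have "compact (F ` cball 0 K)" by (intro compact_continuous_image continuous_on_subset[OF F]) auto
  then obtain C where "\<forall>w\<in>F ` cball 0 K. norm w \<le> C" using compact_imp_bounded bounded_iff by metis
  then have "norm (F (q i t x)) \<le> C" if "i \<in> I" "t \<in> {0..T}" "x \<in> {-1..1}" for i t x using K[OF that] by auto
  then show ?thesis unfolding BM_def using car_comp[OF F BM_car[OF q]] by blast
qed

lemma BM_R0:
  assumes "BM q" shows "RR 0 q"
proof (rule BM_E[OF assms])
  fix K :: real assume K: "K \<ge> 0" "\<And>i t x. i \<in> I \<Longrightarrow> t \<in> {0..T} \<Longrightarrow> x \<in> {-1..1} \<Longrightarrow> norm (q i t x) \<le> K"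
  have L: "L2v (\<lambda>x::real. K)" by (rule L2v_continuous) simp
  show ?thesis
    by (rule R0_I[OF BM_car[OF assms], where g="\<lambda>i x. K" and K="2 * K"]) (use K L n2_bound[OF L K(1)] in auto)
qed

lemma BM_R0_bilinear:
  fixes prod :: "'a::euclidean_space \<Rightarrow> 'b::euclidean_space \<Rightarrow> 'c::euclidean_space"
  assumes bb: "bounded_bilinear prod" and m: "BM m" and q: "RR 0 q"
  shows "RR 0 (\<lambda>i t x. prod (m i t x) (q i t x))"
proof (rule BM_E[OF m])
  fix C assume C: "C \<ge> 0" "\<And>i t x. i \<in> I \<Longrightarrow> t \<in> {0..T} \<Longrightarrow> x \<in> {-1..1} \<Longrightarrow> norm (m i t x) \<le> C"
  obtain K where K: "K > 0" "\<And>a b. norm (prod a b) \<le> norm a * norm b * K"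
    using bounded_bilinear.pos_bounded[OF bb] by blast
  show ?thesis
  proof (rule R0_dom[OF car_bilinear[OF bb BM_car[OF m] R0_car[OF q]] q, of "C * K"])
    fix i t and x :: real assume i: "i \<in> I" "t \<in> {0..T}" "x \<in> {-1..1}"
    have "norm (m i t x) * norm (q i t x) * K \<le> C * norm (q i t x) * K"
      using C(2)[OF i] K(1) by (intro mult_right_mono) auto
    then show "norm (prod (m i t x) (q i t x)) \<le> C * K * norm (q i t x)"
      using K(2)[of "m i t x" "q i t x"] by (simp add: ac_simps)
  qed (use C K in auto)
qed

lemma R0_BM_bilinear:
  fixes prod :: "'a::euclidean_space \<Rightarrow> 'b::euclidean_space \<Rightarrow> 'c::euclidean_space"
  assumes bb: "bounded_bilinear prod" and q: "RR 0 q" and m: "BM m"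
  shows "RR 0 (\<lambda>i t x. prod (q i t x) (m i t x))"
  using BM_R0_bilinear[OF bounded_bilinear.flip[OF bb] m q] by simp

lemma R0_add:
  assumes "RR 0 q" "RR 0 q'" shows "RR 0 (\<lambda>i t x. q i t x + q' i t x)"
proof (rule R0_E[OF assms(1)], rule R0_E[OF assms(2)])
  fix g g' :: "'i \<Rightarrow> real \<Rightarrow> real" and K K'
  assume g: "\<And>i. i \<in> I \<Longrightarrow> L2v (g i)" "\<And>i. i \<in> I \<Longrightarrow> n2 (g i) \<le> K"
      "\<And>i t x. i \<in> I \<Longrightarrow> t \<in> {0..T} \<Longrightarrow> x \<in> {-1..1} \<Longrightarrow> norm (q i t x) \<le> g i x"
    and g': "\<And>i. i \<in> I \<Longrightarrow> L2v (g' i)" "\<And>i. i \<in> I \<Longrightarrow> n2 (g' i) \<le> K'"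
      "\<And>i t x. i \<in> I \<Longrightarrow> t \<in> {0..T} \<Longrightarrow> x \<in> {-1..1} \<Longrightarrow> norm (q' i t x) \<le> g' i x"
  show ?thesis
  proof (rule R0_I[OF car_add[OF R0_car[OF assms(1)] R0_car[OF assms(2)]], where g="\<lambda>i x. g i x + g' i x" and K="K + K'"])
    fix i assume i: "i \<in> I"
    show "L2v (\<lambda>x. g i x + g' i x)" by (rule L2v_add[OF g(1)[OF i] g'(1)[OF i]])
    show "n2 (\<lambda>x. g i x + g' i x) \<le> K + K'" by (rule order_trans[OF n2_add[OF g(1)[OF i] g'(1)[OF i]] add_mono[OF g(2)[OF i] g'(2)[OF i]]])
    show "norm (q i t x + q' i t x) \<le> g i x + g' i x" if "t \<in> {0..T}" "x \<in> {-1..1}" for t x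
      by (intro norm_triangle_le add_mono g(3) g'(3) i that)
  qed
qed

lemma RR_SucE:
  assumes "RR (Suc j) q"
  obtains r K where "RR j r" "\<And>i. i \<in> I \<Longrightarrow> continuous_on {0..T} (\<lambda>t. q i t (-1))"
    "\<And>i t. i \<in> I \<Longrightarrow> t \<in> {0..T} \<Longrightarrow> norm (q i t (-1)) \<le> K"
    "\<And>i t x. i \<in> I \<Longrightarrow> t \<in> {0..T} \<Longrightarrow> x \<in> {-1..1} \<Longrightarrow> q i t x = q i t (-1) + prim (r i t) x"
  using assms unfolding RR.simps(2) by blast

lemma RR_SucI:
  assumes "RR j r" "\<And>i. i \<in> I \<Longrightarrow> continuous_on {0..T} (\<lambda>t. q i t (-1))"
    "\<And>i t. i \<in> I \<Longrightarrow> t \<in> {0..T} \<Longrightarrow> norm (q i t (-1)) \<le> K"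
    "\<And>i t x. i \<in> I \<Longrightarrow> t \<in> {0..T} \<Longrightarrow> x \<in> {-1..1} \<Longrightarrow> q i t x = q i t (-1) + prim (r i t) x"
  shows "RR (Suc j) q"
  unfolding RR.simps(2) using assms by blast

text \<open>One space derivative dominated in L^2, together with a bounded value at -1, gives a
  uniform supremum bound. Continuity in t survives integration by dominated convergence.\<close>

lemma prim_BM:
  assumes r: "RR 0 r"
    and c: "\<And>i. i \<in> I \<Longrightarrow> continuous_on {0..T} (\<lambda>t. q i t (-1))"
    and K: "\<And>i t. i \<in> I \<Longrightarrow> t \<in> {0..T} \<Longrightarrow> norm (q i t (-1)) \<le> K"
    and q: "\<And>i t x. i \<in> I \<Longrightarrow> t \<in> {0..T} \<Longrightarrow> x \<in> {-1..1} \<Longrightarrow> q i t x = q i t (-1) + prim (r i t) x"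
  shows "BM q"
proof (rule R0_E[OF r])
  fix g :: "'i \<Rightarrow> real \<Rightarrow> real" and K'
  assume g: "\<And>i. i \<in> I \<Longrightarrow> L2v (g i)" "\<And>i. i \<in> I \<Longrightarrow> n2 (g i) \<le> K'"
    "\<And>i t x. i \<in> I \<Longrightarrow> t \<in> {0..T} \<Longrightarrow> x \<in> {-1..1} \<Longrightarrow> norm (r i t x) \<le> g i x"
  have L: "L2v (r i t)" if "i \<in> I" "t \<in> {0..T}" for i t by (rule R0_L2v[OF r that])
  have "car q" unfolding car_def
  proof (intro ballI conjI)
    fix i t assume it: "i \<in> I" "t \<in> {0..T}"
    have "continuous_on {-1..1} (q i t)"
      by (rule continuous_on_eq[OF _ q[OF it, symmetric]]) (intro continuous_intros prim_continuous[OF L[OF it]])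
    then show "q i t \<in> borel_measurable (lebesgue_on {-1..1})" by (rule continuous_imp_measurable_on_sets_lebesgue) simp
  next
    fix i and x :: real assume ix: "i \<in> I" "x \<in> {-1..1}"
    have "continuous_on {0..T} (\<lambda>t. q i t (-1) + prim (r i t) x)"
      by (intro continuous_on_add c ix prim_time_continuous[OF L car_continuous[OF R0_car[OF r]] g(1) g(3)])
    then show "continuous_on {0..T} (\<lambda>t. q i t x)" by (rule continuous_on_eq[OF _ q[OF ix(1) _ ix(2), symmetric]])
  qed
  moreover have "norm (q i t x) \<le> K + 2 * K'" if h: "i \<in> I" "t \<in> {0..T}" "x \<in> {-1..1}" for i t x
  proof -
    have "n2 (r i t) \<le> 1 * n2 (g i)"
      by (rule n2_mono[OF L[OF h(1,2)] g(1)[OF h(1)]]) (use g(3)[OF h(1,2)] in force)+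
    then have "norm (prim (r i t) x) \<le> 2 * K'" using prim_bound[OF L[OF h(1,2)] h(3)] g(2)[OF h(1)] by linarith
    then show ?thesis unfolding q[OF h] by (intro norm_triangle_le add_mono K h)
  qed
  ultimately show ?thesis unfolding BM_def by blast
qed

lemma RR_Suc_imp:
  fixes q :: "'i \<Rightarrow> real \<Rightarrow> real \<Rightarrow> 'a::euclidean_space"
  shows "RR (Suc j) q \<Longrightarrow> RR j q"
proof (induction j arbitrary: q)
  case 0
  show ?case by (rule RR_SucE[OF 0]) (rule BM_R0[OF prim_BM])
next
  case (Suc j)
  show ?case
    by (rule RR_SucE[OF Suc.prems]) (rule RR_SucI[OF Suc.IH])
qed

lemma RR_le: "RR j q \<Longrightarrow> i \<le> j \<Longrightarrow> RR i q"
  by (induction j) (auto simp: le_Suc_eq simp del: RR.simps dest: RR_Suc_imp)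

lemma RR_Suc_BM:
  assumes "RR (Suc j) q" shows "BM q"
proof (rule RR_SucE[OF assms])
  fix r K assume r: "RR j r" "\<And>i. i \<in> I \<Longrightarrow> continuous_on {0..T} (\<lambda>t. q i t (-1))"
    "\<And>i t. i \<in> I \<Longrightarrow> t \<in> {0..T} \<Longrightarrow> norm (q i t (-1)) \<le> K"
    "\<And>i t x. i \<in> I \<Longrightarrow> t \<in> {0..T} \<Longrightarrow> x \<in> {-1..1} \<Longrightarrow> q i t x = q i t (-1) + prim (r i t) x"
  show "BM q" by (rule prim_BM[OF RR_le[OF r(1) le0] r(2-4)])
qed

lemma RR_add:
  fixes q :: "'i \<Rightarrow> real \<Rightarrow> real \<Rightarrow> 'a::euclidean_space"
  shows "RR j q \<Longrightarrow> RR j q' \<Longrightarrow> RR j (\<lambda>i t x. q i t x + q' i t x)"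
proof (induction j arbitrary: q q')
  case 0
  then show ?case by (rule R0_add)
next
  case (Suc j)
  show ?case
  proof (rule RR_SucE[OF Suc.prems(1)], rule RR_SucE[OF Suc.prems(2)])
    fix r r' K K'
    assume r: "RR j r" "\<And>i. i \<in> I \<Longrightarrow> continuous_on {0..T} (\<lambda>t. q i t (-1))"
        "\<And>i t. i \<in> I \<Longrightarrow> t \<in> {0..T} \<Longrightarrow> norm (q i t (-1)) \<le> K"
        "\<And>i t x. i \<in> I \<Longrightarrow> t \<in> {0..T} \<Longrightarrow> x \<in> {-1..1} \<Longrightarrow> q i t x = q i t (-1) + prim (r i t) x"
      and r': "RR j r'" "\<And>i. i \<in> I \<Longrightarrow> continuous_on {0..T} (\<lambda>t. q' i t (-1))"
        "\<And>i t. i \<in> I \<Longrightarrow> t \<in> {0..T} \<Longrightarrow> norm (q' i t (-1)) \<le> K'"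
        "\<And>i t x. i \<in> I \<Longrightarrow> t \<in> {0..T} \<Longrightarrow> x \<in> {-1..1} \<Longrightarrow> q' i t x = q' i t (-1) + prim (r' i t) x"
    show ?thesis
    proof (rule RR_SucI[OF Suc.IH[OF r(1) r'(1)], where K="K + K'"])
      fix i assume i: "i \<in> I"
      show "continuous_on {0..T} (\<lambda>t. q i t (-1) + q' i t (-1))" by (intro continuous_on_add r r' i)
      show "norm (q i t (-1) + q' i t (-1)) \<le> K + K'" if "t \<in> {0..T}" for t
        by (intro norm_triangle_le add_mono r r' i that)
      fix t x :: real assume tx: "t \<in> {0..T}" "x \<in> {-1..1}"
      show "q i t x + q' i t x = q i t (-1) + q' i t (-1) + prim (\<lambda>x. r i t x + r' i t x) x"
        unfolding prim_add[OF R0_L2v[OF RR_le[OF r(1) le0] i tx(1)] R0_L2v[OF RR_le[OF r'(1) le0] i tx(1)] tx(2)]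
          r(4)[OF i tx] r'(4)[OF i tx] by (simp add: ac_simps)
    qed
  qed
qed

lemma RR_const_in_tx: "RR j (\<lambda>i t x. c)"
proof (induction j arbitrary: c)
  case 0
  show ?case by (rule BM_R0) (auto simp: BM_def car_def)
next
  case (Suc j)
  show ?case by (rule RR_SucI[OF Suc[of 0], where K="norm c"]) (auto simp: prim_def)
qed

lemma RR_bounded_linear:
  fixes q :: "'i \<Rightarrow> real \<Rightarrow> real \<Rightarrow> 'a::euclidean_space" and F :: "'a \<Rightarrow> 'b::euclidean_space"
  assumes F: "bounded_linear F"
  shows "RR j q \<Longrightarrow> RR j (\<lambda>i t x. F (q i t x))"
proof (induction j arbitrary: q)
  case 0
  obtain K where K: "K > 0" "\<And>x. norm (F x) \<le> norm x * K" using bounded_linear.pos_bounded[OF F] by blast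
  show ?case
    by (rule R0_dom[OF car_comp[OF linear_continuous_on[OF F] R0_car[OF 0]] 0, of K])
       (use K in \<open>auto simp: mult.commute\<close>)
next
  case (Suc j)
  obtain C where C: "C > 0" "\<And>x. norm (F x) \<le> norm x * C" using bounded_linear.pos_bounded[OF F] by blast
  show ?case
  proof (rule RR_SucE[OF Suc.prems])
    fix r K
    assume r: "RR j r" "\<And>i. i \<in> I \<Longrightarrow> continuous_on {0..T} (\<lambda>t. q i t (-1))"
        "\<And>i t. i \<in> I \<Longrightarrow> t \<in> {0..T} \<Longrightarrow> norm (q i t (-1)) \<le> K"
        "\<And>i t x. i \<in> I \<Longrightarrow> t \<in> {0..T} \<Longrightarrow> x \<in> {-1..1} \<Longrightarrow> q i t x = q i t (-1) + prim (r i t) x"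
    show ?thesis
    proof (rule RR_SucI[OF Suc.IH[OF r(1)], where K="K * C"])
      fix i assume i: "i \<in> I"
      show "continuous_on {0..T} (\<lambda>t. F (q i t (-1)))" by (rule bounded_linear.continuous_on[OF F r(2)[OF i]])
      show "norm (F (q i t (-1))) \<le> K * C" if "t \<in> {0..T}" for t
        by (rule order_trans[OF C(2) mult_right_mono[OF r(3)[OF i that]]]) (use C in simp)
      fix t x :: real assume tx: "t \<in> {0..T}" "x \<in> {-1..1}"
      have "r i t integrable_on {-1..x}" by (rule L2v_int_sub[OF R0_L2v[OF RR_le[OF r(1) le0] i tx(1)]]) (use tx in auto)
      from integral_linear[OF this F] have "prim (\<lambda>x. F (r i t x)) x = F (prim (r i t) x)" by (simp add: prim_def o_def)
      then show "F (q i t x) = F (q i t (-1)) + prim (\<lambda>x. F (r i t x)) x"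
        unfolding r(4)[OF i tx] by (simp add: linear_add[OF bounded_linear.linear[OF F]])
    qed
  qed
qed

lemma RR_diff:
  fixes q :: "'i \<Rightarrow> real \<Rightarrow> real \<Rightarrow> 'a::euclidean_space"
  assumes "RR j q" "RR j q'" shows "RR j (\<lambda>i t x. q i t x - q' i t x)"
  using RR_add[OF assms(1) RR_bounded_linear[OF bounded_linear_minus[OF bounded_linear_ident] assms(2)]] by simp

lemma RR_sum:
  fixes q :: "'k \<Rightarrow> 'i \<Rightarrow> real \<Rightarrow> real \<Rightarrow> 'a::euclidean_space"
  assumes "\<And>k. k \<in> A \<Longrightarrow> RR j (q k)"
  shows "RR j (\<lambda>i t x. \<Sum>k\<in>A. q k i t x)"
  using assms
proof (induction A rule: infinite_finite_induct)
  case (insert a A)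
  then show ?case using RR_add[of j "q a"] by simp
qed (auto intro: RR_const_in_tx simp del: RR.simps)

lemma RR_componentwise:
  fixes q :: "'i \<Rightarrow> real \<Rightarrow> real \<Rightarrow> 'a::euclidean_space"
  assumes "\<And>b. b \<in> Basis \<Longrightarrow> RR j (\<lambda>i t x. q i t x \<bullet> b)"
  shows "RR j q"
proof -
  have "RR j (\<lambda>i t x. \<Sum>b\<in>Basis. (q i t x \<bullet> b) *\<^sub>R b)"
    by (rule RR_sum) (rule RR_bounded_linear[OF bounded_linear_scaleR_left assms])
  then show ?thesis by (simp add: euclidean_representation)
qed

text \<open>Initial data enter as families that do not depend on t, but the derivative families
  extracted from them formally may; evaluating those at time 0 removes the dependence.\<close>

lemma RR_freeze:
  fixes q :: "'i \<Rightarrow> real \<Rightarrow> real \<Rightarrow> 'a::euclidean_space"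
  shows "RR j q \<Longrightarrow> RR j (\<lambda>i t. q i 0)"
proof (induction j arbitrary: q)
  case 0
  have z: "0 \<in> {0..T}" using Tpos by simp
  have c: "car (\<lambda>i t. q i 0)" unfolding car_def using car_measurable[OF R0_car[OF 0] _ z] by auto
  show ?case
  proof (rule R0_E[OF 0])
    fix g :: "'i \<Rightarrow> real \<Rightarrow> real" and K
    assume g: "\<And>i. i \<in> I \<Longrightarrow> L2v (g i)" "\<And>i. i \<in> I \<Longrightarrow> n2 (g i) \<le> K"
      "\<And>i t x. i \<in> I \<Longrightarrow> t \<in> {0..T} \<Longrightarrow> x \<in> {-1..1} \<Longrightarrow> norm (q i t x) \<le> g i x"
    show ?thesis by (rule R0_I[OF c g(1) g(2) g(3)[OF _ z]])
  qed
next
  case (Suc j)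
  have z: "0 \<in> {0..T}" using Tpos by simp
  show ?case
    by (rule RR_SucE[OF Suc.prems]) (rule RR_SucI[OF Suc.IH], assumption, rule continuous_on_const, blast intro: z, blast intro: z)
qed

text \<open>Two L^2 functions need not have an L^2 product, so one factor must be bounded, that is,
  have one derivative; hence max j 1. Both placements of the better factor are proved together
  because the product rule in the induction step uses one of each kind.\<close>

lemma RR_bilinear_aux:
  fixes prod :: "'a::euclidean_space \<Rightarrow> 'b::euclidean_space \<Rightarrow> 'c::euclidean_space"
  assumes bb: "bounded_bilinear prod"
  shows "(\<forall>m q. RR (max j 1) m \<longrightarrow> RR j q \<longrightarrow> RR j (\<lambda>i t x. prod (m i t x) (q i t x))) \<and>
    (\<forall>m q. RR j m \<longrightarrow> RR (max j 1) q \<longrightarrow> RR j (\<lambda>i t x. prod (m i t x) (q i t x)))"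
proof (induction j)
  case 0
  have e: "max 0 1 = Suc 0" by simp
  show ?case unfolding e
  proof (intro conjI allI impI)
    fix m :: "'i \<Rightarrow> real \<Rightarrow> real \<Rightarrow> 'a" and q :: "'i \<Rightarrow> real \<Rightarrow> real \<Rightarrow> 'b" assume "RR (Suc 0) m" "RR 0 q"
    then show "RR 0 (\<lambda>i t x. prod (m i t x) (q i t x))" by (intro BM_R0_bilinear[OF bb] RR_Suc_BM)
  next
    fix m :: "'i \<Rightarrow> real \<Rightarrow> real \<Rightarrow> 'a" and q :: "'i \<Rightarrow> real \<Rightarrow> real \<Rightarrow> 'b" assume "RR 0 m" "RR (Suc 0) q"
    then show "RR 0 (\<lambda>i t x. prod (m i t x) (q i t x))" by (intro R0_BM_bilinear[OF bb] RR_Suc_BM)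
  qed
next
  case (Suc j)
  obtain C where C: "C > 0" "\<And>a b. norm (prod a b) \<le> norm a * norm b * C"
    using bounded_bilinear.pos_bounded[OF bb] by blast
  have main: "RR (Suc j) (\<lambda>i t x. prod (m i t x) (q i t x))" if m: "RR (Suc j) m" and q: "RR (Suc j) q" for m q
  proof (rule RR_SucE[OF m], rule RR_SucE[OF q])
    fix r r' K K'
    assume r: "RR j r" "\<And>i. i \<in> I \<Longrightarrow> continuous_on {0..T} (\<lambda>t. m i t (-1))"
        "\<And>i t. i \<in> I \<Longrightarrow> t \<in> {0..T} \<Longrightarrow> norm (m i t (-1)) \<le> K"
        "\<And>i t x. i \<in> I \<Longrightarrow> t \<in> {0..T} \<Longrightarrow> x \<in> {-1..1} \<Longrightarrow> m i t x = m i t (-1) + prim (r i t) x"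
      and r': "RR j r'" "\<And>i. i \<in> I \<Longrightarrow> continuous_on {0..T} (\<lambda>t. q i t (-1))"
        "\<And>i t. i \<in> I \<Longrightarrow> t \<in> {0..T} \<Longrightarrow> norm (q i t (-1)) \<le> K'"
        "\<And>i t x. i \<in> I \<Longrightarrow> t \<in> {0..T} \<Longrightarrow> x \<in> {-1..1} \<Longrightarrow> q i t x = q i t (-1) + prim (r' i t) x"
    have m1: "RR (max j 1) m" by (rule RR_le[OF m]) simp
    have q1: "RR (max j 1) q" by (rule RR_le[OF q]) simp
    have R: "RR j (\<lambda>i t x. prod (m i t x) (r' i t x) + prod (r i t x) (q i t x))"
      by (rule RR_add[OF Suc.IH[THEN conjunct1, rule_format, OF m1 r'(1)] Suc.IH[THEN conjunct2, rule_format, OF r(1) q1]])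
    show ?thesis
    proof (rule RR_SucI[OF R, where K="K * K' * C"])
      fix i assume i: "i \<in> I"
      show "continuous_on {0..T} (\<lambda>t. prod (m i t (-1)) (q i t (-1)))" by (rule bounded_bilinear.continuous_on[OF bb r(2)[OF i] r'(2)[OF i]])
      show "norm (prod (m i t (-1)) (q i t (-1))) \<le> K * K' * C" if t: "t \<in> {0..T}" for t
      proof -
        have "norm (m i t (-1)) * norm (q i t (-1)) \<le> K * K'"
          using r(3)[OF i t] r'(3)[OF i t] order_trans[OF norm_ge_zero r(3)[OF i t]] by (intro mult_mono) auto
        then have "norm (m i t (-1)) * norm (q i t (-1)) * C \<le> K * K' * C" using C(1) by (intro mult_right_mono) auto
        then show ?thesis using C(2) order_trans by blast
      qed
      fix t x :: real assume tx: "t \<in> {0..T}" "x \<in> {-1..1}"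
      show "prod (m i t x) (q i t x) = prod (m i t (-1)) (q i t (-1)) + prim (\<lambda>x. prod (m i t x) (r' i t x) + prod (r i t x) (q i t x)) x"
        unfolding prim_def
        by (rule product_rule_prim[OF bb R0_L2v[OF RR_le[OF r(1) le0] i tx(1)] R0_L2v[OF RR_le[OF r'(1) le0] i tx(1)] r(4)[OF i tx(1)] r'(4)[OF i tx(1)] tx(2)])
    qed
  qed
  have e: "max (Suc j) 1 = Suc j" by simp
  show ?case unfolding e using main by blast
qed

lemma RR_bilinear:
  fixes prod :: "'a::euclidean_space \<Rightarrow> 'b::euclidean_space \<Rightarrow> 'c::euclidean_space"
  assumes "bounded_bilinear prod" "RR (max j 1) m" "RR j q"
  shows "RR j (\<lambda>i t x. prod (m i t x) (q i t x))"
  by (rule RR_bilinear_aux[OF assms(1), THEN conjunct1, rule_format, OF assms(2,3)])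

lemma RR_bilinear':
  fixes prod :: "'a::euclidean_space \<Rightarrow> 'b::euclidean_space \<Rightarrow> 'c::euclidean_space"
  assumes "bounded_bilinear prod" "RR j m" "RR (max j 1) q"
  shows "RR j (\<lambda>i t x. prod (m i t x) (q i t x))"
  by (rule RR_bilinear_aux[OF assms(1), THEN conjunct2, rule_format, OF assms(2,3)])

lemma frechet_basis_sum:
  fixes F :: "'a::euclidean_space \<Rightarrow> 'b::real_normed_vector"
  assumes "C_k (Suc n) F"
  shows "frechet_derivative F (at w) v = (\<Sum>b\<in>Basis. (v \<bullet> b) *\<^sub>R frechet_derivative F (at w) b)"
proof -
  interpret bounded_linear "frechet_derivative F (at w)" by (rule has_derivative_bounded_linear[OF C_kE[OF assms]])
  have "frechet_derivative F (at w) v = frechet_derivative F (at w) (\<Sum>b\<in>Basis. (v \<bullet> b) *\<^sub>R b)" by (simp add: euclidean_representation)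
  also have "\<dots> = (\<Sum>b\<in>Basis. (v \<bullet> b) *\<^sub>R frechet_derivative F (at w) b)" by (simp add: sum scaleR)
  finally show ?thesis .
qed

text \<open>The hypothesis speaks of products with the derivative of F along u, not of that
  derivative itself. This covers j = 0, where the composed derivative is bounded and continuous but
  need not be differentiable.\<close>

lemma RR_comp_step:
  fixes u :: "'i \<Rightarrow> real \<Rightarrow> real \<Rightarrow> 'a::euclidean_space" and F :: "'a \<Rightarrow> 'b::euclidean_space"
  assumes F: "C_k (Suc 0) F" and u: "RR (Suc j) u"
    and D: "\<And>b q. b \<in> Basis \<Longrightarrow> RR j q \<Longrightarrow> RR j (\<lambda>i t x. q i t x *\<^sub>R frechet_derivative F (at (u i t x)) b)"
  shows "RR (Suc j) (\<lambda>i t x. F (u i t x))"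
proof (rule RR_SucE[OF u])
  fix r K assume r: "RR j r" "\<And>i. i \<in> I \<Longrightarrow> continuous_on {0..T} (\<lambda>t. u i t (-1))"
      "\<And>i t. i \<in> I \<Longrightarrow> t \<in> {0..T} \<Longrightarrow> norm (u i t (-1)) \<le> K"
      "\<And>i t x. i \<in> I \<Longrightarrow> t \<in> {0..T} \<Longrightarrow> x \<in> {-1..1} \<Longrightarrow> u i t x = u i t (-1) + prim (r i t) x"
  have cF: "continuous_on UNIV F" by (rule C_k_continuous[OF F])
  have "RR j (\<lambda>i t x. \<Sum>b\<in>Basis. (r i t x \<bullet> b) *\<^sub>R frechet_derivative F (at (u i t x)) b)"
    by (rule RR_sum) (rule D, assumption, rule RR_bounded_linear[OF bounded_linear_inner_left r(1)])
  then have R: "RR j (\<lambda>i t x. frechet_derivative F (at (u i t x)) (r i t x))"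
    by (simp only: frechet_basis_sum[OF F, symmetric])
  show ?thesis
  proof (rule BM_E[OF BM_comp[OF cF RR_Suc_BM[OF u]]])
    fix K' assume K': "\<And>i t x. i \<in> I \<Longrightarrow> t \<in> {0..T} \<Longrightarrow> x \<in> {-1..1} \<Longrightarrow> norm (F (u i t x)) \<le> K'"
    show ?thesis
    proof (rule RR_SucI[OF R, where K=K'])
      fix i assume i: "i \<in> I"
      from continuous_on_compose2[OF cF r(2)[OF i]] show "continuous_on {0..T} (\<lambda>t. F (u i t (-1)))" by simp
      show "norm (F (u i t (-1))) \<le> K'" if "t \<in> {0..T}" for t using K'[OF i that] by simp
      fix t x :: real assume tx: "t \<in> {0..T}" "x \<in> {-1..1}"
      show "F (u i t x) = F (u i t (-1)) + prim (\<lambda>x. frechet_derivative F (at (u i t x)) (r i t x)) x"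
        by (rule chain_rule_L2v(2)[OF F R0_L2v[OF RR_le[OF r(1) le0] i tx(1)] r(4)[OF i tx(1)] tx(2)])
    qed
  qed
qed

lemma RR_comp:
  fixes u :: "'i \<Rightarrow> real \<Rightarrow> real \<Rightarrow> 'a::euclidean_space" and F :: "'a \<Rightarrow> 'b::euclidean_space"
  shows "C_k (Suc j) F \<Longrightarrow> RR (Suc j) u \<Longrightarrow> RR (Suc j) (\<lambda>i t x. F (u i t x))"
proof (induction j arbitrary: F)
  case 0
  show ?case
  proof (rule RR_comp_step[OF 0])
    fix b :: 'a and q :: "'i \<Rightarrow> real \<Rightarrow> real \<Rightarrow> real" assume q: "RR 0 q"
    have "BM (\<lambda>i t x. frechet_derivative F (at (u i t x)) b)"
      by (rule BM_comp[OF _ RR_Suc_BM[OF 0(2)]]) (use C_k_frechet[OF 0(1), of b] in simp)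
    from R0_BM_bilinear[OF bounded_bilinear_scaleR q this]
    show "RR 0 (\<lambda>i t x. q i t x *\<^sub>R frechet_derivative F (at (u i t x)) b)" .
  qed
next
  case (Suc j)
  have F1: "C_k (Suc 0) F" by (rule C_k_le[OF Suc.prems(1)]) simp
  show ?case
  proof (rule RR_comp_step[OF F1 Suc.prems(2)])
    fix b :: 'a and q :: "'i \<Rightarrow> real \<Rightarrow> real \<Rightarrow> real" assume q: "RR (Suc j) q"
    have "RR (Suc j) (\<lambda>i t x. frechet_derivative F (at (u i t x)) b)"
      by (rule Suc.IH[OF C_k_frechet[OF Suc.prems(1)] RR_Suc_imp[OF Suc.prems(2)]])
    then have "RR (max (Suc j) 1) (\<lambda>i t x. frechet_derivative F (at (u i t x)) b)" by (simp del: RR.simps)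
    from RR_bilinear'[OF bounded_bilinear_scaleR q this]
    show "RR (Suc j) (\<lambda>i t x. q i t x *\<^sub>R frechet_derivative F (at (u i t x)) b)" .
  qed
qed

end

section \<open>Linear differential equations with the space variable as a parameter\<close>

context family
begin

lemma lin_ode_unique:
  fixes y z :: "real \<Rightarrow> real^'d" and M :: "real \<Rightarrow> real^'d^'d"
  assumes M: "\<And>t. t \<in> {0..T} \<Longrightarrow> norm (M t) \<le> K" and K: "K \<ge> 0"
    and y: "\<And>t. t \<in> {0..T} \<Longrightarrow> (y has_vector_derivative M t *v y t + f t) (at t within {0..T})"
    and z: "\<And>t. t \<in> {0..T} \<Longrightarrow> (z has_vector_derivative M t *v z t + f t) (at t within {0..T})"
    and i: "y 0 = z 0" and t: "t \<in> {0..T}"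
  shows "y t = z t"
proof -
  have "norm (y t - z t) \<le> (norm (y 0 - z 0) + 0 * t) * exp (K * t)"
  proof (rule ode_bound[where y="\<lambda>t. y t - z t" and y'="\<lambda>t. M t *v (y t - z t)"])
    fix t assume t: "t \<in> {0..T}"
    have "((\<lambda>t. y t - z t) has_vector_derivative (M t *v y t + f t) - (M t *v z t + f t)) (at t within {0..T})"
      by (intro has_vector_derivative_diff y z t)
    then show "((\<lambda>t. y t - z t) has_vector_derivative M t *v (y t - z t)) (at t within {0..T})"
      by (simp add: matrix_vector_mult_diff_distrib)
    show "norm (M t *v (y t - z t)) \<le> K * norm (y t - z t) + 0"
      using order_trans[OF norm_matrix_vector mult_right_mono[OF M[OF t] norm_ge_zero]] by simp
  qed (use K t in auto)
  then show ?thesis using i by simp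
qed

text \<open>The equation is solved separately at every i and x. Measurability in x passes from the
  Picard iterates to the limit, and Gronwall's inequality supplies the dominating function.\<close>

lemma lin_ode_exists:
  fixes M :: "'i \<Rightarrow> real \<Rightarrow> real \<Rightarrow> real^'d^'d"
  assumes M: "BM M" and f: "RR 0 f" and z0: "RR 0 (\<lambda>i t. z0 i)"
  shows "\<exists>z. RR 0 z \<and> (\<forall>i\<in>I. \<forall>x\<in>{-1..1}. z i 0 x = z0 i x \<and>
    (\<forall>t\<in>{0..T}. ((\<lambda>t. z i t x) has_vector_derivative M i t x *v z i t x + f i t x) (at t within {0..T})))"
proof (rule BM_E[OF M], rule R0_E[OF f], rule R0_E[OF z0])
  fix K Kf Kg and g g0 :: "'i \<Rightarrow> real \<Rightarrow> real"
  assume K: "K \<ge> 0" "\<And>i t x. i \<in> I \<Longrightarrow> t \<in> {0..T} \<Longrightarrow> x \<in> {-1..1} \<Longrightarrow> norm (M i t x) \<le> K"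
    and g: "Kf \<ge> 0" "\<And>i. i \<in> I \<Longrightarrow> L2v (g i)" "\<And>i. i \<in> I \<Longrightarrow> n2 (g i) \<le> Kf"
      "\<And>i t x. i \<in> I \<Longrightarrow> t \<in> {0..T} \<Longrightarrow> x \<in> {-1..1} \<Longrightarrow> norm (f i t x) \<le> g i x"
    and g0: "Kg \<ge> 0" "\<And>i. i \<in> I \<Longrightarrow> L2v (g0 i)" "\<And>i. i \<in> I \<Longrightarrow> n2 (g0 i) \<le> Kg"
      "\<And>i t x. i \<in> I \<Longrightarrow> t \<in> {0..T} \<Longrightarrow> x \<in> {-1..1} \<Longrightarrow> norm (z0 i x) \<le> g0 i x"
  have T0: "0 \<le> T" and z: "0 \<in> {0..T}" using Tpos by auto
  define F where "F = (\<lambda>i x s z. M i s x *v z + f i s x)"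
  define P where "P = (\<lambda>i x y. (\<forall>t\<in>{0..T}. (\<lambda>n. pic (F i x) 0 (z0 i x) n t) \<longlonglongrightarrow> y t) \<and> y 0 = z0 i x \<and>
     (\<forall>t\<in>{0..T}. (y has_vector_derivative F i x t (y t)) (at t within {0..T})))"
  have exP: "\<exists>y. P i x y" if ix: "i \<in> I" "x \<in> {-1..1}" for i x
    unfolding P_def
  proof (rule picard[OF T0 K(1), of "F i x" "z0 i x"])
    show "continuous_on {0..T} (\<lambda>t. F i x t y)" for y
      unfolding F_def
      by (intro continuous_on_add car_continuous[OF R0_car[OF f] ix] continuous_on_const
          bounded_bilinear.continuous_on[OF bounded_bilinear_matrix_vector car_continuous[OF BM_car[OF M] ix]])
    show "norm (F i x t y - F i x t z) \<le> K * norm (y - z)" if t: "t \<in> {0..T}" for t y z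
    proof -
      have "F i x t y - F i x t z = M i t x *v (y - z)" by (simp add: F_def matrix_vector_mult_diff_distrib)
      then show ?thesis
        using order_trans[OF norm_matrix_vector mult_right_mono[OF K(2)[OF ix(1) t ix(2)] norm_ge_zero]] by simp
    qed
  qed blast
  define Y where "Y = (\<lambda>i x. SOME y. P i x y)"
  have P: "P i x (Y i x)" if "i \<in> I" "x \<in> {-1..1}" for i x
    unfolding Y_def by (rule someI_ex[OF exP[OF that]])
  have Y: "\<And>i x t. i \<in> I \<Longrightarrow> x \<in> {-1..1} \<Longrightarrow> t \<in> {0..T} \<Longrightarrow> (\<lambda>n. pic (F i x) 0 (z0 i x) n t) \<longlonglongrightarrow> Y i x t"
    "\<And>i x. i \<in> I \<Longrightarrow> x \<in> {-1..1} \<Longrightarrow> Y i x 0 = z0 i x"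
    "\<And>i x t. i \<in> I \<Longrightarrow> x \<in> {-1..1} \<Longrightarrow> t \<in> {0..T} \<Longrightarrow> (Y i x has_vector_derivative F i x t (Y i x t)) (at t within {0..T})"
    using P unfolding P_def by blast+
  define zz where "zz = (\<lambda>i t x. Y i x t)"
  have cp: "car (\<lambda>i t x. pic (F i x) 0 (z0 i x) n t)" for n
  proof (induction n)
    case 0
    show ?case using R0_car[OF z0] by simp
  next
    case (Suc n)
    define h where "h = (\<lambda>i s x. M i s x *v pic (F i x) 0 (z0 i x) n s + f i s x)"
    have h: "car h" unfolding h_def
      by (rule car_add[OF car_bilinear[OF bounded_bilinear_matrix_vector BM_car[OF M] Suc] R0_car[OF f]])
    have e: "pic (F i x) 0 (z0 i x) (Suc n) t = z0 i x + integral {0..t} (\<lambda>s. h i s x)" for i x t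
      by (simp add: h_def F_def)
    show ?case unfolding e car_def
    proof (intro ballI conjI)
      fix i t assume it: "i \<in> I" "t \<in> {0..T}"
      have "(\<lambda>x. integral {0..t} (\<lambda>s. h i s x)) \<in> borel_measurable (lebesgue_on {-1..1})"
      proof (rule measurable_time_integral)
        show "h i s \<in> borel_measurable (lebesgue_on {-1..1})" if "s \<in> {0..t}" for s
          using it that by (intro car_measurable[OF h]) auto
        show "continuous_on {0..t} (\<lambda>s. h i s x)" if "x \<in> {-1..1}" for x
          by (rule continuous_on_subset[OF car_continuous[OF h it(1) that]]) (use it in auto)
      qed (use it in auto)
      then show "(\<lambda>x. z0 i x + integral {0..t} (\<lambda>s. h i s x)) \<in> borel_measurable (lebesgue_on {-1..1})"
        by (intro borel_measurable_add car_measurable[OF R0_car[OF z0] it(1) z])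
    next
      fix i and x :: real assume ix: "i \<in> I" "x \<in> {-1..1}"
      show "continuous_on {0..T} (\<lambda>t. z0 i x + integral {0..t} (\<lambda>s. h i s x))"
        by (intro continuous_on_add continuous_on_const indefinite_integral_continuous_1 integrable_continuous_real car_continuous[OF h ix])
    qed
  qed
  have cz: "car zz" unfolding car_def
  proof (intro ballI conjI)
    fix i t assume it: "i \<in> I" "t \<in> {0..T}"
    show "zz i t \<in> borel_measurable (lebesgue_on {-1..1})"
    proof (rule borel_measurable_LIMSEQ_metric)
      show "(\<lambda>x. pic (F i x) 0 (z0 i x) n t) \<in> borel_measurable (lebesgue_on {-1..1})" for n
        by (rule car_measurable[OF cp it])
      show "(\<lambda>n. pic (F i x) 0 (z0 i x) n t) \<longlonglongrightarrow> zz i t x" if "x \<in> space (lebesgue_on {-1..1})" for x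
        unfolding zz_def by (rule Y(1)[OF it(1) _ it(2)]) (use that in simp)
    qed
  next
    fix i and x :: real assume ix: "i \<in> I" "x \<in> {-1..1}"
    show "continuous_on {0..T} (\<lambda>t. zz i t x)" unfolding zz_def
      using Y(3)[OF ix] has_vector_derivative_continuous continuous_on_eq_continuous_within by metis
  qed
  have "RR 0 zz"
  \<comment> \<open>With K bounding M, and g0 and g dominating the datum and the forcing, Gronwall's
    inequality at fixed x gives exp(K T) (g0 + T g), whose norm is bounded uniformly in i.\<close>
  proof (rule R0_I[OF cz, where g="\<lambda>i x. exp (K * T) *\<^sub>R (g0 i x + T *\<^sub>R g i x)" and K="exp (K * T) * (Kg + T * Kf)"])
    fix i assume i: "i \<in> I"
    have L: "L2v (\<lambda>x. T *\<^sub>R g i x)" by (rule L2v_scaleR[OF g(2)[OF i]])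
    show "L2v (\<lambda>x. exp (K * T) *\<^sub>R (g0 i x + T *\<^sub>R g i x))" by (rule L2v_scaleR[OF L2v_add[OF g0(2)[OF i] L]])
    have "n2 (\<lambda>x. g0 i x + T *\<^sub>R g i x) \<le> n2 (g0 i) + \<bar>T\<bar> * n2 (g i)"
      using n2_add[OF g0(2)[OF i] L] by (simp only: n2_scaleR)
    also have "\<dots> \<le> Kg + T * Kf" using g(3)[OF i] g0(3)[OF i] T0 by (intro add_mono mult_mono) (auto simp: n2_nonneg)
    finally show "n2 (\<lambda>x. exp (K * T) *\<^sub>R (g0 i x + T *\<^sub>R g i x)) \<le> exp (K * T) * (Kg + T * Kf)"
      by (simp only: n2_scaleR abs_exp_cancel) (rule mult_left_mono, simp_all)
    fix t x :: real assume tx: "t \<in> {0..T}" "x \<in> {-1..1}"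
    have "norm (Y i x t) \<le> (norm (Y i x 0) + g i x * t) * exp (K * t)"
    proof (rule ode_bound[OF Y(3)[OF i tx(2)]])
      fix s assume s: "s \<in> {0..T}"
      show "norm (F i x s (Y i x s)) \<le> K * norm (Y i x s) + g i x"
        unfolding F_def
        by (intro norm_triangle_le add_mono order_trans[OF norm_matrix_vector] mult_right_mono K(2) g(4) i s tx norm_ge_zero)
    qed (use K tx order_trans[OF norm_ge_zero g(4)[OF i z tx(2)]] in auto)
    also have "\<dots> \<le> (g0 i x + g i x * T) * exp (K * T)"
      using g0(4)[OF i z tx(2)] order_trans[OF norm_ge_zero g(4)[OF i z tx(2)]] order_trans[OF norm_ge_zero g0(4)[OF i z tx(2)]] tx K T0 Y(2)[OF i tx(2)]
      by (intro mult_mono add_mono mult_left_mono) (auto intro: mult_left_mono add_nonneg_nonneg)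
    finally show "norm (zz i t x) \<le> exp (K * T) *\<^sub>R (g0 i x + T *\<^sub>R g i x)" by (simp add: zz_def ac_simps)
  qed
  moreover have "\<forall>i\<in>I. \<forall>x\<in>{-1..1}. zz i 0 x = z0 i x \<and>
    (\<forall>t\<in>{0..T}. ((\<lambda>t. zz i t x) has_vector_derivative M i t x *v zz i t x + f i t x) (at t within {0..T}))"
    using Y(2,3) by (simp add: zz_def F_def)
  ultimately show ?thesis by blast
qed

text \<open>Nothing is assumed on the measurability or size of y: uniqueness at each x identifies it
  with the solution just constructed, which has both.\<close>

lemma lin_ode_R0:
  fixes M :: "'i \<Rightarrow> real \<Rightarrow> real \<Rightarrow> real^'d^'d"
  assumes M: "BM M" and f: "RR 0 f" and y0: "RR 0 (\<lambda>i t. y0 i)"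
    and i: "\<And>i x. i \<in> I \<Longrightarrow> x \<in> {-1..1} \<Longrightarrow> y i 0 x = y0 i x"
    and y: "\<And>i x t. i \<in> I \<Longrightarrow> x \<in> {-1..1} \<Longrightarrow> t \<in> {0..T} \<Longrightarrow>
      ((\<lambda>t. y i t x) has_vector_derivative M i t x *v y i t x + f i t x) (at t within {0..T})"
  shows "RR 0 y"
proof -
  obtain z where z: "RR 0 z" "\<forall>i\<in>I. \<forall>x\<in>{-1..1}. z i 0 x = y0 i x \<and>
    (\<forall>t\<in>{0..T}. ((\<lambda>t. z i t x) has_vector_derivative M i t x *v z i t x + f i t x) (at t within {0..T}))"
    using lin_ode_exists[OF M f y0] by blast
  show ?thesis
  proof (rule BM_E[OF M], rule RR_cong[OF z(1)])
    fix K i t and x :: real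
    assume K: "K \<ge> 0" "\<And>i t x. i \<in> I \<Longrightarrow> t \<in> {0..T} \<Longrightarrow> x \<in> {-1..1} \<Longrightarrow> norm (M i t x) \<le> K"
      and h: "i \<in> I" "t \<in> {0..T}" "x \<in> {-1..1}"
    show "y i t x = z i t x"
      by (rule lin_ode_unique[OF K(2)[OF h(1) _ h(3)] K(1) y[OF h(1,3)], of "\<lambda>t. z i t x"])
         (use z(2) h i[OF h(1,3)] in auto)
  qed
qed

text \<open>The equation satisfied by z is the formal x-derivative of the one for y. The difference delta
  of y and y(-1) + prim z solves a linear homogeneous equation that is nonlocal in x, with initial
  value zero, and vanishes by iterating the resulting estimate.\<close>

lemma lin_ode_spatial:
  fixes M m :: "'i \<Rightarrow> real \<Rightarrow> real \<Rightarrow> real^'d^'d" and f fx y z :: "'i \<Rightarrow> real \<Rightarrow> real \<Rightarrow> real^'d"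
  assumes M: "BM M" and m: "RR 0 m" and Mm: "\<And>i t x. i \<in> I \<Longrightarrow> t \<in> {0..T} \<Longrightarrow> x \<in> {-1..1} \<Longrightarrow> M i t x = M i t (-1) + prim (m i t) x"
    and fx: "RR 0 fx" and ffx: "\<And>i t x. i \<in> I \<Longrightarrow> t \<in> {0..T} \<Longrightarrow> x \<in> {-1..1} \<Longrightarrow> f i t x = f i t (-1) + prim (fx i t) x"
    and y: "BM y" and z: "RR 0 z"
    and dy: "\<And>i x t. i \<in> I \<Longrightarrow> x \<in> {-1..1} \<Longrightarrow> t \<in> {0..T} \<Longrightarrow>
      ((\<lambda>t. y i t x) has_vector_derivative M i t x *v y i t x + f i t x) (at t within {0..T})"
    and dz: "\<And>i x t. i \<in> I \<Longrightarrow> x \<in> {-1..1} \<Longrightarrow> t \<in> {0..T} \<Longrightarrow>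
      ((\<lambda>t. z i t x) has_vector_derivative M i t x *v z i t x + (m i t x *v y i t x + fx i t x)) (at t within {0..T})"
    and init: "\<And>i x. i \<in> I \<Longrightarrow> x \<in> {-1..1} \<Longrightarrow> y i 0 x = y i 0 (-1) + prim (z i 0) x"
    and i: "i \<in> I" and t: "t \<in> {0..T}" and x: "x \<in> {-1..1}"
  shows "y i t x = y i t (-1) + prim (z i t) x"
proof -
  note mv = bounded_bilinear_matrix_vector
  define Y where "Y = (\<lambda>t x. y i t (-1) + prim (z i t) x)"
  define \<delta> where "\<delta> = (\<lambda>t x. y i t x - Y t x)"
  have m1: "-1 \<in> {-1..1::real}" by simp
  have my: "RR 0 (\<lambda>i t x. m i t x *v y i t x)" by (rule R0_BM_bilinear[OF mv m y])
  have Mz: "RR 0 (\<lambda>i t x. M i t x *v z i t x)" by (rule BM_R0_bilinear[OF mv M z])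
  have z': "RR 0 (\<lambda>i t x. M i t x *v z i t x + (m i t x *v y i t x + fx i t x))" by (intro RR_add Mz my fx)
  have L: "L2v (z i t)" "L2v (m i t)" "L2v (fx i t)" "L2v (\<lambda>x. m i t x *v y i t x)" "L2v (\<lambda>x. M i t x *v z i t x)" if "t \<in> {0..T}" for t
    by (rule R0_L2v[OF z i that], rule R0_L2v[OF m i that], rule R0_L2v[OF fx i that], rule R0_L2v[OF my i that], rule R0_L2v[OF Mz i that])
  have cY: "continuous_on {-1..1} (Y t)" if "t \<in> {0..T}" for t
    unfolding Y_def by (intro continuous_intros prim_continuous L that)
  have mY: "L2v (\<lambda>x. m i t x *v Y t x)" if "t \<in> {0..T}" for t
    by (rule L2v_continuous_mult[OF bounded_bilinear.flip[OF mv] cY[OF that] L(2)[OF that]])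
  have md: "L2v (\<lambda>x. m i t x *v \<delta> t x)" if "t \<in> {0..T}" for t
    using L2v_diff[OF L(4)[OF that] mY[OF that]] by (simp add: \<delta>_def matrix_vector_mult_diff_distrib)
  \<comment> \<open>The product rule for M Y reassembles the integrated equation of z into the
    equation of y, except that z is driven by m y in place of m Y; the mismatch is the term with m
    \<delta>.\<close>
  have dY: "((\<lambda>t. Y t x) has_vector_derivative M i t x *v Y t x + f i t x + prim (\<lambda>x. m i t x *v \<delta> t x) x) (at t within {0..T})"
    if t: "t \<in> {0..T}" and x: "x \<in> {-1..1}" for t x
  proof (rule R0_E[OF z'])
    fix g :: "'i \<Rightarrow> real \<Rightarrow> real" and K
    assume g: "\<And>i. i \<in> I \<Longrightarrow> L2v (g i)"
      "\<And>i t x. i \<in> I \<Longrightarrow> t \<in> {0..T} \<Longrightarrow> x \<in> {-1..1} \<Longrightarrow> norm (M i t x *v z i t x + (m i t x *v y i t x + fx i t x)) \<le> g i x"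
    let ?z' = "\<lambda>t x. M i t x *v z i t x + (m i t x *v y i t x + fx i t x)"
    have "((\<lambda>t. prim (z i t) x) has_vector_derivative prim (?z' t) x) (at t within {0..T})"
      by (rule prim_time_derivative[where q="z i" and q'="?z'", OF L(1) dz[OF i] g(1)[OF i] g(2)[OF i] x t])
    from has_vector_derivative_add[OF dy[OF i m1 t] this]
    have 1: "((\<lambda>t. Y t x) has_vector_derivative M i t (-1) *v y i t (-1) + f i t (-1) + prim (?z' t) x) (at t within {0..T})"
      unfolding Y_def .
    have Ye: "Y t x = Y t (-1) + prim (z i t) x" for x by (simp add: Y_def prim_def)
    have 2: "M i t x *v Y t x = M i t (-1) *v Y t (-1) + integral {-1..x} (\<lambda>x. M i t x *v z i t x + m i t x *v Y t x)"
      by (rule product_rule_prim[OF mv L(2)[OF t] L(1)[OF t] Mm[OF i t] _ x]) (assumption, rule Ye)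
    have 3: "f i t x = f i t (-1) + prim (fx i t) x" by (rule ffx[OF i t x])
    have "prim (\<lambda>x. (M i t x *v z i t x + m i t x *v Y t x) + (fx i t x + m i t x *v \<delta> t x)) x
       = prim (\<lambda>x. M i t x *v z i t x + m i t x *v Y t x) x + (prim (fx i t) x + prim (\<lambda>x. m i t x *v \<delta> t x) x)"
      using prim_add[OF L2v_add[OF L(5)[OF t] mY[OF t]] L2v_add[OF L(3)[OF t] md[OF t]] x] prim_add[OF L(3)[OF t] md[OF t] x] by simp
    moreover have "(\<lambda>x. (M i t x *v z i t x + m i t x *v Y t x) + (fx i t x + m i t x *v \<delta> t x)) = ?z' t"
      by (simp add: \<delta>_def matrix_vector_mult_diff_distrib fun_eq_iff)
    ultimately have "M i t (-1) *v y i t (-1) + f i t (-1) + prim (?z' t) x = M i t x *v Y t x + f i t x + prim (\<lambda>x. m i t x *v \<delta> t x) x"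
      unfolding 2 3 by (simp add: prim_def Y_def ac_simps)
    then show ?thesis using 1 by simp
  qed
  have d\<delta>: "((\<lambda>t. \<delta> t x) has_vector_derivative M i t x *v \<delta> t x - prim (\<lambda>x. m i t x *v \<delta> t x) x) (at t within {0..T})"
    if t: "t \<in> {0..T}" and x: "x \<in> {-1..1}" for t x
  proof -
    have "((\<lambda>t. \<delta> t x) has_vector_derivative (M i t x *v y i t x + f i t x) - (M i t x *v Y t x + f i t x + prim (\<lambda>x. m i t x *v \<delta> t x) x)) (at t within {0..T})"
      unfolding \<delta>_def by (intro has_vector_derivative_diff dy i x t dY[unfolded \<delta>_def])
    moreover have "(M i t x *v y i t x + f i t x) - (M i t x *v Y t x + f i t x + prim (\<lambda>x. m i t x *v \<delta> t x) x) = M i t x *v \<delta> t x - prim (\<lambda>x. m i t x *v \<delta> t x) x"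
      by (simp add: \<delta>_def matrix_vector_mult_diff_distrib)
    ultimately show ?thesis by simp
  qed
  have "\<exists>K c. K > 0 \<and> c \<ge> 0 \<and> (\<forall>t\<in>{0..T}. \<forall>x\<in>{-1..1}. norm (\<delta> t x) \<le> c) \<and>
     (\<forall>t\<in>{0..T}. \<forall>b\<ge>0. (\<forall>x\<in>{-1..1}. norm (\<delta> t x) \<le> b) \<longrightarrow>
        (\<forall>x\<in>{-1..1}. norm (M i t x *v \<delta> t x - prim (\<lambda>x. m i t x *v \<delta> t x) x) \<le> K * b))"
  proof (rule BM_E[OF M], rule R0_E[OF m], rule BM_E[OF y], rule R0_E[OF z])
    fix KM Km Ky Kz and gm gz :: "'i \<Rightarrow> real \<Rightarrow> real"
    assume KM: "KM \<ge> 0" "\<And>i t x. i \<in> I \<Longrightarrow> t \<in> {0..T} \<Longrightarrow> x \<in> {-1..1} \<Longrightarrow> norm (M i t x) \<le> KM"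
      and Km: "Km \<ge> 0" "\<And>i. i \<in> I \<Longrightarrow> L2v (gm i)" "\<And>i. i \<in> I \<Longrightarrow> n2 (gm i) \<le> Km"
        "\<And>i t x. i \<in> I \<Longrightarrow> t \<in> {0..T} \<Longrightarrow> x \<in> {-1..1} \<Longrightarrow> norm (m i t x) \<le> gm i x"
      and Ky: "Ky \<ge> 0" "\<And>i t x. i \<in> I \<Longrightarrow> t \<in> {0..T} \<Longrightarrow> x \<in> {-1..1} \<Longrightarrow> norm (y i t x) \<le> Ky"
      and Kz: "Kz \<ge> 0" "\<And>i. i \<in> I \<Longrightarrow> L2v (gz i)" "\<And>i. i \<in> I \<Longrightarrow> n2 (gz i) \<le> Kz"
        "\<And>i t x. i \<in> I \<Longrightarrow> t \<in> {0..T} \<Longrightarrow> x \<in> {-1..1} \<Longrightarrow> norm (z i t x) \<le> gz i x"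
    have nm: "n2 (m i t) \<le> Km" if t: "t \<in> {0..T}" for t
    proof -
      have "n2 (m i t) \<le> 1 * n2 (gm i)"
        by (rule n2_mono[OF L(2)[OF t] Km(2)[OF i]]) (use Km(4)[OF i t] in force)+
      then show ?thesis using Km(3)[OF i] by simp
    qed
    have nz: "n2 (z i t) \<le> Kz" if t: "t \<in> {0..T}" for t
    proof -
      have "n2 (z i t) \<le> 1 * n2 (gz i)"
        by (rule n2_mono[OF L(1)[OF t] Kz(2)[OF i]]) (use Kz(4)[OF i t] in force)+
      then show ?thesis using Kz(3)[OF i] by simp
    qed
    have "norm (\<delta> t x) \<le> Ky + (Ky + 2 * Kz)" if t: "t \<in> {0..T}" and x: "x \<in> {-1..1}" for t x
    proof -
      have "norm (prim (z i t) x) \<le> 2 * Kz" using prim_bound[OF L(1)[OF t] x] nz[OF t] by simp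
      then show ?thesis unfolding \<delta>_def Y_def
        by (intro order_trans[OF norm_triangle_ineq4] add_mono norm_triangle_le Ky(2) i t x m1)
    qed
    moreover have "norm (M i t x *v \<delta> t x - prim (\<lambda>x. m i t x *v \<delta> t x) x) \<le> (KM + 2 * Km + 1) * b"
      if t: "t \<in> {0..T}" and b: "b \<ge> 0" "\<forall>x\<in>{-1..1}. norm (\<delta> t x) \<le> b" and x: "x \<in> {-1..1}" for t b x
    proof -
      have "norm (M i t x *v \<delta> t x) \<le> KM * b"
        by (rule order_trans[OF norm_matrix_vector]) (use KM(1) KM(2)[OF i t x] b x in \<open>intro mult_mono; auto\<close>)
      moreover have "n2 (\<lambda>x. m i t x *v \<delta> t x) \<le> b * n2 (m i t)"
      proof (rule n2_mono[OF md[OF t] L(2)[OF t] b(1)])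
        fix x :: real assume x: "x \<in> {-1..1}"
        have "norm (m i t x *v \<delta> t x) \<le> norm (m i t x) * norm (\<delta> t x)" by (rule norm_matrix_vector)
        also have "\<dots> \<le> norm (m i t x) * b" using b(2) x by (intro mult_left_mono) auto
        finally show "norm (m i t x *v \<delta> t x) \<le> b * norm (m i t x)" by (simp add: mult.commute)
      qed
      then have "norm (prim (\<lambda>x. m i t x *v \<delta> t x) x) \<le> 2 * (b * Km)"
        using prim_bound[OF md[OF t] x] mult_left_mono[OF nm[OF t] b(1)] by linarith
      ultimately have "norm (M i t x *v \<delta> t x - prim (\<lambda>x. m i t x *v \<delta> t x) x) \<le> KM * b + 2 * (b * Km)"
        using norm_triangle_ineq4 add_mono order_trans by blast
      also have "\<dots> \<le> (KM + 2 * Km + 1) * b" using b(1) by (simp add: algebra_simps)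
      finally show ?thesis .
    qed
    ultimately show ?thesis using KM(1) Km(1) Ky(1) Kz(1)
      by (intro exI[of _ "KM + 2 * Km + 1"] exI[of _ "Ky + (Ky + 2 * Kz)"]) auto
  qed
  then obtain K c where Kc: "K > 0" "c \<ge> 0" "\<And>t x. t \<in> {0..T} \<Longrightarrow> x \<in> {-1..1} \<Longrightarrow> norm (\<delta> t x) \<le> c"
    "\<And>t b x. t \<in> {0..T} \<Longrightarrow> b \<ge> 0 \<Longrightarrow> (\<forall>x\<in>{-1..1}. norm (\<delta> t x) \<le> b) \<Longrightarrow> x \<in> {-1..1} \<Longrightarrow>
       norm (M i t x *v \<delta> t x - prim (\<lambda>x. m i t x *v \<delta> t x) x) \<le> K * b"
    by blast
  \<comment> \<open>The weight exp(2 K t) makes each iteration gain a factor 1/2: K exp(2 K s) has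
    the primitive exp(2 K s)/2.\<close>
  have it: "norm (\<delta> t x) \<le> c * (1/2) ^ n * exp (2 * K * t)" if "t \<in> {0..T}" "x \<in> {-1..1}" for n t x
    using that
  proof (induction n arbitrary: t x)
    case 0
    have "c * 1 \<le> c * exp (2 * K * t)" using Kc(1,2) 0 by (intro mult_left_mono) auto
    then show ?case using Kc(3)[OF 0] by simp
  next
    case (Suc n)
    have d0: "\<delta> 0 x = 0" using init[OF i Suc.prems(2)] by (simp add: \<delta>_def Y_def)
    show ?case
    proof (cases "t = 0")
      case True
      then show ?thesis using d0 Kc(2) by simp
    next
      case False
      then have t0: "0 < t" using Suc.prems by simp
      define \<psi> where "\<psi> = (\<lambda>s. c * (1/2) ^ Suc n * exp (2 * K * s))"
      have "norm (\<delta> t x - \<delta> 0 x) \<le> \<psi> t - \<psi> 0"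
      proof (rule differentiable_bound_general[OF t0, where \<phi>=\<psi> and f="\<lambda>t. \<delta> t x" and f'="\<lambda>t. M i t x *v \<delta> t x - prim (\<lambda>x. m i t x *v \<delta> t x) x" and \<phi>'="\<lambda>s. K * (c * (1/2) ^ n * exp (2 * K * s))"])
        have "continuous_on {0..T} (\<lambda>t. \<delta> t x)"
          unfolding continuous_on_eq_continuous_within
          by (intro ballI has_vector_derivative_continuous[OF d\<delta>[OF _ Suc.prems(2)]])
        then show "continuous_on {0..t} (\<lambda>t. \<delta> t x)" by (rule continuous_on_subset) (use Suc.prems in auto)
        show "continuous_on {0..t} \<psi>" unfolding \<psi>_def by (intro continuous_intros)
        fix s assume s: "0 < s" "s < t"
        then have sT: "s \<in> {0..T}" "s < T" using Suc.prems by auto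
        show "((\<lambda>t. \<delta> t x) has_vector_derivative M i s x *v \<delta> s x - prim (\<lambda>x. m i s x *v \<delta> s x) x) (at s)"
          using d\<delta>[OF sT(1) Suc.prems(2)] at_within_Icc_at[OF s(1) sT(2)] by simp
        have "(\<psi> has_real_derivative K * (c * (1/2) ^ n * exp (2 * K * s))) (at s)"
          unfolding \<psi>_def by (auto intro!: derivative_eq_intros)
        then show "(\<psi> has_vector_derivative K * (c * (1/2) ^ n * exp (2 * K * s))) (at s)"
          by (simp only: has_real_derivative_iff_has_vector_derivative)
        show "norm (M i s x *v \<delta> s x - prim (\<lambda>x. m i s x *v \<delta> s x) x) \<le> K * (c * (1/2) ^ n * exp (2 * K * s))"
          by (rule Kc(4)[OF sT(1) _ _ Suc.prems(2)]) (use Kc(2) Suc.IH[OF sT(1)] in auto)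
      qed
      moreover have "\<psi> 0 \<ge> 0" using Kc(2) by (simp add: \<psi>_def)
      ultimately show ?thesis using d0 by (simp add: \<psi>_def)
    qed
  qed
  have "(\<lambda>n. c * (1/2) ^ n * exp (2 * K * t)) \<longlonglongrightarrow> c * 0 * exp (2 * K * t)"
    by (intro tendsto_mult tendsto_const LIMSEQ_power_zero) simp
  then have "norm (\<delta> t x) \<le> c * 0 * exp (2 * K * t)"
    by (rule LIMSEQ_le_const) (intro exI[of _ 0] allI impI it[OF t x])
  then show ?thesis by (simp add: \<delta>_def Y_def)
qed

text \<open>The formal x-derivative solves an equation with the same matrix M and forcing m y + f_x,
  to which the induction hypothesis applies; \<open>lin_ode_spatial\<close> shows that it is the
  true derivative. Hence f, y0 and y vary in the induction while M is kept.\<close>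

lemma lin_ode_RR:
  fixes M :: "'i \<Rightarrow> real \<Rightarrow> real \<Rightarrow> real^'d^'d" and f y :: "'i \<Rightarrow> real \<Rightarrow> real \<Rightarrow> real^'d"
  shows "\<lbrakk>RR (max j 1) M; RR j f; RR j (\<lambda>i t. y0 i);
    \<And>i x. i \<in> I \<Longrightarrow> x \<in> {-1..1} \<Longrightarrow> y i 0 x = y0 i x;
    \<And>i x t. i \<in> I \<Longrightarrow> x \<in> {-1..1} \<Longrightarrow> t \<in> {0..T} \<Longrightarrow>
      ((\<lambda>t. y i t x) has_vector_derivative M i t x *v y i t x + f i t x) (at t within {0..T})\<rbrakk> \<Longrightarrow> RR j y"
proof (induction j arbitrary: f y0 y)
  case 0
  have "RR (Suc 0) M" using 0(1) by (simp del: RR.simps)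
  from lin_ode_R0[OF RR_Suc_BM[OF this] 0(2-5)] show ?case .
next
  case (Suc j)
  note mv = bounded_bilinear_matrix_vector
  have M: "RR (Suc j) M" using Suc.prems(1) by (simp del: RR.simps)
  have M': "RR (max j 1) M" by (rule RR_le[OF M]) simp
  have bM: "BM M" by (rule RR_Suc_BM[OF M])
  have bf: "BM f" by (rule RR_Suc_BM[OF Suc.prems(2)])
  have by0: "BM (\<lambda>i t. y0 i)" by (rule RR_Suc_BM[OF Suc.prems(3)])
  have z: "0 \<in> {0..T}" using Tpos by simp
  have R0y: "RR 0 y" by (rule lin_ode_R0[OF bM BM_R0[OF bf] BM_R0[OF by0] Suc.prems(4,5)])
  have bmy: "BM y"
  proof (rule BM_E[OF bM], rule BM_E[OF bf], rule BM_E[OF by0])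
    fix K Kf K0
    assume K: "K \<ge> 0" "\<And>i t x. i \<in> I \<Longrightarrow> t \<in> {0..T} \<Longrightarrow> x \<in> {-1..1} \<Longrightarrow> norm (M i t x) \<le> K"
      and Kf: "Kf \<ge> 0" "\<And>i t x. i \<in> I \<Longrightarrow> t \<in> {0..T} \<Longrightarrow> x \<in> {-1..1} \<Longrightarrow> norm (f i t x) \<le> Kf"
      and K0: "K0 \<ge> 0" "\<And>i t x. i \<in> I \<Longrightarrow> t \<in> {0..T} \<Longrightarrow> x \<in> {-1..1} \<Longrightarrow> norm (y0 i x) \<le> K0"
    have "norm (y i t x) \<le> (K0 + Kf * T) * exp (K * T)" if h: "i \<in> I" "t \<in> {0..T}" "x \<in> {-1..1}" for i t x
    proof -
      have "norm (y i t x) \<le> (norm (y i 0 x) + Kf * t) * exp (K * t)"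
      proof (rule ode_bound[OF Suc.prems(5)[OF h(1,3)]])
        fix s assume s: "s \<in> {0..T}"
        show "norm (M i s x *v y i s x + f i s x) \<le> K * norm (y i s x) + Kf"
          by (intro norm_triangle_le add_mono order_trans[OF norm_matrix_vector] mult_right_mono K(2) Kf(2) h s norm_ge_zero)
      qed (use K Kf h in auto)
      also have "\<dots> \<le> (K0 + Kf * T) * exp (K * T)"
        using K0(2)[OF h(1) z h(3)] Suc.prems(4)[OF h(1,3)] K Kf K0 h(2)
        by (intro mult_mono add_mono) (auto intro: mult_left_mono add_nonneg_nonneg)
      finally show ?thesis .
    qed
    then show ?thesis unfolding BM_def using R0_car[OF R0y] by blast
  qed
  show ?case
  proof (rule RR_SucE[OF M], rule RR_SucE[OF Suc.prems(2)], rule RR_SucE[OF Suc.prems(3)])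
    fix m fx w KM Kf K0
    assume m: "RR j m" "\<And>i t x. i \<in> I \<Longrightarrow> t \<in> {0..T} \<Longrightarrow> x \<in> {-1..1} \<Longrightarrow> M i t x = M i t (-1) + prim (m i t) x"
      and fx: "RR j fx" "\<And>i t x. i \<in> I \<Longrightarrow> t \<in> {0..T} \<Longrightarrow> x \<in> {-1..1} \<Longrightarrow> f i t x = f i t (-1) + prim (fx i t) x"
      and w: "RR j w" "\<And>i t x. i \<in> I \<Longrightarrow> t \<in> {0..T} \<Longrightarrow> x \<in> {-1..1} \<Longrightarrow> y0 i x = y0 i (-1) + prim (w i t) x"
    have w0: "RR j (\<lambda>i t. w i 0)" by (rule RR_freeze[OF w(1)])
    \<comment> \<open>For j = 0 it suffices that y is bounded. Otherwise the induction hypothesis is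
      used a first time, for y itself, to obtain the j derivatives of y in the forcing.\<close>
    have my: "RR j (\<lambda>i t x. m i t x *v y i t x)"
    proof (cases j)
      case 0
      show ?thesis using R0_BM_bilinear[OF mv m(1)[unfolded 0] bmy] unfolding 0 .
    next
      case (Suc k)
      have "RR j y" by (rule Suc.IH[OF M' RR_Suc_imp[OF Suc.prems(2)] RR_Suc_imp[OF Suc.prems(3)] Suc.prems(4,5)])
      moreover have "max j 1 = j" using Suc by simp
      ultimately have "RR (max j 1) y" by (simp only:)
      then show ?thesis by (rule RR_bilinear'[OF mv m(1)])
    qed
    have F: "RR j (\<lambda>i t x. m i t x *v y i t x + fx i t x)" by (rule RR_add[OF my fx(1)])
    obtain zz where zz: "RR 0 zz" "\<forall>i\<in>I. \<forall>x\<in>{-1..1}. zz i 0 x = w i 0 x \<and>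
      (\<forall>t\<in>{0..T}. ((\<lambda>t. zz i t x) has_vector_derivative M i t x *v zz i t x + (m i t x *v y i t x + fx i t x)) (at t within {0..T}))"
      using lin_ode_exists[OF bM RR_le[OF F le0] RR_le[OF w0 le0]] by blast
    have zi: "zz i 0 x = w i 0 x" if "i \<in> I" "x \<in> {-1..1}" for i x using zz(2) that by blast
    have dz: "((\<lambda>t. zz i t x) has_vector_derivative M i t x *v zz i t x + (m i t x *v y i t x + fx i t x)) (at t within {0..T})"
      if "i \<in> I" "x \<in> {-1..1}" "t \<in> {0..T}" for i x t using zz(2) that by blast
    have RZ: "RR j zz" by (rule Suc.IH[OF M' F w0 zi dz])
    have init: "y i 0 x = y i 0 (-1) + prim (zz i 0) x" if ix: "i \<in> I" "x \<in> {-1..1}" for i x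
    proof -
      have "prim (zz i 0) x = prim (w i 0) x" unfolding prim_def
        by (rule Henstock_Kurzweil_Integration.integral_cong) (use zi[OF ix(1)] ix in auto)
      then show ?thesis using w(2)[OF ix(1) z ix(2)] Suc.prems(4)[OF ix] Suc.prems(4)[OF ix(1), of "-1"] by simp
    qed
    show "RR (Suc j) y"
    proof (rule BM_E[OF bmy])
      fix Ky assume Ky: "\<And>i t x. i \<in> I \<Longrightarrow> t \<in> {0..T} \<Longrightarrow> x \<in> {-1..1} \<Longrightarrow> norm (y i t x) \<le> Ky"
      show ?thesis
      proof (rule RR_SucI[OF RZ, where K=Ky])
        show "continuous_on {0..T} (\<lambda>t. y i t (-1))" if "i \<in> I" for i
          by (rule car_continuous[OF BM_car[OF bmy] that]) simp
        show "norm (y i t (-1)) \<le> Ky" if "i \<in> I" "t \<in> {0..T}" for i t by (rule Ky[OF that]) simp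
        show "y i t x = y i t (-1) + prim (zz i t) x" if "i \<in> I" "t \<in> {0..T}" "x \<in> {-1..1}" for i t x
          by (rule lin_ode_spatial[OF bM RR_le[OF m(1) le0] m(2) RR_le[OF fx(1) le0] fx(2) bmy zz(1) Suc.prems(5) dz init that])
      qed
    qed
  qed
qed

end

section \<open>Regularity\<close>

lemma C_k_inverse:
  fixes f :: "'a::real_normed_vector \<Rightarrow> real"
  assumes nz: "\<And>x. f x \<noteq> 0"
  shows "C_k n f \<Longrightarrow> C_k n (\<lambda>x. inverse (f x))"
proof (induction n)
  case 0
  then show ?case using nz by (auto intro: continuous_on_inverse)
next
  case (Suc n)
  have i: "C_k n (\<lambda>x. inverse (f x))" by (rule Suc.IH[OF C_k_Suc_imp[OF Suc.prems]])
  show ?case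
  proof (rule C_kI[OF Deriv.has_derivative_inverse[OF nz C_kE[OF Suc.prems]]])
    fix v
    have "C_k n (\<lambda>x. -1 * (inverse (f x) * frechet_derivative f (at x) v * inverse (f x)))"
      by (intro C_k_scale C_k_mult i C_k_frechet[OF Suc.prems])
    then show "C_k n (\<lambda>x. - (inverse (f x) * frechet_derivative f (at x) v * inverse (f x)))"
      by simp
  qed
qed

lemma C_k_prod:
  fixes f :: "'i \<Rightarrow> 'a::real_normed_vector \<Rightarrow> real"
  assumes "finite I" "\<And>i. i \<in> I \<Longrightarrow> C_k n (f i)"
  shows "C_k n (\<lambda>x. \<Prod>i\<in>I. f i x)"
  using assms by (induction I rule: finite_induct) (simp_all add: C_k_const C_k_mult)

lemma C_k_det:
  fixes F :: "'a::real_normed_vector \<Rightarrow> real^'d^'d"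
  assumes "\<And>i j. C_k n (\<lambda>x. F x $ i $ j)"
  shows "C_k n (\<lambda>x. det (F x))"
  unfolding det_def by (intro C_k_sum C_k_scale C_k_prod assms) simp

lemma prim_cong_AE:
  assumes "L2v y" "L2v z" "AE x in Om. y x = z x" "x \<in> {-1..1}"
  shows "prim y x = prim z x"
proof -
  have L: "L2v (\<lambda>x. y x - z x)" by (rule L2v_diff[OF assms(1,2)])
  have "(LINT x|Om. 0::real) = integral {-1..1} (\<lambda>x. (norm (y x - z x))\<^sup>2)"
  proof (rule LINT_AE_eq)
    show "(\<lambda>x. (norm (y x - z x))\<^sup>2) absolutely_integrable_on {-1..1}"
      by (rule nonnegative_absolutely_integrable_1[OF L2v_int_sq[OF L]]) simp
    show "AE x in Om. 0 = (norm (y x - z x))\<^sup>2" using assms(3) by (rule AE_mp) simp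
  qed simp
  then have "n2 (\<lambda>x. y x - z x) = 0" by (simp add: n2_def)
  then have "prim (\<lambda>x. y x - z x) x = 0" using prim_bound[OF L assms(4)] by simp
  then show ?thesis using prim_diff[OF assms(1,2,4)] by simp
qed

lemma rep_zero:
  fixes \<phi> :: "real \<Rightarrow> real^'d"
  assumes "\<phi> \<in> borel_measurable Om" "rep \<phi> y" "AE x in Om. \<phi> x = 0"
  shows "n2 y = 0"
proof -
  have "L2v (\<lambda>x. 0 :: real^'d)" by (rule L2v_continuous) (intro continuous_intros)
  then have "rep \<phi> (\<lambda>x. 0)" using assms(3) by (simp add: rep_def prim_def)
  from Xnorm1_bounds(2)[OF assms(1) this] Xnorm1_bounds(1)[OF assms(1,2)]
  have "n2 y \<le> 5 * n2 (\<lambda>x. 0 :: real^'d)" by (rule order_trans[rotated])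
  then show ?thesis using n2_nonneg[of y] by (simp add: n2_def)
qed

lemma n2_time_continuous:
  fixes r :: "real \<Rightarrow> real \<Rightarrow> 'a::euclidean_space"
  assumes L: "\<And>t. t \<in> S \<Longrightarrow> L2v (r t)" and c: "\<And>x. x \<in> {-1..1} \<Longrightarrow> continuous_on S (\<lambda>t. r t x)"
    and g: "L2v g" "\<And>t x. t \<in> S \<Longrightarrow> x \<in> {-1..1} \<Longrightarrow> norm (r t x) \<le> (g x :: real)"
  shows "continuous_on S (\<lambda>t. n2 (r t))"
proof (rule continuous_on_sequentiallyI)
  fix u a assume u: "\<forall>n. u n \<in> S" "a \<in> S" "u \<longlonglongrightarrow> a"
  have "(\<lambda>n. integral {-1..1} (\<lambda>x. (norm (r (u n) x))\<^sup>2)) \<longlonglongrightarrow> integral {-1..1} (\<lambda>x. (norm (r a x))\<^sup>2)"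
  proof (rule dominated_convergence(2)[where h="\<lambda>x. (norm (g x))\<^sup>2"])
    show "(\<lambda>x. (norm (r (u k) x))\<^sup>2) integrable_on {-1..1}" for k using L u by (intro L2v_int_sq) auto
    show "(\<lambda>x. (norm (g x))\<^sup>2) integrable_on {-1..1}" by (rule L2v_int_sq[OF g(1)])
    fix x :: real assume x: "x \<in> {-1..1}"
    show "norm ((norm (r (u k) x))\<^sup>2) \<le> (norm (g x))\<^sup>2" for k
      using g(2)[of "u k" x] u x by (auto intro: power_mono)
    show "(\<lambda>k. (norm (r (u k) x))\<^sup>2) \<longlonglongrightarrow> (norm (r a x))\<^sup>2"
      using u by (intro tendsto_power tendsto_norm continuous_on_tendsto_compose[OF c[OF x]]) auto
  qed
  then show "(\<lambda>n. n2 (r (u n))) \<longlonglongrightarrow> n2 (r a)" unfolding n2_def by (rule tendsto_real_sqrt)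
qed

section \<open>From families to Sobolev norms and back\<close>

context family
begin

lemma R0_n2:
  fixes q :: "'i \<Rightarrow> real \<Rightarrow> real \<Rightarrow> 'a::euclidean_space"
  assumes q: "RR 0 q"
  shows "\<exists>C. \<forall>i\<in>I. continuous_on {0..T} (\<lambda>t. n2 (q i t)) \<and> (\<forall>t\<in>{0..T}. n2 (q i t) \<le> C)"
proof (rule R0_E[OF q])
  fix g :: "'i \<Rightarrow> real \<Rightarrow> real" and K
  assume g: "\<And>i. i \<in> I \<Longrightarrow> L2v (g i)" "\<And>i. i \<in> I \<Longrightarrow> n2 (g i) \<le> K"
    "\<And>i t x. i \<in> I \<Longrightarrow> t \<in> {0..T} \<Longrightarrow> x \<in> {-1..1} \<Longrightarrow> norm (q i t x) \<le> g i x"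
  have "n2 (q i t) \<le> K" if "i \<in> I" "t \<in> {0..T}" for i t
  proof -
    have "n2 (q i t) \<le> 1 * n2 (g i)"
      by (rule n2_mono[OF R0_L2v[OF q that] g(1)[OF that(1)]]) (use g(3)[OF that] in force)+
    then show ?thesis using g(2)[OF that(1)] by simp
  qed
  moreover have "continuous_on {0..T} (\<lambda>t. n2 (q i t))" if i: "i \<in> I" for i
    by (rule n2_time_continuous[OF R0_L2v[OF q i] car_continuous[OF R0_car[OF q] i] g(1)[OF i] g(3)[OF i]])
  ultimately show ?thesis by blast
qed

text \<open>The \<open>s l\<close> are the successive derivative families. The claim covers every
  measurable f agreeing almost everywhere with the component, because weak solutions are only such
  representatives.\<close>

lemma RR_weak_deriv:
  fixes q :: "'i \<Rightarrow> real \<Rightarrow> real \<Rightarrow> real^'d"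
  shows "RR j q \<Longrightarrow> \<exists>s. (\<forall>l\<le>j. RR 0 (s l)) \<and> (\<forall>i\<in>I. \<forall>t\<in>{0..T}. \<forall>a. \<forall>f\<in>borel_measurable Om.
     (AE x in Om. f x = q i t x $ a) \<longrightarrow> (\<forall>l\<le>j. has_weak_deriv l f (\<lambda>x. s l i t x $ a)))"
proof (induction j arbitrary: q)
  case 0
  have "has_weak_deriv 0 f (\<lambda>x. q i t x $ a)"
    if h: "i \<in> I" "t \<in> {0..T}" "f \<in> borel_measurable Om" "AE x in Om. f x = q i t x $ a" for i t a f
  proof -
    have L: "L2v (\<lambda>x. q i t x $ a)" by (rule L2v_nth[OF R0_L2v[OF 0 h(1,2)]])
    have "(LINT x|Om. f x * \<phi> x) = (LINT x|Om. q i t x $ a * \<phi> x)" if "test_fun \<phi>" for \<phi>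
      using LINT_test_AE[OF h(3) L h(4) that] LINT_test_AE[OF L2v_Om_measurable[OF L] L AE_I2 that] by simp
    then show ?thesis by (simp add: has_weak_deriv_def)
  qed
  then show ?case using 0 by (intro exI[of _ "\<lambda>_. q"]) (simp del: RR.simps)
next
  case (Suc j)
  show ?case
  proof (rule RR_SucE[OF Suc.prems])
    fix r K
    assume r: "RR j r" and q: "\<And>i t x. i \<in> I \<Longrightarrow> t \<in> {0..T} \<Longrightarrow> x \<in> {-1..1} \<Longrightarrow> q i t x = q i t (-1) + prim (r i t) x"
    have r0: "RR 0 r" by (rule RR_le[OF r le0])
    obtain s where s: "\<forall>l\<le>j. RR 0 (s l)" "\<forall>i\<in>I. \<forall>t\<in>{0..T}. \<forall>a. \<forall>f\<in>borel_measurable Om.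
     (AE x in Om. f x = r i t x $ a) \<longrightarrow> (\<forall>l\<le>j. has_weak_deriv l f (\<lambda>x. s l i t x $ a))"
      using Suc.IH[OF r] by blast
    \<comment> \<open>Order zero is q itself, order l + 1 is order l of its derivative r.\<close>
    define s' where "s' = case_nat q s"
    have q0: "RR 0 q" by (rule RR_le[OF Suc.prems le0])
    have "RR 0 (s' l)" if "l \<le> Suc j" for l
      using s(1) q0 that by (cases l) (simp_all add: s'_def del: RR.simps)
    moreover have "has_weak_deriv l f (\<lambda>x. s' l i t x $ a)"
      if h: "i \<in> I" "t \<in> {0..T}" "f \<in> borel_measurable Om" "AE x in Om. f x = q i t x $ a" "l \<le> Suc j" for i t a f l
    proof -
      have L: "L2v (\<lambda>x. q i t x $ a)" by (rule L2v_nth[OF R0_L2v[OF q0 h(1,2)]])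
      have Lr: "L2v (r i t)" by (rule R0_L2v[OF r0 h(1,2)])
      have Lra: "L2v (\<lambda>x. r i t x $ a)" by (rule L2v_nth[OF Lr])
      show ?thesis
      proof (cases l)
        case 0
        have "(LINT x|Om. f x * \<phi> x) = (LINT x|Om. q i t x $ a * \<phi> x)" if "test_fun \<phi>" for \<phi>
          using LINT_test_AE[OF h(3) L h(4) that] LINT_test_AE[OF L2v_Om_measurable[OF L] L AE_I2 that] by simp
        then show ?thesis by (simp add: 0 s'_def has_weak_deriv_def)
      next
        case (Suc l')
        have "AE x in Om. q i t x $ a = q i t (-1) $ a + prim (\<lambda>x. r i t x $ a) x"
        proof (rule Om_AE_I)
          fix x :: real assume "x \<in> {-1<..<1}"
          then have x: "x \<in> {-1..1}" by simp
          show "q i t x $ a = q i t (-1) $ a + prim (\<lambda>x. r i t x $ a) x"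
            unfolding prim_nth[OF Lr x, symmetric] by (subst q[OF h(1,2) x]) simp
        qed
        with h(4) have e: "AE x in Om. f x = q i t (-1) $ a + prim (\<lambda>x. r i t x $ a) x" by eventually_elim (rule trans)
        have "has_weak_deriv l' (\<lambda>x. r i t x $ a) (\<lambda>x. s l' i t x $ a)"
          using s(2) h(1,2,5) L2v_Om_measurable[OF Lra] Suc by auto
        then have "has_weak_deriv (Suc l') f (\<lambda>x. s l' i t x $ a)"
          unfolding has_weak_deriv_shift[OF h(3) Lra e] .
        then show ?thesis by (simp add: Suc s'_def)
      qed
    qed
    ultimately show ?thesis by blast
  qed
qed

text \<open>The essential supremum of the norm in time requires measurability. So the norm is
  identified with an explicit h that is continuous in t, besides being bounded.\<close>

lemma RR_Xnorm:
  fixes q :: "'i \<Rightarrow> real \<Rightarrow> real \<Rightarrow> real^'d"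
  assumes q: "RR j q"
  shows "\<exists>h C. \<forall>i\<in>I. continuous_on {0..T} (h i) \<and> (\<forall>t\<in>{0..T}. h i t \<le> C \<and>
    (\<forall>f\<in>borel_measurable Om. (AE x in Om. f x = q i t x) \<longrightarrow> f \<in> X j \<and> Xnorm j f = h i t))"
proof -
  obtain s where s: "\<forall>l\<le>j. RR 0 (s l)" "\<forall>i\<in>I. \<forall>t\<in>{0..T}. \<forall>a. \<forall>f\<in>borel_measurable Om.
     (AE x in Om. f x = q i t x $ a) \<longrightarrow> (\<forall>l\<le>j. has_weak_deriv l f (\<lambda>x. s l i t x $ a))"
    using RR_weak_deriv[OF q] by blast
  have "\<forall>l\<le>j. \<exists>C. \<forall>i\<in>I. continuous_on {0..T} (\<lambda>t. n2 (s l i t)) \<and> (\<forall>t\<in>{0..T}. n2 (s l i t) \<le> C)"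
    using R0_n2 s(1) by blast
  then obtain C where C: "\<And>l i. l \<le> j \<Longrightarrow> i \<in> I \<Longrightarrow> continuous_on {0..T} (\<lambda>t. n2 (s l i t))"
    "\<And>l i t. l \<le> j \<Longrightarrow> i \<in> I \<Longrightarrow> t \<in> {0..T} \<Longrightarrow> n2 (s l i t) \<le> C l"
    by metis
  define h where "h = (\<lambda>i t. sqrt (\<Sum>l\<le>j. (n2 (s l i t))\<^sup>2))"
  have "continuous_on {0..T} (h i)" if "i \<in> I" for i
    unfolding h_def using C(1) that by (intro continuous_intros) auto
  moreover have "h i t \<le> sqrt (\<Sum>l\<le>j. (C l)\<^sup>2)" if "i \<in> I" "t \<in> {0..T}" for i t
    unfolding h_def using C(2) that by (intro real_sqrt_le_mono sum_mono power_mono n2_nonneg) auto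
  moreover have "f \<in> X j \<and> Xnorm j f = h i t"
    if i: "i \<in> I" "t \<in> {0..T}" and f: "f \<in> borel_measurable Om" "AE x in Om. f x = q i t x" for i t f
  proof
    have L: "L2v (s l i t)" if "l \<le> j" for l using R0_L2v[of "s l", OF _ i] s(1) that by blast
    have Lq: "L2v (q i t)" by (rule R0_L2v[OF RR_le[OF q le0] i])
    have fa: "(\<lambda>x. f x $ a) \<in> borel_measurable Om" for a by (rule vec_nth_measurable[OF f(1)])
    have ea: "AE x in Om. f x $ a = q i t x $ a" for a using f(2) by (rule AE_mp) simp
    have w: "has_weak_deriv l (\<lambda>x. f x $ a) (\<lambda>x. s l i t x $ a)" if "l \<le> j" for l a
      by (rule s(2)[rule_format, OF i fa ea that])
    have "(\<lambda>x. f x $ a) \<in> H j" for a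
      unfolding H_def using L2_AE[OF fa L2v_nth[OF Lq] ea] w L2v_L2[OF L2v_nth[OF L]] by blast
    then show "f \<in> X j" by (simp add: X_def)
    have "norm0 (vderiv l f) = n2 (s l i t)" if "l \<le> j" for l
      by (rule norm0_AE[OF vderiv_AE(1)[OF L[OF that] w[OF that]] L[OF that] vderiv_AE(2)[OF L[OF that] w[OF that]]])
    then show "Xnorm j f = h i t" by (simp add: Xnorm_def h_def)
  qed
  ultimately show ?thesis by blast
qed

text \<open>Norm bounds on the weak derivatives of all members become the uniform domination
  required by \<open>RR\<close>; time plays no part yet. Orders shift by one as in
  \<open>H_SucE\<close>.\<close>

lemma H_data:
  fixes f :: "'i \<Rightarrow> real \<Rightarrow> real"
  shows "\<lbrakk>\<And>i. i \<in> I \<Longrightarrow> f i \<in> H j; \<And>i l. i \<in> I \<Longrightarrow> l \<le> j \<Longrightarrow> (LINT x|Om. (weak_deriv l (f i) x)\<^sup>2) \<le> K\<rbrakk> \<Longrightarrow>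
    \<exists>g. RR j (\<lambda>i t. g i) \<and> (\<forall>i\<in>I. AE x in Om. f i x = g i x)"
proof (induction j arbitrary: f)
  case 0
  have "\<exists>g. L2v g \<and> (\<forall>x\<in>{-1<..<1}. g x = f i x)" if "i \<in> I" for i
    by (rule L2_rep[OF 0(1)[OF that, unfolded H_0]]) blast
  then have "\<forall>i\<in>I. \<exists>g. L2v g \<and> (\<forall>x\<in>{-1<..<1}. g x = f i x)" by blast
  from bchoice[OF this] obtain g where "\<forall>i\<in>I. L2v (g i) \<and> (\<forall>x\<in>{-1<..<1}. g i x = f i x)" by blast
  then have g: "\<And>i. i \<in> I \<Longrightarrow> L2v (g i)" "\<And>i x. i \<in> I \<Longrightarrow> x \<in> {-1<..<1} \<Longrightarrow> g i x = f i x" by blast+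
  have fg: "AE x in Om. f i x = g i x" if "i \<in> I" for i
    by (rule Om_AE_I) (use g(2)[OF that] in simp)
  have b: "n2 (\<lambda>x. norm (g i x)) \<le> sqrt K" if i: "i \<in> I" for i
  proof -
    have fL: "f i \<in> L2" using 0(1)[OF i] unfolding H_0 .
    note wd = weak_deriv_AE[OF fL has_weak_deriv_0]
    have m: "weak_deriv 0 (f i) \<in> borel_measurable Om" using wd(1) by (simp add: L2_def)
    have "(LINT x|Om. (weak_deriv 0 (f i) x)\<^sup>2) = integral {-1..1} (\<lambda>x. (norm (g i x))\<^sup>2)"
    proof (rule LINT_AE_eq)
      show "(\<lambda>x. (weak_deriv 0 (f i) x)\<^sup>2) \<in> borel_measurable Om" using m by measurable
      show "(\<lambda>x. (norm (g i x))\<^sup>2) absolutely_integrable_on {-1..1}"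
        by (rule nonnegative_absolutely_integrable_1[OF L2v_int_sq[OF g(1)[OF i]]]) simp
      show "AE x in Om. (weak_deriv 0 (f i) x)\<^sup>2 = (norm (g i x))\<^sup>2"
        using wd(2) fg[OF i] by eventually_elim simp
    qed
    then show ?thesis using 0(2)[OF i le0] by (simp add: n2_def)
  qed
  have "RR 0 (\<lambda>i t. g i)"
  proof (rule R0_I[where g="\<lambda>i x. norm (g i x)" and K="sqrt K"])
    show "car (\<lambda>i t. g i)" unfolding car_def using L2v_meas[OF g(1)] by (simp add: continuous_on_const)
  qed (use L2v_norm[OF g(1)] b in auto)
  then show ?case using fg by blast
next
  case (Suc j)
  have "\<exists>c y. L2v y \<and> (AE x in Om. f i x = c + prim y x) \<and> y \<in> H j" if "i \<in> I" for i
    by (rule H_SucE[OF Suc.prems(1)[OF that]]) blast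
  then have "\<forall>i\<in>I. \<exists>cy. L2v (snd cy) \<and> (AE x in Om. f i x = fst cy + prim (snd cy) x) \<and> snd cy \<in> H j" by simp
  from bchoice[OF this] obtain cy where cy: "\<forall>i\<in>I. L2v (snd (cy i)) \<and> (AE x in Om. f i x = fst (cy i) + prim (snd (cy i)) x) \<and> snd (cy i) \<in> H j"
    by blast
  define c y where "c = (\<lambda>i. fst (cy i))" and "y = (\<lambda>i. snd (cy i))"
  have y: "\<And>i. i \<in> I \<Longrightarrow> L2v (y i)" "\<And>i. i \<in> I \<Longrightarrow> AE x in Om. f i x = c i + prim (y i) x"
    "\<And>i. i \<in> I \<Longrightarrow> y i \<in> H j"
    using cy unfolding c_def y_def by blast+
  have fm: "f i \<in> borel_measurable Om" if "i \<in> I" for i using H_measurable[OF Suc.prems(1)[OF that]] .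
  have wy: "(LINT x|Om. (weak_deriv l (y i) x)\<^sup>2) \<le> K" if i: "i \<in> I" and l: "l \<le> j" for i l
  proof -
    obtain g where g: "g \<in> L2" "has_weak_deriv l (y i) g" using y(3)[OF i] l unfolding H_def by blast
    have g': "has_weak_deriv (Suc l) (f i) g" unfolding has_weak_deriv_shift[OF fm[OF i] y(1)[OF i] y(2)[OF i]] by (rule g(2))
    note w = weak_deriv_AE[OF g] weak_deriv_AE[OF g(1) g']
    have "(LINT x|Om. (weak_deriv l (y i) x)\<^sup>2) = (LINT x|Om. (weak_deriv (Suc l) (f i) x)\<^sup>2)"
    proof (rule integral_cong_AE)
      show "(\<lambda>x. (weak_deriv l (y i) x)\<^sup>2) \<in> borel_measurable Om" "(\<lambda>x. (weak_deriv (Suc l) (f i) x)\<^sup>2) \<in> borel_measurable Om"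
        using w(1,3) by (auto simp: L2_def)
      show "AE x in Om. (weak_deriv l (y i) x)\<^sup>2 = (weak_deriv (Suc l) (f i) x)\<^sup>2"
        using w(2,4) by eventually_elim simp
    qed
    then show ?thesis using Suc.prems(2)[OF i, of "Suc l"] l by simp
  qed
  have "\<exists>g. RR j (\<lambda>i t. g i) \<and> (\<forall>i\<in>I. AE x in Om. y i x = g i x)" by (rule Suc.IH[OF y(3) wy])
  then obtain gy where gy: "RR j (\<lambda>i t. gy i)" "\<forall>i\<in>I. AE x in Om. y i x = gy i x" by blast
  have z: "0 \<in> {0..T}" using Tpos by simp
  have r0: "RR 0 (\<lambda>i t. gy i)" by (rule RR_le[OF gy(1) le0])
  have L: "L2v (gy i)" if "i \<in> I" for i using R0_L2v[OF r0 that z] .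
  obtain C where C: "\<And>i. i \<in> I \<Longrightarrow> n2 (gy i) \<le> C" using R0_n2[OF r0] z by blast
  define g where "g = (\<lambda>i x. c i + prim (gy i) x)"
  have fg: "AE x in Om. f i x = g i x" if i: "i \<in> I" for i
  proof -
    have "AE x in Om. prim (y i) x = prim (gy i) x"
      by (rule Om_AE_I, rule prim_cong_AE[OF y(1)[OF i] L[OF i]]) (use gy(2) i in auto)
    then show ?thesis using y(2)[OF i] unfolding g_def by eventually_elim simp
  qed
  \<comment> \<open>The constant of integration is the difference of f and a primitive, both bounded
    in L^2, and a constant c has L^2 norm sqrt 2 |c|.\<close>
  have cb: "norm (c i) \<le> sqrt K + 4 * C" if i: "i \<in> I" for i
  proof -
    have "f i \<in> L2" using Suc.prems(1)[OF i] by (simp add: H_def)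
    note wd = weak_deriv_AE[OF this has_weak_deriv_0]
    have Lg: "L2v (g i)" unfolding g_def by (rule L2v_continuous, intro continuous_intros, rule prim_continuous[OF L[OF i]])
    have Lp: "L2v (prim (gy i))" by (rule prim_L2v[OF L[OF i]])
    have m: "weak_deriv 0 (f i) \<in> borel_measurable Om" using wd(1) by (simp add: L2_def)
    have "(LINT x|Om. (weak_deriv 0 (f i) x)\<^sup>2) = integral {-1..1} (\<lambda>x. (norm (g i x))\<^sup>2)"
    proof (rule LINT_AE_eq)
      show "(\<lambda>x. (weak_deriv 0 (f i) x)\<^sup>2) \<in> borel_measurable Om" using m by measurable
      show "(\<lambda>x. (norm (g i x))\<^sup>2) absolutely_integrable_on {-1..1}"
        by (rule nonnegative_absolutely_integrable_1[OF L2v_int_sq[OF Lg]]) simp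
      show "AE x in Om. (weak_deriv 0 (f i) x)\<^sup>2 = (norm (g i x))\<^sup>2"
        using wd(2) fg[OF i] by eventually_elim simp
    qed
    then have "n2 (g i) \<le> sqrt K" using Suc.prems(2)[OF i le0] by (simp add: n2_def)
    moreover have "n2 (\<lambda>x. g i x - prim (gy i) x) \<le> n2 (g i) + n2 (prim (gy i))" by (rule n2_diff[OF Lg Lp])
    moreover have "n2 (\<lambda>x. g i x - prim (gy i) x) = sqrt 2 * \<bar>c i\<bar>"
      by (simp add: g_def n2_def real_sqrt_mult)
    moreover have "\<bar>c i\<bar> \<le> sqrt 2 * \<bar>c i\<bar>" by (simp add: mult_le_cancel_right1)
    moreover have "n2 (prim (gy i)) \<le> 4 * C" using prim_n2[OF L[OF i]] C[OF i] by simp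
    ultimately show ?thesis by simp
  qed
  have "RR (Suc j) (\<lambda>i t. g i)"
  proof (rule RR_SucI[OF gy(1)])
    show "norm (g i (-1)) \<le> sqrt K + 4 * C" if "i \<in> I" for i using cb[OF that] by (simp add: g_def)
    show "g i x = g i (-1) + prim (gy i) x" for i x by (simp add: g_def)
  qed (simp add: continuous_on_const)
  then show ?case using fg by blast
qed

text \<open>One order is spent in passing from u_0 to its derivative. Each squared norm of a
  component derivative is a summand of the squared X^(j+1) norm, hence at most \<rho>^2.\<close>

lemma X0_data:
  fixes u0 :: "'i \<Rightarrow> real \<Rightarrow> real^'d"
  assumes u: "\<And>i. i \<in> I \<Longrightarrow> u0 i \<in> X0 (Suc j)" and b: "\<And>i. i \<in> I \<Longrightarrow> Xnorm (Suc j) (u0 i) \<le> \<rho>"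
  shows "\<exists>y0. RR j (\<lambda>i t. y0 i) \<and> (\<forall>i\<in>I. rep (u0 i) (y0 i))"
proof -
  have H: "(\<lambda>x. u0 i x $ a) \<in> H (Suc j)" if "i \<in> I" for i a using u[OF that] by (simp add: X0_def H0_def)
  have W: "(LINT x|Om. (weak_deriv l (\<lambda>x. u0 i x $ a) x)\<^sup>2) \<le> \<rho>\<^sup>2" if i: "i \<in> I" and l: "l \<le> Suc j" for i l a
  proof -
    have ip: "ip0 (vderiv l (u0 i)) (vderiv l (u0 i)) = (\<Sum>a\<in>UNIV. LINT x|Om. (weak_deriv l (\<lambda>x. u0 i x $ a) x)\<^sup>2)" for l
      by (simp add: ip0_def vderiv_def power2_eq_square)
    have nn: "0 \<le> ip0 (vderiv l (u0 i)) (vderiv l (u0 i))" for l unfolding ip by (intro sum_nonneg) simp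
    have "(LINT x|Om. (weak_deriv l (\<lambda>x. u0 i x $ a) x)\<^sup>2) \<le> (norm0 (vderiv l (u0 i)))\<^sup>2"
      unfolding norm0_def real_sqrt_pow2[OF nn] unfolding ip by (rule member_le_sum) auto
    also have "\<dots> \<le> (\<Sum>l\<le>Suc j. (norm0 (vderiv l (u0 i)))\<^sup>2)"
      by (rule member_le_sum) (use l in auto)
    also have "\<dots> = (Xnorm (Suc j) (u0 i))\<^sup>2"
      unfolding Xnorm_def by (rule real_sqrt_pow2[symmetric]) (intro sum_nonneg zero_le_power2)
    also have "\<dots> \<le> \<rho>\<^sup>2"
      by (rule power_mono[OF b[OF i]]) (simp add: Xnorm_def sum_nonneg del: sum.atMost_Suc)
    finally show ?thesis .
  qed
  have "\<exists>g. RR (Suc j) (\<lambda>i t. g i) \<and> (\<forall>i\<in>I. AE x in Om. u0 i x $ a = g i x)" for a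
    by (rule H_data[OF H W])
  then obtain g where g: "\<And>a. RR (Suc j) (\<lambda>i t. g a i)" "\<And>a i. i \<in> I \<Longrightarrow> AE x in Om. u0 i x $ a = g a i x"
    by metis
  define gg where "gg = (\<lambda>i x. \<chi> a. g a i x)"
  have "RR (Suc j) (\<lambda>i t. gg i)"
  proof (rule RR_componentwise)
    fix b :: "real^'d" assume "b \<in> Basis"
    then obtain a where "b = axis a 1" by (auto simp: Basis_vec_def)
    then show "RR (Suc j) (\<lambda>i t x. gg i x \<bullet> b)" using g(1)[of a] by (simp add: gg_def inner_axis del: RR.simps)
  qed
  then show ?thesis
  proof (rule RR_SucE)
    fix r K
    assume r: "RR j r" and gr: "\<And>i t x. i \<in> I \<Longrightarrow> t \<in> {0..T} \<Longrightarrow> x \<in> {-1..1} \<Longrightarrow> gg i x = gg i (-1) + prim (r i t) x"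
    have z: "0 \<in> {0..T}" using Tpos by simp
    have "rep (u0 i) (r i 0)" if i: "i \<in> I" for i
    proof -
      have L: "L2v (r i 0)" by (rule R0_L2v[OF RR_le[OF r le0] i z])
      have cg: "continuous_on {-1..1} (gg i)"
      proof (rule continuous_on_eq)
        show "continuous_on {-1..1} (\<lambda>x. gg i (-1) + prim (r i 0) x)" by (intro continuous_intros prim_continuous L)
      qed (rule gr[OF i z, symmetric])
      \<comment> \<open>The representative is continuous on [-1,1], so the boundary values
        prescribed by \<open>H0\<close> are attained by it pointwise.\<close>
      have bd: "g a i (-1) = 0 \<and> g a i 1 = 0" for a
      proof -
        obtain h where h: "continuous_on {-1..1} h" "AE x in Om. h x = u0 i x $ a" "h (-1) = 0" "h 1 = 0"
          using u[OF i] unfolding X0_def H0_def by blast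
        have ca: "continuous_on {-1..1} (\<lambda>x. g a i x)"
          using continuous_on_component[OF cg, of a] by (simp add: gg_def)
        have "AE x in Om. h x = g a i x" using h(2) g(2)[OF i, of a] by eventually_elim simp
        then have "h x = g a i x" if "x \<in> {-1..1}" for x by (rule continuous_AE_eq[OF h(1) ca _ that])
        from this[of "-1"] this[of 1] show ?thesis using h(3,4) by simp
      qed
      then have b0: "gg i (-1) = 0" "gg i 1 = 0" by (simp_all add: gg_def vec_eq_iff)
      have gp: "gg i x = prim (r i 0) x" if "x \<in> {-1..1}" for x
        using gr[OF i z that] unfolding b0 by simp
      have "AE x in Om. u0 i x = gg i x"
      proof -
        have "AE x in Om. \<forall>a. u0 i x $ a = g a i x" unfolding AE_all_countable using g(2)[OF i] by blast
        then show ?thesis by eventually_elim (simp add: gg_def vec_eq_iff)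
      qed
      moreover have "AE x in Om. gg i x = prim (r i 0) x" by (rule Om_AE_I) (use gp in auto)
      ultimately have "AE x in Om. u0 i x = prim (r i 0) x" by eventually_elim simp
      moreover have "prim (r i 0) 1 = 0" using gp[of 1] b0(2) by simp
      ultimately show ?thesis using L by (simp add: rep_def)
    qed
    then show ?thesis using RR_freeze[OF r] by (intro exI[of _ "\<lambda>i. r i 0"]) blast
  qed
qed

lemma RR_comp_components:
  fixes F :: "'a::euclidean_space \<Rightarrow> 'b::euclidean_space"
  assumes F: "\<And>b. b \<in> Basis \<Longrightarrow> C_k (Suc j) (\<lambda>w. F w \<bullet> b)" and u: "RR (Suc j) u"
  shows "RR (Suc j) (\<lambda>i t x. F (u i t x))"
proof (rule RR_componentwise)
  fix b :: 'b assume "b \<in> Basis"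
  then show "RR (Suc j) (\<lambda>i t x. F (u i t x) \<bullet> b)" by (rule RR_comp[OF F u, of b])
qed

end

lemma C_k_vec_components:
  fixes F :: "'a::real_normed_vector \<Rightarrow> real^'d"
  assumes "\<And>i. C_k n (\<lambda>w. F w $ i)" and "b \<in> Basis"
  shows "C_k n (\<lambda>w. F w \<bullet> b)"
proof -
  obtain i where "b = axis i 1" using assms(2) by (auto simp: Basis_vec_def)
  then show ?thesis using assms(1)[of i] by (simp add: inner_axis)
qed

lemma C_k_matrix_components:
  fixes F :: "'a::real_normed_vector \<Rightarrow> real^'d^'d"
  assumes "\<And>i j. C_k n (\<lambda>w. F w $ i $ j)" and "b \<in> Basis"
  shows "C_k n (\<lambda>w. F w \<bullet> b)"
proof -
  obtain i j where "b = axis i (axis j 1)" using assms(2) by (auto simp: Basis_vec_def)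
  then show ?thesis using assms(1)[of i j] by (simp add: inner_axis)
qed

context coeffs
begin

text \<open>Cramer's rule: the entries of the inverse are quotients of polynomials in the entries of
  A, with nowhere vanishing denominator det A.\<close>

lemma N_C_k:
  assumes "\<And>i j. C_k n (\<lambda>w. A w $ i $ j)"
  shows "C_k n (\<lambda>w. N w $ a $ b)"
proof -
  have d: "det (A w) \<noteq> 0" for w
    using N_inverse[of w] unfolding invertible_det_nz[symmetric] invertible_def by blast
  have "N w $ a $ b = det (\<chi> i j. if j = a then axis b 1 $ i else A w $ i $ j) * inverse (det (A w))" for w
  proof -
    have "A w *v (N w *v axis b 1) = axis b 1" by (rule A_N)
    then have "N w *v axis b 1 = (\<chi> k. det (\<chi> i j. if j = k then axis b 1 $ i else A w $ i $ j) / det (A w))"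
      unfolding cramer[OF d] .
    then have "(N w *v axis b 1) $ a = det (\<chi> i j. if j = a then axis b 1 $ i else A w $ i $ j) / det (A w)" by simp
    then show ?thesis by (simp add: matrix_vector_mult_basis column_def divide_inverse)
  qed
  moreover have "C_k n (\<lambda>w. det (\<chi> i j. if j = a then axis b 1 $ i else A w $ i $ j) * inverse (det (A w)))"
  proof (intro C_k_mult C_k_inverse d C_k_det assms)
    show "C_k n (\<lambda>w. (\<chi> i j. if j = a then axis b 1 $ i else A w $ i $ j) $ i $ j)" for i j
      using assms by (cases "j = a") (simp_all add: C_k_const)
  qed
  ultimately show ?thesis by simp
qed

end

section \<open>Bootstrapping the regularity of the constructed solutions\<close>

locale coeffs_family = coeffs A B G \<gamma> \<alpha> K + family I T
  for A B :: "real^'d \<Rightarrow> real^'d^'d" and G \<gamma> :: "real^'d \<Rightarrow> real^'d" and \<alpha> K :: real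
    and I :: "'i set" and T :: real
begin

text \<open>With l derivatives on y, the function u has l + 1, and so have the coefficients
  evaluated at u. The equation for y, read as linear with these coefficients as given, then yields
  the next derivative of y by \<open>lin_ode_RR\<close>.\<close>

lemma RR_solution:
  fixes y0 :: "'i \<Rightarrow> real \<Rightarrow> real^'d"
  assumes y0: "RR j (\<lambda>i t. y0 i)" and p0: "\<And>i. i \<in> I \<Longrightarrow> prim (y0 i) 1 = 0"
    and A: "\<And>a b. C_k j (\<lambda>w. A w $ a $ b)" and B: "\<And>a b. C_k j (\<lambda>w. B w $ a $ b)"
    and G: "\<And>a. C_k j (\<lambda>w. G w $ a)" and \<gamma>: "\<And>a. C_k j (\<lambda>w. \<gamma> w $ a)"
  shows "\<exists>y \<eta>. (\<forall>i\<in>I. sol T (y i) (\<eta> i) \<and> y i 0 = y0 i) \<and>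
    RR (Suc j) (\<lambda>i t. prim (y i t)) \<and> RR (Suc j) (\<lambda>i t. prim (\<eta> i t))"
proof (rule R0_E[OF RR_le[OF y0 le0]])
  fix g0 :: "'i \<Rightarrow> real \<Rightarrow> real" and \<rho>
  assume \<rho>: "\<rho> \<ge> 0" and g0: "\<And>i. i \<in> I \<Longrightarrow> L2v (g0 i)" "\<And>i. i \<in> I \<Longrightarrow> n2 (g0 i) \<le> \<rho>"
    "\<And>i t x. i \<in> I \<Longrightarrow> t \<in> {0..T} \<Longrightarrow> x \<in> {-1..1} \<Longrightarrow> norm (y0 i x) \<le> g0 i x"
  note mv = bounded_bilinear_matrix_vector
  have z: "0 \<in> {0..T}" using Tpos by simp
  have r00: "RR 0 (\<lambda>i t. y0 i)" by (rule RR_le[OF y0 le0])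
  have L0: "L2v (y0 i)" if "i \<in> I" for i by (rule R0_L2v[OF r00 that z])
  have n0: "n2 (y0 i) \<le> \<rho>" if i: "i \<in> I" for i
  proof -
    have "n2 (y0 i) \<le> 1 * n2 (g0 i)"
      by (rule n2_mono[OF L0[OF i] g0(1)[OF i]]) (use g0(3)[OF i z] in force)+
    then show ?thesis using g0(2)[OF i] by simp
  qed
  obtain C where C: "C \<ge> 0" "\<forall>y0. L2v y0 \<longrightarrow> prim y0 1 = 0 \<longrightarrow> n2 y0 \<le> \<rho> \<longrightarrow> (\<exists>y \<eta> p. sol T y \<eta> \<and> y 0 = y0 \<and>
     (\<forall>t. L2v (y t) \<and> ell (y t) (\<eta> t) (p t)) \<and>
     (\<forall>t\<in>{0..T}. \<forall>x\<in>{-1..1}. norm (y t x) \<le> C * (norm (y0 x) + 1) \<and> norm (p t x) \<le> C \<and>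
        ((\<lambda>t. y t x) has_vector_derivative \<eta> t x) (at t within {0..T})) \<and>
     (\<forall>t\<in>{0..T}. n2 (y t) \<le> C) \<and> (\<forall>x\<in>{-1..1}. continuous_on {0..T} (\<lambda>t. p t x)))"
    using existence[OF Tpos \<rho>] by blast
  \<comment> \<open>The triple (y, \<eta>, p) is packed into one variable so that a single choice
    per index fixes all three consistently.\<close>
  define P where "P = (\<lambda>i w. case w of (y, \<eta>, p) \<Rightarrow> sol T y \<eta> \<and> y 0 = y0 i \<and>
     (\<forall>t. L2v (y t) \<and> ell (y t) (\<eta> t) (p t)) \<and>
     (\<forall>t\<in>{0..T}. \<forall>x\<in>{-1..1}. norm (y t x) \<le> C * (norm (y0 i x) + 1) \<and> norm (p t x) \<le> C \<and>
        ((\<lambda>t. y t x) has_vector_derivative \<eta> t x) (at t within {0..T})) \<and>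
     (\<forall>t\<in>{0..T}. n2 (y t) \<le> C) \<and> (\<forall>x\<in>{-1..1}. continuous_on {0..T} (\<lambda>t. p t x)))"
  have "\<forall>i\<in>I. \<exists>w. P i w"
  proof
    fix i assume i: "i \<in> I"
    show "\<exists>w. P i w" using C(2)[rule_format, OF L0[OF i] p0[OF i] n0[OF i]] unfolding P_def by auto
  qed
  from bchoice[OF this] obtain w where w: "\<forall>i\<in>I. P i (w i)" by blast
  define y \<eta> p where "y = (\<lambda>i. fst (w i))" and "\<eta> = (\<lambda>i. fst (snd (w i)))" and "p = (\<lambda>i. snd (snd (w i)))"
  have P: "P i (y i, \<eta> i, p i)" if "i \<in> I" for i using w that by (simp add: y_def \<eta>_def p_def)
  note P' = P[unfolded P_def prod.case]
  have s: "sol T (y i) (\<eta> i)" "y i 0 = y0 i" if "i \<in> I" for i using P'[OF that] by blast+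
  have Ly: "L2v (y i t)" and el: "ell (y i t) (\<eta> i t) (p i t)" if "i \<in> I" for i t using P'[OF that] by blast+
  have yb: "norm (y i t x) \<le> C * (norm (y0 i x) + 1)" and bp: "norm (p i t x) \<le> C"
    and dy: "((\<lambda>t. y i t x) has_vector_derivative \<eta> i t x) (at t within {0..T})"
    if "i \<in> I" "t \<in> {0..T}" "x \<in> {-1..1}" for i t x using P'[OF that(1)] that(2,3) by blast+
  have cp: "continuous_on {0..T} (\<lambda>t. p i t x)" if "i \<in> I" "x \<in> {-1..1}" for i x using P'[OF that(1)] that(2) by blast
  define u where "u = (\<lambda>i t. prim (y i t))"
  define \<phi> where "\<phi> = (\<lambda>i t. prim (\<eta> i t))"
  define f where "f = (\<lambda>i t x. N (u i t x) *v (p i t x - G (u i t x)))"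
  have \<eta>f: "\<eta> i t x = Mc (u i t x) *v y i t x + f i t x" if "i \<in> I" "x \<in> {-1..1}" for i t x
    by (rule trans[OF ellD(5)[OF el[OF that(1)] that(2)]])
       (simp add: flux_def f_def u_def Mc_def matrix_vector_mul_assoc[symmetric] matrix_vector_mult_diff_distrib
         matrix_vector_mult_add_rdistrib matrix_vector_right_distrib algebra_simps)
  have dyM: "((\<lambda>t. y i t x) has_vector_derivative Mc (u i t x) *v y i t x + f i t x) (at t within {0..T})"
    if "i \<in> I" "x \<in> {-1..1}" "t \<in> {0..T}" for i x t
    using dy[OF that(1,3,2)] unfolding \<eta>f[OF that(1,2)] .
  have u1: "RR (Suc l) u" if "RR l y" for l
    by (rule RR_SucI[OF that, where K=0]) (simp_all add: u_def continuous_on_const)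
  have \<phi>1: "RR (Suc l) \<phi>" if "RR l \<eta>" for l
    by (rule RR_SucI[OF that, where K=0]) (simp_all add: \<phi>_def continuous_on_const)
  have p1: "RR (Suc l) p" if "RR l (\<lambda>i t x. \<phi> i t x - \<gamma> (u i t x))" for l
  proof (rule RR_SucI[OF that, where K=C])
    fix i assume i: "i \<in> I"
    show "continuous_on {0..T} (\<lambda>t. p i t (-1))" by (rule cp[OF i]) simp
    fix t assume t: "t \<in> {0..T}"
    show "norm (p i t (-1)) \<le> C" by (rule bp[OF i t]) simp
    fix x :: real assume x: "x \<in> {-1..1}"
    show "p i t x = p i t (-1) + prim (\<lambda>x. \<phi> i t x - \<gamma> (u i t x)) x"
      unfolding \<phi>_def u_def by (rule ellD(4)[OF el[OF i] x])
  qed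
  have carp: "car p" unfolding car_def
    using cp continuous_imp_measurable_on_sets_lebesgue[OF ellD(1)[OF el]] by auto
  have bmp: "BM p" unfolding BM_def using carp bp by blast
  have "car (\<lambda>i t x. y0 i x)" using R0_car[OF r00] .
  then have "car (\<lambda>i t x. norm (y0 i x))" by (rule car_comp[OF continuous_on_norm_id])
  then have "RR 0 (\<lambda>i t x. norm (y0 i x))" by (rule R0_dom[OF _ r00, of _ 1]) simp_all
  then have r1: "RR 0 (\<lambda>i t x. norm (y0 i x) + 1)" by (rule RR_add[OF _ RR_const_in_tx])
  have y0R: "RR 0 y"
  proof (rule R0_dom[OF _ r1 C(1)])
    show "car y" unfolding car_def
    proof (intro ballI conjI)
      show "y i t \<in> borel_measurable (lebesgue_on {-1..1})" if "i \<in> I" for i t by (rule L2v_meas[OF Ly[OF that]])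
      show "continuous_on {0..T} (\<lambda>t. y i t x)" if "i \<in> I" "x \<in> {-1..1}" for i x
        unfolding continuous_on_eq_continuous_within
        by (intro ballI has_vector_derivative_continuous[OF dy[OF that(1) _ that(2)]])
    qed
    show "norm (y i t x) \<le> C * norm (norm (y0 i x) + 1)" if "i \<in> I" "t \<in> {0..T}" "x \<in> {-1..1}" for i t x
      using yb[OF that] by simp
  qed
  have bmu: "BM u" by (rule RR_Suc_BM[OF u1[OF y0R]])
  have bN: "BM (\<lambda>i t x. N (u i t x))" and bG: "BM (\<lambda>i t x. G (u i t x))"
    and bB: "BM (\<lambda>i t x. B (u i t x))" and bg: "BM (\<lambda>i t x. \<gamma> (u i t x))"
    by (rule BM_comp[OF N_continuous bmu] BM_comp[OF cont_coeffs(3) bmu] BM_comp[OF cont_coeffs(2) bmu] BM_comp[OF cont_coeffs(4) bmu])+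
  have \<eta>N: "\<eta> i t x = N (u i t x) *v (B (u i t x) *v y i t x - G (u i t x) + p i t x)"
    if "i \<in> I" "t \<in> {0..T}" "x \<in> {-1..1}" for i t x
    unfolding u_def by (rule trans[OF ellD(5)[OF el[OF that(1)] that(3)]]) (simp add: flux_def)
  have \<eta>0: "RR 0 \<eta>"
    by (rule RR_cong[OF _ \<eta>N])
       (intro BM_R0_bilinear[OF mv bN] RR_add RR_diff BM_R0_bilinear[OF mv bB] y0R BM_R0[OF bG] BM_R0[OF bmp])
  \<comment> \<open>p stays one order ahead of y and \<eta>: its derivative u_t - \<gamma>(u) is
    built from the primitives. Thus the forcing N (p - G) already has the order that is needed for
    y.\<close>
  have main: "l \<le> j \<Longrightarrow> RR l y \<and> RR l \<eta> \<and> RR (Suc l) p" for l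
  proof (induction l)
    case 0
    have "RR 0 (\<lambda>i t x. \<phi> i t x - \<gamma> (u i t x))"
      by (rule RR_diff[OF RR_le[OF \<phi>1[OF \<eta>0] le0] BM_R0[OF bg]])
    then show ?case using y0R \<eta>0 p1 by blast
  next
    case (Suc l)
    then have IH: "RR l y" "RR l \<eta>" "RR (Suc l) p" by auto
    note u = u1[OF IH(1)]
    have le: "Suc l \<le> j" by fact
    have mx: "max (Suc l) 1 = Suc l" by simp
    have RN: "RR (Suc l) (\<lambda>i t x. N (u i t x))"
      by (rule RR_comp_components[OF C_k_matrix_components[OF C_k_le[OF N_C_k[OF A] le]] u])
    have RB: "RR (Suc l) (\<lambda>i t x. B (u i t x))"
      by (rule RR_comp_components[OF C_k_matrix_components[OF C_k_le[OF B le]] u])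
    have RG: "RR (Suc l) (\<lambda>i t x. G (u i t x))"
      by (rule RR_comp_components[OF C_k_vec_components[OF C_k_le[OF G le]] u])
    have Rg: "RR (Suc l) (\<lambda>i t x. \<gamma> (u i t x))"
      by (rule RR_comp_components[OF C_k_vec_components[OF C_k_le[OF \<gamma> le]] u])
    have RN': "RR (max (Suc l) 1) (\<lambda>i t x. N (u i t x))" and RB': "RR (max (Suc l) 1) (\<lambda>i t x. B (u i t x))"
      unfolding mx by (rule RN RB)+
    have RM: "RR (max (Suc l) 1) (\<lambda>i t x. Mc (u i t x))"
      unfolding mx Mc_def by (rule RR_bilinear[OF bounded_bilinear_matrix_matrix RN' RB])
    have Rf: "RR (Suc l) f" unfolding f_def by (rule RR_bilinear[OF mv RN' RR_diff[OF IH(3) RG]])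
    have Ry: "RR (Suc l) y"
    proof (rule lin_ode_RR[OF RM Rf RR_le[OF y0 le] _ dyM])
      show "y i 0 x = y0 i x" if "i \<in> I" for i x using s(2)[OF that] by simp
    qed
    have R\<eta>: "RR (Suc l) \<eta>"
      by (rule RR_cong[OF RR_bilinear[OF mv RN' RR_add[OF RR_diff[OF RR_bilinear[OF mv RB' Ry] RG] IH(3)]] \<eta>N])
    have "RR (Suc (Suc l)) p" by (rule p1[OF RR_diff[OF RR_Suc_imp[OF \<phi>1[OF R\<eta>]] Rg]])
    then show ?case using Ry R\<eta> by blast
  qed
  have "RR (Suc j) u" "RR (Suc j) \<phi>" using u1 \<phi>1 main[OF order_refl] by blast+
  then show ?thesis using s unfolding u_def \<phi>_def by blast
qed

end

text \<open>Since h is continuous, the integrand of the essential supremum is measurable; the stated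
  membership in X^k excludes the value infinity.\<close>

lemma LinfX_le:
  fixes u :: "real \<Rightarrow> real \<Rightarrow> real^'d"
  assumes u: "\<And>t. t \<in> {0<..<T} \<Longrightarrow> u t \<in> X k \<and> Xnorm k (u t) = h t"
    and h: "continuous_on {0<..<T} h" and C: "\<And>t. t \<in> {0<..<T} \<Longrightarrow> h t \<le> C"
  shows "LinfX T k u \<le> ereal C"
  unfolding LinfX_def
proof (rule esssup_I)
  have "h \<in> borel_measurable (lebesgue_on {0<..<T})"
    by (rule continuous_imp_measurable_on_sets_lebesgue[OF h]) simp
  then have M: "(\<lambda>t. ereal (h t)) \<in> borel_measurable (lebesgue_on {0<..<T})" by measurable
  have e: "(if u t \<in> X k then ereal (Xnorm k (u t)) else \<infinity>) = ereal (h t)"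
    if "t \<in> space (lebesgue_on {0<..<T})" for t
    using u[of t] that by simp
  show "(\<lambda>t. if u t \<in> X k then ereal (Xnorm k (u t)) else \<infinity>) \<in> borel_measurable (lebesgue_on {0<..<T})"
    by (rule measurable_cong[THEN iffD2, OF e M])
  show "AE t in lebesgue_on {0<..<T}. (if u t \<in> X k then ereal (Xnorm k (u t)) else \<infinity>) \<le> ereal C"
    by (rule AE_I2) (use u C in auto)
qed

lemma X01_X: "\<phi> \<in> X0 k \<Longrightarrow> \<phi> \<in> X k"
  by (simp add: X0_def X_def H0_def)

text \<open>Only the function values vanish at the ends, so the boundary condition of order one
  serves for every order.\<close>

lemma X0I: "\<phi> \<in> X k \<Longrightarrow> \<phi> \<in> X0 1 \<Longrightarrow> \<phi> \<in> X0 k"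
  unfolding X0_def X_def H0_def by blast

text \<open>This provides the continuous, hence measurable, time dependence that
  \<open>LinfX_le\<close> asks for.\<close>

lemma Xnorm1_continuous:
  fixes \<phi> :: "real \<Rightarrow> real \<Rightarrow> real^'d"
  assumes m: "\<And>t. t \<in> S \<Longrightarrow> \<phi> t \<in> borel_measurable Om" and r: "\<And>t. t \<in> S \<Longrightarrow> rep (\<phi> t) (y t)"
    and c: "\<And>t. t \<in> S \<Longrightarrow> ((\<lambda>s. n2 (\<lambda>x. y s x - y t x)) \<longlongrightarrow> 0) (at t within S)"
  shows "continuous_on S (\<lambda>t. Xnorm 1 (\<phi> t))"
proof -
  have L: "L2v (y t)" if "t \<in> S" for t by (rule rep_L2v[OF r[OF that]])
  have cp: "((\<lambda>s. n2 (\<lambda>x. prim (y s) x - prim (y t) x)) \<longlongrightarrow> 0) (at t within S)" if t: "t \<in> S" for t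
  proof (rule Lim_null_comparison)
    show "((\<lambda>s. 4 * n2 (\<lambda>x. y s x - y t x)) \<longlongrightarrow> 0) (at t within S)"
      using tendsto_mult_left[OF c[OF t], of 4] by simp
    show "\<forall>\<^sub>F s in at t within S. norm (n2 (\<lambda>x. prim (y s) x - prim (y t) x)) \<le> 4 * n2 (\<lambda>x. y s x - y t x)"
      unfolding eventually_at_filter
    proof (intro always_eventually allI impI)
      fix s assume s: "s \<in> S"
      have "n2 (\<lambda>x. prim (y s) x - prim (y t) x) = n2 (prim (\<lambda>x. y s x - y t x))"
        by (rule n2_cong) (rule prim_diff[OF L[OF s] L[OF t], symmetric])
      also have "\<dots> \<le> 4 * n2 (\<lambda>x. y s x - y t x)" by (rule prim_n2[OF L2v_diff[OF L[OF s] L[OF t]]])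
      finally show "norm (n2 (\<lambda>x. prim (y s) x - prim (y t) x)) \<le> 4 * n2 (\<lambda>x. y s x - y t x)"
        by (simp only: real_norm_def abs_of_nonneg[OF n2_nonneg])
    qed
  qed
  have "continuous_on S (\<lambda>t. n2 (prim (y t)))" by (rule n2_continuous[OF prim_L2v[OF L] cp])
  then have "continuous_on S (\<lambda>t. sqrt ((n2 (prim (y t)))\<^sup>2 + (n2 (y t))\<^sup>2))"
    by (intro continuous_on_real_sqrt continuous_on_add continuous_on_power n2_continuous[OF L c])
  then show ?thesis by (rule continuous_on_eq) (rule Xnorm1_rep[OF m r, symmetric])
qed

lemma prim_eq_of_n2_diff:
  assumes "L2v y" "L2v z" "n2 (\<lambda>x. y x - z x) = 0" "x \<in> {-1..1}"
  shows "prim y x = prim z x"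
  using prim_bound[OF L2v_diff[OF assms(1,2)] assms(4)] unfolding assms(3) prim_diff[OF assms(1,2,4)] by simp

lemma rep_cong:
  assumes "rep \<phi> y" "AE x in Om. \<phi> x = \<psi> x" shows "rep \<psi> y"
proof -
  have "AE x in Om. \<psi> x = prim y x" using rep_AE[OF assms(1)] assms(2) by eventually_elim simp
  then show ?thesis using assms(1) by (simp add: rep_def)
qed

lemma tendsto_n2_diff:
  assumes L: "\<And>s. s \<in> S \<Longrightarrow> L2v (y s)" "\<And>s. s \<in> S \<Longrightarrow> L2v (z s)" and t: "t \<in> S"
    and y: "((\<lambda>s. n2 (\<lambda>x. y s x - y t x)) \<longlongrightarrow> 0) (at t within S)"
    and z: "((\<lambda>s. n2 (\<lambda>x. z s x - z t x)) \<longlongrightarrow> 0) (at t within S)"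
  shows "((\<lambda>s. n2 (\<lambda>x. (y s x - z s x) - (y t x - z t x))) \<longlongrightarrow> 0) (at t within S)"
proof (rule Lim_null_comparison)
  show "((\<lambda>s. n2 (\<lambda>x. y s x - y t x) + n2 (\<lambda>x. z s x - z t x)) \<longlongrightarrow> 0) (at t within S)"
    using tendsto_add[OF y z] by simp
  show "\<forall>\<^sub>F s in at t within S. norm (n2 (\<lambda>x. (y s x - z s x) - (y t x - z t x))) \<le> n2 (\<lambda>x. y s x - y t x) + n2 (\<lambda>x. z s x - z t x)"
    unfolding eventually_at_filter
  proof (intro always_eventually allI impI)
    fix s assume s: "s \<in> S"
    have "(\<lambda>x. (y s x - z s x) - (y t x - z t x)) = (\<lambda>x. (y s x - y t x) - (z s x - z t x))" by (simp add: fun_eq_iff)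
    then have "n2 (\<lambda>x. (y s x - z s x) - (y t x - z t x)) = n2 (\<lambda>x. (y s x - y t x) - (z s x - z t x))" by simp
    also have "\<dots> \<le> n2 (\<lambda>x. y s x - y t x) + n2 (\<lambda>x. z s x - z t x)"
      by (intro n2_diff L2v_diff L s t)
    finally show "norm (n2 (\<lambda>x. (y s x - z s x) - (y t x - z t x))) \<le> n2 (\<lambda>x. y s x - y t x) + n2 (\<lambda>x. z s x - z t x)"
      by (simp only: real_norm_def abs_of_nonneg[OF n2_nonneg])
  qed
qed

section \<open>Statements about arbitrary weak solutions\<close>

context coeffs
begin

lemma stab_mono: "0 \<le> r \<Longrightarrow> r \<le> s \<Longrightarrow> stab r \<le> stab s"
  unfolding stab_def using E_nonneg K alpha by (intro mult_left_mono add_mono mult_mono) auto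

lemma rep_eq_AE:
  assumes w: "w \<in> X0 1" "rep w y" and u0: "u0 \<in> borel_measurable Om" "rep u0 z"
    and e: "AE x in Om. w x = u0 x"
  shows "n2 (\<lambda>x. y x - z x) = 0"
proof (rule rep_zero[OF _ rep_diff[OF w(2) u0(2)]])
  show "(\<lambda>x. w x - u0 x) \<in> borel_measurable Om"
    by (rule borel_measurable_diff[OF X01_measurable[OF w(1)] u0(1)])
  show "AE x in Om. w x - u0 x = 0" using e by eventually_elim simp
qed

lemma weak_solution_exists:
  assumes T: "T > 0" and u0: "u0 \<in> X0 1"
  shows "\<exists>u ut. weak_solution T A B G \<gamma> u0 u ut"
proof (rule X01_rep[OF u0])
  fix y0 assume r: "rep u0 y0"
  obtain y \<eta> where y: "sol T y \<eta>" "y 0 = y0"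
    using existence[OF T n2_nonneg] rep_L2v[OF r] rep_prim1[OF r] order_refl by metis
  have "AE x in Om. prim (y 0) x = u0 x" using rep_AE[OF r] unfolding y(2) by eventually_elim (rule sym)
  from sol_weak_solution[OF y(1) this] show ?thesis by blast
qed

lemma weak_solution_diff:
  assumes T: "T > 0" and u0: "u0 \<in> X0 1" and v0: "v0 \<in> X0 1"
    and u: "weak_solution T A B G \<gamma> u0 u ut" and v: "weak_solution T A B G \<gamma> v0 v vt"
  shows "\<exists>w. \<forall>t\<in>{0..T}. (\<lambda>x. u t x - v t x) \<in> borel_measurable Om \<and> rep (\<lambda>x. u t x - v t x) (w t) \<and>
    ((\<lambda>s. n2 (\<lambda>x. w s x - w t x)) \<longlongrightarrow> 0) (at t within {0..T}) \<and>
    n2 (w t) \<le> Xnorm 1 (\<lambda>x. u0 x - v0 x) * exp (stab (growth T (Xnorm 1 u0)) * T)"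
proof (rule weak_solution_rep[OF u], rule weak_solution_rep[OF v])
  fix y \<eta> z \<zeta>
  assume y: "sol T y \<eta>" "AE x in Om. u 0 x = u0 x" "\<And>t. t \<in> {0..T} \<Longrightarrow> u t \<in> X0 1 \<and> rep (u t) (y t)"
    and z: "sol T z \<zeta>" "AE x in Om. v 0 x = v0 x" "\<And>t. t \<in> {0..T} \<Longrightarrow> v t \<in> X0 1 \<and> rep (v t) (z t)"
  have 0: "0 \<in> {0..T}" using T by simp
  have ru: "rep u0 (y 0)" by (rule rep_cong[OF y(3)[OF 0, THEN conjunct2] y(2)])
  have rv: "rep v0 (z 0)" by (rule rep_cong[OF z(3)[OF 0, THEN conjunct2] z(2)])
  have m: "(\<lambda>x. u0 x - v0 x) \<in> borel_measurable Om"
    by (rule borel_measurable_diff[OF X01_measurable[OF u0] X01_measurable[OF v0]])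
  have n0: "n2 (\<lambda>x. y 0 x - z 0 x) \<le> Xnorm 1 (\<lambda>x. u0 x - v0 x)"
    by (rule Xnorm1_bounds(1)[OF m rep_diff[OF ru rv]])
  have ny: "n2 (y 0) \<le> Xnorm 1 u0" by (rule Xnorm1_bounds(1)[OF X01_measurable[OF u0] ru])
  show ?thesis
  proof (intro exI[of _ "\<lambda>t x. y t x - z t x"] ballI conjI)
    fix t assume t: "t \<in> {0..T}"
    show "(\<lambda>x. u t x - v t x) \<in> borel_measurable Om"
      by (rule borel_measurable_diff[OF X01_measurable[OF y(3)[OF t, THEN conjunct1]] X01_measurable[OF z(3)[OF t, THEN conjunct1]]])
    show "rep (\<lambda>x. u t x - v t x) (\<lambda>x. y t x - z t x)"
      by (rule rep_diff[OF y(3)[OF t, THEN conjunct2] z(3)[OF t, THEN conjunct2]])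
    show "((\<lambda>s. n2 (\<lambda>x. (y s x - z s x) - (y t x - z t x))) \<longlongrightarrow> 0) (at t within {0..T})"
    proof (rule tendsto_n2_diff[OF _ _ t])
      show "((\<lambda>s. n2 (\<lambda>x. y s x - y t x)) \<longlongrightarrow> 0) (at t within {0..T})"
        "((\<lambda>s. n2 (\<lambda>x. z s x - z t x)) \<longlongrightarrow> 0) (at t within {0..T})"
        using y(1) z(1) t unfolding sol_def by blast+
      show "L2v (y s)" "L2v (z s)" if "s \<in> {0..T}" for s using y(1) z(1) that unfolding sol_def by blast+
    qed
    \<comment> \<open>\<open>sol_diff\<close> is used with the roles exchanged, so that the rate is
      taken at y, that is, at u_0 and not at the perturbed datum.\<close>
    have "n2 (\<lambda>x. z t x - y t x) \<le> n2 (\<lambda>x. z 0 x - y 0 x) * exp (stab (growth T (n2 (y 0))) * t)"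
      by (rule sol_diff[OF z(1) y(1) t])
    also have "\<dots> \<le> Xnorm 1 (\<lambda>x. u0 x - v0 x) * exp (stab (growth T (Xnorm 1 u0)) * T)"
    proof (rule mult_mono)
      show "n2 (\<lambda>x. z 0 x - y 0 x) \<le> Xnorm 1 (\<lambda>x. u0 x - v0 x)" using n0 by (subst n2_commute)
      have g0: "0 \<le> growth T (n2 (y 0))" unfolding growth_def using E_nonneg T n2_nonneg by (intro mult_nonneg_nonneg add_nonneg_nonneg) auto
      have "growth T (n2 (y 0)) \<le> growth T (Xnorm 1 u0)"
        by (rule growth_mono[OF _ order_refl n2_nonneg ny]) (use T in simp)
      then have "stab (growth T (n2 (y 0))) \<le> stab (growth T (Xnorm 1 u0))" by (rule stab_mono[OF g0])
      moreover have "0 \<le> stab (growth T (n2 (y 0)))" by (rule stab_nonneg[OF g0])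
      ultimately show "exp (stab (growth T (n2 (y 0))) * t) \<le> exp (stab (growth T (Xnorm 1 u0)) * T)"
        unfolding exp_le_cancel_iff using t by (intro mult_mono) auto
      show "0 \<le> Xnorm 1 (\<lambda>x. u0 x - v0 x)" using order_trans[OF n2_nonneg n0] .
    qed simp
    finally show "n2 (\<lambda>x. y t x - z t x) \<le> Xnorm 1 (\<lambda>x. u0 x - v0 x) * exp (stab (growth T (Xnorm 1 u0)) * T)"
      by (subst n2_commute)
  qed
qed

text \<open>With equal initial values the estimate for the difference has right-hand side zero, so
  its derivative vanishes in norm and its primitive at every point.\<close>

lemma weak_solution_unique:
  assumes T: "T > 0" and u0: "u0 \<in> X0 1"
    and u: "weak_solution T A B G \<gamma> u0 u ut" and v: "weak_solution T A B G \<gamma> u0 v vt" and t: "t \<in> {0..T}"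
  shows "AE x in Om. u t x = v t x"
proof -
  obtain w where w: "rep (\<lambda>x. u t x - v t x) w"
    "n2 w \<le> Xnorm 1 (\<lambda>x. u0 x - u0 x) * exp (stab (growth T (Xnorm 1 u0)) * T)"
    using weak_solution_diff[OF T u0 u0 u v] t by blast
  have "rep (\<lambda>x. u0 x - u0 x) (\<lambda>x. 0)"
    using L2v_continuous[OF continuous_on_const, of "0 :: real^'d"] by (simp add: rep_def prim_def)
  from Xnorm1_bounds(2)[OF _ this] have "Xnorm 1 (\<lambda>x. u0 x - u0 x) \<le> 0" by (simp add: n2_def)
  then have "n2 w \<le> 0" using w(2) order_trans mult_nonpos_nonneg[OF _ exp_ge_zero] by blast
  then have n: "n2 w = 0" using n2_nonneg[of w] by simp
  have "AE x in Om. prim w x = 0"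
    by (rule Om_AE_I) (use prim_bound[OF rep_L2v[OF w(1)]] n in force)
  then show ?thesis using rep_AE[OF w(1)] by eventually_elim simp
qed

lemma continuous_dependence:
  assumes T: "T > 0" and u0: "u0 \<in> X0 1" and e: "\<epsilon> > 0"
  shows "\<exists>\<delta>>0. \<forall>v0\<in>X0 1. \<forall>u ut v vt.
        weak_solution T A B G \<gamma> u0 u ut \<longrightarrow> weak_solution T A B G \<gamma> v0 v vt \<longrightarrow>
        Xnorm 1 (\<lambda>x. u0 x - v0 x) < \<delta> \<longrightarrow>
        LinfX T 1 (\<lambda>t x. u t x - v t x) < ereal \<epsilon>"
proof -
  \<comment> \<open>The Gronwall factor. With initial distance below \<epsilon> / (10 F), the factor
    5 of \<open>Xnorm1_bounds\<close> leaves \<epsilon> / 2, which makes the bound on the essential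
    supremum strict.\<close>
  define F where "F = exp (stab (growth T (Xnorm 1 u0)) * T)"
  have F: "F > 0" by (simp add: F_def)
  have "LinfX T 1 (\<lambda>t x. u t x - v t x) < ereal \<epsilon>"
    if v0: "v0 \<in> X0 1" and u: "weak_solution T A B G \<gamma> u0 u ut" and v: "weak_solution T A B G \<gamma> v0 v vt"
      and d: "Xnorm 1 (\<lambda>x. u0 x - v0 x) < \<epsilon> / (10 * F)" for v0 u ut v vt
  proof -
    obtain w where w: "\<forall>t\<in>{0..T}. (\<lambda>x. u t x - v t x) \<in> borel_measurable Om \<and> rep (\<lambda>x. u t x - v t x) (w t) \<and>
      ((\<lambda>s. n2 (\<lambda>x. w s x - w t x)) \<longlongrightarrow> 0) (at t within {0..T}) \<and>
      n2 (w t) \<le> Xnorm 1 (\<lambda>x. u0 x - v0 x) * F"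
      using weak_solution_diff[OF T u0 v0 u v] unfolding F_def by blast
    have c: "continuous_on {0..T} (\<lambda>t. Xnorm 1 (\<lambda>x. u t x - v t x))"
      by (rule Xnorm1_continuous[of _ _ w]) (use w in blast)+
    have "LinfX T 1 (\<lambda>t x. u t x - v t x) \<le> ereal (\<epsilon> / 2)"
    proof (rule LinfX_le)
      show "continuous_on {0<..<T} (\<lambda>t. Xnorm 1 (\<lambda>x. u t x - v t x))" by (rule continuous_on_subset[OF c]) auto
      fix t assume t: "t \<in> {0<..<T}"
      then have t': "t \<in> {0..T}" by simp
      have m: "(\<lambda>x. u t x - v t x) \<in> borel_measurable Om" and r: "rep (\<lambda>x. u t x - v t x) (w t)"
        and b: "n2 (w t) \<le> Xnorm 1 (\<lambda>x. u0 x - v0 x) * F" using w t' by blast+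
      show "(\<lambda>x. u t x - v t x) \<in> X 1 \<and> Xnorm 1 (\<lambda>x. u t x - v t x) = Xnorm 1 (\<lambda>x. u t x - v t x)"
        using X01_X[OF X01I[OF m r]] by blast
      have "Xnorm 1 (\<lambda>x. u0 x - v0 x) * F \<le> \<epsilon> / (10 * F) * F" using d F by (intro mult_right_mono) auto
      then show "Xnorm 1 (\<lambda>x. u t x - v t x) \<le> \<epsilon> / 2"
        using Xnorm1_bounds(2)[OF m r] b F by simp
    qed
    also have "\<dots> < ereal \<epsilon>" using e by simp
    finally show ?thesis .
  qed
  moreover have "\<epsilon> / (10 * F) > 0" using e F by simp
  ultimately show ?thesis by blast
qed

text \<open>\<open>growth\<close> bounds the derivative of u, and the energy estimate then bounds
  that of u_t; the factors 5 come from the norm equivalence.\<close>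

lemma a_priori_bound:
  assumes T: "T > 0" and u0: "u0 \<in> X0 1" and u: "weak_solution T A B G \<gamma> u0 u ut"
  shows "LinfX T 1 u + LinfX T 1 ut \<le>
    ereal (5 * growth T (Xnorm 1 u0) + 5 * (E * (1 + growth T (Xnorm 1 u0))))"
proof (rule weak_solution_rep[OF u])
  fix y \<eta>
  assume y: "sol T y \<eta>" "AE x in Om. u 0 x = u0 x" "\<And>t. t \<in> {0..T} \<Longrightarrow> u t \<in> X0 1 \<and> rep (u t) (y t)"
    "\<And>t. t \<in> {0<..T} \<Longrightarrow> ut t \<in> X0 1 \<and> rep (ut t) (\<eta> t)"
  have 0: "0 \<in> {0..T}" using T by simp
  have ru: "rep u0 (y 0)" by (rule rep_cong[OF y(3)[OF 0, THEN conjunct2] y(2)])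
  have ny: "n2 (y 0) \<le> Xnorm 1 u0" by (rule Xnorm1_bounds(1)[OF X01_measurable[OF u0] ru])
  have b: "n2 (y t) \<le> growth T (Xnorm 1 u0)" if "t \<in> {0..T}" for t
    by (rule order_trans[OF sol_bound[OF y(1) that] growth_mono[OF _ order_refl n2_nonneg ny]]) (use T in simp)
  have "LinfX T 1 u \<le> ereal (5 * growth T (Xnorm 1 u0))"
  proof (rule LinfX_le)
    have "continuous_on {0..T} (\<lambda>t. Xnorm 1 (u t))"
    proof (rule Xnorm1_continuous)
      fix t assume t: "t \<in> {0..T}"
      show "u t \<in> borel_measurable Om" "rep (u t) (y t)" using y(3)[OF t] X01_measurable by blast+
      show "((\<lambda>s. n2 (\<lambda>x. y s x - y t x)) \<longlongrightarrow> 0) (at t within {0..T})" using y(1) t unfolding sol_def by blast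
    qed
    then show "continuous_on {0<..<T} (\<lambda>t. Xnorm 1 (u t))" by (rule continuous_on_subset) auto
    fix t assume "t \<in> {0<..<T}"
    then have t: "t \<in> {0..T}" by simp
    show "u t \<in> X 1 \<and> Xnorm 1 (u t) = Xnorm 1 (u t)" using X01_X y(3)[OF t] by blast
    show "Xnorm 1 (u t) \<le> 5 * growth T (Xnorm 1 u0)"
      by (rule order_trans[OF Xnorm1_bounds(2)[OF X01_measurable[OF y(3)[OF t, THEN conjunct1]] y(3)[OF t, THEN conjunct2]] mult_left_mono[OF b[OF t]]]) simp
  qed
  moreover have "LinfX T 1 ut \<le> ereal (5 * (E * (1 + growth T (Xnorm 1 u0))))"
  proof (rule LinfX_le)
    have "continuous_on {0<..T} (\<lambda>t. Xnorm 1 (ut t))"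
    proof (rule Xnorm1_continuous)
      fix t assume t: "t \<in> {0<..T}"
      show "ut t \<in> borel_measurable Om" "rep (ut t) (\<eta> t)" using y(4)[OF t] X01_measurable by blast+
      show "((\<lambda>s. n2 (\<lambda>x. \<eta> s x - \<eta> t x)) \<longlongrightarrow> 0) (at t within {0<..T})" by (rule sol_eta_continuous[OF y(1) t])
    qed
    then show "continuous_on {0<..<T} (\<lambda>t. Xnorm 1 (ut t))" by (rule continuous_on_subset) auto
    fix t assume "t \<in> {0<..<T}"
    then have t: "t \<in> {0<..T}" and t': "t \<in> {0..T}" by auto
    show "ut t \<in> X 1 \<and> Xnorm 1 (ut t) = Xnorm 1 (ut t)" using X01_X y(4)[OF t] by blast
    have "E * (1 + n2 (y t)) \<le> E * (1 + growth T (Xnorm 1 u0))"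
      by (intro mult_left_mono add_left_mono b t' E_nonneg)
    then have "n2 (\<eta> t) \<le> E * (1 + growth T (Xnorm 1 u0))" using sol_eta_bound[OF y(1) t] by simp
    then show "Xnorm 1 (ut t) \<le> 5 * (E * (1 + growth T (Xnorm 1 u0)))"
      using Xnorm1_bounds(2)[OF X01_measurable[OF y(4)[OF t, THEN conjunct1]] y(4)[OF t, THEN conjunct2]] by simp
  qed
  ultimately show ?thesis unfolding plus_ereal.simps(1)[symmetric] by (rule add_mono)
qed

text \<open>The bounds are proved for the constructed solutions as one family and transferred to an
  arbitrary weak solution by uniqueness, both for u and for u_t.\<close>

lemma regularity:
  assumes T: "T > 0"
    and A: "\<And>a b. C_k j (\<lambda>w. A w $ a $ b)" and B: "\<And>a b. C_k j (\<lambda>w. B w $ a $ b)"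
    and G: "\<And>a. C_k j (\<lambda>w. G w $ a)" and \<gamma>: "\<And>a. C_k j (\<lambda>w. \<gamma> w $ a)"
  shows "\<exists>C. \<forall>u0\<in>X0 (Suc j). \<forall>u ut. Xnorm (Suc j) u0 \<le> \<rho> \<longrightarrow> weak_solution T A B G \<gamma> u0 u ut \<longrightarrow>
     (\<forall>t\<in>{0..T}. u t \<in> X0 (Suc j)) \<and> LinfX T (Suc j) u + LinfX T (Suc j) ut \<le> ereal C"
proof -
  \<comment> \<open>Every datum in the ball together with every one of its weak solutions is an
    index, so the bounds obtained for the family are uniform over all of them.\<close>
  define I where "I = {(u0, u, ut). u0 \<in> X0 (Suc j) \<and> Xnorm (Suc j) u0 \<le> \<rho> \<and> weak_solution T A B G \<gamma> u0 u ut}"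
  interpret F: coeffs_family A B G \<gamma> \<alpha> K I T by unfold_locales (rule T)
  have "\<exists>y0. F.RR j (\<lambda>i t. y0 i) \<and> (\<forall>i\<in>I. rep (fst i) (y0 i))"
    by (rule F.X0_data[where \<rho>=\<rho>]) (auto simp: I_def)
  then obtain y0 where y0: "F.RR j (\<lambda>i t. y0 i)" "\<And>i. i \<in> I \<Longrightarrow> rep (fst i) (y0 i)" by blast
  obtain y \<eta> where y: "\<forall>i\<in>I. sol T (y i) (\<eta> i) \<and> y i 0 = y0 i"
    "F.RR (Suc j) (\<lambda>i t. prim (y i t))" "F.RR (Suc j) (\<lambda>i t. prim (\<eta> i t))"
    using F.RR_solution[OF y0(1) rep_prim1[OF y0(2)] A B G \<gamma>] by blast
  obtain h C where h: "\<forall>i\<in>I. continuous_on {0..T} (h i) \<and> (\<forall>t\<in>{0..T}. h i t \<le> C \<and>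
    (\<forall>f\<in>borel_measurable Om. (AE x in Om. f x = prim (y i t) x) \<longrightarrow> f \<in> X (Suc j) \<and> Xnorm (Suc j) f = h i t))"
    using F.RR_Xnorm[OF y(2)] by blast
  obtain h' C' where h': "\<forall>i\<in>I. continuous_on {0..T} (h' i) \<and> (\<forall>t\<in>{0..T}. h' i t \<le> C' \<and>
    (\<forall>f\<in>borel_measurable Om. (AE x in Om. f x = prim (\<eta> i t) x) \<longrightarrow> f \<in> X (Suc j) \<and> Xnorm (Suc j) f = h' i t))"
    using F.RR_Xnorm[OF y(3)] by blast
  have "(\<forall>t\<in>{0..T}. u t \<in> X0 (Suc j)) \<and> LinfX T (Suc j) u + LinfX T (Suc j) ut \<le> ereal (C + C')"
    if u0: "u0 \<in> X0 (Suc j)" and b: "Xnorm (Suc j) u0 \<le> \<rho>" and u: "weak_solution T A B G \<gamma> u0 u ut" for u0 u ut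
  proof (rule weak_solution_rep[OF u])
    fix z \<zeta>
    assume z: "sol T z \<zeta>" "AE x in Om. u 0 x = u0 x" "\<And>t. t \<in> {0..T} \<Longrightarrow> u t \<in> X0 1 \<and> rep (u t) (z t)"
      "\<And>t. t \<in> {0<..T} \<Longrightarrow> ut t \<in> X0 1 \<and> rep (ut t) (\<zeta> t)"
    define i where "i = (u0, u, ut)"
    have i: "i \<in> I" using u0 b u by (simp add: i_def I_def)
    have 0: "0 \<in> {0..T}" using T by simp
    have s: "sol T (y i) (\<eta> i)" "y i 0 = y0 i" using y(1) i by blast+
    have r0: "rep u0 (y i 0)" using y0(2)[OF i] unfolding s(2) by (simp add: i_def)
    have z0: "n2 (\<lambda>x. z 0 x - y i 0 x) = 0"
      by (rule rep_eq_AE[OF z(3)[OF 0, THEN conjunct1] z(3)[OF 0, THEN conjunct2] X01_measurable[OF u0] r0 z(2)])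
    \<comment> \<open>The given solution and the constructed one start at L^2 distance zero, and
      \<open>sol_diff\<close> propagates this.\<close>
    have zy: "n2 (\<lambda>x. z t x - y i t x) = 0" if t: "t \<in> {0..T}" for t
      using sol_diff[OF z(1) s(1) t] n2_nonneg[of "\<lambda>x. z t x - y i t x"] unfolding z0 by simp
    have Lz: "L2v (z t)" "L2v (y i t)" if "t \<in> {0..T}" for t using z(1) s(1) that unfolding sol_def by blast+
    have uAE: "AE x in Om. u t x = prim (y i t) x" if t: "t \<in> {0..T}" for t
    proof -
      have "AE x in Om. prim (z t) x = prim (y i t) x"
        by (rule Om_AE_I, rule prim_eq_of_n2_diff[OF Lz[OF t] zy[OF t]]) simp
      then show ?thesis using rep_AE[OF z(3)[OF t, THEN conjunct2]] by eventually_elim simp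
    qed
    have utAE: "AE x in Om. ut t x = prim (\<eta> i t) x" if t: "t \<in> {0<..T}" for t
    proof -
      have t': "t \<in> {0..T}" using t by simp
      have L: "L2v (\<zeta> t)" "prim (\<zeta> t) 1 = 0" "L2v (\<eta> i t)" "prim (\<eta> i t) 1 = 0" "WF (z t) (\<zeta> t)" "WF (y i t) (\<eta> i t)"
        using z(1) s(1) t unfolding sol_def by blast+
      \<comment> \<open>The time derivatives agree as well, because \<eta> depends on y in a
        Lipschitz way.\<close>
      have "n2 (\<lambda>x. \<zeta> t x - \<eta> i t x) \<le> stab (n2 (y i t)) * n2 (\<lambda>x. z t x - y i t x)"
        by (rule WF_stab[OF Lz[OF t'] L order_refl])
      then have n: "n2 (\<lambda>x. \<zeta> t x - \<eta> i t x) = 0"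
        unfolding zy[OF t'] using n2_nonneg[of "\<lambda>x. \<zeta> t x - \<eta> i t x"] by simp
      have "AE x in Om. prim (\<zeta> t) x = prim (\<eta> i t) x"
        by (rule Om_AE_I, rule prim_eq_of_n2_diff[OF L(1,3) n]) simp
      then show ?thesis using rep_AE[OF z(4)[OF t, THEN conjunct2]] by eventually_elim simp
    qed
    have X: "u t \<in> X (Suc j) \<and> Xnorm (Suc j) (u t) = h i t" if t: "t \<in> {0..T}" for t
      using h[rule_format, OF i, THEN conjunct2, rule_format, OF t, THEN conjunct2, rule_format, OF X01_measurable[OF z(3)[OF t, THEN conjunct1]] uAE[OF t]] .
    have Xt: "ut t \<in> X (Suc j) \<and> Xnorm (Suc j) (ut t) = h' i t" if t: "t \<in> {0<..T}" for t
    proof -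
      have t': "t \<in> {0..T}" using t by simp
      show ?thesis
        using h'[rule_format, OF i, THEN conjunct2, rule_format, OF t', THEN conjunct2, rule_format, OF X01_measurable[OF z(4)[OF t, THEN conjunct1]] utAE[OF t]] .
    qed
    have "LinfX T (Suc j) u \<le> ereal C"
    proof (rule LinfX_le)
      show "continuous_on {0<..<T} (h i)"
        by (rule continuous_on_subset[OF h[rule_format, OF i, THEN conjunct1]]) auto
      show "u t \<in> X (Suc j) \<and> Xnorm (Suc j) (u t) = h i t" if "t \<in> {0<..<T}" for t by (rule X) (use that in simp)
      show "h i t \<le> C" if "t \<in> {0<..<T}" for t using h i that by auto
    qed
    moreover have "LinfX T (Suc j) ut \<le> ereal C'"
    proof (rule LinfX_le)
      show "continuous_on {0<..<T} (h' i)"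
        by (rule continuous_on_subset[OF h'[rule_format, OF i, THEN conjunct1]]) auto
      show "ut t \<in> X (Suc j) \<and> Xnorm (Suc j) (ut t) = h' i t" if "t \<in> {0<..<T}" for t by (rule Xt) (use that in simp)
      show "h' i t \<le> C'" if "t \<in> {0<..<T}" for t using h' i that by auto
    qed
    ultimately have "LinfX T (Suc j) u + LinfX T (Suc j) ut \<le> ereal C + ereal C'" by (rule add_mono)
    moreover have "u t \<in> X0 (Suc j)" if "t \<in> {0..T}" for t
      by (rule X0I[OF X[OF that, THEN conjunct1] z(3)[OF that, THEN conjunct1]])
    ultimately show ?thesis by simp
  qed
  then show ?thesis by blast
qed

end

section \<open>The theorem\<close>

lemma norm_matrix_le_entries: "norm (M :: real^'n^'m) \<le> (\<Sum>i\<in>UNIV. \<Sum>j\<in>UNIV. \<bar>M $ i $ j\<bar>)"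
proof -
  have "norm M \<le> (\<Sum>i\<in>UNIV. norm (M $ i))" unfolding norm_vec_def by (rule L2_set_le_sum) simp
  also have "\<dots> \<le> (\<Sum>i\<in>UNIV. \<Sum>j\<in>UNIV. \<bar>M $ i $ j\<bar>)" by (intro sum_mono norm_le_l1_cart)
  finally show ?thesis .
qed

lemma coeffs_exists:
  fixes A B :: "real^'d \<Rightarrow> real^'d^'d" and G \<gamma> :: "real^'d \<Rightarrow> real^'d"
  assumes \<alpha>: "\<alpha> > 0"
    and A_elliptic: "\<And>w \<xi>. \<xi> \<bullet> (A w *v \<xi>) \<ge> \<alpha> * (norm \<xi>)\<^sup>2"
    and A_lip: "\<And>i j. L-lipschitz_on UNIV (\<lambda>w. A w $ i $ j)"
    and G: "C_k 1 G"
    and bdd: "bounded (range B)" "bounded (range G)" "bounded (range \<gamma>)"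
    and lip: "\<exists>M. M-lipschitz_on UNIV B" "\<exists>M. M-lipschitz_on UNIV G" "\<exists>M. M-lipschitz_on UNIV \<gamma>"
  shows "\<exists>K. coeffs A B G \<gamma> \<alpha> K"
proof -
  obtain lB lG l\<gamma> where l: "lB-lipschitz_on UNIV B" "lG-lipschitz_on UNIV G" "l\<gamma>-lipschitz_on UNIV \<gamma>" using lip by blast
  obtain bB bG b\<gamma> where b: "\<And>w. norm (B w) \<le> bB" "\<And>w. norm (G w) \<le> bG" "\<And>w. norm (\<gamma> w) \<le> b\<gamma>"
    using bdd unfolding bounded_iff by blast
  \<comment> \<open>An entrywise Lipschitz constant L gives d^2 L for the Frobenius norm, bounded by
    the sum over the d^2 entries.\<close>
  define lA where "lA = real CARD('d) * (real CARD('d) * L)"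
  have a: "norm (A w - A w') \<le> lA * norm (w - w')" for w w'
  proof -
    have "norm (A w - A w') \<le> (\<Sum>i\<in>UNIV. \<Sum>j\<in>UNIV. \<bar>(A w - A w') $ i $ j\<bar>)" by (rule norm_matrix_le_entries)
    also have "\<dots> \<le> (\<Sum>i\<in>(UNIV::'d set). \<Sum>j\<in>(UNIV::'d set). L * norm (w - w'))"
      using lipschitz_onD[OF A_lip, of w w'] by (intro sum_mono) (simp add: dist_norm)
    finally show ?thesis by (simp add: lA_def mult.assoc)
  qed
  define K where "K = \<bar>lA\<bar> + \<bar>lB\<bar> + \<bar>lG\<bar> + \<bar>l\<gamma>\<bar> + \<bar>bB\<bar> + \<bar>bG\<bar> + \<bar>b\<gamma>\<bar>"
  have K: "lA \<le> K" "lB \<le> K" "lG \<le> K" "l\<gamma> \<le> K" "bB \<le> K" "bG \<le> K" "b\<gamma> \<le> K" "0 \<le> K" unfolding K_def by linarith+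
  have L: "norm (f w - f w') \<le> K * norm (w - w')" if "l-lipschitz_on UNIV f" "l \<le> K" for l w w' and f :: "real^'d \<Rightarrow> 'b::real_normed_vector"
    using lipschitz_onD[OF that(1), of w w'] mult_right_mono[OF that(2) norm_ge_zero[of "w - w'"]] by (simp add: dist_norm)
  have "coeffs A B G \<gamma> \<alpha> K"
  proof
    show "norm (A w - A w') \<le> K * norm (w - w')" for w w'
      using a[of w w'] mult_right_mono[OF K(1) norm_ge_zero[of "w - w'"]] by simp
    show "C_k (Suc 0) G" using G unfolding One_nat_def .
    show "norm (B w) \<le> K" "norm (G w) \<le> K" "norm (\<gamma> w) \<le> K" for w
      by (rule order_trans[OF b(1) K(5)] order_trans[OF b(2) K(6)] order_trans[OF b(3) K(7)])+
  qed (use \<alpha> A_elliptic K(8) L[OF l(1) K(2)] L[OF l(2) K(3)] L[OF l(3) K(4)] in auto)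
  then show ?thesis by blast
qed

theorem theorem2p1:
  fixes A B :: "real^'d \<Rightarrow> real^'d^'d"
    and G \<gamma> :: "real^'d \<Rightarrow> real^'d"
    and T \<alpha> L :: real
  assumes T: "T > 0"
    and \<alpha>: "\<alpha> > 0"
    and A_elliptic: "\<And>w \<xi>. \<xi> \<bullet> (A w *v \<xi>) \<ge> \<alpha> * (norm \<xi>)\<^sup>2"
    and A_lip: "\<And>i j. L-lipschitz_on UNIV (\<lambda>w. A w $ i $ j)"
    and C1: "C_k 1 B" "C_k 1 G" "C_k 1 \<gamma>"
    and bdd: "bounded (range B)" "bounded (range G)" "bounded (range \<gamma>)"
    and lip: "\<exists>M. M-lipschitz_on UNIV B" "\<exists>M. M-lipschitz_on UNIV G" "\<exists>M. M-lipschitz_on UNIV \<gamma>"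
  shows
    \<comment> \<open>existence and uniqueness\<close>
    "(\<forall>u0\<in>X0 1.
        (\<exists>u ut. weak_solution T A B G \<gamma> u0 u ut) \<and>
        (\<forall>u ut v vt. weak_solution T A B G \<gamma> u0 u ut \<longrightarrow> weak_solution T A B G \<gamma> u0 v vt \<longrightarrow>
           (\<forall>t\<in>{0..T}. AE x in Om. u t x = v t x)))
     \<and>
     \<comment> \<open>continuous dependence on the initial data\<close>
     (\<forall>u0\<in>X0 1. \<forall>\<epsilon>>0. \<exists>\<delta>>0. \<forall>v0\<in>X0 1. \<forall>u ut v vt.
        weak_solution T A B G \<gamma> u0 u ut \<longrightarrow> weak_solution T A B G \<gamma> v0 v vt \<longrightarrow>
        Xnorm 1 (\<lambda>x. u0 x - v0 x) < \<delta> \<longrightarrow>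
        LinfX T 1 (\<lambda>t x. u t x - v t x) < ereal \<epsilon>)
     \<and>
     \<comment> \<open>a priori bound, the constant depending on the data only through the norm of u0\<close>
     (\<exists>C :: real \<Rightarrow> real. \<forall>u0\<in>X0 1. \<forall>u ut. weak_solution T A B G \<gamma> u0 u ut \<longrightarrow>
        LinfX T 1 u + LinfX T 1 ut \<le> ereal (C (Xnorm 1 u0)))
     \<and>
     \<comment> \<open>regularity\<close>
     (\<forall>k m. k > 1 \<longrightarrow> m = max 1 (k - 1) \<longrightarrow>
        (\<forall>i j. C_k k (\<lambda>w. A w $ i $ j)) \<longrightarrow>
        (\<forall>i j. C_k m (\<lambda>w. B w $ i $ j)) \<longrightarrow>
        (\<forall>i. C_k m (\<lambda>w. G w $ i)) \<longrightarrow>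
        (\<forall>i. C_k m (\<lambda>w. \<gamma> w $ i)) \<longrightarrow>
        (\<exists>C :: real \<Rightarrow> real. \<forall>u0\<in>X0 k. \<forall>u ut. weak_solution T A B G \<gamma> u0 u ut \<longrightarrow>
           (\<forall>t\<in>{0..T}. u t \<in> X0 k) \<and>
           LinfX T k u + LinfX T k ut \<le> ereal (C (Xnorm k u0))))"
proof -
  obtain K where "coeffs A B G \<gamma> \<alpha> K"
    using coeffs_exists[OF \<alpha> A_elliptic A_lip C1(2) bdd lip] by blast
  then interpret coeffs A B G \<gamma> \<alpha> K .
  have R: "\<exists>C :: real \<Rightarrow> real. \<forall>u0\<in>X0 k. \<forall>u ut. weak_solution T A B G \<gamma> u0 u ut \<longrightarrow>
      (\<forall>t\<in>{0..T}. u t \<in> X0 k) \<and> LinfX T k u + LinfX T k ut \<le> ereal (C (Xnorm k u0))"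
    if k: "k > 1" and m: "m = max 1 (k - 1)"
      and c: "\<forall>i j. C_k k (\<lambda>w. A w $ i $ j)" "\<forall>i j. C_k m (\<lambda>w. B w $ i $ j)" "\<forall>i. C_k m (\<lambda>w. G w $ i)" "\<forall>i. C_k m (\<lambda>w. \<gamma> w $ i)" for k m
  proof -
    \<comment> \<open>As k > 1, the maximum in m is k - 1: the data have k derivatives and y_0, the
      derivative of u_0, has m.\<close>
    have km: "k = Suc m" using k m by simp
    have "\<exists>C. \<forall>u0\<in>X0 k. \<forall>u ut. Xnorm k u0 \<le> \<rho> \<longrightarrow> weak_solution T A B G \<gamma> u0 u ut \<longrightarrow>
      (\<forall>t\<in>{0..T}. u t \<in> X0 k) \<and> LinfX T k u + LinfX T k ut \<le> ereal C" for \<rho>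
      unfolding km by (rule regularity[OF T C_k_Suc_imp]) (use c km in blast)+
    \<comment> \<open>One constant is chosen for each radius \<rho>; for a given datum it is
      evaluated at \<rho> equal to its own norm.\<close>
    then obtain C where "\<And>\<rho>. \<forall>u0\<in>X0 k. \<forall>u ut. Xnorm k u0 \<le> \<rho> \<longrightarrow> weak_solution T A B G \<gamma> u0 u ut \<longrightarrow>
      (\<forall>t\<in>{0..T}. u t \<in> X0 k) \<and> LinfX T k u + LinfX T k ut \<le> ereal (C \<rho>)" by metis
    then show ?thesis by (intro exI[of _ C]) blast
  qed
  show ?thesis
  proof (intro conjI)
    show "\<forall>u0\<in>X0 1. (\<exists>u ut. weak_solution T A B G \<gamma> u0 u ut) \<and>
        (\<forall>u ut v vt. weak_solution T A B G \<gamma> u0 u ut \<longrightarrow> weak_solution T A B G \<gamma> u0 v vt \<longrightarrow>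
           (\<forall>t\<in>{0..T}. AE x in Om. u t x = v t x))"
      using weak_solution_exists[OF T] weak_solution_unique[OF T] by blast
    show "\<forall>u0\<in>X0 1. \<forall>\<epsilon>>0. \<exists>\<delta>>0. \<forall>v0\<in>X0 1. \<forall>u ut v vt.
        weak_solution T A B G \<gamma> u0 u ut \<longrightarrow> weak_solution T A B G \<gamma> v0 v vt \<longrightarrow>
        Xnorm 1 (\<lambda>x. u0 x - v0 x) < \<delta> \<longrightarrow>
        LinfX T 1 (\<lambda>t x. u t x - v t x) < ereal \<epsilon>"
      by (intro ballI allI impI continuous_dependence[OF T])
    show "\<exists>C :: real \<Rightarrow> real. \<forall>u0\<in>X0 1. \<forall>u ut. weak_solution T A B G \<gamma> u0 u ut \<longrightarrow>
        LinfX T 1 u + LinfX T 1 ut \<le> ereal (C (Xnorm 1 u0))"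
      by (rule exI[of _ "\<lambda>r. 5 * growth T r + 5 * (E * (1 + growth T r))"])
         (intro ballI allI impI a_priori_bound[OF T])
  qed (use R in blast)
qed

end
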